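(* Let $B$ be a commutative noetherian ring which is a quotient of a Cohen-Macaulay ring. Then there exists a Cohen-Macaulay DG-ring $A$ such that $\mathrm{H}^0(A)\cong B$.
   Context: "DG-ring" means commutative non-positive DG-ring: a graded ring $A=\bigoplus_{n\le 0}A^n$ with a differential $d$ of degree $+1$, satisfying $d(ab)=d(a)b+(-1)^{\deg a}a\,d(b)$, $ba=(-1)^{\deg a\deg b}ab$, and $a^2=0$ for $\deg a$ odd. $\mathrm{D}(A)$ is the derived category of DG-modules over $A$. $\pi_A:A\to\mathrm{H}^0(A)$ is the natural map, with surjective degree-zero part $\pi^0_A:A^0\to\mathrm{H}^0(A)$. $A$ is noetherian if $\mathrm{H}^0(A)$ is noetherian and each $\mathrm{H}^n(A)$ is a finitely generated $\mathrm{H}^0(A)$-module; bounded cohomology means $\mathrm{H}^n(A)=0$ for $n\ll0$; $(A,\bar{\mathfrak m})$ is noetherian local if $A$ is noetherian and $\mathrm{H}^0(A)$ is local with maximal ideal $\bar{\mathfrak m}$. $\inf(M)=\inf\{n:\mathrm{H}^n(M)\ne0\}$. Localization: for $\bar{\mathfrak p}\in\operatorname{Spec}(\mathrm{H}^0(A))$, $A_{\bar{\mathfrak p}}=A\otimes_{A^0}A^0_{\mathfrak p}$ with $\mathfrak p=(\pi_A^0)^{-1}(\bar{\mathfrak p})$. For $(A,\bar{\mathfrak m})$ noetherian local and $M\in\mathrm{D}(A)$ with cohomology bounded below: $\bar x\in\bar{\mathfrak m}$ is $M$-regular if multiplication by $\bar x$ on $\mathrm{H}^{\inf(M)}(M)$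 is injective; a sequence $\bar a_1,\dots,\bar a_n\in\bar{\mathfrak m}$ is $M$-regular if $\bar a_1$ is $M$-regular and $\bar a_2,\dots,\bar a_n$ is $K(M;\bar a_1)$-regular, where $K(M;\bar a_1)$ is the cone of $\bar a_1:M\to M$ in $\mathrm{D}(A)$. $\operatorname{seq.depth}_A(M)$ is the maximal length of an $M$-regular sequence in $\bar{\mathfrak m}$. A noetherian local DG-ring with bounded cohomology is local-Cohen-Macaulay if $\operatorname{seq.depth}_A(A)=\dim(\mathrm{H}^0(A))$ (Krull dimension); a noetherian DG-ring $A$ with bounded cohomology is Cohen-Macaulay if $A_{\bar{\mathfrak p}}$ is local-Cohen-Macaulay for every $\bar{\mathfrak p}\in\operatorname{Spec}(\mathrm{H}^0(A))$. *)

theory Defs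
  imports "HOL-Algebra.Subrings" "HOL-Algebra.Module" "HOL-Algebra.Ring_Divisibility"
    "HOL-Library.Extended_Nat"
begin

section \<open>Commutative rings\<close>

definition local_ring :: "('a, 'b) ring_scheme \<Rightarrow> bool" where
  "local_ring R \<longleftrightarrow> cring R \<and> (\<exists>!M. maximalideal M R)"

definition max_ideal :: "('a, 'b) ring_scheme \<Rightarrow> 'a set" where
  "max_ideal R = (THE M. maximalideal M R)"

definition krull_dim :: "('a, 'b) ring_scheme \<Rightarrow> enat" where
  "krull_dim R =
     (SUP n \<in> {n. \<exists>P. (\<forall>i\<le>n. primeideal (P i) R) \<and> (\<forall>i<n. P i \<subset> P (Suc i))}. enat n)"

definition finitely_generated_module :: "('a, 'b) ring_scheme \<Rightarrow> ('a, 'm, 'c) module_scheme \<Rightarrow> bool" where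
  "finitely_generated_module R M \<longleftrightarrow>
     (\<exists>U. U \<subseteq> carrier M \<and> finite U \<and> (\<forall>N. submodule N R M \<and> U \<subseteq> N \<longrightarrow> N = carrier M))"


subsection \<open>Rings of fractions\<close>

text \<open>
  The ring \<open>R\<close> need not be commutative; the denominators \<open>S\<close> are meant to form a central
  multiplicative set.  The fraction \<open>a / s\<close> is the equivalence class of \<open>(a, s)\<close>.
\<close>

definition fraction :: "('a, 'b) ring_scheme \<Rightarrow> 'a set \<Rightarrow> 'a \<Rightarrow> 'a \<Rightarrow> ('a \<times> 'a) set" where
  "fraction R S a s = {(b, t). b \<in> carrier R \<and> t \<in> S \<and>
     (\<exists>u\<in>S. u \<otimes>\<^bsub>R\<^esub> (t \<otimes>\<^bsub>R\<^esub> a) = u \<otimes>\<^bsub>R\<^esub> (s \<otimes>\<^bsub>R\<^esub> b))}"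

definition fraction_ring :: "('a, 'b) ring_scheme \<Rightarrow> 'a set \<Rightarrow> ('a \<times> 'a) set ring" where
  "fraction_ring R S = \<lparr>
     carrier = {fraction R S a s | a s. a \<in> carrier R \<and> s \<in> S},
     monoid.mult = (\<lambda>U V. \<Union>(a, s)\<in>U. \<Union>(b, t)\<in>V. fraction R S (a \<otimes>\<^bsub>R\<^esub> b) (s \<otimes>\<^bsub>R\<^esub> t)),
     one = fraction R S \<one>\<^bsub>R\<^esub> \<one>\<^bsub>R\<^esub>,
     zero = fraction R S \<zero>\<^bsub>R\<^esub> \<one>\<^bsub>R\<^esub>,
     add = (\<lambda>U V. \<Union>(a, s)\<in>U. \<Union>(b, t)\<in>V.
              fraction R S (t \<otimes>\<^bsub>R\<^esub> a \<oplus>\<^bsub>R\<^esub> s \<otimes>\<^bsub>R\<^esub> b) (s \<otimes>\<^bsub>R\<^esub> t))\<rparr>"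

locale central_denominators = ring R for R :: "('a, 'b) ring_scheme" (structure) +
  fixes S :: "'a set"
  assumes S_carrier: "S \<subseteq> carrier R"
    and S_one: "\<one> \<in> S"
    and S_mult: "\<lbrakk>s \<in> S; t \<in> S\<rbrakk> \<Longrightarrow> s \<otimes> t \<in> S"
    and S_central: "\<lbrakk>s \<in> S; a \<in> carrier R\<rbrakk> \<Longrightarrow> a \<otimes> s = s \<otimes> a"
begin

lemma S_mem [simp]: "s \<in> S \<Longrightarrow> s \<in> carrier R"
  using S_carrier by auto

lemma S_lcomm: "\<lbrakk>s \<in> S; t \<in> S; a \<in> carrier R\<rbrakk> \<Longrightarrow> s \<otimes> (t \<otimes> a) = t \<otimes> (s \<otimes> a)"
  by (metis S_central S_mem m_assoc)

lemma S_move: "\<lbrakk>s \<in> S; b \<in> carrier R; a \<in> carrier R\<rbrakk> \<Longrightarrow> a \<otimes> (s \<otimes> b) = s \<otimes> (a \<otimes> b)"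
  by (metis S_central S_mem m_assoc)

lemmas S_simps = S_mult S_one m_assoc S_lcomm S_move r_distr l_distr

lemma fraction_mem_iff:
  "(b, t) \<in> fraction R S a s \<longleftrightarrow>
     b \<in> carrier R \<and> t \<in> S \<and> (\<exists>u\<in>S. u \<otimes> (t \<otimes> a) = u \<otimes> (s \<otimes> b))"
  by (simp add: fraction_def)

lemma fraction_self: "\<lbrakk>a \<in> carrier R; s \<in> S\<rbrakk> \<Longrightarrow> (a, s) \<in> fraction R S a s"
  using S_one by (auto simp: fraction_mem_iff)

lemma fraction_sym:
  "\<lbrakk>a \<in> carrier R; s \<in> S; (b, t) \<in> fraction R S a s\<rbrakk> \<Longrightarrow> (a, s) \<in> fraction R S b t"
  by (auto simp: fraction_mem_iff intro: sym)

lemma fraction_trans: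
  assumes "a \<in> carrier R" "s \<in> S" "(b, t) \<in> fraction R S a s" "(c, r) \<in> fraction R S b t"
  shows "(c, r) \<in> fraction R S a s"
proof -
  obtain u where u: "u \<in> S" "u \<otimes> (t \<otimes> a) = u \<otimes> (s \<otimes> b)" and b: "b \<in> carrier R" "t \<in> S"
    using assms(3) by (auto simp: fraction_mem_iff)
  obtain v where v: "v \<in> S" "v \<otimes> (r \<otimes> b) = v \<otimes> (t \<otimes> c)" and c: "c \<in> carrier R" "r \<in> S"
    using assms(4) by (auto simp: fraction_mem_iff)
  let ?w = "u \<otimes> (v \<otimes> t)"
  have "?w \<otimes> (r \<otimes> a) = v \<otimes> (r \<otimes> (u \<otimes> (t \<otimes> a)))"
    using assms(1,2) u(1) v(1) b c by (simp add: S_simps)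
  also have "\<dots> = u \<otimes> (s \<otimes> (v \<otimes> (r \<otimes> b)))"
    using assms(1,2) u v(1) b c by (simp add: S_simps)
  also have "\<dots> = ?w \<otimes> (s \<otimes> c)"
    using assms(1,2) u(1) v b c by (simp add: S_simps)
  finally show ?thesis
    using u v b c S_mult by (auto simp: fraction_mem_iff)
qed

lemma fraction_eq_iff:
  assumes "a \<in> carrier R" "s \<in> S" "b \<in> carrier R" "t \<in> S"
  shows "fraction R S a s = fraction R S b t \<longleftrightarrow> (\<exists>u\<in>S. u \<otimes> (t \<otimes> a) = u \<otimes> (s \<otimes> b))"
proof
  assume "fraction R S a s = fraction R S b t"
  then show "\<exists>u\<in>S. u \<otimes> (t \<otimes> a) = u \<otimes> (s \<otimes> b)"
    using fraction_self[OF assms(3,4)] fraction_mem_iff by blast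
next
  assume "\<exists>u\<in>S. u \<otimes> (t \<otimes> a) = u \<otimes> (s \<otimes> b)"
  then have m: "(b, t) \<in> fraction R S a s"
    using assms by (auto simp: fraction_mem_iff)
  then have m': "(a, s) \<in> fraction R S b t" using assms fraction_sym by blast
  show "fraction R S a s = fraction R S b t"
  proof (intro subset_antisym subrelI)
    fix c r assume "(c, r) \<in> fraction R S a s"
    then show "(c, r) \<in> fraction R S b t" using fraction_trans m' assms by blast
  next
    fix c r assume "(c, r) \<in> fraction R S b t"
    then show "(c, r) \<in> fraction R S a s" using fraction_trans m assms by blast
  qed
qed

lemma fraction_eqI:
  assumes "a \<in> carrier R" "s \<in> S" "b \<in> carrier R" "t \<in> S" "t \<otimes> a = s \<otimes> b"
  shows "fraction R S a s = fraction R S b t"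
  using assms S_one fraction_eq_iff by auto

lemma fraction_union:
  assumes "a \<in> carrier R" "s \<in> S"
    and "\<And>b t. (b, t) \<in> fraction R S a s \<Longrightarrow> F b t = Z"
  shows "(\<Union>(b, t)\<in>fraction R S a s. F b t) = Z"
  using fraction_self[OF assms(1,2)] assms(3) by fast

lemma fraction_mult:
  assumes "a \<in> carrier R" "s \<in> S" "b \<in> carrier R" "t \<in> S"
  shows "fraction R S a s \<otimes>\<^bsub>fraction_ring R S\<^esub> fraction R S b t = fraction R S (a \<otimes> b) (s \<otimes> t)"
proof -
  have 1: "fraction R S (a' \<otimes> b') (s' \<otimes> t') = fraction R S (a \<otimes> b) (s \<otimes> t)"
    if h: "(a', s') \<in> fraction R S a s" "(b', t') \<in> fraction R S b t" for a' s' b' t'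
  proof -
    obtain u where u: "u \<in> S" "u \<otimes> (s' \<otimes> a) = u \<otimes> (s \<otimes> a')" and a': "a' \<in> carrier R" "s' \<in> S"
      using h(1) unfolding fraction_mem_iff by blast
    obtain v where v: "v \<in> S" "v \<otimes> (t' \<otimes> b) = v \<otimes> (t \<otimes> b')" and b': "b' \<in> carrier R" "t' \<in> S"
      using h(2) unfolding fraction_mem_iff by blast
    have "(u \<otimes> v) \<otimes> ((s \<otimes> t) \<otimes> (a' \<otimes> b')) = (u \<otimes> (s \<otimes> a')) \<otimes> (v \<otimes> (t \<otimes> b'))"
      using assms u(1) v(1) a' b' by (simp add: S_simps)
    also have "\<dots> = (u \<otimes> (s' \<otimes> a)) \<otimes> (v \<otimes> (t' \<otimes> b))" using u v by simp
    also have "\<dots> = (u \<otimes> v) \<otimes> ((s' \<otimes> t') \<otimes> (a \<otimes> b))"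
      using assms u(1) v(1) a' b' by (simp add: S_simps)
    finally show ?thesis
      using assms a' b' u(1) v(1) S_mult by (subst fraction_eq_iff) auto
  qed
  show ?thesis
    unfolding fraction_ring_def monoid.simps ring.simps
    by (intro fraction_union assms 1)
qed

lemma fraction_add:
  assumes "a \<in> carrier R" "s \<in> S" "b \<in> carrier R" "t \<in> S"
  shows "fraction R S a s \<oplus>\<^bsub>fraction_ring R S\<^esub> fraction R S b t =
    fraction R S (t \<otimes> a \<oplus> s \<otimes> b) (s \<otimes> t)"
proof -
  have 1: "fraction R S (t' \<otimes> a' \<oplus> s' \<otimes> b') (s' \<otimes> t') = fraction R S (t \<otimes> a \<oplus> s \<otimes> b) (s \<otimes> t)"
    if h: "(a', s') \<in> fraction R S a s" "(b', t') \<in> fraction R S b t" for a' s' b' t'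
  proof -
    obtain u where u: "u \<in> S" "u \<otimes> (s' \<otimes> a) = u \<otimes> (s \<otimes> a')" and a': "a' \<in> carrier R" "s' \<in> S"
      using h(1) unfolding fraction_mem_iff by blast
    obtain v where v: "v \<in> S" "v \<otimes> (t' \<otimes> b) = v \<otimes> (t \<otimes> b')" and b': "b' \<in> carrier R" "t' \<in> S"
      using h(2) unfolding fraction_mem_iff by blast
    have "(u \<otimes> v) \<otimes> ((s \<otimes> t) \<otimes> (t' \<otimes> a' \<oplus> s' \<otimes> b')) =
        v \<otimes> (t \<otimes> (t' \<otimes> (u \<otimes> (s \<otimes> a')))) \<oplus> u \<otimes> (s \<otimes> (s' \<otimes> (v \<otimes> (t \<otimes> b'))))"
      using assms u(1) v(1) a' b' by (simp add: S_simps)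
    also have "\<dots> = v \<otimes> (t \<otimes> (t' \<otimes> (u \<otimes> (s' \<otimes> a)))) \<oplus> u \<otimes> (s \<otimes> (s' \<otimes> (v \<otimes> (t' \<otimes> b))))"
      using u v by simp
    also have "\<dots> = (u \<otimes> v) \<otimes> ((s' \<otimes> t') \<otimes> (t \<otimes> a \<oplus> s \<otimes> b))"
      using assms u(1) v(1) a' b' by (simp add: S_simps)
    finally show ?thesis
      using assms a' b' u(1) v(1) S_mult by (subst fraction_eq_iff) auto
  qed
  show ?thesis
    unfolding fraction_ring_def monoid.simps ring.simps
    by (intro fraction_union assms 1)
qed

lemma fraction_carrier: "carrier (fraction_ring R S) = {fraction R S a s | a s. a \<in> carrier R \<and> s \<in> S}"
  and fraction_zero: "\<zero>\<^bsub>fraction_ring R S\<^esub> = fraction R S \<zero> \<one>"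
  and fraction_one: "\<one>\<^bsub>fraction_ring R S\<^esub> = fraction R S \<one> \<one>"
  by (simp_all add: fraction_ring_def)

lemma fractionE:
  assumes "U \<in> carrier (fraction_ring R S)"
  obtains a s where "U = fraction R S a s" "a \<in> carrier R" "s \<in> S"
  using assms unfolding fraction_carrier by blast

lemma fraction_closed: "\<lbrakk>a \<in> carrier R; s \<in> S\<rbrakk> \<Longrightarrow> fraction R S a s \<in> carrier (fraction_ring R S)"
  unfolding fraction_carrier by blast

lemma ring_fraction_ring: "ring (fraction_ring R S)" (is "ring ?F")
proof -
  note closed = S_mult S_one fraction_closed
  show ?thesis
  proof (rule ringI)
    show "abelian_group ?F"
    proof (rule abelian_groupI)
      fix U V assume "U \<in> carrier ?F" "V \<in> carrier ?F"
      then show "U \<oplus>\<^bsub>?F\<^esub> V \<in> carrier ?F"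
        by (elim fractionE) (simp add: fraction_add closed)
    next
      show "\<zero>\<^bsub>?F\<^esub> \<in> carrier ?F" by (simp add: fraction_zero closed)
    next
      fix U V Z assume "U \<in> carrier ?F" "V \<in> carrier ?F" "Z \<in> carrier ?F"
      then show "U \<oplus>\<^bsub>?F\<^esub> V \<oplus>\<^bsub>?F\<^esub> Z = U \<oplus>\<^bsub>?F\<^esub> (V \<oplus>\<^bsub>?F\<^esub> Z)"
        by (elim fractionE) (simp add: fraction_add S_simps a_assoc)
    next
      fix U V assume "U \<in> carrier ?F" "V \<in> carrier ?F"
      then show "U \<oplus>\<^bsub>?F\<^esub> V = V \<oplus>\<^bsub>?F\<^esub> U"
        by (elim fractionE) (simp add: fraction_add a_comm S_central)
    next
      fix U assume "U \<in> carrier ?F"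
      then show "\<zero>\<^bsub>?F\<^esub> \<oplus>\<^bsub>?F\<^esub> U = U"
        by (elim fractionE) (simp add: fraction_add fraction_zero closed)
    next
      fix U assume "U \<in> carrier ?F"
      then obtain a s where U: "U = fraction R S a s" and as: "a \<in> carrier R" "s \<in> S"
        by (rule fractionE)
      have "fraction R S (\<ominus> a) s \<oplus>\<^bsub>?F\<^esub> U = fraction R S \<zero> (s \<otimes> s)"
        unfolding U using as by (simp add: fraction_add r_minus l_neg)
      also have "\<dots> = \<zero>\<^bsub>?F\<^esub>"
        unfolding fraction_zero using as closed by (intro fraction_eqI) auto
      finally show "\<exists>V\<in>carrier ?F. V \<oplus>\<^bsub>?F\<^esub> U = \<zero>\<^bsub>?F\<^esub>"
        using as by (intro bexI[of _ "fraction R S (\<ominus> a) s"] fraction_closed) auto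
    qed
  next
    show "monoid ?F"
    proof (rule monoidI)
      fix U V assume "U \<in> carrier ?F" "V \<in> carrier ?F"
      then show "U \<otimes>\<^bsub>?F\<^esub> V \<in> carrier ?F"
        by (elim fractionE) (simp add: fraction_mult closed)
    next
      show "\<one>\<^bsub>?F\<^esub> \<in> carrier ?F" by (simp add: fraction_one closed)
    next
      fix U V Z assume "U \<in> carrier ?F" "V \<in> carrier ?F" "Z \<in> carrier ?F"
      then show "U \<otimes>\<^bsub>?F\<^esub> V \<otimes>\<^bsub>?F\<^esub> Z = U \<otimes>\<^bsub>?F\<^esub> (V \<otimes>\<^bsub>?F\<^esub> Z)"
        by (elim fractionE) (simp add: fraction_mult closed m_assoc)
    next
      fix U assume "U \<in> carrier ?F"
      then show "\<one>\<^bsub>?F\<^esub> \<otimes>\<^bsub>?F\<^esub> U = U"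
        by (elim fractionE) (simp add: fraction_mult fraction_one closed)
    next
      fix U assume "U \<in> carrier ?F"
      then show "U \<otimes>\<^bsub>?F\<^esub> \<one>\<^bsub>?F\<^esub> = U"
        by (elim fractionE) (simp add: fraction_mult fraction_one closed)
    qed
  next
    fix U V Z assume "U \<in> carrier ?F" "V \<in> carrier ?F" "Z \<in> carrier ?F"
    then obtain a s b t c r where U: "U = fraction R S a s" and V: "V = fraction R S b t"
      and Z: "Z = fraction R S c r" and as: "a \<in> carrier R" "s \<in> S"
        "b \<in> carrier R" "t \<in> S" "c \<in> carrier R" "r \<in> S" by (metis fractionE)
    have *: "U \<otimes>\<^bsub>?F\<^esub> Z \<oplus>\<^bsub>?F\<^esub> V \<otimes>\<^bsub>?F\<^esub> Z =
        fraction R S ((t \<otimes> r) \<otimes> (a \<otimes> c) \<oplus> (s \<otimes> r) \<otimes> (b \<otimes> c)) ((s \<otimes> r) \<otimes> (t \<otimes> r))"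
      "Z \<otimes>\<^bsub>?F\<^esub> U \<oplus>\<^bsub>?F\<^esub> Z \<otimes>\<^bsub>?F\<^esub> V =
        fraction R S ((r \<otimes> t) \<otimes> (c \<otimes> a) \<oplus> (r \<otimes> s) \<otimes> (c \<otimes> b)) ((r \<otimes> s) \<otimes> (r \<otimes> t))"
      "(U \<oplus>\<^bsub>?F\<^esub> V) \<otimes>\<^bsub>?F\<^esub> Z = fraction R S ((t \<otimes> a \<oplus> s \<otimes> b) \<otimes> c) ((s \<otimes> t) \<otimes> r)"
      "Z \<otimes>\<^bsub>?F\<^esub> (U \<oplus>\<^bsub>?F\<^esub> V) = fraction R S (c \<otimes> (t \<otimes> a \<oplus> s \<otimes> b)) (r \<otimes> (s \<otimes> t))"
      unfolding U V Z using as by (simp_all add: fraction_mult fraction_add closed)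
    show "(U \<oplus>\<^bsub>?F\<^esub> V) \<otimes>\<^bsub>?F\<^esub> Z = U \<otimes>\<^bsub>?F\<^esub> Z \<oplus>\<^bsub>?F\<^esub> V \<otimes>\<^bsub>?F\<^esub> Z"
      unfolding * using as by (intro fraction_eqI) (simp_all add: closed, simp add: S_simps)
    have mv: "c \<otimes> (t \<otimes> a) = t \<otimes> (c \<otimes> a)" "c \<otimes> (s \<otimes> b) = s \<otimes> (c \<otimes> b)"
      using as S_move by auto
    show "Z \<otimes>\<^bsub>?F\<^esub> (U \<oplus>\<^bsub>?F\<^esub> V) = Z \<otimes>\<^bsub>?F\<^esub> U \<oplus>\<^bsub>?F\<^esub> Z \<otimes>\<^bsub>?F\<^esub> V"
      unfolding * using as by (intro fraction_eqI) (simp_all add: closed, simp add: S_simps, unfold mv, simp add: S_lcomm)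
  qed
qed

end

text \<open>
  Biadditive maps \<open>f\<close> on \<open>R \<times> S\<inverse>R\<^sub>0\<close>, for a subring \<open>R\<^sub>0\<close> of \<open>R\<close> containing \<open>S\<close>, with
  \<open>f (a r, x) = f (a, r x)\<close> for \<open>r\<close> in \<open>R\<^sub>0\<close>.
\<close>

definition balanced_map ::
    "('a, 'b) ring_scheme \<Rightarrow> 'a set \<Rightarrow> 'a set \<Rightarrow> ('g, 'h) ring_scheme \<Rightarrow> ('a \<Rightarrow> ('a \<times> 'a) set \<Rightarrow> 'g) \<Rightarrow> bool" where
  "balanced_map R R0 S G f \<longleftrightarrow> (let L = fraction_ring (R\<lparr>carrier := R0\<rparr>) S in
     (\<forall>a\<in>carrier R. \<forall>x\<in>carrier L. f a x \<in> carrier G) \<and>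
     (\<forall>a\<in>carrier R. \<forall>b\<in>carrier R. \<forall>x\<in>carrier L. f (a \<oplus>\<^bsub>R\<^esub> b) x = f a x \<oplus>\<^bsub>G\<^esub> f b x) \<and>
     (\<forall>a\<in>carrier R. \<forall>x\<in>carrier L. \<forall>y\<in>carrier L. f a (x \<oplus>\<^bsub>L\<^esub> y) = f a x \<oplus>\<^bsub>G\<^esub> f a y) \<and>
     (\<forall>a\<in>carrier R. \<forall>r\<in>R0. \<forall>x\<in>carrier L.
        f (a \<otimes>\<^bsub>R\<^esub> r) x = f a (fraction (R\<lparr>carrier := R0\<rparr>) S r \<one>\<^bsub>R\<^esub> \<otimes>\<^bsub>L\<^esub> x)))"

text \<open>
  \<open>S\<inverse>R\<close> is the tensor product of \<open>R\<close> with \<open>S\<inverse>R\<^sub>0\<close> over \<open>R\<^sub>0\<close>, by \<open>(a, r / s) \<mapsto> (a r) / s\<close>.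
\<close>

theorem (in central_denominators) fraction_ring_is_tensor:
  assumes R0: "subring R0 R" "S \<subseteq> R0" and G: "abelian_group G" and f: "balanced_map R R0 S G f"
  shows "\<exists>!g. g \<in> hom (add_monoid (fraction_ring R S)) (add_monoid G) \<inter> extensional (carrier (fraction_ring R S)) \<and>
    (\<forall>a\<in>carrier R. \<forall>r\<in>R0. \<forall>s\<in>S. g (fraction R S (a \<otimes> r) s) = f a (fraction (R\<lparr>carrier := R0\<rparr>) S r s))"
proof -
  let ?R0 = "R\<lparr>carrier := R0\<rparr>" let ?L = "fraction_ring ?R0 S" and ?F = "fraction_ring R S"
  have f_closed: "\<And>a x. \<lbrakk>a \<in> carrier R; x \<in> carrier ?L\<rbrakk> \<Longrightarrow> f a x \<in> carrier G"
    and f_add_left: "\<And>a b x. \<lbrakk>a \<in> carrier R; b \<in> carrier R; x \<in> carrier ?L\<rbrakk> \<Longrightarrow>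
      f (a \<oplus> b) x = f a x \<oplus>\<^bsub>G\<^esub> f b x"
    and f_balanced: "\<And>a r x. \<lbrakk>a \<in> carrier R; r \<in> R0; x \<in> carrier ?L\<rbrakk> \<Longrightarrow>
      f (a \<otimes> r) x = f a (fraction ?R0 S r \<one> \<otimes>\<^bsub>?L\<^esub> x)"
    using f unfolding balanced_map_def Let_def by blast+
  interpret G: abelian_group G by (rule G)
  have R0c: "R0 \<subseteq> carrier R" "\<one> \<in> R0" using R0 by (auto dest: subringE(1,3))
  interpret Z: central_denominators ?R0 S
  proof -
    interpret R0': ring ?R0 using subring_is_ring R0(1) by simp
    show "central_denominators ?R0 S"
      by unfold_locales (use R0 R0c S_one S_mult S_central in auto)
  qed
  have S0: "s \<in> R0" if "s \<in> S" for s using that R0(2) by auto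
  have L: "fraction ?R0 S r s \<in> carrier ?L" if "r \<in> R0" "s \<in> S" for r s
    using that by (auto simp: Z.fraction_carrier)
  have key: "f (a \<otimes> r) (fraction ?R0 S p s) = f a (fraction ?R0 S (r \<otimes> p) s)"
    if "a \<in> carrier R" "r \<in> R0" "p \<in> R0" "s \<in> S" for a r p s
    using that f_balanced[of a r "fraction ?R0 S p s"] L Z.fraction_mult[of r \<one> p s] S_one by auto
  have cancel: "f (a \<otimes> t) (fraction ?R0 S \<one> (t \<otimes> s)) = f a (fraction ?R0 S \<one> s)"
    if "a \<in> carrier R" "t \<in> S" "s \<in> S" for a t s
  proof -
    have "fraction ?R0 S (t \<otimes> \<one>) (t \<otimes> s) = fraction ?R0 S \<one> s"
      using that S0 R0c S_mult S_central by (intro Z.fraction_eqI) (auto simp: S_mult Z.S_mult)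
    then show ?thesis using that key[of a t \<one> "t \<otimes> s"] R0c S0 S_mult by auto
  qed
  define g where "g = (\<lambda>U\<in>carrier ?F. let (a, s) = (SOME p. p \<in> U \<and> fst p \<in> carrier R \<and> snd p \<in> S) in f a (fraction ?R0 S \<one> s))"
  have wd: "f a (fraction ?R0 S \<one> s) = f b (fraction ?R0 S \<one> t)"
    if h: "a \<in> carrier R" "s \<in> S" "(b, t) \<in> fraction R S a s" for a s b t
  proof -
    obtain u where u: "u \<in> S" "u \<otimes> (t \<otimes> a) = u \<otimes> (s \<otimes> b)" and b: "b \<in> carrier R" "t \<in> S"
      using h(3) unfolding fraction_mem_iff by blast
    have "f a (fraction ?R0 S \<one> s) = f (a \<otimes> (u \<otimes> t)) (fraction ?R0 S \<one> ((u \<otimes> t) \<otimes> s))"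
      using h u(1) b S_mult by (intro cancel[symmetric]) auto
    also have "a \<otimes> (u \<otimes> t) = b \<otimes> (u \<otimes> s)"
      using u h(1,2) b S_central[of "u \<otimes> t" a] S_central[of "u \<otimes> s" b] S_mult by (simp add: m_assoc)
    also have "(u \<otimes> t) \<otimes> s = (u \<otimes> s) \<otimes> t"
      using u(1) b h S_central[of t s] by (simp add: m_assoc)
    also have "f (b \<otimes> (u \<otimes> s)) (fraction ?R0 S \<one> ((u \<otimes> s) \<otimes> t)) = f b (fraction ?R0 S \<one> t)"
      using h u(1) b S_mult by (intro cancel) auto
    finally show ?thesis .
  qed
  have g: "g (fraction R S a s) = f a (fraction ?R0 S \<one> s)" if "a \<in> carrier R" "s \<in> S" for a s
  proof -
    let ?P = "\<lambda>p. p \<in> fraction R S a s \<and> fst p \<in> carrier R \<and> snd p \<in> S"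
    have "?P (a, s)" using that fraction_self by auto
    then have "?P (SOME p. ?P p)" by (rule someI)
    then show ?thesis
      using that wd[of a s "fst (SOME p. ?P p)" "snd (SOME p. ?P p)"]
      by (auto simp: g_def fraction_carrier split_beta Let_def)
  qed
  show ?thesis
  proof (rule ex1I[of _ g], intro conjI ballI IntI homI)
    show "g \<in> extensional (carrier ?F)" by (simp add: g_def)
  next
    fix U assume "U \<in> carrier (add_monoid ?F)"
    then show "g U \<in> carrier (add_monoid G)" using g f_closed L R0c by (auto simp: fraction_carrier)
  next
    fix U V assume "U \<in> carrier (add_monoid ?F)" "V \<in> carrier (add_monoid ?F)"
    then obtain a s b t where U: "U = fraction R S a s" "V = fraction R S b t"
      and c: "a \<in> carrier R" "s \<in> S" "b \<in> carrier R" "t \<in> S" by (auto simp: fraction_carrier)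
    have "g (U \<oplus>\<^bsub>?F\<^esub> V) = f (a \<otimes> t \<oplus> b \<otimes> s) (fraction ?R0 S \<one> (s \<otimes> t))"
      unfolding U using c S_mult by (simp add: fraction_add g S_central[of t a] S_central[of s b])
    also have "\<dots> = f (a \<otimes> t) (fraction ?R0 S \<one> (t \<otimes> s)) \<oplus>\<^bsub>G\<^esub> f (b \<otimes> s) (fraction ?R0 S \<one> (s \<otimes> t))"
      using c S_mult L R0c S_central[of t s] by (simp add: f_add_left)
    also have "\<dots> = g U \<oplus>\<^bsub>G\<^esub> g V" unfolding U using c by (simp add: cancel g)
    finally show "g (U \<otimes>\<^bsub>add_monoid ?F\<^esub> V) = g U \<otimes>\<^bsub>add_monoid G\<^esub> g V" by simp
  next
    fix a r s assume "a \<in> carrier R" "r \<in> R0" "s \<in> S"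
    then show "g (fraction R S (a \<otimes> r) s) = f a (fraction ?R0 S r s)"
      using R0c key[of a r \<one> s] by (subst g) auto
  next
    fix h assume h: "h \<in> hom (add_monoid ?F) (add_monoid G) \<inter> extensional (carrier ?F) \<and>
      (\<forall>a\<in>carrier R. \<forall>r\<in>R0. \<forall>s\<in>S. h (fraction R S (a \<otimes> r) s) = f a (fraction ?R0 S r s))"
    show "h = g"
    proof (rule extensionalityI[of _ "carrier ?F"])
      fix U assume "U \<in> carrier ?F"
      then obtain a s where U: "U = fraction R S a s" "a \<in> carrier R" "s \<in> S" by (auto simp: fraction_carrier)
      have "h (fraction R S (a \<otimes> \<one>) s) = f a (fraction ?R0 S \<one> s)" using h U R0c by blast
      then show "h U = g U" using U g by simp
    qed (use h in \<open>auto simp: g_def\<close>)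
  qed
qed

definition localization :: "('a, 'b) ring_scheme \<Rightarrow> 'a set \<Rightarrow> ('a \<times> 'a) set ring" where
  "localization R P = fraction_ring R (carrier R - P)"


subsection \<open>Cohen-Macaulay rings\<close>

definition nonzerodivisor :: "('a, 'b) ring_scheme \<Rightarrow> 'a \<Rightarrow> bool" where
  "nonzerodivisor R x \<longleftrightarrow>
     (\<forall>y\<in>carrier R. x \<otimes>\<^bsub>R\<^esub> y = \<zero>\<^bsub>R\<^esub> \<longrightarrow> y = \<zero>\<^bsub>R\<^esub>)"

definition regular_sequence :: "('a, 'b) ring_scheme \<Rightarrow> 'a list \<Rightarrow> bool" where
  "regular_sequence R xs \<longleftrightarrow> set xs \<subseteq> carrier R \<and> Idl\<^bsub>R\<^esub> (set xs) \<noteq> carrier R \<and>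
     (\<forall>i<length xs. let I = Idl\<^bsub>R\<^esub> (set (take i xs)) in
        nonzerodivisor (R Quot I) (I +>\<^bsub>R\<^esub> xs ! i))"

definition local_depth :: "('a, 'b) ring_scheme \<Rightarrow> enat" where
  "local_depth R =
     (SUP xs \<in> {xs. set xs \<subseteq> max_ideal R \<and> regular_sequence R xs}. enat (length xs))"

definition cohen_macaulay_local_ring :: "('a, 'b) ring_scheme \<Rightarrow> bool" where
  "cohen_macaulay_local_ring R \<longleftrightarrow>
     noetherian_ring R \<and> local_ring R \<and> local_depth R = krull_dim R"

definition cohen_macaulay_ring :: "('a, 'b) ring_scheme \<Rightarrow> bool" where
  "cohen_macaulay_ring R \<longleftrightarrow> cring R \<and> noetherian_ring R \<and>
     (\<forall>P. primeideal P R \<longrightarrow> cohen_macaulay_local_ring (localization R P))"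


section \<open>Commutative non-positive DG-rings\<close>

record 'a dg_ring = "'a ring" +
  dg_comp :: "int \<Rightarrow> 'a set"
  dg_diff :: "'a \<Rightarrow> 'a"

definition deg_sign :: "('a, 'b) ring_scheme \<Rightarrow> int \<Rightarrow> 'a \<Rightarrow> 'a" where
  "deg_sign G n a = (if even n then a else \<ominus>\<^bsub>G\<^esub> a)"

definition decomposition :: "('a, 'b) ring_scheme \<Rightarrow> (int \<Rightarrow> 'a set) \<Rightarrow> 'a \<Rightarrow> (int \<Rightarrow> 'a) \<Rightarrow> bool" where
  "decomposition G C a f \<longleftrightarrow> (\<forall>n. f n \<in> C n) \<and> finite {n. f n \<noteq> \<zero>\<^bsub>G\<^esub>} \<and>
     a = (\<Oplus>\<^bsub>G\<^esub>n\<in>{n. f n \<noteq> \<zero>\<^bsub>G\<^esub>}. f n)"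

locale direct_sum_grading = abelian_group G
  for G :: "('a, 'b) ring_scheme" (structure) and C :: "int \<Rightarrow> 'a set" +
  assumes comp_subgroup: "additive_subgroup (C n) G"
    and decomposition_unique: "a \<in> carrier G \<Longrightarrow> \<exists>!f. decomposition G C a f"

locale dg_ring = ring A + direct_sum_grading A "dg_comp A"
  for A :: "('a, 'b) dg_ring_scheme" (structure) +
  assumes one_comp: "\<one> \<in> dg_comp A 0"
    and mult_comp: "\<lbrakk>a \<in> dg_comp A m; b \<in> dg_comp A n\<rbrakk> \<Longrightarrow> a \<otimes> b \<in> dg_comp A (m + n)"
    and comp_nonpositive: "n > 0 \<Longrightarrow> dg_comp A n = {\<zero>}"
    and diff_closed: "a \<in> carrier A \<Longrightarrow> dg_diff A a \<in> carrier A"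
    and diff_add: "\<lbrakk>a \<in> carrier A; b \<in> carrier A\<rbrakk> \<Longrightarrow>
      dg_diff A (a \<oplus> b) = dg_diff A a \<oplus> dg_diff A b"
    and diff_comp: "a \<in> dg_comp A n \<Longrightarrow> dg_diff A a \<in> dg_comp A (n + 1)"
    and diff_diff: "a \<in> carrier A \<Longrightarrow> dg_diff A (dg_diff A a) = \<zero>"
    and leibniz: "\<lbrakk>a \<in> dg_comp A n; b \<in> carrier A\<rbrakk> \<Longrightarrow>
      dg_diff A (a \<otimes> b) = dg_diff A a \<otimes> b \<oplus> deg_sign A n (a \<otimes> dg_diff A b)"
    and graded_commute: "\<lbrakk>a \<in> dg_comp A m; b \<in> dg_comp A n\<rbrakk> \<Longrightarrow>
      b \<otimes> a = deg_sign A (m * n) (a \<otimes> b)"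
    and odd_square: "\<lbrakk>a \<in> dg_comp A n; odd n\<rbrakk> \<Longrightarrow> a \<otimes> a = \<zero>"


section \<open>DG-modules and cohomology\<close>

text \<open>
  The fields \<^const>\<open>monoid.mult\<close> and \<^const>\<open>one\<close> that a \<open>module\<close> record inherits from
  \<open>ring\<close> carry no meaning.
\<close>

record ('a, 'm) dg_module = "('a, 'm) module" +
  dgm_comp :: "int \<Rightarrow> 'm set"
  dgm_diff :: "'m \<Rightarrow> 'm"

locale dg_module = A?: dg_ring A + M?: direct_sum_grading M "dgm_comp M"
  for A :: "('a, 'b) dg_ring_scheme" (structure) and M :: "('a, 'm, 'c) dg_module_scheme" (structure) +
  assumes smult_closed: "\<lbrakk>a \<in> carrier A; x \<in> carrier M\<rbrakk> \<Longrightarrow> a \<odot>\<^bsub>M\<^esub> x \<in> carrier M"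
    and smult_l_distr: "\<lbrakk>a \<in> carrier A; b \<in> carrier A; x \<in> carrier M\<rbrakk> \<Longrightarrow>
      (a \<oplus>\<^bsub>A\<^esub> b) \<odot>\<^bsub>M\<^esub> x = a \<odot>\<^bsub>M\<^esub> x \<oplus>\<^bsub>M\<^esub> b \<odot>\<^bsub>M\<^esub> x"
    and smult_r_distr: "\<lbrakk>a \<in> carrier A; x \<in> carrier M; y \<in> carrier M\<rbrakk> \<Longrightarrow>
      a \<odot>\<^bsub>M\<^esub> (x \<oplus>\<^bsub>M\<^esub> y) = a \<odot>\<^bsub>M\<^esub> x \<oplus>\<^bsub>M\<^esub> a \<odot>\<^bsub>M\<^esub> y"
    and smult_assoc: "\<lbrakk>a \<in> carrier A; b \<in> carrier A; x \<in> carrier M\<rbrakk> \<Longrightarrow>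
      (a \<otimes>\<^bsub>A\<^esub> b) \<odot>\<^bsub>M\<^esub> x = a \<odot>\<^bsub>M\<^esub> (b \<odot>\<^bsub>M\<^esub> x)"
    and smult_one: "x \<in> carrier M \<Longrightarrow> \<one>\<^bsub>A\<^esub> \<odot>\<^bsub>M\<^esub> x = x"
    and smult_comp: "\<lbrakk>a \<in> dg_comp A m; x \<in> dgm_comp M n\<rbrakk> \<Longrightarrow> a \<odot>\<^bsub>M\<^esub> x \<in> dgm_comp M (m + n)"
    and mdiff_closed: "x \<in> carrier M \<Longrightarrow> dgm_diff M x \<in> carrier M"
    and mdiff_add: "\<lbrakk>x \<in> carrier M; y \<in> carrier M\<rbrakk> \<Longrightarrow>
      dgm_diff M (x \<oplus>\<^bsub>M\<^esub> y) = dgm_diff M x \<oplus>\<^bsub>M\<^esub> dgm_diff M y"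
    and mdiff_comp: "x \<in> dgm_comp M n \<Longrightarrow> dgm_diff M x \<in> dgm_comp M (n + 1)"
    and mdiff_mdiff: "x \<in> carrier M \<Longrightarrow> dgm_diff M (dgm_diff M x) = \<zero>\<^bsub>M\<^esub>"
    and mleibniz: "\<lbrakk>a \<in> dg_comp A n; x \<in> carrier M\<rbrakk> \<Longrightarrow>
      dgm_diff M (a \<odot>\<^bsub>M\<^esub> x) = dg_diff A a \<odot>\<^bsub>M\<^esub> x \<oplus>\<^bsub>M\<^esub> deg_sign M n (a \<odot>\<^bsub>M\<^esub> dgm_diff M x)"

definition regular_dg_module :: "('a, 'b) dg_ring_scheme \<Rightarrow> ('a, 'a) dg_module" where
  "regular_dg_module A = \<lparr>carrier = carrier A, monoid.mult = monoid.mult A, one = one A, zero = zero A,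
     add = add A, smult = monoid.mult A, dgm_comp = dg_comp A, dgm_diff = dg_diff A\<rparr>"

definition cocycles :: "('a, 'm, 'c) dg_module_scheme \<Rightarrow> int \<Rightarrow> 'm set" where
  "cocycles M n = {x \<in> dgm_comp M n. dgm_diff M x = \<zero>\<^bsub>M\<^esub>}"

definition coboundaries :: "('a, 'm, 'c) dg_module_scheme \<Rightarrow> int \<Rightarrow> 'm set" where
  "coboundaries M n = dgm_diff M ` dgm_comp M (n - 1)"

definition H0 :: "('a, 'b) dg_ring_scheme \<Rightarrow> 'a set ring" where
  "H0 A = (A\<lparr>carrier := cocycles (regular_dg_module A) 0\<rparr>)
            Quot (coboundaries (regular_dg_module A) 0)"

text \<open>
  Cosets act on cosets as in \<^const>\<open>FactRing\<close>: all the representatives give the same coset,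
  so the union below is that coset.
\<close>

definition cohomology :: "('a, 'm, 'c) dg_module_scheme \<Rightarrow> int \<Rightarrow> ('a set, 'm set) module" where
  "cohomology M n = \<lparr>
     carrier = (\<lambda>x. coboundaries M n +>\<^bsub>M\<^esub> x) ` cocycles M n,
     monoid.mult = undefined, one = undefined,
     zero = coboundaries M n,
     add = (\<lambda>U V. U <+>\<^bsub>M\<^esub> V),
     smult = (\<lambda>U V. \<Union>a\<in>U. \<Union>x\<in>V. coboundaries M n +>\<^bsub>M\<^esub> (a \<odot>\<^bsub>M\<^esub> x))\<rparr>"

definition cohomology_nonzero :: "('a, 'm, 'c) dg_module_scheme \<Rightarrow> int \<Rightarrow> bool" where
  "cohomology_nonzero M n \<longleftrightarrow> carrier (cohomology M n) \<noteq> {\<zero>\<^bsub>cohomology M n\<^esub>}"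

text \<open>
  Meant for \<open>M\<close> with non-zero cohomology that is bounded below.  If \<open>M\<close> is acyclic, the value
  does not matter below, since then multiplication is injective on every \<open>H\<^sup>n(M) = 0\<close>.
\<close>

definition cohomological_inf :: "('a, 'm, 'c) dg_module_scheme \<Rightarrow> int" where
  "cohomological_inf M = Inf {n. cohomology_nonzero M n}"

definition noetherian_dg_ring :: "('a, 'b) dg_ring_scheme \<Rightarrow> bool" where
  "noetherian_dg_ring A \<longleftrightarrow> dg_ring A \<and> noetherian_ring (H0 A) \<and>
     (\<forall>n. finitely_generated_module (H0 A) (cohomology (regular_dg_module A) n))"

definition bounded_cohomology :: "('a, 'b) dg_ring_scheme \<Rightarrow> bool" where
  "bounded_cohomology A \<longleftrightarrow> (\<exists>N. \<forall>n<N. \<not> cohomology_nonzero (regular_dg_module A) n)"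

definition noetherian_local_dg_ring :: "('a, 'b) dg_ring_scheme \<Rightarrow> bool" where
  "noetherian_local_dg_ring A \<longleftrightarrow> noetherian_dg_ring A \<and> local_ring (H0 A)"


section \<open>Localization\<close>

text \<open>
  \<open>A\<close> tensored over \<open>A\<^sup>0\<close> with \<open>S\<inverse>A\<^sup>0\<close> is realized by the fractions \<open>a / s\<close> with \<open>a\<close> in \<open>A\<close> and
  \<open>s\<close> in \<open>S\<close>; see \<open>dg_fraction_ring_is_tensor\<close> below.
\<close>

definition dg_fraction_ring :: "('a, 'b) dg_ring_scheme \<Rightarrow> 'a set \<Rightarrow> ('a \<times> 'a) set dg_ring" where
  "dg_fraction_ring A S = (let F = fraction_ring A S in
     \<lparr>carrier = carrier F, monoid.mult = monoid.mult F, one = one F, zero = zero F, add = add F,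
      dg_comp = (\<lambda>n. {fraction A S a s | a s. a \<in> dg_comp A n \<and> s \<in> S}),
      dg_diff = (\<lambda>U. \<Union>(a, s)\<in>U. fraction A S (dg_diff A a) s)\<rparr>)"

context dg_ring
begin

lemma comp_carrier: "a \<in> dg_comp A n \<Longrightarrow> a \<in> carrier A"
  using additive_subgroup.a_subset[OF comp_subgroup] by blast

lemma degree_zero_central:
  assumes "s \<in> dg_comp A 0" "a \<in> carrier A"
  shows "a \<otimes> s = s \<otimes> a"
proof -
  obtain f where f: "decomposition A (dg_comp A) a f"
    using decomposition_unique[OF assms(2)] by blast
  let ?N = "{n. f n \<noteq> \<zero>}"
  have fin: "finite ?N" and a: "a = (\<Oplus>n\<in>?N. f n)" and fC: "\<And>n. f n \<in> dg_comp A n"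
    using f by (auto simp: decomposition_def)
  have fc: "f \<in> ?N \<rightarrow> carrier A" and s: "s \<in> carrier A"
    using fC assms(1) comp_carrier by auto
  have c: "f n \<otimes> s = s \<otimes> f n" for n
    using graded_commute[OF assms(1) fC, of n] by (simp add: deg_sign_def)
  have "a \<otimes> s = (\<Oplus>n\<in>?N. f n \<otimes> s)" unfolding a using fin s fc by (rule finsum_ldistr)
  also have "\<dots> = (\<Oplus>n\<in>?N. s \<otimes> f n)" by (simp only: c)
  also have "\<dots> = s \<otimes> a" unfolding a using fin s fc by (rule finsum_rdistr[symmetric])
  finally show ?thesis .
qed

lemma degree_zero_subring: "subring (dg_comp A 0) A"
proof -
  interpret Z: additive_subgroup "dg_comp A 0" A by (rule comp_subgroup)
  show ?thesis
    using Z.a_subset Z.a_inv_closed Z.a_closed one_comp mult_comp[of _ 0 _ 0]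
    by (intro subringI) auto
qed

lemma diff_degree_zero: "s \<in> dg_comp A 0 \<Longrightarrow> dg_diff A s = \<zero>"
  using diff_comp[of s 0] comp_nonpositive[of 1] by auto

lemma diff_degree_zero_mult:
  "\<lbrakk>s \<in> dg_comp A 0; a \<in> carrier A\<rbrakk> \<Longrightarrow> dg_diff A (s \<otimes> a) = s \<otimes> dg_diff A a"
  using leibniz[of s 0 a] comp_carrier[of s 0] diff_closed[of a]
  by (simp add: diff_degree_zero deg_sign_def)

lemma central_denominators:
  assumes "S \<subseteq> dg_comp A 0" "\<one> \<in> S" "\<And>s t. \<lbrakk>s \<in> S; t \<in> S\<rbrakk> \<Longrightarrow> s \<otimes> t \<in> S"
  shows "central_denominators A S"
  by unfold_locales (use assms comp_carrier degree_zero_central in auto)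

lemma fraction_diff:
  assumes S: "S \<subseteq> dg_comp A 0" "\<one> \<in> S" "\<And>s t. \<lbrakk>s \<in> S; t \<in> S\<rbrakk> \<Longrightarrow> s \<otimes> t \<in> S"
    and a: "a \<in> carrier A" "s \<in> S"
  shows "dg_diff (dg_fraction_ring A S) (fraction A S a s) = fraction A S (dg_diff A a) s"
proof -
  interpret central_denominators A S using central_denominators[OF S] .
  have "fraction A S (dg_diff A b) t = fraction A S (dg_diff A a) s"
    if "(b, t) \<in> fraction A S a s" for b t
  proof -
    have b: "b \<in> carrier A" "t \<in> S" and "\<exists>u\<in>S. u \<otimes> (t \<otimes> a) = u \<otimes> (s \<otimes> b)"
      using that unfolding fraction_mem_iff by auto
    then obtain u where u: "u \<in> S" "u \<otimes> (t \<otimes> a) = u \<otimes> (s \<otimes> b)" by blast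
    have "dg_diff A (u \<otimes> (t \<otimes> a)) = dg_diff A (u \<otimes> (s \<otimes> b))" using u by simp
    then have "u \<otimes> (t \<otimes> dg_diff A a) = u \<otimes> (s \<otimes> dg_diff A b)"
      using a b u(1) S(1) by (simp add: diff_degree_zero_mult subset_iff)
    then show ?thesis
      using a b u(1) diff_closed by (subst fraction_eq_iff) (auto intro: sym)
  qed
  then show ?thesis
    unfolding dg_fraction_ring_def Let_def dg_ring.simps
    by (intro fraction_union a) auto
qed

theorem dg_fraction_ring_is_tensor:
  assumes S: "S \<subseteq> dg_comp A 0" "\<one> \<in> S" "\<And>s t. \<lbrakk>s \<in> S; t \<in> S\<rbrakk> \<Longrightarrow> s \<otimes> t \<in> S"
    and G: "abelian_group G" and f: "balanced_map A (dg_comp A 0) S G f"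
  shows "\<exists>!g. g \<in> hom (add_monoid (dg_fraction_ring A S)) (add_monoid G) \<inter>
      extensional (carrier (dg_fraction_ring A S)) \<and>
    (\<forall>a\<in>carrier A. \<forall>r\<in>dg_comp A 0. \<forall>s\<in>S.
       g (fraction A S (a \<otimes> r) s) = f a (fraction (A\<lparr>carrier := dg_comp A 0\<rparr>) S r s))"
proof -
  interpret central_denominators A S using central_denominators[OF S] .
  show ?thesis
    using fraction_ring_is_tensor[OF degree_zero_subring S(1) G f]
    by (simp add: dg_fraction_ring_def Let_def hom_def)
qed

end

definition pi_preimage :: "('a, 'b) dg_ring_scheme \<Rightarrow> 'a set set \<Rightarrow> 'a set" where
  "pi_preimage A P = {a \<in> dg_comp A 0. coboundaries (regular_dg_module A) 0 +>\<^bsub>A\<^esub> a \<in> P}"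

definition dg_localization :: "('a, 'b) dg_ring_scheme \<Rightarrow> 'a set set \<Rightarrow> ('a \<times> 'a) set dg_ring" where
  "dg_localization A P = dg_fraction_ring A (dg_comp A 0 - pi_preimage A P)"


section \<open>Regular sequences\<close>

text \<open>
  The mapping cone of an endomorphism of \<open>M\<close> has pairs of elements of \<open>M\<close> as its elements.  In order
  to iterate cones without changing types, DG-modules are put on binary trees.  The same type serves
  as a universe of elements for DG-rings built from a ring with elements in \<open>'m\<close>.
\<close>

datatype 'm pair_tree = Leaf 'm | Pair "'m pair_tree" "'m pair_tree"

primrec left :: "'m pair_tree \<Rightarrow> 'm pair_tree" where
  "left (Pair x y) = x" | "left (Leaf m) = Leaf m"

primrec right :: "'m pair_tree \<Rightarrow> 'm pair_tree" where
  "right (Pair x y) = y" | "right (Leaf m) = Leaf m"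

primrec leaf :: "'m pair_tree \<Rightarrow> 'm" where
  "leaf (Leaf m) = m" | "leaf (Pair x y) = leaf x"

definition tree_dg_module :: "('a, 'm, 'c) dg_module_scheme \<Rightarrow> ('a, 'm pair_tree) dg_module" where
  "tree_dg_module M = \<lparr>carrier = Leaf ` carrier M, monoid.mult = undefined, one = undefined,
     zero = Leaf \<zero>\<^bsub>M\<^esub>,
     add = (\<lambda>x y. Leaf (leaf x \<oplus>\<^bsub>M\<^esub> leaf y)),
     smult = (\<lambda>a x. Leaf (a \<odot>\<^bsub>M\<^esub> leaf x)),
     dgm_comp = (\<lambda>n. Leaf ` dgm_comp M n),
     dgm_diff = (\<lambda>x. Leaf (dgm_diff M (leaf x)))\<rparr>"

text \<open>\<open>a \<mapsto> (-1)\<^bsup>deg a\<^esup> a\<close>, extended additively to inhomogeneous \<open>a\<close>.\<close>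

definition grade_involution :: "('a, 'b) dg_ring_scheme \<Rightarrow> 'a \<Rightarrow> 'a" where
  "grade_involution A a = (let f = (THE f. decomposition A (dg_comp A) a f) in
     \<Oplus>\<^bsub>A\<^esub>n\<in>{n. f n \<noteq> \<zero>\<^bsub>A\<^esub>}. deg_sign A n (f n))"

text \<open>
  The cone of multiplication by \<open>x \<in> A\<^sup>0\<close> on \<open>M\<close> is \<open>M[1] \<oplus> M\<close>, where the shift changes
  the sign of the differential and twists the action of \<open>A\<close> by the sign of the degree.
\<close>

definition mult_cone ::
    "('a, 'b) dg_ring_scheme \<Rightarrow> ('a, 'm pair_tree) dg_module \<Rightarrow> 'a \<Rightarrow> ('a, 'm pair_tree) dg_module" where
  "mult_cone A M x = \<lparr>
     carrier = {Pair y z | y z. y \<in> carrier M \<and> z \<in> carrier M},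
     monoid.mult = undefined, one = undefined,
     zero = Pair \<zero>\<^bsub>M\<^esub> \<zero>\<^bsub>M\<^esub>,
     add = (\<lambda>u v. Pair (left u \<oplus>\<^bsub>M\<^esub> left v) (right u \<oplus>\<^bsub>M\<^esub> right v)),
     smult = (\<lambda>a u. Pair (grade_involution A a \<odot>\<^bsub>M\<^esub> left u) (a \<odot>\<^bsub>M\<^esub> right u)),
     dgm_comp = (\<lambda>n. {Pair y z | y z. y \<in> dgm_comp M (n + 1) \<and> z \<in> dgm_comp M n}),
     dgm_diff = (\<lambda>u. Pair (\<ominus>\<^bsub>M\<^esub> dgm_diff M (left u))
                          (x \<odot>\<^bsub>M\<^esub> left u \<oplus>\<^bsub>M\<^esub> dgm_diff M (right u)))\<rparr>"

text \<open>
  An element of \<open>H\<^sup>0(A)\<close> is the set of its lifts to \<open>A\<^sup>0\<close>, and acts on \<open>M\<close> in the derived category as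
  multiplication by any of them: lifts differing by \<open>d b\<close> give maps homotopic via
  multiplication by \<open>b\<close>, hence isomorphic cones.
\<close>

definition koszul_cone ::
    "('a, 'b) dg_ring_scheme \<Rightarrow> ('a, 'm pair_tree) dg_module \<Rightarrow> 'a set \<Rightarrow> ('a, 'm pair_tree) dg_module" where
  "koszul_cone A M U = mult_cone A M (SOME x. x \<in> U)"

definition regular_element :: "('a, 'm, 'c) dg_module_scheme \<Rightarrow> 'a set \<Rightarrow> bool" where
  "regular_element M U \<longleftrightarrow> (let H = cohomology M (cohomological_inf M) in
     inj_on (\<lambda>y. U \<odot>\<^bsub>H\<^esub> y) (carrier H))"

primrec dg_regular_sequence ::
    "('a, 'b) dg_ring_scheme \<Rightarrow> ('a, 'm pair_tree) dg_module \<Rightarrow> 'a set list \<Rightarrow> bool" where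
  "dg_regular_sequence A M [] \<longleftrightarrow> True"
| "dg_regular_sequence A M (U # Us) \<longleftrightarrow>
     regular_element M U \<and> dg_regular_sequence A (koszul_cone A M U) Us"

definition seq_depth :: "('a, 'b) dg_ring_scheme \<Rightarrow> ('a, 'm, 'c) dg_module_scheme \<Rightarrow> enat" where
  "seq_depth A M = (SUP Us \<in> {Us. set Us \<subseteq> max_ideal (H0 A) \<and>
     dg_regular_sequence A (tree_dg_module M) Us}. enat (length Us))"


section \<open>Cohen-Macaulay DG-rings\<close>

definition local_cohen_macaulay_dg_ring :: "('a, 'b) dg_ring_scheme \<Rightarrow> bool" where
  "local_cohen_macaulay_dg_ring A \<longleftrightarrow> noetherian_local_dg_ring A \<and> bounded_cohomology A \<and>
     seq_depth A (regular_dg_module A) = krull_dim (H0 A)"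

definition cohen_macaulay_dg_ring :: "('a, 'b) dg_ring_scheme \<Rightarrow> bool" where
  "cohen_macaulay_dg_ring A \<longleftrightarrow> noetherian_dg_ring A \<and> bounded_cohomology A \<and>
     (\<forall>P. primeideal P (H0 A) \<longrightarrow> local_cohen_macaulay_dg_ring (dg_localization A P))"

end

theory Submission
  imports Defs
begin

text \<open>
  Write \<open>I = (a\<^sub>1, \<dots>, a\<^sub>k)\<close>.  The DG-ring is the Koszul complex \<open>A = K(C; a\<^sub>1, \<dots>, a\<^sub>k)\<close>, built by adjoining one
  variable of degree \<open>-1\<close> for each generator (\<open>dg_ring_tate\<close>); its cohomology in degree \<open>0\<close> is \<open>C / I\<close>.

  Let \<open>A'\<close> be the localization of \<open>A\<close> at a prime of \<open>C / I\<close>, and let \<open>R\<close> be its part of degree zero.  Then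
  \<open>R\<close> is the localization of \<open>C\<close> at a prime containing \<open>I\<close>, a Cohen-Macaulay local ring of some dimension
  \<open>d\<close>, and \<open>A'\<close> is, as a complex of \<open>R\<close>-modules, the Koszul complex over \<open>R\<close> on the images of the
  \<open>a\<^sub>i\<close> (\<open>localization_unique\<close>).  The iterated cones in the definition of the sequential depth of \<open>A'\<close> are
  again Koszul complexes, on longer lists, because an element of \<open>H\<^sup>0(A')\<close> can be lifted to \<open>R\<close>, and
  two lifts differ by an element that acts as zero on the cohomology.

  So everything reduces to the Koszul complex on a list \<open>bs\<close> in the maximal ideal of \<open>R\<close>.  Its lowest
  non-vanishing cohomology is in degree \<open>d - length bs - dim (R / bs)\<close> (\<open>koszul_bottom\<close>).  Comparing this
  formula for \<open>bs\<close> and for \<open>x # bs\<close> by means of the long exact sequence of the cone shows that \<open>x\<close> is regular on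
  the lowest cohomology exactly if \<open>dim (R / (x, bs)) < dim (R / bs)\<close> (\<open>koszul_regular_iff\<close>).  Hence a
  regular sequence lowers the dimension in each step, and by prime avoidance it can be continued until the dimension is
  zero; so the sequential depth of \<open>A'\<close> is \<open>dim (R / I R) = dim H\<^sup>0(A')\<close>.

  The formula for the lowest degree follows from two facts on adding an element to the list.  Adding any element shifts the lowest degree by at most one downwards.  Adding
  an element that is nilpotent on the cohomology shifts it by exactly one, as it kills some non-zero class of
  lowest degree; and after localization at a minimal prime over the list all elements of that prime are
  nilpotent on the cohomology, since elements of the ideal \<open>(bs)\<close> are null-homotopic.

  For the bound from below let \<open>\<mm>\<close> be minimal over \<open>bs\<close> and \<open>ys\<close> be a maximal regular sequence.
  The lowest degree for \<open>ys @ bs\<close> is that for \<open>bs\<close> minus \<open>d\<close>, but it is at least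
  \<open>- length bs\<close> because the Koszul complex on \<open>ys\<close> has cohomology in degree \<open>0\<close> only
  (\<open>koszul_exact_of_regular_sequence\<close>).  In general, add elements that lower the dimension; by Nakayama's lemma the
  lowest degree does not go up (\<open>koszul_exact_low\<close>).

  For the bound from above let \<open>P\<close> be the bottom of a chain of primes over \<open>bs\<close> of length \<open>dim (R / bs)\<close>, and
  \<open>zs\<close> be elements of \<open>P\<close> over which \<open>P\<close> is minimal, no more than the height of \<open>P\<close>
  (\<open>parameters_at_prime\<close>).  At \<open>P\<close> the complex on \<open>zs @ bs\<close> has cohomology in degree \<open>- length bs\<close>, so the
  complex on \<open>bs\<close> has some in degree at most \<open>length zs - length bs\<close>, as adding \<open>zs\<close> lowers the lowest
  degree by at most \<open>length zs\<close>; and \<open>length zs + dim (R / bs) \<le> d\<close> (\<open>koszul_not_exact\<close>).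
\<close>


section \<open>Primes in noetherian rings\<close>

locale noetherian_cring = cring R + noetherian_ring R for R (structure)

lemma (in noetherian_ring) noetherian_induct [consumes 1, case_names ideal]:
  assumes "ideal I R"
    and step: "\<And>I. \<lbrakk>ideal I R; \<And>J. \<lbrakk>ideal J R; I \<subset> J\<rbrakk> \<Longrightarrow> P J\<rbrakk> \<Longrightarrow> P I"
  shows "P I"
proof (rule ccontr)
  assume "\<not> P I"
  let ?Bad = "{J. ideal J R \<and> \<not> P J}"
  have "\<exists>M\<in>?Bad. \<forall>X\<in>?Bad. M \<subseteq> X \<longrightarrow> X = M"
  proof (rule subset_Zorn_nonempty)
    show "?Bad \<noteq> {}" using assms(1) \<open>\<not> P I\<close> by blast
    show "\<Union>\<C> \<in> ?Bad" if c: "\<C> \<noteq> {}" "subset.chain ?Bad \<C>" for \<C>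
    proof -
      have "subset.chain {I. ideal I R} \<C>" using c(2) unfolding pred_on.chain_def by auto
      then have "\<Union>\<C> \<in> \<C>" using ideal_chain_is_trivial c(1) by blast
      then show ?thesis using c(2) unfolding pred_on.chain_def by blast
    qed
  qed
  then show False using step by (metis (mono_tags, lifting) mem_Collect_eq psubset_eq)
qed

lemma (in noetherian_ring) exists_maximalideal:
  assumes "ideal I R" "I \<noteq> carrier R"
  shows "\<exists>M. maximalideal M R \<and> I \<subseteq> M"
  using assms
proof (induction rule: noetherian_induct)
  case (ideal I)
  show ?case
  proof (cases "maximalideal I R")
    case False
    then obtain J where "ideal J R" "I \<subseteq> J" "J \<noteq> I" "J \<noteq> carrier R"
      using maximalidealI[OF ideal(1)] ideal(3) by metis
    then show ?thesis using ideal(2)[of J] by blast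
  qed blast
qed

definition minimal_primes :: "('a, 'b) ring_scheme \<Rightarrow> 'a set \<Rightarrow> 'a set set" where
  "minimal_primes R X =
     {P. primeideal P R \<and> X \<subseteq> P \<and> (\<forall>Q. primeideal Q R \<and> X \<subseteq> Q \<and> Q \<subseteq> P \<longrightarrow> Q = P)}"

lemma minimal_primesD:
  assumes "P \<in> minimal_primes R X"
  shows "primeideal P R" "X \<subseteq> P" "\<lbrakk>primeideal Q R; X \<subseteq> Q; Q \<subseteq> P\<rbrakk> \<Longrightarrow> Q = P"
  using assms unfolding minimal_primes_def by simp_all

lemma minimal_primesI:
  assumes "primeideal P R" "X \<subseteq> P" "\<And>Q. \<lbrakk>primeideal Q R; X \<subseteq> Q; Q \<subseteq> P\<rbrakk> \<Longrightarrow> Q = P"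
  shows "P \<in> minimal_primes R X"
  using assms unfolding minimal_primes_def by simp

definition ring_prod :: "('a, 'b) ring_scheme \<Rightarrow> 'a list \<Rightarrow> 'a" where
  "ring_prod R xs = foldr (\<otimes>\<^bsub>R\<^esub>) xs \<one>\<^bsub>R\<^esub>"

context cring
begin

lemma ring_prod_simps [simp]:
  "ring_prod R [] = \<one>" "ring_prod R (x # xs) = x \<otimes> ring_prod R xs"
  by (simp_all add: ring_prod_def)

lemma ring_prod_closed [simp, intro]: "set xs \<subseteq> carrier R \<Longrightarrow> ring_prod R xs \<in> carrier R"
  by (induction xs) auto

lemma ring_prod_append:
  "\<lbrakk>set xs \<subseteq> carrier R; set ys \<subseteq> carrier R\<rbrakk> \<Longrightarrow> ring_prod R (xs @ ys) = ring_prod R xs \<otimes> ring_prod R ys"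
  by (induction xs) (auto simp: m_assoc)

lemma primeideal_subset: "primeideal P R \<Longrightarrow> P \<subseteq> carrier R"
  using additive_subgroup.a_subset[OF ideal.axioms(1)[OF primeideal.axioms(1)]] .

lemma primeideal_one: "primeideal P R \<Longrightarrow> \<one> \<notin> P"
  using ideal.one_imp_carrier[of P R] primeideal.I_notcarr[of P R] primeideal.axioms(1)[of P R]
  by (metis (no_types, lifting))

lemma prime_notin_mult:
  "\<lbrakk>primeideal P R; a \<in> carrier R; b \<in> carrier R; a \<notin> P; b \<notin> P\<rbrakk> \<Longrightarrow> a \<otimes> b \<notin> P"
  using primeideal.I_prime[of P R a b] by blast

lemma ring_prod_prime:
  "\<lbrakk>primeideal P R; set xs \<subseteq> carrier R; set xs \<inter> P = {}\<rbrakk> \<Longrightarrow> ring_prod R xs \<notin> P"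
  by (induction xs) (auto simp: primeideal_one prime_notin_mult)


lemma choice_subset_carrier:
  assumes "list_all2 (\<in>) xs Ps" "\<forall>P\<in>set Ps. primeideal P R"
  shows "set xs \<subseteq> carrier R"
  using assms
proof (induction rule: list_all2_induct)
  case (Cons x xs P Ps)
  then have "P \<subseteq> carrier R" using primeideal_subset[of P] by simp
  then show ?case using Cons by simp blast
qed simp

lemma colon_ideal:
  assumes "ideal J R" "X \<subseteq> carrier R"
  shows "ideal {y \<in> carrier R. \<forall>x\<in>X. x \<otimes> y \<in> J} R"
proof (rule idealI)
  interpret J: ideal J R by fact
  have c: "x \<in> carrier R" if "x \<in> X" for x using assms(2) that by auto
  show "ring R" by (rule ring_axioms)
  show "subgroup {y \<in> carrier R. \<forall>x\<in>X. x \<otimes> y \<in> J} (add_monoid R)"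
  proof (rule group.subgroupI[OF a_group])
    have "\<zero> \<in> {y \<in> carrier R. \<forall>x\<in>X. x \<otimes> y \<in> J}" using c by simp
    then show "{y \<in> carrier R. \<forall>x\<in>X. x \<otimes> y \<in> J} \<noteq> {}" by blast
  qed (use c in \<open>auto simp: r_distr r_minus simp flip: a_inv_def\<close>)
  fix a x assume a: "a \<in> {y \<in> carrier R. \<forall>x\<in>X. x \<otimes> y \<in> J}" and x: "x \<in> carrier R"
  have *: "y \<otimes> (x \<otimes> a) \<in> J" if "y \<in> X" for y
    using a x c[OF that] that J.I_l_closed[of "y \<otimes> a" x] m_lcomm[of y x a] by auto
  then show "x \<otimes> a \<in> {y \<in> carrier R. \<forall>x\<in>X. x \<otimes> y \<in> J}" using a x by auto
  then show "a \<otimes> x \<in> {y \<in> carrier R. \<forall>x\<in>X. x \<otimes> y \<in> J}" using a x by (auto simp: m_comm)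
qed

end

text \<open>
  If \<open>a b \<in> J\<close> but \<open>a, b \<notin> J\<close>, then the colon ideals \<open>(J : b)\<close> and \<open>(J : (J : b))\<close> are strictly
  larger than \<open>J\<close>, and their product lies in \<open>J\<close>; so noetherian induction applies.
\<close>

lemma (in noetherian_cring) product_of_primes:
  assumes "ideal J R"
  shows "\<exists>Ps. (\<forall>P\<in>set Ps. primeideal P R \<and> J \<subseteq> P) \<and>
    (\<forall>xs. list_all2 (\<in>) xs Ps \<longrightarrow> ring_prod R xs \<in> J)"
  using assms
proof (induction rule: noetherian_induct)
  case (ideal J)
  interpret J: ideal J R by fact
  consider "primeideal J R" | "J = carrier R" | a b where
    "a \<in> carrier R" "b \<in> carrier R" "a \<otimes> b \<in> J" "a \<notin> J" "b \<notin> J"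
    using primeidealI[OF ideal(1) is_cring] by metis
  then show ?case
  proof cases
    case 1
    then show ?thesis by (intro exI[of _ "[J]"]) (auto simp: list_all2_Cons2 primeideal_subset)
  next
    case 2
    then show ?thesis by (intro exI[of _ "[]"]) auto
  next
    case 3
    \<comment> \<open>\<open>?K\<close> is \<open>(J : b)\<close> and \<open>?L\<close> is \<open>(J : ?K)\<close>\<close>
    let ?K = "{y \<in> carrier R. \<forall>x\<in>{b}. x \<otimes> y \<in> J}"
    let ?L = "{y \<in> carrier R. \<forall>x\<in>?K. x \<otimes> y \<in> J}"
    have K: "ideal ?K R" using 3 by (intro colon_ideal ideal(1)) simp
    have L: "ideal ?L R" by (intro colon_ideal ideal(1)) auto
    have "a \<in> ?K" "b \<in> ?L" using 3 by (auto simp: m_comm)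
    moreover have "J \<subseteq> ?K" "J \<subseteq> ?L" using 3 by (auto intro: J.I_l_closed)
    ultimately have JK: "J \<subset> ?K" and JL: "J \<subset> ?L" using 3 by blast+
    obtain Ps Qs where PQ:
      "\<forall>P\<in>set Ps. primeideal P R \<and> ?K \<subseteq> P" "\<forall>xs. list_all2 (\<in>) xs Ps \<longrightarrow> ring_prod R xs \<in> ?K"
      "\<forall>P\<in>set Qs. primeideal P R \<and> ?L \<subseteq> P" "\<forall>xs. list_all2 (\<in>) xs Qs \<longrightarrow> ring_prod R xs \<in> ?L"
      using ideal(2)[OF K JK] ideal(2)[OF L JL] by (elim exE conjE) (rule that)
    have prod: "ring_prod R xs \<in> J" if xs: "list_all2 (\<in>) xs (Ps @ Qs)" for xs
    proof -
      obtain us vs where "xs = us @ vs" "list_all2 (\<in>) us Ps" "list_all2 (\<in>) vs Qs"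
        using xs list_all2_append2 by blast
      moreover have "ring_prod R us \<in> ?K" "ring_prod R vs \<in> ?L"
        using PQ(2,4) calculation(2,3) by simp_all
      moreover have "set us \<subseteq> carrier R" "set vs \<subseteq> carrier R"
        using PQ(1,3) calculation(2,3) by (simp_all add: choice_subset_carrier)
      ultimately show ?thesis by (simp add: ring_prod_append)
    qed
    moreover have "\<forall>P\<in>set (Ps @ Qs). primeideal P R \<and> J \<subseteq> P"
      using PQ(1,3) subset_trans[OF psubset_imp_subset[OF JK]] subset_trans[OF psubset_imp_subset[OF JL]]
      by (simp only: set_append ball_Un) simp
    ultimately show ?thesis using prod by (intro exI[of _ "Ps @ Qs"] conjI allI impI)
  qed
qed

context noetherian_cring
begin

text \<open>
  The primes of \<open>product_of_primes\<close> for \<open>Idl X\<close>; a prime that contains a product contains a factor, so it lies above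
  one of them.
\<close>

lemma primes_over:
  assumes "X \<subseteq> carrier R"
  shows "\<exists>Ps. (\<forall>P\<in>set Ps. primeideal P R \<and> X \<subseteq> P) \<and>
    (\<forall>xs. list_all2 (\<in>) xs Ps \<longrightarrow> ring_prod R xs \<in> Idl X) \<and>
    (\<forall>Q. primeideal Q R \<and> X \<subseteq> Q \<longrightarrow> (\<exists>P\<in>set Ps. P \<subseteq> Q))"
proof -
  obtain Ps where Ps: "\<forall>P\<in>set Ps. primeideal P R \<and> Idl X \<subseteq> P"
    "\<forall>xs. list_all2 (\<in>) xs Ps \<longrightarrow> ring_prod R xs \<in> Idl X"
    using product_of_primes[OF genideal_ideal[OF assms]] by blast
  have "\<exists>P\<in>set Ps. P \<subseteq> Q" if Q: "primeideal Q R" "X \<subseteq> Q" for Q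
  proof (rule ccontr)
    assume "\<not> (\<exists>P\<in>set Ps. P \<subseteq> Q)"
    then have "\<forall>P. \<exists>x. P \<in> set Ps \<longrightarrow> x \<in> P \<and> x \<notin> Q" by blast
    then obtain f where f: "\<And>P. P \<in> set Ps \<Longrightarrow> f P \<in> P \<and> f P \<notin> Q" by metis
    have "list_all2 (\<in>) (map f Ps) Ps" using f by (auto simp: list_all2_conv_all_nth)
    then have "ring_prod R (map f Ps) \<in> Q"
      using Ps genideal_minimal[OF primeideal.axioms(1)[OF Q(1)] Q(2)] by blast
    moreover have "set (map f Ps) \<subseteq> carrier R" using Ps f primeideal_subset by fastforce
    ultimately show False using ring_prod_prime[OF Q(1)] f by fastforce
  qed
  then show ?thesis using Ps genideal_self[OF assms] by blast
qed

lemma finite_minimal_primes: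
  assumes "X \<subseteq> carrier R"
  shows "finite (minimal_primes R X)"
proof -
  obtain Ps where Ps: "\<forall>P\<in>set Ps. primeideal P R \<and> X \<subseteq> P"
    "\<forall>Q. primeideal Q R \<and> X \<subseteq> Q \<longrightarrow> (\<exists>P\<in>set Ps. P \<subseteq> Q)"
    using primes_over[OF assms] by blast
  have "P \<in> set Ps" if P: "P \<in> minimal_primes R X" for P
  proof -
    obtain Q where Q: "Q \<in> set Ps" "Q \<subseteq> P"
      using Ps(2) minimal_primesD(1,2)[OF P] by meson
    then have "Q = P" using Ps(1) minimal_primesD(3)[OF P] by meson
    then show ?thesis using Q by simp
  qed
  then have "minimal_primes R X \<subseteq> set Ps" by (rule subsetI)
  then show ?thesis by (rule finite_subset) simp
qed

lemma minimal_prime_below: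
  assumes "primeideal Q R" "X \<subseteq> Q"
  shows "\<exists>P\<in>minimal_primes R X. P \<subseteq> Q"
proof -
  have X: "X \<subseteq> carrier R" using assms(2) primeideal_subset[OF assms(1)] by blast
  obtain Ps where Ps: "\<forall>P\<in>set Ps. primeideal P R \<and> X \<subseteq> P"
    "\<forall>Q. primeideal Q R \<and> X \<subseteq> Q \<longrightarrow> (\<exists>P\<in>set Ps. P \<subseteq> Q)"
    using primes_over[OF X] by blast
  let ?A = "{P \<in> set Ps. P \<subseteq> Q}"
  obtain P0 where "P0 \<in> set Ps" "P0 \<subseteq> Q" using Ps(2) assms by meson
  then have A: "finite ?A" "?A \<noteq> {}" by auto
  obtain P where P: "P \<in> ?A" "\<forall>P'\<in>?A. P' \<subseteq> P \<longrightarrow> P = P'"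
    using finite_has_minimal[OF A] by (elim bexE) (rule that)
  have "Q' = P" if Q': "primeideal Q' R" "X \<subseteq> Q'" "Q' \<subseteq> P" for Q'
  proof -
    obtain P' where P': "P' \<in> set Ps" "P' \<subseteq> Q'" using Ps(2) Q'(1,2) by meson
    then have "P' \<subseteq> P" "P' \<subseteq> Q" using Q'(3) P(1) by auto
    then have "P = P'" using P(2) P'(1) by simp
    then show ?thesis using P'(2) Q'(3) by simp
  qed
  then have "P \<in> minimal_primes R X" using P(1) Ps(1) by (intro minimal_primesI) auto
  then show ?thesis using P(1) by auto
qed

text \<open>
  In the localization at a minimal prime \<open>P\<close> over \<open>X\<close>, the ideal of \<open>P\<close> is nilpotent modulo \<open>X\<close>;
  this is the statement with denominators cleared.
\<close>

lemma minimal_prime_nilpotent: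
  assumes P: "P \<in> minimal_primes R X" and b: "b \<in> P"
  shows "\<exists>s N. s \<in> carrier R - P \<and> s \<otimes> b [^] (N::nat) \<in> Idl X"
proof -
  note pP = minimal_primesD(1,2)[OF P]
  have X: "X \<subseteq> carrier R" using pP(2) primeideal_subset[OF pP(1)] by blast
  obtain Ps where Ps: "\<forall>P\<in>set Ps. primeideal P R \<and> X \<subseteq> P"
    "\<forall>xs. list_all2 (\<in>) xs Ps \<longrightarrow> ring_prod R xs \<in> Idl X"
    using primes_over[OF X] by blast
  have bc: "b \<in> carrier R" using b primeideal_subset[OF pP(1)] by blast
  \<comment> \<open>choose \<open>b\<close> from every prime equal to \<open>P\<close>, and an element outside \<open>P\<close> from every other one\<close>
  have "\<exists>s N xs. s \<in> carrier R - P \<and> list_all2 (\<in>) xs Ps \<and> ring_prod R xs = s \<otimes> b [^] (N::nat)"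
    using Ps(1)
  proof (induction Ps)
    case Nil
    show ?case using primeideal_one[OF pP(1)]
      by (intro exI[of _ \<one>] exI[of _ 0] exI[of _ "[]"]) auto
  next
    case (Cons Q Ps)
    then obtain s N xs where IH: "s \<in> carrier R - P" "list_all2 (\<in>) xs Ps"
      "ring_prod R xs = s \<otimes> b [^] (N::nat)" by auto
    show ?case
    proof (cases "Q \<subseteq> P")
      case True
      then have "Q = P" using minimal_primesD(3)[OF P] Cons.prems by simp
      then show ?thesis using IH b bc
        by (intro exI[of _ s] exI[of _ "Suc N"] exI[of _ "b # xs"])
          (auto simp: m_ac)
    next
      case False
      then obtain t where t: "t \<in> Q" "t \<notin> P" by blast
      then have "t \<in> carrier R" using Cons.prems primeideal_subset by auto
      then show ?thesis using IH t bc prime_notin_mult[OF pP(1)]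
        by (intro exI[of _ "t \<otimes> s"] exI[of _ N] exI[of _ "t # xs"]) (auto simp: m_assoc)
    qed
  qed
  then show ?thesis using Ps(2) by metis
qed

end

text \<open>
  By induction on the number of primes, redundant primes being discarded first: if \<open>x \<in> I\<close> avoids all the
  primes but \<open>P\<close>, add to it an element of \<open>I\<close> that lies in all of them but not in \<open>P\<close>.
\<close>

lemma (in cring) prime_avoidance:
  assumes "finite \<P>" "\<forall>P\<in>\<P>. primeideal P R \<and> \<not> I \<subseteq> P" "ideal I R"
  shows "\<exists>x\<in>I. \<forall>P\<in>\<P>. x \<notin> P"
  using assms(1,2)
proof (induction "card \<P>" arbitrary: \<P> rule: less_induct)
  case less
  interpret I: ideal I R by fact
  consider "\<P> = {}" | P Q where "P \<in> \<P>" "Q \<in> \<P>" "P \<noteq> Q" "Q \<subseteq> P"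
    | P where "P \<in> \<P>" "\<forall>Q\<in>\<P> - {P}. \<not> Q \<subseteq> P"
    by (metis Diff_iff ex_in_conv insertCI)
  then show ?case
  proof cases
    case 1 then show ?thesis using I.zero_closed by blast
  next
    case 2
    have "card (\<P> - {Q}) < card \<P>" using less.prems(1) 2 by (meson card_Diff1_less)
    moreover have "finite (\<P> - {Q})" "\<forall>P\<in>\<P> - {Q}. primeideal P R \<and> \<not> I \<subseteq> P"
      using less.prems by simp_all
    ultimately obtain x where "x \<in> I" "\<forall>P\<in>\<P> - {Q}. x \<notin> P" using less.hyps by meson
    then show ?thesis using 2 by (intro bexI[of _ x]) auto
  next
    case 3
    have "card (\<P> - {P}) < card \<P>" using less.prems(1) 3 by (meson card_Diff1_less)
    moreover have rest: "finite (\<P> - {P})" "\<forall>Q\<in>\<P> - {P}. primeideal Q R \<and> \<not> I \<subseteq> Q"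
      using less.prems by simp_all
    ultimately obtain x where x: "x \<in> I" "\<forall>Q\<in>\<P> - {P}. x \<notin> Q" using less.hyps by meson
    have P: "primeideal P R" using less.prems 3 by blast
    have "\<exists>y. y \<in> I - P \<and> (\<forall>Q\<in>\<Q>. y \<in> Q)" if "finite \<Q>" "\<forall>Q\<in>\<Q>. primeideal Q R \<and> \<not> Q \<subseteq> P" for \<Q>
      using that
    proof (induction \<Q>)
      case empty then show ?case using less.prems 3 by blast
    next
      case (insert Q \<Q>)
      then obtain y where y: "y \<in> I - P" "\<forall>Q\<in>\<Q>. y \<in> Q" by auto
      obtain t where t: "t \<in> Q" "t \<notin> P" using insert by blast
      have "primeideal Q R" using insert.prems by simp
      then have c: "t \<in> carrier R" "y \<in> carrier R" using t(1) y primeideal_subset by auto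
      have "t \<otimes> y \<in> Q'" if "Q' \<in> insert Q \<Q>" for Q'
      proof -
        have "primeideal Q' R" using that insert.prems by auto
        then have "ideal Q' R" by (rule primeideal.axioms(1))
        then interpret Q': ideal Q' R .
        show ?thesis using that t y c Q'.I_l_closed[of y t] Q'.I_r_closed[of t y] by auto
      qed
      then show ?case using t(2) y(1) c prime_notin_mult[OF P, of t y] I.I_l_closed[of y t] by blast
    qed
    moreover have "\<forall>Q\<in>\<P> - {P}. primeideal Q R \<and> \<not> Q \<subseteq> P" using rest(2) 3(2) by simp
    ultimately obtain y where y: "y \<in> I - P" "\<forall>Q\<in>\<P> - {P}. y \<in> Q"
      using rest(1) by meson
    have sum: "a \<in> Q" if "a \<oplus> b \<in> Q" "b \<in> Q" "ideal Q R" "a \<in> carrier R" "b \<in> carrier R" for a b Q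
    proof -
      interpret Q: ideal Q R by fact
      have "(a \<oplus> b) \<oplus> (\<ominus> b) \<in> Q" using that by blast
      then show ?thesis using that by (simp add: a_assoc r_neg)
    qed
    have xy: "x \<in> carrier R" "y \<in> carrier R" using x y by auto
    show ?thesis
    proof (cases "x \<in> P")
      case False then show ?thesis using x by blast
    next
      case True
      have "x \<oplus> y \<notin> Q" if Q: "Q \<in> \<P>" for Q
      proof -
        have "primeideal Q R" using Q less.prems by simp
        then have "ideal Q R" by (rule primeideal.axioms(1))
        then show ?thesis using Q sum[of x y Q] sum[of y x Q] x y xy True by (auto simp: a_comm)
      qed
      then show ?thesis using x y by (intro bexI[of _ "x \<oplus> y"]) auto
    qed
  qed
qed


subsection \<open>Chains of primes\<close>

definition prime_chain :: "('a, 'b) ring_scheme \<Rightarrow> 'a set \<Rightarrow> nat \<Rightarrow> (nat \<Rightarrow> 'a set) \<Rightarrow> bool" where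
  "prime_chain R X n P \<longleftrightarrow> (\<forall>i\<le>n. primeideal (P i) R \<and> X \<subseteq> P i) \<and> (\<forall>i<n. P i \<subset> P (Suc i))"


lemma prime_chain_take: "\<lbrakk>prime_chain R X n P; m \<le> n\<rbrakk> \<Longrightarrow> prime_chain R X m P"
  by (simp add: prime_chain_def)

lemma prime_chain_mono: "\<lbrakk>prime_chain R X n P; Y \<subseteq> X\<rbrakk> \<Longrightarrow> prime_chain R Y n P"
  by (auto simp: prime_chain_def)

lemma prime_chain_cons:
  assumes "prime_chain R X n P" "primeideal Q R" "Y \<subseteq> Q" "Y \<subseteq> X" "Q \<subset> P 0"
  shows "prime_chain R Y (Suc n) (\<lambda>i. case i of 0 \<Rightarrow> Q | Suc i \<Rightarrow> P i)"
proof -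
  have "Y \<subseteq> P i" if "i \<le> n" for i using assms(1,4) that unfolding prime_chain_def by blast
  then show ?thesis using assms unfolding prime_chain_def by (auto split: nat.splits)
qed

lemma prime_chain_append:
  assumes "prime_chain R X m P" "prime_chain R Y n Q" "P m = Q 0" "X \<subseteq> Y"
  shows "prime_chain R X (m + n) (\<lambda>i. if i \<le> m then P i else Q (i - m))"
proof -
  have 1: "primeideal (if i \<le> m then P i else Q (i - m)) R \<and> X \<subseteq> (if i \<le> m then P i else Q (i - m))"
    if "i \<le> m + n" for i
  proof (cases "i \<le> m")
    case False
    then have "primeideal (Q (i - m)) R" "Y \<subseteq> Q (i - m)" using assms(2) that by (auto simp: prime_chain_def)
    then show ?thesis using False assms(4) by simp
  qed (use assms(1) in \<open>simp add: prime_chain_def\<close>)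
  have 2: "(if i \<le> m then P i else Q (i - m)) \<subset> (if Suc i \<le> m then P (Suc i) else Q (Suc i - m))"
    if "i < m + n" for i
  proof -
    consider "i < m" | "i = m" | "i > m" by linarith
    then show ?thesis
    proof cases
      case 2
      then have "Q 0 \<subset> Q 1" using assms(2) that by (simp add: prime_chain_def)
      then show ?thesis using 2 assms(3) by simp
    next
      case 3
      then have "Q (i - m) \<subset> Q (Suc (i - m))" using assms(2) that by (simp add: prime_chain_def)
      then show ?thesis using 3 by (simp add: Suc_diff_le)
    qed (use assms(1) in \<open>simp add: prime_chain_def\<close>)
  qed
  from 1 2 show ?thesis unfolding prime_chain_def by blast
qed

context noetherian_cring
begin

text \<open>
  The choice of \<open>zs\<close> is greedy: as long as \<open>P\<close> is not minimal over \<open>zs\<close>, take the next element of \<open>P\<close> outside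
  the minimal primes over \<open>zs\<close> that lie below \<open>P\<close>.  Every minimal prime over \<open>zs\<close> below \<open>P\<close> is then the top
  of a chain of length \<open>length zs\<close>, so the process stops.
\<close>

lemma parameters_at_prime:
  assumes P: "primeideal P R" and bound: "\<And>n C. prime_chain R {} n C \<Longrightarrow> n \<le> d"
  shows "\<exists>zs C. set zs \<subseteq> P \<and> P \<in> minimal_primes R (set zs) \<and>
    prime_chain R {} (length zs) C \<and> C (length zs) = P"
proof -
  \<comment> \<open>the invariant: every minimal prime over \<open>zs\<close> below \<open>P\<close> is the top of a chain of length \<open>length zs\<close>\<close>
  define good where "good = (\<lambda>zs. set zs \<subseteq> P \<and> (\<forall>Q\<in>minimal_primes R (set zs). Q \<subseteq> P \<longrightarrow>
    (\<exists>C. prime_chain R {} (length zs) C \<and> C (length zs) = Q)))"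
  have below: "\<exists>Q\<in>minimal_primes R (set zs). Q \<subseteq> P" if "set zs \<subseteq> P" for zs
    using minimal_prime_below[OF P that] .
  have step: "\<exists>z. good (z # zs)" if zs: "good zs" "P \<notin> minimal_primes R (set zs)" for zs
  proof -
    have zsP: "set zs \<subseteq> P" using zs by (simp add: good_def)
    let ?\<P> = "{Q \<in> minimal_primes R (set zs). Q \<subseteq> P}"
    have "finite (minimal_primes R (set zs))"
      using zsP primeideal_subset[OF P] by (intro finite_minimal_primes) simp
    then have fin: "finite ?\<P>" by simp
    have notin: "\<forall>Q\<in>?\<P>. primeideal Q R \<and> \<not> P \<subseteq> Q"
    proof
      fix Q assume Q: "Q \<in> ?\<P>"
      then have "Q \<noteq> P" using zs(2) by auto
      then show "primeideal Q R \<and> \<not> P \<subseteq> Q" using Q minimal_primesD(1)[of Q R "set zs"] by auto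
    qed
    obtain z where z: "z \<in> P" "\<forall>Q\<in>?\<P>. z \<notin> Q"
      using prime_avoidance[OF fin notin primeideal.axioms(1)[OF P]] by (elim bexE) (rule that)
    have "\<exists>C. prime_chain R {} (Suc (length zs)) C \<and> C (Suc (length zs)) = Q'"
      if Q': "Q' \<in> minimal_primes R (set (z # zs))" "Q' \<subseteq> P" for Q'
    proof -
      have pQ': "primeideal Q' R" "set zs \<subseteq> Q'" "z \<in> Q'" using minimal_primesD(1,2)[OF Q'(1)] by auto
      obtain Q where Q: "Q \<in> minimal_primes R (set zs)" "Q \<subseteq> Q'"
        using minimal_prime_below[OF pQ'(1,2)] by (elim bexE) (rule that)
      have "Q \<subseteq> P" using Q(2) Q'(2) by (rule subset_trans)
      then have "Q \<subset> Q'" using z(2) Q pQ'(3) by auto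
      obtain C where C: "prime_chain R {} (length zs) C" "C (length zs) = Q"
        using zs(1) Q(1) \<open>Q \<subseteq> P\<close> unfolding good_def by meson
      have "prime_chain R {} (Suc (length zs)) (C(Suc (length zs) := Q'))"
        using C pQ' \<open>Q \<subset> Q'\<close> by (auto simp: prime_chain_def less_Suc_eq)
      then show ?thesis by auto
    qed
    then have "good (z # zs)" using zsP z by (auto simp: good_def)
    then show ?thesis by blast
  qed
  have "\<exists>zs. good zs \<and> P \<in> minimal_primes R (set zs)"
  proof (rule ccontr)
    assume "\<not> (\<exists>zs. good zs \<and> P \<in> minimal_primes R (set zs))"
    then have *: "\<exists>zs. good zs \<and> length zs = n" for n
    proof (induction n)
      case 0
      have "\<exists>C. prime_chain R {} 0 C \<and> C 0 = Q" if "Q \<in> minimal_primes R {}" for Q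
        using minimal_primesD(1)[OF that] by (intro exI[of _ "\<lambda>_. Q"]) (simp add: prime_chain_def)
      then have "good []" by (simp add: good_def)
      then show ?case by (intro exI[of _ "[]"]) simp
    next
      case (Suc n)
      then obtain zs where zs: "good zs" "length zs = n" "P \<notin> minimal_primes R (set zs)" by meson
      then obtain z where "good (z # zs)" using step[OF zs(1,3)] by (elim exE)
      then show ?case using zs(2) by (intro exI[of _ "z # zs"]) simp
    qed
    then obtain zs where zs: "good zs" "length zs = Suc d" by meson
    then obtain Q C where "prime_chain R {} (length zs) C"
      using below[of zs] unfolding good_def by meson
    then show False using bound[of "length zs" C] zs(2) by simp
  qed
  then obtain zs where zs: "good zs" "P \<in> minimal_primes R (set zs)" by (elim exE conjE)
  then obtain C where "prime_chain R {} (length zs) C" "C (length zs) = P"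
    unfolding good_def by (meson subset_refl)
  then show ?thesis using zs unfolding good_def by (intro exI[of _ zs] exI[of _ C]) simp
qed

end


section \<open>Complexes of modules\<close>

locale cochain_complex = module R M
  for R :: "('a, 'b) ring_scheme" (structure) and M :: "('a, 'm, 'c) dg_module_scheme" (structure) +
  assumes comp_submodule: "submodule (dgm_comp M n) R M"
    and diff_comp: "x \<in> dgm_comp M n \<Longrightarrow> dgm_diff M x \<in> dgm_comp M (n + 1)"
    and diff_add: "\<lbrakk>x \<in> dgm_comp M n; y \<in> dgm_comp M n\<rbrakk> \<Longrightarrow>
      dgm_diff M (x \<oplus>\<^bsub>M\<^esub> y) = dgm_diff M x \<oplus>\<^bsub>M\<^esub> dgm_diff M y"
    and diff_smult: "\<lbrakk>a \<in> carrier R; x \<in> dgm_comp M n\<rbrakk> \<Longrightarrow>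
      dgm_diff M (a \<odot>\<^bsub>M\<^esub> x) = a \<odot>\<^bsub>M\<^esub> dgm_diff M x"
    and diff_diff: "x \<in> dgm_comp M n \<Longrightarrow> dgm_diff M (dgm_diff M x) = \<zero>\<^bsub>M\<^esub>"
begin

lemma comp_carrier: "x \<in> dgm_comp M n \<Longrightarrow> x \<in> carrier M"
  using submoduleE(1)[OF comp_submodule[of n]] by auto

lemma comp_zero: "\<zero>\<^bsub>M\<^esub> \<in> dgm_comp M n"
  using subgroup.one_closed[OF submodule.axioms(1)[OF comp_submodule[of n]]] by simp

lemma comp_add: "\<lbrakk>x \<in> dgm_comp M n; y \<in> dgm_comp M n\<rbrakk> \<Longrightarrow> x \<oplus>\<^bsub>M\<^esub> y \<in> dgm_comp M n"
  by (rule submoduleE(5)[OF comp_submodule])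

lemma comp_minus: "x \<in> dgm_comp M n \<Longrightarrow> \<ominus>\<^bsub>M\<^esub> x \<in> dgm_comp M n"
  by (rule submoduleE(3)[OF comp_submodule])

lemma comp_smult: "\<lbrakk>a \<in> carrier R; x \<in> dgm_comp M n\<rbrakk> \<Longrightarrow> a \<odot>\<^bsub>M\<^esub> x \<in> dgm_comp M n"
  by (rule submoduleE(4)[OF comp_submodule])

lemma diff_comp': "x \<in> dgm_comp M (n - 1) \<Longrightarrow> dgm_diff M x \<in> dgm_comp M n"
  using diff_comp[of x "n - 1"] by simp

lemmas comp_closed = comp_zero comp_add comp_minus comp_smult diff_comp

lemma diff_zero: "dgm_diff M \<zero>\<^bsub>M\<^esub> = \<zero>\<^bsub>M\<^esub>"
  using diff_smult[of \<zero> "\<zero>\<^bsub>M\<^esub>" 0] comp_carrier[OF diff_comp[OF comp_zero[of 0]]] comp_zero[of 0]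
  by simp

lemma minus_zero: "\<ominus>\<^bsub>M\<^esub> \<zero>\<^bsub>M\<^esub> = \<zero>\<^bsub>M\<^esub>"
  by (rule M.minus_equality) simp_all

lemma diff_minus:
  assumes "x \<in> dgm_comp M n"
  shows "dgm_diff M (\<ominus>\<^bsub>M\<^esub> x) = \<ominus>\<^bsub>M\<^esub> dgm_diff M x"
proof -
  have "dgm_diff M (\<ominus>\<^bsub>M\<^esub> x) \<oplus>\<^bsub>M\<^esub> dgm_diff M x = \<zero>\<^bsub>M\<^esub>"
    using diff_add[OF comp_minus[OF assms] assms] comp_carrier[OF assms]
    by (simp add: M.l_neg diff_zero)
  then show ?thesis
    using comp_carrier[OF diff_comp[OF assms]] comp_carrier[OF diff_comp[OF comp_minus[OF assms]]]
    by (simp add: M.minus_equality)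
qed

lemma cocycles_iff: "z \<in> cocycles M n \<longleftrightarrow> z \<in> dgm_comp M n \<and> dgm_diff M z = \<zero>\<^bsub>M\<^esub>"
  by (simp add: cocycles_def)

lemma coboundariesI: "w \<in> dgm_comp M (n - 1) \<Longrightarrow> dgm_diff M w \<in> coboundaries M n"
  by (simp add: coboundaries_def)

lemma coboundariesE:
  assumes "z \<in> coboundaries M n"
  obtains w where "w \<in> dgm_comp M (n - 1)" "z = dgm_diff M w"
  using assms unfolding coboundaries_def by blast

lemma coboundaries_comp: "z \<in> coboundaries M n \<Longrightarrow> z \<in> dgm_comp M n"
  by (elim coboundariesE) (simp add: diff_comp')


lemma cocycles_submodule: "submodule (cocycles M n) R M"
  using comp_carrier
  by (intro submoduleI)
    (auto simp: cocycles_iff comp_closed diff_zero diff_minus diff_add diff_smult)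

lemma coboundaries_submodule: "submodule (coboundaries M n) R M"
proof (rule submoduleI)
  show "coboundaries M n \<subseteq> carrier M" using coboundaries_comp comp_carrier by blast
  show "\<zero>\<^bsub>M\<^esub> \<in> coboundaries M n"
    using coboundariesI[OF comp_zero] by (simp add: diff_zero)
  fix x assume "x \<in> coboundaries M n"
  then obtain w where w: "w \<in> dgm_comp M (n - 1)" "x = dgm_diff M w" by (rule coboundariesE)
  then show "\<ominus>\<^bsub>M\<^esub> x \<in> coboundaries M n"
    using coboundariesI[OF comp_minus[OF w(1)]] by (simp add: diff_minus)
  show "a \<odot>\<^bsub>M\<^esub> x \<in> coboundaries M n" if "a \<in> carrier R" for a
    using coboundariesI[OF comp_smult[OF that w(1)]] that w by (simp add: diff_smult)
  fix y assume "y \<in> coboundaries M n"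
  then obtain v where v: "v \<in> dgm_comp M (n - 1)" "y = dgm_diff M v" by (rule coboundariesE)
  then show "x \<oplus>\<^bsub>M\<^esub> y \<in> coboundaries M n"
    using coboundariesI[OF comp_add[OF w(1) v(1)]] w by (simp add: diff_add)
qed

lemmas cocycles_closed = submoduleE(3,4,5)[OF cocycles_submodule]
lemmas coboundaries_closed = submoduleE(3,4,5)[OF coboundaries_submodule]

lemma coboundaries_zero: "\<zero>\<^bsub>M\<^esub> \<in> coboundaries M n"
  using coboundariesI[OF comp_zero] by (simp add: diff_zero)

end

text \<open>
  The cohomology of \<open>S\<inverse>M\<close> vanishes in degree \<open>n\<close>, with denominators cleared.  For \<open>S = {\<one>}\<close>
  this is exactness of \<open>M\<close> itself.
\<close>

definition loc_exact_at :: "('a, 'm, 'c) dg_module_scheme \<Rightarrow> 'a set \<Rightarrow> int \<Rightarrow> bool" where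
  "loc_exact_at M S n \<longleftrightarrow> (\<forall>z\<in>cocycles M n. \<exists>s\<in>S. s \<odot>\<^bsub>M\<^esub> z \<in> coboundaries M n)"

definition exact_at :: "('a, 'm, 'c) dg_module_scheme \<Rightarrow> int \<Rightarrow> bool" where
  "exact_at M n \<longleftrightarrow> cocycles M n \<subseteq> coboundaries M n"

definition cohomology_injective :: "('a, 'm, 'c) dg_module_scheme \<Rightarrow> 'a \<Rightarrow> int \<Rightarrow> bool" where
  "cohomology_injective M x n \<longleftrightarrow>
     (\<forall>z\<in>cocycles M n. x \<odot>\<^bsub>M\<^esub> z \<in> coboundaries M n \<longrightarrow> z \<in> coboundaries M n)"

lemma exact_imp_injective: "exact_at M n \<Longrightarrow> cohomology_injective M x n"
  by (auto simp: exact_at_def cohomology_injective_def)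


subsection \<open>The cone of a scalar\<close>

definition cone :: "('a, 'm pair_tree, 'c) dg_module_scheme \<Rightarrow> 'a \<Rightarrow> ('a, 'm pair_tree) dg_module" where
  "cone M x = \<lparr>
     carrier = {Pair y z | y z. y \<in> carrier M \<and> z \<in> carrier M},
     monoid.mult = undefined, one = undefined,
     zero = Pair \<zero>\<^bsub>M\<^esub> \<zero>\<^bsub>M\<^esub>,
     add = (\<lambda>u v. Pair (left u \<oplus>\<^bsub>M\<^esub> left v) (right u \<oplus>\<^bsub>M\<^esub> right v)),
     smult = (\<lambda>a u. Pair (a \<odot>\<^bsub>M\<^esub> left u) (a \<odot>\<^bsub>M\<^esub> right u)),
     dgm_comp = (\<lambda>n. {Pair y z | y z. y \<in> dgm_comp M (n + 1) \<and> z \<in> dgm_comp M n}),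
     dgm_diff = (\<lambda>u. Pair (\<ominus>\<^bsub>M\<^esub> dgm_diff M (left u))
                          (x \<odot>\<^bsub>M\<^esub> left u \<oplus>\<^bsub>M\<^esub> dgm_diff M (right u)))\<rparr>"

lemma cone_simps [simp]:
  "Pair y z \<in> carrier (cone M x) \<longleftrightarrow> y \<in> carrier M \<and> z \<in> carrier M"
  "\<zero>\<^bsub>cone M x\<^esub> = Pair \<zero>\<^bsub>M\<^esub> \<zero>\<^bsub>M\<^esub>"
  "Pair y z \<oplus>\<^bsub>cone M x\<^esub> Pair y' z' = Pair (y \<oplus>\<^bsub>M\<^esub> y') (z \<oplus>\<^bsub>M\<^esub> z')"
  "a \<odot>\<^bsub>cone M x\<^esub> Pair y z = Pair (a \<odot>\<^bsub>M\<^esub> y) (a \<odot>\<^bsub>M\<^esub> z)"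
  "Pair y z \<in> dgm_comp (cone M x) n \<longleftrightarrow> y \<in> dgm_comp M (n + 1) \<and> z \<in> dgm_comp M n"
  "dgm_diff (cone M x) (Pair y z) =
    Pair (\<ominus>\<^bsub>M\<^esub> dgm_diff M y) (x \<odot>\<^bsub>M\<^esub> y \<oplus>\<^bsub>M\<^esub> dgm_diff M z)"
  by (simp_all add: cone_def)

lemma cone_carrierE:
  assumes "u \<in> carrier (cone M x)"
  obtains y z where "u = Pair y z" "y \<in> carrier M" "z \<in> carrier M"
  using assms by (auto simp: cone_def)

lemma cone_compE:
  assumes "u \<in> dgm_comp (cone M x) n"
  obtains y z where "u = Pair y z" "y \<in> dgm_comp M (n + 1)" "z \<in> dgm_comp M n"
  using assms by (auto simp: cone_def)

context cochain_complex
begin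

lemma diff_carrier: "x \<in> dgm_comp M n \<Longrightarrow> dgm_diff M x \<in> carrier M"
  using comp_carrier diff_comp by blast


end

locale tree_complex = cochain_complex R M
  for R :: "('a, 'b) ring_scheme" (structure) and M :: "('a, 'm pair_tree, 'c) dg_module_scheme" (structure)
begin

lemma cone_abelian_group: "abelian_group (cone M x)"
proof (rule abelian_groupI)
  fix u assume "u \<in> carrier (cone M x)"
  then obtain y z where u: "u = Pair y z" "y \<in> carrier M" "z \<in> carrier M" by (rule cone_carrierE)
  then show "\<exists>v\<in>carrier (cone M x). v \<oplus>\<^bsub>cone M x\<^esub> u = \<zero>\<^bsub>cone M x\<^esub>"
    by (intro bexI[of _ "Pair (\<ominus>\<^bsub>M\<^esub> y) (\<ominus>\<^bsub>M\<^esub> z)"]) (simp_all add: M.l_neg)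
qed (auto elim!: cone_carrierE simp: M.a_ac)

lemma cone_minus:
  assumes "y \<in> carrier M" "z \<in> carrier M"
  shows "\<ominus>\<^bsub>cone M x\<^esub> Pair y z = Pair (\<ominus>\<^bsub>M\<^esub> y) (\<ominus>\<^bsub>M\<^esub> z)"
proof -
  interpret C: abelian_group "cone M x" by (rule cone_abelian_group)
  show ?thesis using assms by (intro C.minus_equality) (simp_all add: M.l_neg)
qed

lemma cone_module: "module R (cone M x)"
  by (rule moduleI[OF R.is_cring cone_abelian_group])
    (auto elim!: cone_carrierE simp: smult_l_distr smult_r_distr smult_assoc1)

lemma cone_complex:
  assumes x: "x \<in> carrier R"
  shows "tree_complex R (cone M x)"
proof -
  interpret C: module R "cone M x" by (rule cone_module)
  note [simp] = comp_carrier diff_carrier comp_closed comp_closed(5)[of _ "n + 1" for n]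
  show ?thesis
  proof (intro tree_complex.intro cochain_complex.intro cochain_complex_axioms.intro cone_module)
    show "submodule (dgm_comp (cone M x) n) R (cone M x)" for n
      by (rule C.submoduleI) (auto elim!: cone_compE simp: cone_minus)
  next
    fix u n assume "u \<in> dgm_comp (cone M x) n"
    then obtain y z where u: "u = Pair y z" "y \<in> dgm_comp M (n + 1)" "z \<in> dgm_comp M n"
      by (rule cone_compE)
    note c = comp_carrier[OF u(2)] comp_carrier[OF u(3)] diff_carrier[OF u(2)] diff_carrier[OF u(3)]
    show "dgm_diff (cone M x) u \<in> dgm_comp (cone M x) (n + 1)"
      using u x diff_comp[OF u(2)] diff_comp[OF u(3)] by (simp add: comp_closed)
    have "dgm_diff M (x \<odot>\<^bsub>M\<^esub> y \<oplus>\<^bsub>M\<^esub> dgm_diff M z) = x \<odot>\<^bsub>M\<^esub> dgm_diff M y"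
      using u x c diff_comp[OF u(3)] diff_diff[OF u(3)]
      by (simp add: diff_add[of _ "n + 1"] comp_smult diff_smult[OF x u(2)])
    then show "dgm_diff (cone M x) (dgm_diff (cone M x) u) = \<zero>\<^bsub>cone M x\<^esub>"
      using u x c diff_minus[OF diff_comp[OF u(2)]] diff_diff[OF u(2)]
      by (simp add: smult_r_minus M.l_neg)
    fix a assume a: "a \<in> carrier R"
    show "dgm_diff (cone M x) (a \<odot>\<^bsub>cone M x\<^esub> u) = a \<odot>\<^bsub>cone M x\<^esub> dgm_diff (cone M x) u"
      using u x a c diff_smult[OF a u(2)] diff_smult[OF a u(3)]
      by (simp add: smult_r_minus smult_r_distr smult_assoc1[symmetric] R.m_comm)
  next
    fix u v n assume "u \<in> dgm_comp (cone M x) n" "v \<in> dgm_comp (cone M x) n"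
    then obtain y z y' z' where u: "u = Pair y z" "y \<in> dgm_comp M (n + 1)" "z \<in> dgm_comp M n"
      and v: "v = Pair y' z'" "y' \<in> dgm_comp M (n + 1)" "z' \<in> dgm_comp M n"
      by (elim cone_compE)
    note c = comp_carrier[OF u(2)] comp_carrier[OF u(3)] diff_carrier[OF u(2)] diff_carrier[OF u(3)]
      comp_carrier[OF v(2)] comp_carrier[OF v(3)] diff_carrier[OF v(2)] diff_carrier[OF v(3)]
    show "dgm_diff (cone M x) (u \<oplus>\<^bsub>cone M x\<^esub> v) =
        dgm_diff (cone M x) u \<oplus>\<^bsub>cone M x\<^esub> dgm_diff (cone M x) v"
      using x c by (simp add: u v diff_add[OF u(2) v(2)] diff_add[OF u(3) v(3)] smult_r_distr
        M.minus_add, simp add: M.a_ac)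
  qed
qed

lemma cone_cocycle_iff:
  assumes "x \<in> carrier R"
  shows "Pair y z \<in> cocycles (cone M x) n \<longleftrightarrow>
    y \<in> cocycles M (n + 1) \<and> z \<in> dgm_comp M n \<and> x \<odot>\<^bsub>M\<^esub> y \<oplus>\<^bsub>M\<^esub> dgm_diff M z = \<zero>\<^bsub>M\<^esub>"
  using diff_carrier[of y "n + 1"] by (auto simp: cocycles_def)

lemma cone_coboundary_iff:
  "Pair y z \<in> coboundaries (cone M x) n \<longleftrightarrow>
    (\<exists>y'\<in>dgm_comp M n. \<exists>z'\<in>dgm_comp M (n - 1).
       y = \<ominus>\<^bsub>M\<^esub> dgm_diff M y' \<and> z = x \<odot>\<^bsub>M\<^esub> y' \<oplus>\<^bsub>M\<^esub> dgm_diff M z')"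
proof
  assume "Pair y z \<in> coboundaries (cone M x) n"
  then obtain u where u: "u \<in> dgm_comp (cone M x) (n - 1)" "Pair y z = dgm_diff (cone M x) u"
    unfolding coboundaries_def by blast
  from u(1) obtain y' z' where "u = Pair y' z'" "y' \<in> dgm_comp M (n - 1 + 1)" "z' \<in> dgm_comp M (n - 1)"
    by (rule cone_compE)
  then show "\<exists>y'\<in>dgm_comp M n. \<exists>z'\<in>dgm_comp M (n - 1).
       y = \<ominus>\<^bsub>M\<^esub> dgm_diff M y' \<and> z = x \<odot>\<^bsub>M\<^esub> y' \<oplus>\<^bsub>M\<^esub> dgm_diff M z'"
    using u(2) by (intro bexI[of _ y'] bexI[of _ z']) auto
next
  assume "\<exists>y'\<in>dgm_comp M n. \<exists>z'\<in>dgm_comp M (n - 1).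
       y = \<ominus>\<^bsub>M\<^esub> dgm_diff M y' \<and> z = x \<odot>\<^bsub>M\<^esub> y' \<oplus>\<^bsub>M\<^esub> dgm_diff M z'"
  then obtain y' z' where *: "y' \<in> dgm_comp M n" "z' \<in> dgm_comp M (n - 1)"
    "y = \<ominus>\<^bsub>M\<^esub> dgm_diff M y'" "z = x \<odot>\<^bsub>M\<^esub> y' \<oplus>\<^bsub>M\<^esub> dgm_diff M z'" by blast
  then have "Pair y' z' \<in> dgm_comp (cone M x) (n - 1)" by simp
  then show "Pair y z \<in> coboundaries (cone M x) n"
    unfolding coboundaries_def using * by (intro image_eqI[of _ _ "Pair y' z'"]) simp_all
qed

lemma cone_boundaryD:
  assumes "Pair y z \<in> coboundaries (cone M x) n"
  shows "y \<in> coboundaries M (n + 1)"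
proof -
  obtain y' where "y' \<in> dgm_comp M n" "y = \<ominus>\<^bsub>M\<^esub> dgm_diff M y'"
    using assms unfolding cone_coboundary_iff by blast
  then show ?thesis using coboundariesI[of "\<ominus>\<^bsub>M\<^esub> y'" "n + 1"] by (simp add: diff_minus comp_minus)
qed

text \<open>
  The long exact sequence \<open>H\<^sup>n(M) \<rightarrow> H\<^sup>n(cone) \<rightarrow> H\<^sup>n\<^sup>+\<^sup>1(M) \<rightarrow> H\<^sup>n\<^sup>+\<^sup>1(M)\<close>, whose last map is multiplication by \<open>x\<close>,
  gives this and the next three lemmas.
\<close>

lemma cone_exact_at:
  assumes x: "x \<in> carrier R" and ex: "exact_at M n" and inj: "cohomology_injective M x (n + 1)"
  shows "exact_at (cone M x) n"
  unfolding exact_at_def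
proof
  fix u assume u: "u \<in> cocycles (cone M x) n"
  then obtain y z where uyz: "u = Pair y z" unfolding cocycles_def by (auto elim: cone_compE)
  have y: "y \<in> cocycles M (n + 1)" "y \<in> dgm_comp M (n + 1)" and z: "z \<in> dgm_comp M n"
    and yz: "x \<odot>\<^bsub>M\<^esub> y \<oplus>\<^bsub>M\<^esub> dgm_diff M z = \<zero>\<^bsub>M\<^esub>"
    using u x unfolding uyz by (simp_all add: cone_cocycle_iff cocycles_iff)
  note c = comp_carrier[OF y(2)] comp_carrier[OF z] diff_carrier[OF z]
  have "x \<odot>\<^bsub>M\<^esub> y = \<ominus>\<^bsub>M\<^esub> dgm_diff M z"
    using yz c x by (metis M.minus_equality smult_closed)
  also have "\<dots> \<in> coboundaries M (n + 1)"
    using coboundariesI[of "\<ominus>\<^bsub>M\<^esub> z" "n + 1"] z by (simp add: comp_minus diff_minus)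
  finally have "y \<in> coboundaries M (n + 1)"
    using inj y(1) unfolding cohomology_injective_def by simp
  then obtain w where "w \<in> dgm_comp M (n + 1 - 1)" "y = dgm_diff M w" by (rule coboundariesE)
  then have w: "w \<in> dgm_comp M n" "y = dgm_diff M w" by simp_all
  have "z \<oplus>\<^bsub>M\<^esub> x \<odot>\<^bsub>M\<^esub> w \<in> cocycles M n"
    using w z x yz c by (simp add: cocycles_iff comp_closed diff_add diff_smult M.a_comm)
  then obtain v where v: "v \<in> dgm_comp M (n - 1)" "z \<oplus>\<^bsub>M\<^esub> x \<odot>\<^bsub>M\<^esub> w = dgm_diff M v"
    using ex unfolding exact_at_def by (meson coboundariesE subsetD)
  have "x \<odot>\<^bsub>M\<^esub> (\<ominus>\<^bsub>M\<^esub> w) \<oplus>\<^bsub>M\<^esub> dgm_diff M v = z"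
    using x c comp_carrier[OF w(1)] unfolding v(2)[symmetric]
    by (simp add: smult_r_minus M.a_comm[of z] M.r_neg1)
  then show "u \<in> coboundaries (cone M x) n"
    unfolding uyz cone_coboundary_iff using w v c
    by (intro bexI[of _ "\<ominus>\<^bsub>M\<^esub> w"] bexI[of _ v]) (simp_all add: comp_minus diff_minus diff_carrier)
qed

lemma annihilated_class_in_cone:
  assumes x: "x \<in> carrier R" and y: "y \<in> cocycles M (n + 1)" and xy: "x \<odot>\<^bsub>M\<^esub> y \<in> coboundaries M (n + 1)"
  obtains z where "Pair y z \<in> cocycles (cone M x) n"
proof -
  obtain w where "w \<in> dgm_comp M (n + 1 - 1)" "x \<odot>\<^bsub>M\<^esub> y = dgm_diff M w"
    using xy by (rule coboundariesE)
  then have w: "w \<in> dgm_comp M n" "x \<odot>\<^bsub>M\<^esub> y = dgm_diff M w" by simp_all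
  then have "Pair y (\<ominus>\<^bsub>M\<^esub> w) \<in> cocycles (cone M x) n"
    using x y diff_carrier[OF w(1)] by (simp add: cone_cocycle_iff comp_minus diff_minus M.r_neg)
  then show thesis by (rule that)
qed

lemma cone_exact_at_imp_injective:
  assumes x: "x \<in> carrier R" and ex: "exact_at (cone M x) n"
  shows "cohomology_injective M x (n + 1)"
  unfolding cohomology_injective_def
proof (intro ballI impI)
  fix y assume "y \<in> cocycles M (n + 1)" "x \<odot>\<^bsub>M\<^esub> y \<in> coboundaries M (n + 1)"
  then obtain z where "Pair y z \<in> cocycles (cone M x) n" by (rule annihilated_class_in_cone[OF x])
  then have "Pair y z \<in> coboundaries (cone M x) n" using ex unfolding exact_at_def by blast
  then show "y \<in> coboundaries M (n + 1)" by (rule cone_boundaryD)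
qed

lemma cone_exact_at_imp_surjective:
  assumes x: "x \<in> carrier R" and ex: "exact_at (cone M x) n" and z: "z \<in> cocycles M n"
  obtains y b where "y \<in> cocycles M n" "b \<in> coboundaries M n" "z = x \<odot>\<^bsub>M\<^esub> y \<oplus>\<^bsub>M\<^esub> b"
proof -
  have "Pair \<zero>\<^bsub>M\<^esub> z \<in> cocycles (cone M x) n"
    using x z by (simp add: cone_cocycle_iff cocycles_iff comp_zero diff_zero)
  then have "Pair \<zero>\<^bsub>M\<^esub> z \<in> coboundaries (cone M x) n" using ex unfolding exact_at_def by blast
  then obtain y w where y: "y \<in> dgm_comp M n" and w: "w \<in> dgm_comp M (n - 1)"
    and 0: "\<zero>\<^bsub>M\<^esub> = \<ominus>\<^bsub>M\<^esub> dgm_diff M y" and zy: "z = x \<odot>\<^bsub>M\<^esub> y \<oplus>\<^bsub>M\<^esub> dgm_diff M w"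
    unfolding cone_coboundary_iff by blast
  have "dgm_diff M y = \<zero>\<^bsub>M\<^esub>" using arg_cong[OF 0, of "a_inv M"] diff_carrier[OF y] by (simp add: minus_zero)
  then show thesis using y w zy by (intro that[of y "dgm_diff M w"]) (auto simp: cocycles_iff coboundariesI)
qed

text \<open>
  Locally, \<open>x\<close> acts nilpotently on the cohomology, so it kills some non-zero class, and this class
  comes from the cone.
\<close>

lemma cone_not_loc_exact_at:
  assumes x: "x \<in> carrier R"
    and S: "S \<subseteq> carrier R" "\<And>s t. \<lbrakk>s \<in> S; t \<in> S\<rbrakk> \<Longrightarrow> s \<otimes> t \<in> S"
    and ne: "\<not> loc_exact_at M S (n + 1)"
    and nil: "\<And>z. z \<in> cocycles M (n + 1) \<Longrightarrow>
      \<exists>s\<in>S. \<exists>N. (s \<otimes> x [^] (N::nat)) \<odot>\<^bsub>M\<^esub> z \<in> coboundaries M (n + 1)"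
  shows "\<not> loc_exact_at (cone M x) S n"
proof -
  let ?B = "coboundaries M (n + 1)"
  obtain z where z: "z \<in> cocycles M (n + 1)" and nk: "\<And>s. s \<in> S \<Longrightarrow> s \<odot>\<^bsub>M\<^esub> z \<notin> ?B"
    using ne unfolding loc_exact_at_def by blast
  have zc: "z \<in> carrier M" using z comp_carrier by (auto simp: cocycles_iff)
  have sc: "s \<in> carrier R" if "s \<in> S" for s using S(1) that by blast
  \<comment> \<open>take the last power of \<open>x\<close> that does not kill the class of \<open>z\<close>, even after multiplication by elements of \<open>S\<close>\<close>
  define kills where "kills = (\<lambda>N. \<exists>s\<in>S. (s \<otimes> x [^] (N::nat)) \<odot>\<^bsub>M\<^esub> z \<in> ?B)"
  define N where "N = (LEAST N. kills N)"
  have "\<exists>N. kills N" using nil[OF z] unfolding kills_def by blast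
  then have N: "kills N" "\<And>k. k < N \<Longrightarrow> \<not> kills k"
    unfolding N_def by (auto intro: LeastI_ex dest: not_less_Least)
  have "\<not> kills 0" using nk sc unfolding kills_def by auto
  then obtain k where k: "N = Suc k" using N(1) by (cases N) auto
  obtain s where s: "s \<in> S" "(s \<otimes> x [^] Suc k) \<odot>\<^bsub>M\<^esub> z \<in> ?B" using N(1) k unfolding kills_def by blast
  define y where "y = (s \<otimes> x [^] k) \<odot>\<^bsub>M\<^esub> z"
  have yk: "t \<odot>\<^bsub>M\<^esub> y \<notin> ?B" if t: "t \<in> S" for t
  proof
    assume "t \<odot>\<^bsub>M\<^esub> y \<in> ?B"
    moreover have "t \<odot>\<^bsub>M\<^esub> y = ((t \<otimes> s) \<otimes> x [^] k) \<odot>\<^bsub>M\<^esub> z"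
      unfolding y_def using sc[OF t] sc[OF s(1)] x zc by (simp add: smult_assoc1 R.m_assoc)
    ultimately have "kills k" unfolding kills_def using S(2)[OF t s(1)] by auto
    then show False using N(2) k by simp
  qed
  have yZ: "y \<in> cocycles M (n + 1)" unfolding y_def using sc[OF s(1)] x z by (intro cocycles_closed(2)) auto
  have "x \<odot>\<^bsub>M\<^esub> y = (s \<otimes> x [^] Suc k) \<odot>\<^bsub>M\<^esub> z"
    unfolding y_def using sc[OF s(1)] x zc by (simp add: smult_assoc1[symmetric] R.m_ac)
  then have "x \<odot>\<^bsub>M\<^esub> y \<in> ?B" using s(2) by simp
  then obtain w where w: "Pair y w \<in> cocycles (cone M x) n" by (rule annihilated_class_in_cone[OF x yZ])
  have "t \<odot>\<^bsub>cone M x\<^esub> Pair y w \<notin> coboundaries (cone M x) n" if "t \<in> S" for t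
    using cone_boundaryD yk[OF that] by auto
  then show ?thesis using w unfolding loc_exact_at_def by blast
qed

end


subsection \<open>Null-homotopic scalars\<close>

definition homotopy_to_zero :: "('a, 'b) ring_scheme \<Rightarrow> ('a, 'm, 'c) dg_module_scheme \<Rightarrow> 'a \<Rightarrow> ('m \<Rightarrow> 'm) \<Rightarrow> bool" where
  "homotopy_to_zero R M x h \<longleftrightarrow>
     (\<forall>n. \<forall>y\<in>dgm_comp M n. h y \<in> dgm_comp M (n - 1) \<and>
        dgm_diff M (h y) \<oplus>\<^bsub>M\<^esub> h (dgm_diff M y) = x \<odot>\<^bsub>M\<^esub> y \<and>
        (\<forall>a\<in>carrier R. h (a \<odot>\<^bsub>M\<^esub> y) = a \<odot>\<^bsub>M\<^esub> h y) \<and>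
        (\<forall>z\<in>dgm_comp M n. h (y \<oplus>\<^bsub>M\<^esub> z) = h y \<oplus>\<^bsub>M\<^esub> h z))"

definition null_homotopic :: "('a, 'b) ring_scheme \<Rightarrow> ('a, 'm, 'c) dg_module_scheme \<Rightarrow> 'a \<Rightarrow> bool" where
  "null_homotopic R M x \<longleftrightarrow> (\<exists>h. homotopy_to_zero R M x h)"

lemma homotopy_to_zeroD:
  assumes "homotopy_to_zero R M x h" "y \<in> dgm_comp M n"
  shows "h y \<in> dgm_comp M (n - 1)"
    "dgm_diff M (h y) \<oplus>\<^bsub>M\<^esub> h (dgm_diff M y) = x \<odot>\<^bsub>M\<^esub> y"
    "a \<in> carrier R \<Longrightarrow> h (a \<odot>\<^bsub>M\<^esub> y) = a \<odot>\<^bsub>M\<^esub> h y"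
    "z \<in> dgm_comp M n \<Longrightarrow> h (y \<oplus>\<^bsub>M\<^esub> z) = h y \<oplus>\<^bsub>M\<^esub> h z"
  using assms unfolding homotopy_to_zero_def by blast+

context cochain_complex
begin

lemma null_homotopic_cocycle:
  assumes "null_homotopic R M x" "z \<in> cocycles M n"
  shows "x \<odot>\<^bsub>M\<^esub> z \<in> coboundaries M n"
proof -
  obtain h where h: "homotopy_to_zero R M x h" using assms(1) unfolding null_homotopic_def by blast
  have z: "z \<in> dgm_comp M n" "dgm_diff M z = \<zero>\<^bsub>M\<^esub>" using assms(2) by (auto simp: cocycles_iff)
  have "h (\<zero> \<odot>\<^bsub>M\<^esub> z) = \<zero> \<odot>\<^bsub>M\<^esub> h z" using homotopy_to_zeroD(3)[OF h z(1)] by simp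
  then have "h \<zero>\<^bsub>M\<^esub> = \<zero>\<^bsub>M\<^esub>" using comp_carrier[OF z(1)] comp_carrier[OF homotopy_to_zeroD(1)[OF h z(1)]] by simp
  then have "x \<odot>\<^bsub>M\<^esub> z = dgm_diff M (h z)"
    using homotopy_to_zeroD(1,2)[OF h z(1)] z(2) diff_carrier[of "h z"] by auto
  then show ?thesis using coboundariesI[OF homotopy_to_zeroD(1)[OF h z(1)]] by simp
qed

text \<open>Homotopies can be added and multiplied by scalars.\<close>

lemma null_homotopic_ideal: "ideal {x \<in> carrier R. null_homotopic R M x} R"
proof (rule idealI)
  let ?I = "{x \<in> carrier R. null_homotopic R M x}"
  have smult: "b \<otimes> x \<in> ?I" if "x \<in> ?I" and b: "b \<in> carrier R" for x b
  proof -
    obtain h where h: "homotopy_to_zero R M x h" and x: "x \<in> carrier R"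
      using \<open>x \<in> ?I\<close> unfolding null_homotopic_def by blast
    note hD = homotopy_to_zeroD[OF h]
    have "homotopy_to_zero R M (b \<otimes> x) (\<lambda>y. b \<odot>\<^bsub>M\<^esub> h y)"
      unfolding homotopy_to_zero_def
    proof (intro allI ballI conjI)
      fix n y assume y: "y \<in> dgm_comp M n"
      note c = comp_carrier[OF y] comp_carrier[OF hD(1)[OF y]] diff_carrier[OF hD(1)[OF y]]
        comp_carrier[OF hD(1)[OF diff_comp[OF y]]]
      show "b \<odot>\<^bsub>M\<^esub> h y \<in> dgm_comp M (n - 1)" using comp_smult[OF b hD(1)[OF y]] .
      show "dgm_diff M (b \<odot>\<^bsub>M\<^esub> h y) \<oplus>\<^bsub>M\<^esub> b \<odot>\<^bsub>M\<^esub> h (dgm_diff M y) = (b \<otimes> x) \<odot>\<^bsub>M\<^esub> y"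
        using c b x hD(2)[OF y] diff_smult[OF b hD(1)[OF y]]
        by (simp add: smult_r_distr[symmetric] smult_assoc1)
      show "b \<odot>\<^bsub>M\<^esub> h (a \<odot>\<^bsub>M\<^esub> y) = a \<odot>\<^bsub>M\<^esub> (b \<odot>\<^bsub>M\<^esub> h y)" if "a \<in> carrier R" for a
        using that b c hD(3)[OF y that] by (simp add: smult_assoc1[symmetric] R.m_comm)
      show "b \<odot>\<^bsub>M\<^esub> h (y \<oplus>\<^bsub>M\<^esub> z) = b \<odot>\<^bsub>M\<^esub> h y \<oplus>\<^bsub>M\<^esub> b \<odot>\<^bsub>M\<^esub> h z" if z: "z \<in> dgm_comp M n" for z
        using b c comp_carrier[OF hD(1)[OF z]] hD(4)[OF y z] by (simp add: smult_r_distr)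
    qed
    then show ?thesis using b x unfolding null_homotopic_def by blast
  qed
  have zero: "\<zero> \<in> ?I"
  proof -
    have "homotopy_to_zero R M \<zero> (\<lambda>_. \<zero>\<^bsub>M\<^esub>)"
      unfolding homotopy_to_zero_def by (auto simp: comp_zero diff_zero comp_carrier)
    then show ?thesis unfolding null_homotopic_def by auto
  qed
  have add: "x \<oplus> x' \<in> ?I" if xx': "x \<in> ?I" "x' \<in> ?I" for x x'
  proof -
    obtain h h' where h: "homotopy_to_zero R M x h" and h': "homotopy_to_zero R M x' h'"
      and x: "x \<in> carrier R" "x' \<in> carrier R"
      using xx' unfolding null_homotopic_def by blast
    note hD = homotopy_to_zeroD[OF h] note hD' = homotopy_to_zeroD[OF h']
    have "homotopy_to_zero R M (x \<oplus> x') (\<lambda>y. h y \<oplus>\<^bsub>M\<^esub> h' y)"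
      unfolding homotopy_to_zero_def
    proof (intro allI ballI conjI)
      fix n y assume y: "y \<in> dgm_comp M n"
      note c = comp_carrier[OF y] comp_carrier[OF hD(1)[OF y]] diff_carrier[OF hD(1)[OF y]]
        comp_carrier[OF hD(1)[OF diff_comp[OF y]]]
        comp_carrier[OF hD'(1)[OF y]] diff_carrier[OF hD'(1)[OF y]]
        comp_carrier[OF hD'(1)[OF diff_comp[OF y]]]
      show "h y \<oplus>\<^bsub>M\<^esub> h' y \<in> dgm_comp M (n - 1)" using comp_add[OF hD(1)[OF y] hD'(1)[OF y]] .
      show "dgm_diff M (h y \<oplus>\<^bsub>M\<^esub> h' y) \<oplus>\<^bsub>M\<^esub> (h (dgm_diff M y) \<oplus>\<^bsub>M\<^esub> h' (dgm_diff M y)) = (x \<oplus> x') \<odot>\<^bsub>M\<^esub> y"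
        using c x diff_add[OF hD(1)[OF y] hD'(1)[OF y]]
        by (simp add: smult_l_distr hD(2)[OF y, symmetric] hD'(2)[OF y, symmetric] M.a_ac)
      show "h (a \<odot>\<^bsub>M\<^esub> y) \<oplus>\<^bsub>M\<^esub> h' (a \<odot>\<^bsub>M\<^esub> y) = a \<odot>\<^bsub>M\<^esub> (h y \<oplus>\<^bsub>M\<^esub> h' y)" if "a \<in> carrier R" for a
        using that c hD(3)[OF y that] hD'(3)[OF y that] by (simp add: smult_r_distr)
      show "h (y \<oplus>\<^bsub>M\<^esub> z) \<oplus>\<^bsub>M\<^esub> h' (y \<oplus>\<^bsub>M\<^esub> z) = (h y \<oplus>\<^bsub>M\<^esub> h' y) \<oplus>\<^bsub>M\<^esub> (h z \<oplus>\<^bsub>M\<^esub> h' z)"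
        if z: "z \<in> dgm_comp M n" for z
        using c comp_carrier[OF hD(1)[OF z]] comp_carrier[OF hD'(1)[OF z]] hD(4)[OF y z] hD'(4)[OF y z]
        by (simp add: M.a_ac)
    qed
    then show ?thesis using x unfolding null_homotopic_def by blast
  qed
  show "ring R" by (rule R.ring_axioms)
  show "subgroup ?I (add_monoid R)"
  proof (rule group.subgroupI[OF R.a_group])
    show "inv\<^bsub>add_monoid R\<^esub> x \<in> ?I" if "x \<in> ?I" for x
      using smult[OF that, of "\<ominus> \<one>"] that by (simp add: R.l_minus flip: a_inv_def)
  qed (use zero add in auto)
  show "b \<otimes> x \<in> ?I" "x \<otimes> b \<in> ?I" if "x \<in> ?I" "b \<in> carrier R" for x b
    using smult[OF that] that by (simp_all add: R.m_comm)
qed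

end

context tree_complex
begin

lemma cone_null_homotopic_self:
  assumes x: "x \<in> carrier R"
  shows "null_homotopic R (cone M x) x"
proof -
  \<comment> \<open>in the notation \<open>z + e y\<close> for \<open>Pair y z\<close>, where \<open>d e = x\<close>, this is multiplication by \<open>e\<close>\<close>
  let ?h = "\<lambda>u. Pair (right u) \<zero>\<^bsub>M\<^esub>"
  have "homotopy_to_zero R (cone M x) x ?h"
    unfolding homotopy_to_zero_def
  proof (intro allI ballI conjI)
    fix n u assume "u \<in> dgm_comp (cone M x) n"
    then obtain y z where u: "u = Pair y z" "y \<in> dgm_comp M (n + 1)" "z \<in> dgm_comp M n"
      by (rule cone_compE)
    note c = comp_carrier[OF u(2)] comp_carrier[OF u(3)] diff_carrier[OF u(2)] diff_carrier[OF u(3)]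
    show "?h u \<in> dgm_comp (cone M x) (n - 1)" using u by (simp add: comp_zero)
    have *: "\<ominus>\<^bsub>M\<^esub> dgm_diff M z \<oplus>\<^bsub>M\<^esub> (x \<odot>\<^bsub>M\<^esub> y \<oplus>\<^bsub>M\<^esub> dgm_diff M z) = x \<odot>\<^bsub>M\<^esub> y"
      using c x by (simp add: M.a_comm[of "x \<odot>\<^bsub>M\<^esub> y"] M.r_neg1)
    show "dgm_diff (cone M x) (?h u) \<oplus>\<^bsub>cone M x\<^esub> ?h (dgm_diff (cone M x) u) = x \<odot>\<^bsub>cone M x\<^esub> u"
      using c x * by (simp add: u(1) diff_zero)
    show "?h (a \<odot>\<^bsub>cone M x\<^esub> u) = a \<odot>\<^bsub>cone M x\<^esub> ?h u" if "a \<in> carrier R" for a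
      using that by (simp add: u(1))
    show "?h (u \<oplus>\<^bsub>cone M x\<^esub> v) = ?h u \<oplus>\<^bsub>cone M x\<^esub> ?h v" if "v \<in> dgm_comp (cone M x) n" for v
      using that by (elim cone_compE) (simp add: u(1))
  qed
  then show ?thesis unfolding null_homotopic_def by blast
qed

lemma cone_null_homotopic:
  assumes x: "x \<in> carrier R" and r: "r \<in> carrier R" and null: "null_homotopic R M r"
  shows "null_homotopic R (cone M x) r"
proof -
  obtain h where h: "homotopy_to_zero R M r h" using null unfolding null_homotopic_def by blast
  note hD = homotopy_to_zeroD[OF h]
  let ?h = "\<lambda>u. Pair (\<ominus>\<^bsub>M\<^esub> h (left u)) (h (right u))"
  have hm: "h (\<ominus>\<^bsub>M\<^esub> y) = \<ominus>\<^bsub>M\<^esub> h y" if "y \<in> dgm_comp M n" for y n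
    using hD(3)[OF that, of "\<ominus> \<one>"] comp_carrier[OF that] comp_carrier[OF hD(1)[OF that]]
    by (simp add: smult_l_minus)
  have "homotopy_to_zero R (cone M x) r ?h"
    unfolding homotopy_to_zero_def
  proof (intro allI ballI conjI)
    fix n u assume "u \<in> dgm_comp (cone M x) n"
    then obtain y z where u: "u = Pair y z" "y \<in> dgm_comp M (n + 1)" "z \<in> dgm_comp M n"
      by (rule cone_compE)
    have hy: "h y \<in> dgm_comp M n" using hD(1)[OF u(2)] by simp
    have hz: "h z \<in> dgm_comp M (n - 1)" using hD(1)[OF u(3)] .
    have hdy: "h (dgm_diff M y) \<in> dgm_comp M (n + 1)" using hD(1)[OF diff_comp[OF u(2)]] by (simp add: algebra_simps)
    have hdz: "h (dgm_diff M z) \<in> dgm_comp M n" using hD(1)[OF diff_comp[OF u(3)]] by simp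
    note c = comp_carrier[OF u(2)] comp_carrier[OF u(3)] diff_carrier[OF u(2)] diff_carrier[OF u(3)]
      comp_carrier[OF hy] comp_carrier[OF hz] diff_carrier[OF hy] diff_carrier[OF hz]
      comp_carrier[OF hdy] comp_carrier[OF hdz]
    show "?h u \<in> dgm_comp (cone M x) (n - 1)" using u hy hz by (simp add: comp_minus)
    have 1: "h (x \<odot>\<^bsub>M\<^esub> y \<oplus>\<^bsub>M\<^esub> dgm_diff M z) = x \<odot>\<^bsub>M\<^esub> h y \<oplus>\<^bsub>M\<^esub> h (dgm_diff M z)"
      using hD(4)[OF comp_smult[OF x u(2)] diff_comp[OF u(3)]] hD(3)[OF u(2) x] by simp
    have 2: "x \<odot>\<^bsub>M\<^esub> (\<ominus>\<^bsub>M\<^esub> h y) \<oplus>\<^bsub>M\<^esub> dgm_diff M (h z) \<oplus>\<^bsub>M\<^esub> (x \<odot>\<^bsub>M\<^esub> h y \<oplus>\<^bsub>M\<^esub> h (dgm_diff M z))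
        = r \<odot>\<^bsub>M\<^esub> z"
    proof -
      have "x \<odot>\<^bsub>M\<^esub> (\<ominus>\<^bsub>M\<^esub> h y) \<oplus>\<^bsub>M\<^esub> dgm_diff M (h z) \<oplus>\<^bsub>M\<^esub> (x \<odot>\<^bsub>M\<^esub> h y \<oplus>\<^bsub>M\<^esub> h (dgm_diff M z))
        = (\<ominus>\<^bsub>M\<^esub> (x \<odot>\<^bsub>M\<^esub> h y) \<oplus>\<^bsub>M\<^esub> x \<odot>\<^bsub>M\<^esub> h y) \<oplus>\<^bsub>M\<^esub> (dgm_diff M (h z) \<oplus>\<^bsub>M\<^esub> h (dgm_diff M z))"
        using c x by (simp add: smult_r_minus M.a_ac)
      then show ?thesis using c x r hD(2)[OF u(3)] by (simp add: M.l_neg)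
    qed
    show "dgm_diff (cone M x) (?h u) \<oplus>\<^bsub>cone M x\<^esub> ?h (dgm_diff (cone M x) u) = r \<odot>\<^bsub>cone M x\<^esub> u"
      using c x 1 2 hD(2)[OF u(2)] diff_minus[OF hy] hm[OF diff_comp[OF u(2)]] by (simp add: u(1))
    show "?h (a \<odot>\<^bsub>cone M x\<^esub> u) = a \<odot>\<^bsub>cone M x\<^esub> ?h u" if "a \<in> carrier R" for a
      using that c hD(3)[OF u(2) that] hD(3)[OF u(3) that] by (simp add: u(1) smult_r_minus)
    show "?h (u \<oplus>\<^bsub>cone M x\<^esub> v) = ?h u \<oplus>\<^bsub>cone M x\<^esub> ?h v" if v: "v \<in> dgm_comp (cone M x) n" for v
    proof -
      obtain y' z' where v': "v = Pair y' z'" "y' \<in> dgm_comp M (n + 1)" "z' \<in> dgm_comp M n"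
        using v by (rule cone_compE)
      show ?thesis using c comp_carrier[OF hD(1)[OF v'(2)]] hD(4)[OF u(2) v'(2)] hD(4)[OF u(3) v'(3)]
        by (simp add: u(1) v'(1) M.minus_add)
    qed
  qed
  then show ?thesis unfolding null_homotopic_def by blast
qed

end


subsection \<open>Isomorphisms of complexes\<close>

definition complex_iso ::
    "('a, 'b) ring_scheme \<Rightarrow> ('a, 'm, 'c) dg_module_scheme \<Rightarrow> ('a, 'n, 'd) dg_module_scheme \<Rightarrow> ('m \<Rightarrow> 'n) \<Rightarrow> bool" where
  "complex_iso R X Y f \<longleftrightarrow>
     (\<forall>n. bij_betw f (dgm_comp X n) (dgm_comp Y n) \<and>
       (\<forall>u\<in>dgm_comp X n. f (dgm_diff X u) = dgm_diff Y (f u) \<and>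
          (\<forall>a\<in>carrier R. f (a \<odot>\<^bsub>X\<^esub> u) = a \<odot>\<^bsub>Y\<^esub> f u) \<and>
          (\<forall>v\<in>dgm_comp X n. f (u \<oplus>\<^bsub>X\<^esub> v) = f u \<oplus>\<^bsub>Y\<^esub> f v)))"

lemma complex_isoD:
  assumes "complex_iso R X Y f"
  shows "bij_betw f (dgm_comp X n) (dgm_comp Y n)"
    "u \<in> dgm_comp X n \<Longrightarrow> f u \<in> dgm_comp Y n"
    "u \<in> dgm_comp X n \<Longrightarrow> f (dgm_diff X u) = dgm_diff Y (f u)"
    "\<lbrakk>a \<in> carrier R; u \<in> dgm_comp X n\<rbrakk> \<Longrightarrow> f (a \<odot>\<^bsub>X\<^esub> u) = a \<odot>\<^bsub>Y\<^esub> f u"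
    "\<lbrakk>u \<in> dgm_comp X n; v \<in> dgm_comp X n\<rbrakk> \<Longrightarrow> f (u \<oplus>\<^bsub>X\<^esub> v) = f u \<oplus>\<^bsub>Y\<^esub> f v"
    "\<lbrakk>u \<in> dgm_comp X n; v \<in> dgm_comp X n; f u = f v\<rbrakk> \<Longrightarrow> u = v"
    "w \<in> dgm_comp Y n \<Longrightarrow> \<exists>u\<in>dgm_comp X n. w = f u"
proof -
  show b: "bij_betw f (dgm_comp X n) (dgm_comp Y n)" using assms unfolding complex_iso_def by blast
  show "u \<in> dgm_comp X n \<Longrightarrow> f (dgm_diff X u) = dgm_diff Y (f u)"
    "\<lbrakk>a \<in> carrier R; u \<in> dgm_comp X n\<rbrakk> \<Longrightarrow> f (a \<odot>\<^bsub>X\<^esub> u) = a \<odot>\<^bsub>Y\<^esub> f u"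
    "\<lbrakk>u \<in> dgm_comp X n; v \<in> dgm_comp X n\<rbrakk> \<Longrightarrow> f (u \<oplus>\<^bsub>X\<^esub> v) = f u \<oplus>\<^bsub>Y\<^esub> f v"
    using assms unfolding complex_iso_def by blast+
  show "u \<in> dgm_comp X n \<Longrightarrow> f u \<in> dgm_comp Y n"
    "\<lbrakk>u \<in> dgm_comp X n; v \<in> dgm_comp X n; f u = f v\<rbrakk> \<Longrightarrow> u = v"
    "w \<in> dgm_comp Y n \<Longrightarrow> \<exists>u\<in>dgm_comp X n. w = f u"
    using b unfolding bij_betw_def inj_on_def by blast+
qed

lemma complex_isoI:
  assumes "\<And>n u. u \<in> dgm_comp X n \<Longrightarrow> f u \<in> dgm_comp Y n"
    "\<And>n u v. \<lbrakk>u \<in> dgm_comp X n; v \<in> dgm_comp X n; f u = f v\<rbrakk> \<Longrightarrow> u = v"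
    "\<And>n w. w \<in> dgm_comp Y n \<Longrightarrow> \<exists>u\<in>dgm_comp X n. w = f u"
    "\<And>n u. u \<in> dgm_comp X n \<Longrightarrow> f (dgm_diff X u) = dgm_diff Y (f u)"
    "\<And>n a u. \<lbrakk>a \<in> carrier R; u \<in> dgm_comp X n\<rbrakk> \<Longrightarrow> f (a \<odot>\<^bsub>X\<^esub> u) = a \<odot>\<^bsub>Y\<^esub> f u"
    "\<And>n u v. \<lbrakk>u \<in> dgm_comp X n; v \<in> dgm_comp X n\<rbrakk> \<Longrightarrow> f (u \<oplus>\<^bsub>X\<^esub> v) = f u \<oplus>\<^bsub>Y\<^esub> f v"
  shows "complex_iso R X Y f"
proof -
  have "bij_betw f (dgm_comp X n) (dgm_comp Y n)" for n
  proof (rule bij_betwI')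
    fix w assume "w \<in> dgm_comp Y n"
    then show "\<exists>u\<in>dgm_comp X n. w = f u" by (rule assms(3))
  qed (use assms(1)[of _ n] assms(2)[of _ n] in auto)
  then show ?thesis unfolding complex_iso_def using assms(4-6) by simp
qed

lemma complex_iso_refl: "complex_iso R X X (\<lambda>u. u)"
  by (rule complex_isoI) auto

lemma complex_iso_trans:
  assumes "complex_iso R X Y f" "complex_iso R Y Z g"
  shows "complex_iso R X Z (\<lambda>u. g (f u))"
proof (rule complex_isoI)
  note F = complex_isoD[OF assms(1)] note G = complex_isoD[OF assms(2)]
  fix n w assume "w \<in> dgm_comp Z n"
  then obtain v where v: "v \<in> dgm_comp Y n" "w = g v" using G(7) by blast
  then obtain u where "u \<in> dgm_comp X n" "v = f u" using F(7) by blast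
  then show "\<exists>u\<in>dgm_comp X n. w = g (f u)" using v by blast
next
  note F = complex_isoD[OF assms(1)] note G = complex_isoD[OF assms(2)]
  fix n u v assume uv: "u \<in> dgm_comp X n" "v \<in> dgm_comp X n"
  show "g (f (u \<oplus>\<^bsub>X\<^esub> v)) = g (f u) \<oplus>\<^bsub>Z\<^esub> g (f v)" using uv F(2,5)[of _ n] G(5)[of _ n] by simp
  show "u = v" if "g (f u) = g (f v)"
    using F(6)[OF uv G(6)[OF F(2)[OF uv(1)] F(2)[OF uv(2)] that]] .
next
  note F = complex_isoD[OF assms(1)] note G = complex_isoD[OF assms(2)]
  fix n u assume u: "u \<in> dgm_comp X n"
  show "g (f u) \<in> dgm_comp Z n" using u F(2) G(2) by blast
  show "g (f (dgm_diff X u)) = dgm_diff Z (g (f u))" using F(3)[OF u] G(3)[OF F(2)[OF u]] by simp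
  show "g (f (a \<odot>\<^bsub>X\<^esub> u)) = a \<odot>\<^bsub>Z\<^esub> g (f u)" if "a \<in> carrier R" for a
    using F(4)[OF that u] G(4)[OF that F(2)[OF u]] by simp
qed

locale iso_of_complexes = X: cochain_complex R X + Y: cochain_complex R Y
  for R :: "('a, 'b) ring_scheme" (structure) and X :: "('a, 'm, 'c) dg_module_scheme"
    and Y :: "('a, 'n, 'd) dg_module_scheme" +
  fixes f :: "'m \<Rightarrow> 'n"
  assumes iso: "complex_iso R X Y f"
begin

lemmas isoD = complex_isoD[OF iso]

lemma iso_zero: "f \<zero>\<^bsub>X\<^esub> = \<zero>\<^bsub>Y\<^esub>"
  using isoD(4)[of \<zero> "\<zero>\<^bsub>X\<^esub>" 0] X.comp_zero[of 0] Y.comp_carrier[OF isoD(2)[OF X.comp_zero[of 0]]]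
  by simp

lemma iso_minus:
  assumes "u \<in> dgm_comp X n"
  shows "f (\<ominus>\<^bsub>X\<^esub> u) = \<ominus>\<^bsub>Y\<^esub> f u"
  using isoD(4)[of "\<ominus> \<one>" u n] assms X.comp_carrier[OF assms] Y.comp_carrier[OF isoD(2)[OF assms]]
  by (simp add: X.smult_l_minus Y.smult_l_minus)

lemma iso_cocycles_iff: "u \<in> dgm_comp X n \<Longrightarrow> f u \<in> cocycles Y n \<longleftrightarrow> u \<in> cocycles X n"
  using isoD(2,3)[of u n] isoD(6)[OF X.diff_comp[of u n] X.comp_zero] iso_zero
  by (auto simp: cocycles_def)

lemma iso_coboundaries_iff:
  assumes u: "u \<in> dgm_comp X n"
  shows "f u \<in> coboundaries Y n \<longleftrightarrow> u \<in> coboundaries X n"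
proof
  assume "f u \<in> coboundaries Y n"
  then obtain w where w: "w \<in> dgm_comp Y (n - 1)" "f u = dgm_diff Y w" by (rule Y.coboundariesE)
  obtain v where v: "v \<in> dgm_comp X (n - 1)" "w = f v" using isoD(7)[OF w(1)] by blast
  then have "f u = f (dgm_diff X v)" using isoD(3)[OF v(1)] w by simp
  then have "u = dgm_diff X v" using isoD(6)[OF u X.diff_comp'[OF v(1)]] by simp
  then show "u \<in> coboundaries X n" using X.coboundariesI[OF v(1)] by simp
next
  assume "u \<in> coboundaries X n"
  then obtain w where "w \<in> dgm_comp X (n - 1)" "u = dgm_diff X w" by (rule X.coboundariesE)
  then show "f u \<in> coboundaries Y n" using isoD(3) Y.coboundariesI[OF isoD(2)] by simp
qed

lemma iso_cocycle_ex:
  assumes "w \<in> cocycles Y n"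
  obtains u where "u \<in> cocycles X n" "w = f u"
proof -
  obtain u where "u \<in> dgm_comp X n" "w = f u" using assms isoD(7) unfolding cocycles_def by blast
  then show thesis using that iso_cocycles_iff assms by blast
qed

lemma iso_multiple_coboundary_iff:
  assumes "u \<in> dgm_comp X n" "a \<in> carrier R"
  shows "a \<odot>\<^bsub>Y\<^esub> f u \<in> coboundaries Y n \<longleftrightarrow> a \<odot>\<^bsub>X\<^esub> u \<in> coboundaries X n"
  using iso_coboundaries_iff[OF X.comp_smult[OF assms(2,1)]] isoD(4)[OF assms(2,1)] by simp

lemma iso_exact_at: "exact_at Y n \<longleftrightarrow> exact_at X n"
proof
  assume Y: "exact_at Y n"
  show "exact_at X n" unfolding exact_at_def
  proof
    fix u assume u: "u \<in> cocycles X n"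
    then have "u \<in> dgm_comp X n" by (simp add: cocycles_def)
    then show "u \<in> coboundaries X n"
      using Y u iso_cocycles_iff iso_coboundaries_iff unfolding exact_at_def by blast
  qed
next
  assume X: "exact_at X n"
  show "exact_at Y n" unfolding exact_at_def
  proof
    fix w assume "w \<in> cocycles Y n"
    then obtain u where u: "u \<in> cocycles X n" "w = f u" by (rule iso_cocycle_ex)
    then have "u \<in> dgm_comp X n" by (simp add: cocycles_def)
    then show "w \<in> coboundaries Y n"
      using X u iso_coboundaries_iff unfolding exact_at_def by blast
  qed
qed


lemma iso_cohomology_injective:
  assumes "x \<in> carrier R"
  shows "cohomology_injective Y x n \<longleftrightarrow> cohomology_injective X x n"
proof -
  have *: "(x \<odot>\<^bsub>Y\<^esub> f u \<in> coboundaries Y n \<longrightarrow> f u \<in> coboundaries Y n) \<longleftrightarrow>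
      (x \<odot>\<^bsub>X\<^esub> u \<in> coboundaries X n \<longrightarrow> u \<in> coboundaries X n)"
    if "u \<in> cocycles X n" for u
    using that iso_multiple_coboundary_iff[of u n x] iso_coboundaries_iff[of u n] assms
    unfolding cocycles_def by blast
  show ?thesis
  proof
    assume Y: "cohomology_injective Y x n"
    show "cohomology_injective X x n" unfolding cohomology_injective_def
    proof
      fix u assume u: "u \<in> cocycles X n"
      then have "f u \<in> cocycles Y n" using iso_cocycles_iff by (simp add: cocycles_def)
      then show "x \<odot>\<^bsub>X\<^esub> u \<in> coboundaries X n \<longrightarrow> u \<in> coboundaries X n"
        using Y *[OF u] unfolding cohomology_injective_def by blast
    qed
  next
    assume X: "cohomology_injective X x n"
    show "cohomology_injective Y x n" unfolding cohomology_injective_def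
    proof
      fix w assume "w \<in> cocycles Y n"
      then obtain u where u: "u \<in> cocycles X n" "w = f u" by (rule iso_cocycle_ex)
      then show "x \<odot>\<^bsub>Y\<^esub> w \<in> coboundaries Y n \<longrightarrow> w \<in> coboundaries Y n"
        using X *[OF u(1)] unfolding cohomology_injective_def by blast
    qed
  qed
qed

end

lemma cone_iso:
  assumes "tree_complex R X" "tree_complex R Y" and x: "x \<in> carrier R" and f: "complex_iso R X Y f"
  shows "complex_iso R (cone X x) (cone Y x) (\<lambda>u. Pair (f (left u)) (f (right u)))"
proof -
  interpret X: tree_complex R X by fact
  interpret Y: tree_complex R Y by fact
  interpret iso_of_complexes R X Y f by unfold_locales (rule f)
  show ?thesis
  proof (rule complex_isoI)
    fix n u assume "u \<in> dgm_comp (cone X x) n"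
    then obtain y z where u: "u = Pair y z" "y \<in> dgm_comp X (n + 1)" "z \<in> dgm_comp X n"
      by (rule cone_compE)
    show "Pair (f (left u)) (f (right u)) \<in> dgm_comp (cone Y x) n" using u isoD(2) by simp
    have "f (x \<odot>\<^bsub>X\<^esub> y \<oplus>\<^bsub>X\<^esub> dgm_diff X z) = x \<odot>\<^bsub>Y\<^esub> f y \<oplus>\<^bsub>Y\<^esub> dgm_diff Y (f z)"
      using isoD(5)[OF X.comp_smult[OF x u(2)] X.diff_comp[OF u(3)]] isoD(4)[OF x u(2)] isoD(3)[OF u(3)]
      by simp
    then show "Pair (f (left (dgm_diff (cone X x) u))) (f (right (dgm_diff (cone X x) u))) =
        dgm_diff (cone Y x) (Pair (f (left u)) (f (right u)))"
      using iso_minus[OF X.diff_comp[OF u(2)]] isoD(3)[OF u(2)] by (simp add: u(1))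
    show "Pair (f (left (a \<odot>\<^bsub>cone X x\<^esub> u))) (f (right (a \<odot>\<^bsub>cone X x\<^esub> u))) =
        a \<odot>\<^bsub>cone Y x\<^esub> Pair (f (left u)) (f (right u))" if "a \<in> carrier R" for a
      using isoD(4)[OF that u(2)] isoD(4)[OF that u(3)] by (simp add: u(1))
  next
    fix n u v assume "u \<in> dgm_comp (cone X x) n" "v \<in> dgm_comp (cone X x) n"
    then obtain y z y' z' where u: "u = Pair y z" "y \<in> dgm_comp X (n + 1)" "z \<in> dgm_comp X n"
      and v: "v = Pair y' z'" "y' \<in> dgm_comp X (n + 1)" "z' \<in> dgm_comp X n"
      by (elim cone_compE)
    show "Pair (f (left (u \<oplus>\<^bsub>cone X x\<^esub> v))) (f (right (u \<oplus>\<^bsub>cone X x\<^esub> v))) =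
       Pair (f (left u)) (f (right u)) \<oplus>\<^bsub>cone Y x\<^esub> Pair (f (left v)) (f (right v))"
      using isoD(5)[OF u(2) v(2)] isoD(5)[OF u(3) v(3)] by (simp add: u(1) v(1))
    show "u = v" if "Pair (f (left u)) (f (right u)) = Pair (f (left v)) (f (right v))"
      using that isoD(6)[OF u(2) v(2)] isoD(6)[OF u(3) v(3)] by (simp add: u(1) v(1))
  next
    fix n w assume "w \<in> dgm_comp (cone Y x) n"
    then obtain y z where w: "w = Pair y z" "y \<in> dgm_comp Y (n + 1)" "z \<in> dgm_comp Y n"
      by (rule cone_compE)
    obtain y' z' where "y' \<in> dgm_comp X (n + 1)" "y = f y'" "z' \<in> dgm_comp X n" "z = f z'"
      using isoD(7)[OF w(2)] isoD(7)[OF w(3)] by blast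
    then show "\<exists>u\<in>dgm_comp (cone X x) n. w = Pair (f (left u)) (f (right u))"
      using w by (intro bexI[of _ "Pair y' z'"]) simp_all
  qed
qed

text \<open>The sign comes from interchanging two variables of degree \<open>-1\<close>.\<close>

lemma cone_swap:
  assumes "tree_complex R X" and x: "x \<in> carrier R" and y: "y \<in> carrier R"
  shows "complex_iso R (cone (cone X x) y) (cone (cone X y) x)
    (\<lambda>u. Pair (Pair (\<ominus>\<^bsub>X\<^esub> left (left u)) (left (right u))) (Pair (right (left u)) (right (right u))))"
    (is "complex_iso R ?C ?D ?f")
proof -
  interpret X: tree_complex R X by fact
  have elim: "\<exists>p q r s. u = Pair (Pair p q) (Pair r s) \<and> p \<in> dgm_comp X (n + 2) \<and>
      q \<in> dgm_comp X (n + 1) \<and> r \<in> dgm_comp X (n + 1) \<and> s \<in> dgm_comp X n"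
    if u: "u \<in> dgm_comp (cone (cone X a) b) n" for u n a b
  proof -
    obtain v w where v: "u = Pair v w" "v \<in> dgm_comp (cone X a) (n + 1)" "w \<in> dgm_comp (cone X a) n"
      using u by (rule cone_compE)
    obtain p q where "v = Pair p q" "p \<in> dgm_comp X (n + 1 + 1)" "q \<in> dgm_comp X (n + 1)"
      using v(2) by (rule cone_compE)
    moreover obtain r s where "w = Pair r s" "r \<in> dgm_comp X (n + 1)" "s \<in> dgm_comp X n"
      using v(3) by (rule cone_compE)
    ultimately show ?thesis using v(1) by (simp add: add.assoc)
  qed
  have minus_inj: "p = p'" if "\<ominus>\<^bsub>X\<^esub> p = \<ominus>\<^bsub>X\<^esub> p'" "p \<in> carrier X" "p' \<in> carrier X" for p p'
    using that by (metis X.M.minus_minus)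
  have cm: "\<ominus>\<^bsub>cone X a\<^esub> Pair p q = Pair (\<ominus>\<^bsub>X\<^esub> p) (\<ominus>\<^bsub>X\<^esub> q)" if "p \<in> carrier X" "q \<in> carrier X" for a p q
    using that by (rule X.cone_minus)
  show ?thesis
  proof (rule complex_isoI)
    fix n u assume "u \<in> dgm_comp ?C n"
    from elim[OF this] obtain p q r s where u: "u = Pair (Pair p q) (Pair r s)" "p \<in> dgm_comp X (n + 2)"
      "q \<in> dgm_comp X (n + 1)" "r \<in> dgm_comp X (n + 1)" "s \<in> dgm_comp X n" by blast
    note c = u(2-5)[THEN X.comp_carrier] u(2-5)[THEN X.diff_carrier]
    show "?f u \<in> dgm_comp ?D n" using u by (simp add: X.comp_minus add.assoc)
    show "?f (dgm_diff ?C u) = dgm_diff ?D (?f u)"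
      using c x y by (simp add: u(1) cm X.diff_minus[OF u(2)] X.smult_r_minus X.M.minus_add)
        (simp add: X.M.a_ac)
    show "?f (a \<odot>\<^bsub>?C\<^esub> u) = a \<odot>\<^bsub>?D\<^esub> ?f u" if "a \<in> carrier R" for a
      using c that by (simp add: u(1) X.smult_r_minus)
  next
    fix n u v assume uv: "u \<in> dgm_comp ?C n" "v \<in> dgm_comp ?C n"
    from elim[OF uv(1)] obtain p q r s where u: "u = Pair (Pair p q) (Pair r s)" "p \<in> dgm_comp X (n + 2)"
      "q \<in> dgm_comp X (n + 1)" "r \<in> dgm_comp X (n + 1)" "s \<in> dgm_comp X n" by blast
    from elim[OF uv(2)] obtain p' q' r' s' where v: "v = Pair (Pair p' q') (Pair r' s')"
      "p' \<in> dgm_comp X (n + 2)" "q' \<in> dgm_comp X (n + 1)" "r' \<in> dgm_comp X (n + 1)" "s' \<in> dgm_comp X n"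
      by blast
    note c = u(2-5)[THEN X.comp_carrier] v(2-5)[THEN X.comp_carrier]
    show "?f (u \<oplus>\<^bsub>?C\<^esub> v) = ?f u \<oplus>\<^bsub>?D\<^esub> ?f v" using c by (simp add: u(1) v(1) X.M.minus_add)
    show "u = v" if "?f u = ?f v" using that c minus_inj[of p p'] by (simp add: u(1) v(1))
  next
    fix n w assume "w \<in> dgm_comp ?D n"
    from elim[OF this] obtain p q r s where w: "w = Pair (Pair p q) (Pair r s)" "p \<in> dgm_comp X (n + 2)"
      "q \<in> dgm_comp X (n + 1)" "r \<in> dgm_comp X (n + 1)" "s \<in> dgm_comp X n" by blast
    then show "\<exists>u\<in>dgm_comp ?C n. w = ?f u"
      using w(2)[THEN X.comp_carrier]
      by (intro bexI[of _ "Pair (Pair (\<ominus>\<^bsub>X\<^esub> p) r) (Pair q s)"]) (simp_all add: X.comp_minus add.assoc)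
  qed
qed


section \<open>Koszul complexes\<close>

definition unit_complex :: "('a, 'b) ring_scheme \<Rightarrow> ('a, 'a pair_tree) dg_module" where
  "unit_complex R = \<lparr>carrier = Leaf ` carrier R, monoid.mult = undefined, one = undefined,
     zero = Leaf \<zero>\<^bsub>R\<^esub>,
     add = (\<lambda>x y. Leaf (leaf x \<oplus>\<^bsub>R\<^esub> leaf y)),
     smult = (\<lambda>a x. Leaf (a \<otimes>\<^bsub>R\<^esub> leaf x)),
     dgm_comp = (\<lambda>n. if n = 0 then Leaf ` carrier R else {Leaf \<zero>\<^bsub>R\<^esub>}),
     dgm_diff = (\<lambda>_. Leaf \<zero>\<^bsub>R\<^esub>)\<rparr>"

primrec koszul_complex :: "('a, 'b) ring_scheme \<Rightarrow> 'a list \<Rightarrow> ('a, 'a pair_tree) dg_module" where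
  "koszul_complex R [] = unit_complex R"
| "koszul_complex R (x # xs) = cone (koszul_complex R xs) x"

lemma unit_complex_simps [simp]:
  "carrier (unit_complex R) = Leaf ` carrier R"
  "\<zero>\<^bsub>unit_complex R\<^esub> = Leaf \<zero>\<^bsub>R\<^esub>"
  "Leaf a \<oplus>\<^bsub>unit_complex R\<^esub> Leaf b = Leaf (a \<oplus>\<^bsub>R\<^esub> b)"
  "a \<odot>\<^bsub>unit_complex R\<^esub> Leaf b = Leaf (a \<otimes>\<^bsub>R\<^esub> b)"
  "dgm_comp (unit_complex R) n = (if n = 0 then Leaf ` carrier R else {Leaf \<zero>\<^bsub>R\<^esub>})"
  "dgm_diff (unit_complex R) u = Leaf \<zero>\<^bsub>R\<^esub>"
  by (simp_all add: unit_complex_def)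

context cring
begin

lemma unit_complex: "tree_complex R (unit_complex R)"
proof -
  have g: "abelian_group (unit_complex R)"
    by (rule abelian_groupI) (auto simp: a_ac intro: bexI[of _ "\<ominus> a" for a] l_neg)
  have m: "module R (unit_complex R)"
    by (rule moduleI[OF is_cring g]) (auto simp: l_distr r_distr m_assoc)
  interpret U: module R "unit_complex R" by (rule m)
  have neg: "\<ominus>\<^bsub>unit_complex R\<^esub> Leaf a = Leaf (\<ominus> a)" if "a \<in> carrier R" for a
    using that by (intro U.M.minus_equality) (auto simp: l_neg)
  show ?thesis
  proof (intro tree_complex.intro cochain_complex.intro cochain_complex_axioms.intro m)
    show "submodule (dgm_comp (unit_complex R) n) R (unit_complex R)" for n
      by (rule U.submoduleI) (auto simp: neg)
  qed auto
qed

lemma koszul_complex: "set xs \<subseteq> carrier R \<Longrightarrow> tree_complex R (koszul_complex R xs)"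
  by (induction xs) (auto intro: unit_complex tree_complex.cone_complex)

lemma koszul_comp_trivial:
  "n > 0 \<or> n < - int (length xs) \<Longrightarrow> dgm_comp (koszul_complex R xs) n = {\<zero>\<^bsub>koszul_complex R xs\<^esub>}"
  by (induction xs arbitrary: n) (auto simp: cone_def)

lemma koszul_exact_outside:
  assumes "set xs \<subseteq> carrier R" "n > 0 \<or> n < - int (length xs)"
  shows "exact_at (koszul_complex R xs) n"
proof -
  interpret K: tree_complex R "koszul_complex R xs" using koszul_complex assms(1) .
  show ?thesis
    unfolding exact_at_def cocycles_def koszul_comp_trivial[OF assms(2)]
    using K.coboundaries_zero by auto
qed

lemma koszul_move:
  assumes "x \<in> carrier R" "set us \<subseteq> carrier R" "set vs \<subseteq> carrier R"
  shows "\<exists>f. complex_iso R (koszul_complex R (x # us @ vs)) (koszul_complex R (us @ x # vs)) f"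
  using assms(2)
proof (induction us)
  case Nil
  then show ?case using complex_iso_refl by auto
next
  case (Cons u us)
  then obtain f where f: "complex_iso R (koszul_complex R (x # us @ vs)) (koszul_complex R (us @ x # vs)) f"
    by auto
  have "complex_iso R (koszul_complex R (u # x # us @ vs)) (koszul_complex R (u # us @ x # vs))
      (\<lambda>w. Pair (f (left w)) (f (right w)))"
    using cone_iso[OF _ _ _ f, of u] Cons.prems assms koszul_complex[of "x # us @ vs"]
      koszul_complex[of "us @ x # vs"] by simp
  moreover have "\<exists>g. complex_iso R (koszul_complex R (x # u # us @ vs)) (koszul_complex R (u # x # us @ vs)) g"
    using cone_swap[of R "koszul_complex R (us @ vs)" u x] Cons.prems assms koszul_complex[of "us @ vs"]
    by auto
  ultimately show ?case using complex_iso_trans by fastforce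
qed

text \<open>
  The Koszul complex on \<open>ys @ bs\<close> arises from that on \<open>bs\<close> by adding \<open>ys\<close>, and up to isomorphism from that on
  \<open>ys\<close> by adding \<open>bs\<close>.
\<close>

lemma koszul_permute:
  assumes "mset xs = mset ys" "set xs \<subseteq> carrier R"
  shows "\<exists>f. complex_iso R (koszul_complex R xs) (koszul_complex R ys) f"
  using assms
proof (induction xs arbitrary: ys)
  case Nil then show ?case using complex_iso_refl by auto
next
  case (Cons x xs)
  have "x \<in> set ys" using Cons.prems(1) by (metis list.set_intros(1) set_mset_mset)
  then obtain us vs where ys: "ys = us @ x # vs" using split_list by metis
  then have m: "mset xs = mset (us @ vs)" using Cons.prems(1) by simp
  then have s: "set xs = set (us @ vs)" by (metis set_mset_mset)
  obtain f where "complex_iso R (koszul_complex R xs) (koszul_complex R (us @ vs)) f"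
    using Cons.IH[OF m] Cons.prems(2) by auto
  then have "complex_iso R (koszul_complex R (x # xs)) (koszul_complex R (x # us @ vs))
      (\<lambda>w. Pair (f (left w)) (f (right w)))"
    using cone_iso[of R "koszul_complex R xs" "koszul_complex R (us @ vs)" x f] Cons.prems(2) s
      koszul_complex[of xs] koszul_complex[of "us @ vs"] by simp
  moreover obtain g where "complex_iso R (koszul_complex R (x # us @ vs)) (koszul_complex R ys) g"
    using koszul_move[of x us vs] Cons.prems(2) s ys by auto
  ultimately show ?case using complex_iso_trans by blast
qed

lemma koszul_permute_iso:
  assumes "mset xs = mset ys" "set xs \<subseteq> carrier R"
  obtains f where "iso_of_complexes R (koszul_complex R xs) (koszul_complex R ys) f"
proof -
  have ys: "set ys \<subseteq> carrier R" using assms by (metis set_mset_mset)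
  obtain f where f: "complex_iso R (koszul_complex R xs) (koszul_complex R ys) f"
    using koszul_permute[OF assms] by blast
  show thesis
    by (rule that[of f], intro iso_of_complexes.intro iso_of_complexes_axioms.intro f)
      (use koszul_complex[OF assms(2)] koszul_complex[OF ys] in \<open>auto dest: tree_complex.axioms\<close>)
qed

text \<open>
  Each \<open>x\<close> in the list is null-homotopic on the cone that introduces it, hence on all later cones; and null-homotopic scalars
  form an ideal.
\<close>

lemma koszul_null_homotopic:
  assumes "set xs \<subseteq> carrier R" "r \<in> Idl (set xs)"
  shows "null_homotopic R (koszul_complex R xs) r"
proof -
  have "set xs \<subseteq> {r \<in> carrier R. null_homotopic R (koszul_complex R xs) r}"
    using assms(1)
  proof (induction xs)
    case (Cons x xs)
    interpret K: tree_complex R "koszul_complex R xs" using koszul_complex Cons.prems by simp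
    show ?case using Cons K.cone_null_homotopic_self K.cone_null_homotopic by auto
  qed simp
  moreover interpret K: tree_complex R "koszul_complex R xs" using koszul_complex assms(1) .
  have "ideal {r \<in> carrier R. null_homotopic R (koszul_complex R xs) r} R"
    by (rule K.null_homotopic_ideal)
  ultimately show ?thesis using genideal_minimal assms(2) by blast
qed

lemma Idl_insert:
  assumes "x \<in> carrier R" "X \<subseteq> carrier R"
  shows "Idl (insert x X) = {x \<otimes> a \<oplus> j | a j. a \<in> carrier R \<and> j \<in> Idl X}"
proof -
  have "Idl {x} = {a \<otimes> x | a. a \<in> carrier R}"
    using cgenideal_eq_genideal[OF assms(1)] by (simp add: cgenideal_def)
  also have "\<dots> = {x \<otimes> a | a. a \<in> carrier R}"
    by (intro Collect_cong ex_cong1) (auto simp: m_comm[OF assms(1)])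
  finally have P: "Idl {x} = {x \<otimes> a | a. a \<in> carrier R}" .
  have I: "ideal (Idl {x}) R" "ideal (Idl X) R" using assms by (auto intro: genideal_ideal)
  have "Idl (Idl {x} \<union> Idl X) = Idl (insert x X)"
  proof (rule subset_antisym; rule genideal_minimal)
    show "ideal (Idl (insert x X)) R" "ideal (Idl (Idl {x} \<union> Idl X)) R"
      using assms I by (auto intro!: genideal_ideal dest: ideal.Icarr)
    show "Idl {x} \<union> Idl X \<subseteq> Idl (insert x X)" using assms by (auto intro: subset_Idl_subset[THEN subsetD])
    have "Idl {x} \<union> Idl X \<subseteq> Idl (Idl {x} \<union> Idl X)" using I by (intro genideal_self) (auto dest: ideal.Icarr)
    then show "insert x X \<subseteq> Idl (Idl {x} \<union> Idl X)"
      using genideal_self[of X] genideal_self'[OF assms(1)] assms(2) by blast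
  qed
  then have "Idl (insert x X) = Idl {x} <+> Idl X" using union_genideal[OF I] by simp
  then show ?thesis unfolding P set_add_def' by blast
qed

end

text \<open>The degree zero part of the Koszul complex is a copy of \<open>R\<close>, at the rightmost leaves.\<close>

primrec last_leaf :: "'a pair_tree \<Rightarrow> 'a" where
  "last_leaf (Leaf a) = a" | "last_leaf (Pair y z) = last_leaf z"

context cring
begin

lemma koszul_degree_zero:
  assumes "set xs \<subseteq> carrier R"
  shows "last_leaf ` dgm_comp (koszul_complex R xs) 0 = carrier R"
    and "u \<in> dgm_comp (koszul_complex R xs) n \<Longrightarrow> v \<in> dgm_comp (koszul_complex R xs) n \<Longrightarrow>
      last_leaf (u \<oplus>\<^bsub>koszul_complex R xs\<^esub> v) = last_leaf u \<oplus> last_leaf v"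
    and "u \<in> dgm_comp (koszul_complex R xs) n \<Longrightarrow> a \<in> carrier R \<Longrightarrow>
      last_leaf (a \<odot>\<^bsub>koszul_complex R xs\<^esub> u) = a \<otimes> last_leaf u"
    and "u \<in> dgm_comp (koszul_complex R xs) n \<Longrightarrow> last_leaf u \<in> carrier R"
proof -
  show "last_leaf ` dgm_comp (koszul_complex R xs) 0 = carrier R"
    using assms
  proof (induction xs)
    case (Cons x xs)
    have "dgm_comp (koszul_complex R (x # xs)) 0 =
        Pair \<zero>\<^bsub>koszul_complex R xs\<^esub> ` dgm_comp (koszul_complex R xs) 0"
      using koszul_comp_trivial[of 1 xs] by (auto simp: cone_def)
    then show ?case using Cons by (simp add: image_image)
  qed (simp add: image_image)
  show "u \<in> dgm_comp (koszul_complex R xs) n \<Longrightarrow> v \<in> dgm_comp (koszul_complex R xs) n \<Longrightarrow>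
      last_leaf (u \<oplus>\<^bsub>koszul_complex R xs\<^esub> v) = last_leaf u \<oplus> last_leaf v"
    using assms by (induction xs arbitrary: u v) (auto elim!: cone_compE split: if_splits)
  show "u \<in> dgm_comp (koszul_complex R xs) n \<Longrightarrow> a \<in> carrier R \<Longrightarrow>
      last_leaf (a \<odot>\<^bsub>koszul_complex R xs\<^esub> u) = a \<otimes> last_leaf u"
    using assms by (induction xs arbitrary: u) (auto elim!: cone_compE split: if_splits)
  show "u \<in> dgm_comp (koszul_complex R xs) n \<Longrightarrow> last_leaf u \<in> carrier R"
    using assms by (induction xs arbitrary: u) (auto elim!: cone_compE split: if_splits)
qed

text \<open>The cohomology in degree zero is the quotient of \<open>R\<close> by the ideal that the list generates.\<close>

lemma koszul_coboundaries_zero: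
  assumes "set xs \<subseteq> carrier R" "u \<in> dgm_comp (koszul_complex R xs) 0"
  shows "u \<in> coboundaries (koszul_complex R xs) 0 \<longleftrightarrow> last_leaf u \<in> Idl (set xs)"
  using assms
proof (induction xs arbitrary: u)
  case Nil
  have "\<zero> \<in> Idl {}"
    using additive_subgroup.zero_closed[OF ideal.axioms(1)[OF genideal_ideal[of "{}"]]] by simp
  then have Idl: "Idl {} = {\<zero>}" using genideal_minimal[OF zeroideal, of "{}"] by auto
  obtain a where "u = Leaf a" using Nil(2) by auto
  moreover have "coboundaries (unit_complex R) 0 = {Leaf \<zero>}" by (simp add: coboundaries_def)
  ultimately show ?case by (simp add: Idl)
next
  case (Cons x xs)
  let ?K = "koszul_complex R xs"
  have xs: "set xs \<subseteq> carrier R" and x: "x \<in> carrier R" using Cons.prems by auto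
  interpret K: tree_complex R ?K using koszul_complex xs .
  interpret I: ideal "Idl (set xs)" R using genideal_ideal[OF xs] .
  note deg0 = koszul_degree_zero[OF xs]
  have triv: "dgm_comp ?K 1 = {\<zero>\<^bsub>?K\<^esub>}" using koszul_comp_trivial[of 1 xs] by simp
  from Cons.prems(2) obtain z where u: "u = Pair \<zero>\<^bsub>?K\<^esub> z" and z: "z \<in> dgm_comp ?K 0"
    using triv by (auto elim: cone_compE)
  show ?case
  proof
    assume "u \<in> coboundaries (koszul_complex R (x # xs)) 0"
    then obtain y w where y: "y \<in> dgm_comp ?K 0" and w: "w \<in> dgm_comp ?K (0 - 1)"
      and zyw: "z = x \<odot>\<^bsub>?K\<^esub> y \<oplus>\<^bsub>?K\<^esub> dgm_diff ?K w"
      unfolding u koszul_complex.simps K.cone_coboundary_iff by blast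
    have dw: "dgm_diff ?K w \<in> dgm_comp ?K 0" "dgm_diff ?K w \<in> coboundaries ?K 0"
      using K.diff_comp'[OF w] K.coboundariesI[OF w] by simp_all
    then have "last_leaf (dgm_diff ?K w) \<in> Idl (set xs)" using Cons.IH[OF xs] by simp
    moreover have "last_leaf u = x \<otimes> last_leaf y \<oplus> last_leaf (dgm_diff ?K w)"
      unfolding u zyw using deg0(2)[OF K.comp_smult[OF x y] dw(1)] deg0(3)[OF y x] by simp
    ultimately show "last_leaf u \<in> Idl (set (x # xs))"
      using Idl_insert[OF x xs] deg0(4)[OF y] by auto
  next
    assume "last_leaf u \<in> Idl (set (x # xs))"
    then obtain a j where aj: "last_leaf z = x \<otimes> a \<oplus> j" "a \<in> carrier R" "j \<in> Idl (set xs)"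
      unfolding u using Idl_insert[OF x xs] by auto
    have "a \<in> last_leaf ` dgm_comp ?K 0" using deg0(1) aj(2) by simp
    then obtain y where y: "y \<in> dgm_comp ?K 0" "a = last_leaf y" by blast
    let ?b = "z \<oplus>\<^bsub>?K\<^esub> (\<ominus> x) \<odot>\<^bsub>?K\<^esub> y"
    have mx: "\<ominus> x \<in> carrier R" using x by simp
    have xy: "(\<ominus> x) \<odot>\<^bsub>?K\<^esub> y \<in> dgm_comp ?K 0" using K.comp_smult[OF mx y(1)] .
    have b: "?b \<in> dgm_comp ?K 0" using K.comp_add[OF z xy] .
    have j: "j \<in> carrier R" using aj(3) by (rule I.Icarr)
    have "last_leaf ?b = (x \<otimes> a \<oplus> j) \<oplus> \<ominus> (x \<otimes> a)"
      using deg0(2)[OF z xy] deg0(3)[OF y(1) mx] x aj y(2) by (simp add: l_minus)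
    also have "\<dots> = j" using x aj(2) j by (simp add: a_ac r_neg)
    finally have "?b \<in> coboundaries ?K 0" using Cons.IH[OF xs b] aj(3) by simp
    then obtain w where w: "w \<in> dgm_comp ?K (0 - 1)" "?b = dgm_diff ?K w" by (rule K.coboundariesE)
    have "z = x \<odot>\<^bsub>?K\<^esub> y \<oplus>\<^bsub>?K\<^esub> dgm_diff ?K w"
      using K.comp_carrier[OF z] K.comp_carrier[OF y(1)] x unfolding w(2)[symmetric]
      by (simp add: K.smult_l_minus K.M.a_lcomm K.M.r_neg)
    moreover have "dgm_diff ?K y = \<zero>\<^bsub>?K\<^esub>" using K.diff_comp[OF y(1)] triv by simp
    ultimately show "u \<in> coboundaries (koszul_complex R (x # xs)) 0"
      unfolding u koszul_complex.simps K.cone_coboundary_iff using y(1) w(1) K.minus_zero by metis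
  qed
qed

lemma koszul_cocycles_zero:
  assumes "set xs \<subseteq> carrier R"
  shows "cocycles (koszul_complex R xs) 0 = dgm_comp (koszul_complex R xs) 0"
proof -
  interpret K: tree_complex R "koszul_complex R xs" using koszul_complex assms .
  have "dgm_diff (koszul_complex R xs) z = \<zero>\<^bsub>koszul_complex R xs\<^esub>" if "z \<in> dgm_comp (koszul_complex R xs) 0" for z
    using K.diff_comp[OF that] koszul_comp_trivial[of 1 xs] by simp
  then show ?thesis by (auto simp: cocycles_def)
qed

lemma koszul_injective_zero:
  assumes xs: "set xs \<subseteq> carrier R" and x: "x \<in> carrier R"
  shows "cohomology_injective (koszul_complex R xs) x 0 \<longleftrightarrow>
    (\<forall>r\<in>carrier R. x \<otimes> r \<in> Idl (set xs) \<longrightarrow> r \<in> Idl (set xs))"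
proof -
  let ?K = "koszul_complex R xs"
  interpret K: tree_complex R ?K using koszul_complex xs .
  note deg0 = koszul_degree_zero[OF xs] note cob = koszul_coboundaries_zero[OF xs]
  have *: "x \<odot>\<^bsub>?K\<^esub> z \<in> coboundaries ?K 0 \<longleftrightarrow> x \<otimes> last_leaf z \<in> Idl (set xs)" if "z \<in> dgm_comp ?K 0" for z
    using cob[OF K.comp_smult[OF x that]] deg0(3)[OF that x] by simp
  have "cohomology_injective ?K x 0 \<longleftrightarrow> (\<forall>z\<in>dgm_comp ?K 0.
      x \<otimes> last_leaf z \<in> Idl (set xs) \<longrightarrow> last_leaf z \<in> Idl (set xs))"
    unfolding cohomology_injective_def koszul_cocycles_zero[OF xs] using * cob by simp
  also have "\<dots> \<longleftrightarrow> (\<forall>r\<in>last_leaf ` dgm_comp ?K 0. x \<otimes> r \<in> Idl (set xs) \<longrightarrow> r \<in> Idl (set xs))"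
    by simp
  finally show ?thesis unfolding deg0(1) .
qed

lemma koszul_not_loc_exact_zero:
  assumes xs: "set xs \<subseteq> carrier R" and S: "S \<subseteq> carrier R" "S \<inter> Idl (set xs) = {}"
  shows "\<not> loc_exact_at (koszul_complex R xs) S 0"
proof -
  let ?K = "koszul_complex R xs"
  interpret K: tree_complex R ?K using koszul_complex xs .
  note deg0 = koszul_degree_zero[OF xs]
  have "\<one> \<in> last_leaf ` dgm_comp ?K 0" using deg0(1) by simp
  then obtain u where u: "u \<in> dgm_comp ?K 0" "last_leaf u = \<one>" by force
  have "s \<odot>\<^bsub>?K\<^esub> u \<notin> coboundaries ?K 0" if s: "s \<in> S" for s
  proof -
    have "s \<in> carrier R" using s S by blast
    then show ?thesis using koszul_coboundaries_zero[OF xs K.comp_smult[OF _ u(1)]] deg0(3)[OF u(1)] u(2) s S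
      by auto
  qed
  then show ?thesis unfolding loc_exact_at_def koszul_cocycles_zero[OF xs] using u(1) by blast
qed

end


subsection \<open>Finite generation and Nakayama's lemma\<close>

text \<open>Generation is expressed by the submodules that contain the generators, instead of by linear combinations.\<close>

definition finitely_generated_submodule ::
    "('a, 'b) ring_scheme \<Rightarrow> ('a, 'm, 'c) module_scheme \<Rightarrow> 'm set \<Rightarrow> bool" where
  "finitely_generated_submodule R M N \<longleftrightarrow>
     (\<exists>U. finite U \<and> U \<subseteq> N \<and> (\<forall>N'. submodule N' R M \<and> U \<subseteq> N' \<longrightarrow> N \<subseteq> N'))"

definition noetherian_at :: "('a, 'b) ring_scheme \<Rightarrow> ('a, 'm, 'c) dg_module_scheme \<Rightarrow> int \<Rightarrow> bool" where
  "noetherian_at R M n \<longleftrightarrow>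
     (\<forall>N. submodule N R M \<and> N \<subseteq> dgm_comp M n \<longrightarrow> finitely_generated_submodule R M N)"

context module
begin

lemma submodule_zero: "submodule N R M \<Longrightarrow> \<zero>\<^bsub>M\<^esub> \<in> N"
  using subgroup.one_closed[OF submodule.axioms(1)] by fastforce

lemma submodule_Int:
  assumes "submodule N R M" "submodule N' R M"
  shows "submodule (N \<inter> N') R M"
  using submoduleE[OF assms(1)] submoduleE[OF assms(2)] submodule_zero[OF assms(1)] submodule_zero[OF assms(2)]
  by (intro submoduleI) auto

lemma submodule_add_cyclic:
  assumes W: "submodule W R M" and u: "u \<in> carrier M"
  shows "submodule {r \<odot>\<^bsub>M\<^esub> u \<oplus>\<^bsub>M\<^esub> w | r w. r \<in> carrier R \<and> w \<in> W} R M" (is "submodule ?W R M")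
proof (rule submoduleI)
  note E = submoduleE[OF W]
  have c: "w \<in> carrier M" if "w \<in> W" for w using E(1) that by blast
  show "?W \<subseteq> carrier M" using c u by auto
  show "\<zero>\<^bsub>M\<^esub> \<in> ?W" using submodule_zero[OF W] u by (intro CollectI exI[of _ \<zero>] exI[of _ "\<zero>\<^bsub>M\<^esub>"]) auto
  fix v assume "v \<in> ?W"
  then obtain r w where v: "v = r \<odot>\<^bsub>M\<^esub> u \<oplus>\<^bsub>M\<^esub> w" "r \<in> carrier R" "w \<in> W" by blast
  show "\<ominus>\<^bsub>M\<^esub> v \<in> ?W"
    using v E(3) c u by (intro CollectI exI[of _ "\<ominus> r"] exI[of _ "\<ominus>\<^bsub>M\<^esub> w"])
      (auto simp: M.minus_add smult_l_minus)
  show "a \<odot>\<^bsub>M\<^esub> v \<in> ?W" if "a \<in> carrier R" for a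
    using v E(4) c u that by (intro CollectI exI[of _ "a \<otimes> r"] exI[of _ "a \<odot>\<^bsub>M\<^esub> w"])
      (auto simp: smult_r_distr smult_assoc1)
  fix v' assume "v' \<in> ?W"
  then obtain r' w' where v': "v' = r' \<odot>\<^bsub>M\<^esub> u \<oplus>\<^bsub>M\<^esub> w'" "r' \<in> carrier R" "w' \<in> W" by blast
  show "v \<oplus>\<^bsub>M\<^esub> v' \<in> ?W"
    using v v' E(5) c u by (intro CollectI exI[of _ "r \<oplus> r'"] exI[of _ "w \<oplus>\<^bsub>M\<^esub> w'"])
      (auto simp: smult_l_distr M.a_ac)
qed

text \<open>
  Induction on the generators: if \<open>Z \<subseteq> R u + W\<close> and \<open>Z \<subseteq> x Z + W\<close>, then \<open>(1 - x r) u \<in> W\<close> for some \<open>r\<close>, so \<open>u \<in> W\<close>.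
\<close>

lemma nakayama:
  assumes Z: "submodule Z R M" "finitely_generated_submodule R M Z" and B: "submodule B R M"
    and x: "x \<in> carrier R" "\<And>r. r \<in> carrier R \<Longrightarrow> \<one> \<ominus> x \<otimes> r \<in> Units R"
    and gen: "\<And>z. z \<in> Z \<Longrightarrow> \<exists>y\<in>Z. \<exists>b\<in>B. z = x \<odot>\<^bsub>M\<^esub> y \<oplus>\<^bsub>M\<^esub> b"
  shows "Z \<subseteq> B"
proof -
  obtain U where U: "finite U" "U \<subseteq> Z" "\<forall>N'. submodule N' R M \<and> U \<subseteq> N' \<longrightarrow> Z \<subseteq> N'"
    using Z(2) unfolding finitely_generated_submodule_def by blast
  have "Z \<subseteq> B" if "finite U" "U \<subseteq> Z" "\<forall>N'. submodule N' R M \<and> B \<subseteq> N' \<and> U \<subseteq> N' \<longrightarrow> Z \<subseteq> N'" for U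
    using that
  proof (induction U)
    case empty then show ?case using B by blast
  next
    case (insert u U)
    have u: "u \<in> Z" "u \<in> carrier M" using insert.prems submoduleE(1)[OF Z(1)] by auto
    have "Z \<subseteq> W" if W: "submodule W R M" "B \<subseteq> W" "U \<subseteq> W" for W
    proof -
      let ?W = "{r \<odot>\<^bsub>M\<^esub> u \<oplus>\<^bsub>M\<^esub> w | r w. r \<in> carrier R \<and> w \<in> W}"
      note E = submoduleE[OF W(1)]
      have c: "w \<in> carrier M" if "w \<in> W" for w using E(1) that by blast
      have "w \<in> ?W" if "w \<in> W" for w
        using that c u by (intro CollectI exI[of _ \<zero>] exI[of _ w]) auto
      then have "W \<subseteq> ?W" by blast
      moreover have "u \<in> ?W"
        using submodule_zero[OF W(1)] u by (intro CollectI exI[of _ \<one>] exI[of _ "\<zero>\<^bsub>M\<^esub>"]) auto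
      ultimately have "B \<subseteq> ?W" "insert u U \<subseteq> ?W" using W by auto
      then have "Z \<subseteq> ?W" using insert.prems(2) submodule_add_cyclic[OF W(1) u(2)] by blast
      obtain y b where y: "y \<in> Z" "b \<in> B" "u = x \<odot>\<^bsub>M\<^esub> y \<oplus>\<^bsub>M\<^esub> b" using gen[OF u(1)] by blast
      then obtain r w where r: "y = r \<odot>\<^bsub>M\<^esub> u \<oplus>\<^bsub>M\<^esub> w" "r \<in> carrier R" "w \<in> W" using \<open>Z \<subseteq> ?W\<close> by blast
      have bc: "b \<in> W" "b \<in> carrier M" using y(2) W(2) c by auto
      have xwb: "x \<odot>\<^bsub>M\<^esub> w \<oplus>\<^bsub>M\<^esub> b \<in> W" using E(4)[OF x(1) r(3)] E(5) bc by blast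
      have ueq: "u = (x \<otimes> r) \<odot>\<^bsub>M\<^esub> u \<oplus>\<^bsub>M\<^esub> (x \<odot>\<^bsub>M\<^esub> w \<oplus>\<^bsub>M\<^esub> b)"
        using y(3) r x(1) u c[OF r(3)] bc by (simp add: smult_r_distr smult_assoc1 M.a_assoc)
      have "(\<one> \<ominus> x \<otimes> r) \<odot>\<^bsub>M\<^esub> u = u \<oplus>\<^bsub>M\<^esub> \<ominus>\<^bsub>M\<^esub> ((x \<otimes> r) \<odot>\<^bsub>M\<^esub> u)"
        using x(1) r(2) u by (simp add: R.minus_eq smult_l_distr smult_l_minus)
      also have "\<dots> = ((x \<otimes> r) \<odot>\<^bsub>M\<^esub> u \<oplus>\<^bsub>M\<^esub> (x \<odot>\<^bsub>M\<^esub> w \<oplus>\<^bsub>M\<^esub> b)) \<oplus>\<^bsub>M\<^esub> \<ominus>\<^bsub>M\<^esub> ((x \<otimes> r) \<odot>\<^bsub>M\<^esub> u)"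
        using ueq by simp
      also have "\<dots> = x \<odot>\<^bsub>M\<^esub> w \<oplus>\<^bsub>M\<^esub> b"
        using x(1) r(2) u c[OF xwb] by (simp add: M.a_comm[of "(x \<otimes> r) \<odot>\<^bsub>M\<^esub> u"] M.a_assoc M.r_neg)
      finally have 1: "(\<one> \<ominus> x \<otimes> r) \<odot>\<^bsub>M\<^esub> u \<in> W" using xwb by simp
      have unit: "\<one> \<ominus> x \<otimes> r \<in> Units R" using x(2)[OF r(2)] .
      have "u = (inv (\<one> \<ominus> x \<otimes> r) \<otimes> (\<one> \<ominus> x \<otimes> r)) \<odot>\<^bsub>M\<^esub> u" using unit u by simp
      also have "\<dots> = inv (\<one> \<ominus> x \<otimes> r) \<odot>\<^bsub>M\<^esub> ((\<one> \<ominus> x \<otimes> r) \<odot>\<^bsub>M\<^esub> u)"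
        using unit u by (intro smult_assoc1) (auto intro: R.Units_closed)
      also have "\<dots> \<in> W" using E(4)[OF R.Units_inv_closed[OF unit] 1] .
      finally have "insert u U \<subseteq> W" using W(3) by simp
      then show ?thesis using insert.prems(2) W by blast
    qed
    then show ?case using insert by blast
  qed
  then show ?thesis using U by (meson)
qed

end

text \<open>
  In each degree the cone is an extension of \<open>M\<^sup>n\<^sup>+\<^sup>1\<close> by \<open>M\<^sup>n\<close>.
\<close>

lemma (in tree_complex) cone_noetherian_at:
  assumes x: "x \<in> carrier R" and n1: "noetherian_at R M (n + 1)" and n0: "noetherian_at R M n"
  shows "noetherian_at R (cone M x) n"
  unfolding noetherian_at_def
proof (intro allI impI)
  fix N assume N: "submodule N R (cone M x) \<and> N \<subseteq> dgm_comp (cone M x) n"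
  interpret C: module R "cone M x" by (rule cone_module)
  define fsts where "fsts = (\<lambda>N :: 'm pair_tree set. {y. \<exists>z. Pair y z \<in> N})"
  define snds where "snds = (\<lambda>N :: 'm pair_tree set. {z. Pair \<zero>\<^bsub>M\<^esub> z \<in> N})"
  have sub: "submodule (fsts N') R M" "submodule (snds N') R M" if N': "submodule N' R (cone M x)" for N'
  proof -
    note E = C.submoduleE[OF N']
    have z: "Pair \<zero>\<^bsub>M\<^esub> \<zero>\<^bsub>M\<^esub> \<in> N'" using C.submodule_zero[OF N'] by simp
    have c: "y \<in> carrier M \<and> z \<in> carrier M" if "Pair y z \<in> N'" for y z using subsetD[OF E(1) that] by simp
    have minus: "Pair (\<ominus>\<^bsub>M\<^esub> y) (\<ominus>\<^bsub>M\<^esub> z) \<in> N'" if "Pair y z \<in> N'" for y z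
      using E(3)[OF that] c[OF that] by (simp add: cone_minus)
    have add: "Pair (y \<oplus>\<^bsub>M\<^esub> y') (z \<oplus>\<^bsub>M\<^esub> z') \<in> N'" if "Pair y z \<in> N'" "Pair y' z' \<in> N'" for y z y' z'
      using E(5)[OF that] by simp
    have smult: "Pair (a \<odot>\<^bsub>M\<^esub> y) (a \<odot>\<^bsub>M\<^esub> z) \<in> N'" if "a \<in> carrier R" "Pair y z \<in> N'" for a y z
      using E(4)[OF that] by simp
    show "submodule (fsts N') R M"
    proof (rule submoduleI)
      fix a assume "a \<in> fsts N'"
      then obtain a' where a: "Pair a a' \<in> N'" unfolding fsts_def by blast
      show "\<ominus>\<^bsub>M\<^esub> a \<in> fsts N'" using minus[OF a] unfolding fsts_def by blast
      show "r \<odot>\<^bsub>M\<^esub> a \<in> fsts N'" if "r \<in> carrier R" for r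
        using smult[OF that a] unfolding fsts_def by blast
      show "a \<oplus>\<^bsub>M\<^esub> b \<in> fsts N'" if b: "b \<in> fsts N'" for b
      proof -
        obtain b' where "Pair b b' \<in> N'" using b unfolding fsts_def by blast
        from add[OF a this] show ?thesis unfolding fsts_def by blast
      qed
    qed (use c z in \<open>auto simp: fsts_def\<close>)
    show "submodule (snds N') R M"
    proof (rule submoduleI)
      fix a assume a: "a \<in> snds N'"
      then show "\<ominus>\<^bsub>M\<^esub> a \<in> snds N'" using minus[of "\<zero>\<^bsub>M\<^esub>" a] by (simp add: snds_def minus_zero)
      show "r \<odot>\<^bsub>M\<^esub> a \<in> snds N'" if "r \<in> carrier R" for r
        using smult[OF that, of "\<zero>\<^bsub>M\<^esub>" a] a that by (simp add: snds_def)
      show "a \<oplus>\<^bsub>M\<^esub> b \<in> snds N'" if "b \<in> snds N'" for b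
        using add[of "\<zero>\<^bsub>M\<^esub>" a "\<zero>\<^bsub>M\<^esub>" b] a that by (simp add: snds_def)
    qed (use c z in \<open>auto simp: snds_def\<close>)
  qed
  have "fsts N \<subseteq> dgm_comp M (n + 1)" "snds N \<subseteq> dgm_comp M n"
    using N by (auto simp: fsts_def snds_def)
  then have fg: "finitely_generated_submodule R M (fsts N)" "finitely_generated_submodule R M (snds N)"
    using n1 n0 sub[OF conjunct1[OF N]] unfolding noetherian_at_def by simp_all
  obtain U1 where U1: "finite U1" "U1 \<subseteq> fsts N" "\<And>N'. \<lbrakk>submodule N' R M; U1 \<subseteq> N'\<rbrakk> \<Longrightarrow> fsts N \<subseteq> N'"
    using fg(1) unfolding finitely_generated_submodule_def by meson
  obtain U2 where U2: "finite U2" "U2 \<subseteq> snds N" "\<And>N'. \<lbrakk>submodule N' R M; U2 \<subseteq> N'\<rbrakk> \<Longrightarrow> snds N \<subseteq> N'"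
    using fg(2) unfolding finitely_generated_submodule_def by meson
  have "\<forall>y. \<exists>z. y \<in> U1 \<longrightarrow> Pair y z \<in> N" using U1(2) unfolding fsts_def by blast
  then obtain g where g: "\<And>y. y \<in> U1 \<Longrightarrow> Pair y (g y) \<in> N" by metis
  let ?U = "(\<lambda>y. Pair y (g y)) ` U1 \<union> Pair \<zero>\<^bsub>M\<^esub> ` U2"
  have main: "N \<subseteq> N'" if N': "submodule N' R (cone M x)" "?U \<subseteq> N'" for N'
  proof
    fix u assume u: "u \<in> N"
    have NN: "submodule (N \<inter> N') R (cone M x)" using N N'(1) by (auto intro: C.submodule_Int)
    note E = C.submoduleE[OF conjunct1[OF N]]
    have 1: "fsts N \<subseteq> fsts (N \<inter> N')" using N' g by (intro U1(3) sub NN) (auto simp: fsts_def)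
    have 2: "snds N \<subseteq> snds (N \<inter> N')" using N' U2(2) by (intro U2(3) sub NN) (auto simp: snds_def)
    obtain y z where uyz: "u = Pair y z" "y \<in> carrier M" "z \<in> carrier M"
      using subsetD[OF E(1) u] by (rule cone_carrierE)
    have "y \<in> fsts (N \<inter> N')" using 1 u uyz by (auto simp: fsts_def)
    then obtain z' where z': "Pair y z' \<in> N" "Pair y z' \<in> N'" unfolding fsts_def by blast
    have z'c: "z' \<in> carrier M" using subsetD[OF E(1) z'(1)] by simp
    have "Pair \<zero>\<^bsub>M\<^esub> (z \<oplus>\<^bsub>M\<^esub> \<ominus>\<^bsub>M\<^esub> z') \<in> N"
      using E(5)[OF u E(3)[OF z'(1)]] uyz z'c by (simp add: cone_minus M.r_neg)
    then have "Pair \<zero>\<^bsub>M\<^esub> (z \<oplus>\<^bsub>M\<^esub> \<ominus>\<^bsub>M\<^esub> z') \<in> N'" using 2 unfolding snds_def by blast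
    from C.submoduleE(5)[OF N'(1) this z'(2)] show "u \<in> N'"
      using uyz z'c by (simp add: M.a_assoc M.l_neg)
  qed
  show "finitely_generated_submodule R (cone M x) N"
    unfolding finitely_generated_submodule_def
  proof (intro exI[of _ ?U] conjI allI impI)
    show "finite ?U" "?U \<subseteq> N" using U1 U2 g by (auto simp: snds_def)
    show "N \<subseteq> N'" if "submodule N' R (cone M x) \<and> ?U \<subseteq> N'" for N' using main that by simp
  qed
qed

context noetherian_cring
begin

lemma unit_complex_noetherian_at: "noetherian_at R (unit_complex R) n"
  unfolding noetherian_at_def
proof (intro allI impI)
  fix N assume N: "submodule N R (unit_complex R) \<and> N \<subseteq> dgm_comp (unit_complex R) n"
  interpret U: tree_complex R "unit_complex R" by (rule unit_complex)
  have neg: "\<ominus>\<^bsub>unit_complex R\<^esub> Leaf a = Leaf (\<ominus> a)" if "a \<in> carrier R" for a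
    using that by (intro U.M.minus_equality) (auto simp: l_neg)
  have I: "ideal {r \<in> carrier R. Leaf r \<in> N'} R" if N': "submodule N' R (unit_complex R)" for N'
  proof (rule idealI[OF ring_axioms])
    note E = U.submoduleE[OF N']
    show "subgroup {r \<in> carrier R. Leaf r \<in> N'} (add_monoid R)"
    proof (rule group.subgroupI[OF a_group])
      have "\<zero> \<in> {r \<in> carrier R. Leaf r \<in> N'}" using U.submodule_zero[OF N'] by simp
      then show "{r \<in> carrier R. Leaf r \<in> N'} \<noteq> {}" by blast
      show "inv\<^bsub>add_monoid R\<^esub> a \<in> {r \<in> carrier R. Leaf r \<in> N'}" if "a \<in> {r \<in> carrier R. Leaf r \<in> N'}" for a
        using that E(3)[of "Leaf a"] neg by (simp flip: a_inv_def)
      show "a \<otimes>\<^bsub>add_monoid R\<^esub> b \<in> {r \<in> carrier R. Leaf r \<in> N'}"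
        if "a \<in> {r \<in> carrier R. Leaf r \<in> N'}" "b \<in> {r \<in> carrier R. Leaf r \<in> N'}" for a b
        using that E(5)[of "Leaf a" "Leaf b"] by simp
    qed auto
    show "x \<otimes> a \<in> {r \<in> carrier R. Leaf r \<in> N'}" "a \<otimes> x \<in> {r \<in> carrier R. Leaf r \<in> N'}"
      if "a \<in> {r \<in> carrier R. Leaf r \<in> N'}" "x \<in> carrier R" for a x
      using that E(4)[of x "Leaf a"] by (simp_all add: m_comm)
  qed
  obtain A where A: "A \<subseteq> carrier R" "finite A" "{r \<in> carrier R. Leaf r \<in> N} = Idl A"
    using finetely_gen[OF I] N by blast
  have NA: "N = Leaf ` (Idl A)"
  proof -
    have "N \<subseteq> Leaf ` carrier R" using N U.submoduleE(1) by fastforce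
    then show ?thesis unfolding A(3)[symmetric] by auto
  qed
  have "N \<subseteq> N'" if N': "submodule N' R (unit_complex R)" "Leaf ` A \<subseteq> N'" for N'
  proof -
    have "Idl A \<subseteq> {r \<in> carrier R. Leaf r \<in> N'}" using N' A by (intro genideal_minimal I) auto
    then show ?thesis unfolding NA by auto
  qed
  moreover have "finite (Leaf ` A)" "Leaf ` A \<subseteq> N" using A NA genideal_self[OF A(1)] by auto
  ultimately show "finitely_generated_submodule R (unit_complex R) N"
    unfolding finitely_generated_submodule_def by blast
qed

lemma koszul_noetherian_at: "set xs \<subseteq> carrier R \<Longrightarrow> noetherian_at R (koszul_complex R xs) n"
  by (induction xs arbitrary: n)
    (auto intro: unit_complex_noetherian_at tree_complex.cone_noetherian_at koszul_complex)

end


section \<open>Koszul complexes over a Cohen-Macaulay local ring\<close>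

locale noetherian_local = noetherian_cring R for R (structure) +
  assumes local: "local_ring R"
begin

abbreviation \<mm> :: "'a set" where "\<mm> \<equiv> max_ideal R"

lemma maximalideal_mm: "maximalideal \<mm> R"
  using local theI'[of "\<lambda>M. maximalideal M R"] unfolding local_ring_def max_ideal_def by blast

lemma primeideal_mm: "primeideal \<mm> R"
  by (rule maximalideal_prime[OF maximalideal_mm])

lemma ideal_mm: "ideal \<mm> R"
  by (rule primeideal.axioms(1)[OF primeideal_mm])

lemma mm_subset: "\<mm> \<subseteq> carrier R"
  by (rule primeideal_subset[OF primeideal_mm])

lemma proper_ideal_le_mm:
  assumes "ideal I R" "I \<noteq> carrier R"
  shows "I \<subseteq> \<mm>"
proof -
  obtain M where "maximalideal M R" "I \<subseteq> M" using exists_maximalideal[OF assms] by meson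
  moreover have ex1: "\<exists>!M. maximalideal M R" using local unfolding local_ring_def by simp
  obtain M' where "\<forall>N. maximalideal N R \<longrightarrow> N = M'" using ex1 by (elim ex1E) (rule that)
  then have "M = M'" "\<mm> = M'" using \<open>maximalideal M R\<close> maximalideal_mm by meson+
  ultimately show ?thesis by simp
qed

lemma prime_le_mm: "primeideal P R \<Longrightarrow> P \<subseteq> \<mm>"
  using proper_ideal_le_mm[OF primeideal.axioms(1)] primeideal.I_notcarr[of P R] by metis

lemma unit_of_notin_mm:
  assumes "u \<in> carrier R" "u \<notin> \<mm>"
  shows "u \<in> Units R"
proof -
  have "PIdl u = carrier R"
    using proper_ideal_le_mm[OF cgenideal_ideal[OF assms(1)]] cgenideal_self[OF assms(1)] assms(2) by blast
  then have "\<one> \<in> PIdl u" by simp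
  then obtain v where "v \<in> carrier R" "\<one> = v \<otimes> u" unfolding cgenideal_def by blast
  then show ?thesis using assms(1) unfolding Units_def by (auto simp: m_comm intro!: bexI[of _ v])
qed

lemma one_minus_unit:
  assumes "x \<in> \<mm>" "r \<in> carrier R"
  shows "\<one> \<ominus> x \<otimes> r \<in> Units R"
proof (rule unit_of_notin_mm)
  interpret m: ideal \<mm> R by (rule ideal_mm)
  have x: "x \<in> carrier R" using assms(1) by (rule m.Icarr)
  then show "\<one> \<ominus> x \<otimes> r \<in> carrier R" using assms(2) by simp
  show "\<one> \<ominus> x \<otimes> r \<notin> \<mm>"
  proof
    assume "\<one> \<ominus> x \<otimes> r \<in> \<mm>"
    then have "(\<one> \<ominus> x \<otimes> r) \<oplus> x \<otimes> r \<in> \<mm>" using m.I_r_closed[OF assms] by (rule m.a_closed)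
    moreover have "(\<one> \<ominus> x \<otimes> r) \<oplus> x \<otimes> r = \<one>" using x assms(2) by (simp add: minus_eq a_assoc l_neg)
    ultimately show False using primeideal_one[OF primeideal_mm] by simp
  qed
qed

text \<open>
  If the cone of \<open>y\<close> is exact in degree \<open>n\<close>, then \<open>y\<close> acts surjectively on the cohomology in that degree; Nakayama's lemma applies.
\<close>

lemma koszul_exact_drop:
  assumes "set ys \<subseteq> \<mm>" "set xs \<subseteq> carrier R" "exact_at (koszul_complex R (ys @ xs)) n"
  shows "exact_at (koszul_complex R xs) n"
  using assms
proof (induction ys)
  case (Cons y ys)
  let ?K = "koszul_complex R (ys @ xs)"
  have yc: "y \<in> carrier R" "set (ys @ xs) \<subseteq> carrier R" using Cons.prems mm_subset by auto
  interpret K: tree_complex R ?K using koszul_complex yc(2) .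
  have fg: "finitely_generated_submodule R ?K (cocycles ?K n)"
    using koszul_noetherian_at[OF yc(2)] K.cocycles_submodule[of n]
    unfolding noetherian_at_def by (auto simp: cocycles_def)
  have "cocycles ?K n \<subseteq> coboundaries ?K n"
  proof (rule K.nakayama[OF K.cocycles_submodule fg K.coboundaries_submodule yc(1)])
    show "\<one> \<ominus> y \<otimes> r \<in> Units R" if "r \<in> carrier R" for r
      using one_minus_unit[OF _ that, of y] Cons.prems(1) by simp
    fix z assume z: "z \<in> cocycles ?K n"
    obtain y' b where "y' \<in> cocycles ?K n" "b \<in> coboundaries ?K n" "z = y \<odot>\<^bsub>?K\<^esub> y' \<oplus>\<^bsub>?K\<^esub> b"
      by (rule K.cone_exact_at_imp_surjective[OF yc(1) _ z]) (use Cons.prems(3) in auto)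
    then show "\<exists>y'\<in>cocycles ?K n. \<exists>b\<in>coboundaries ?K n. z = y \<odot>\<^bsub>?K\<^esub> y' \<oplus>\<^bsub>?K\<^esub> b" by blast
  qed
  then have "exact_at ?K n" by (simp add: exact_at_def)
  then show ?case using Cons by simp
qed simp

end

context cring
begin

text \<open>Each further element lowers the bound by at most one.\<close>

lemma koszul_exact_below:
  assumes "set ys \<subseteq> carrier R" "set xs \<subseteq> carrier R" "\<And>n. n < t \<Longrightarrow> exact_at (koszul_complex R xs) n"
    "n < t - int (length ys)"
  shows "exact_at (koszul_complex R (ys @ xs)) n"
  using assms(1,4)
proof (induction ys arbitrary: n)
  case (Cons y ys)
  interpret K: tree_complex R "koszul_complex R (ys @ xs)" using koszul_complex Cons.prems assms(2) by simp
  show ?case using Cons K.cone_exact_at[of y n] by (simp add: exact_imp_injective)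
qed (use assms in simp)

text \<open>A regular sequence, except that it may generate the unit ideal.\<close>

definition weakly_regular :: "'a list \<Rightarrow> bool" where
  "weakly_regular ys \<longleftrightarrow> (\<forall>i<length ys. \<forall>r\<in>carrier R.
     ys ! i \<otimes> r \<in> Idl (set (take i ys)) \<longrightarrow> r \<in> Idl (set (take i ys)))"

text \<open>
  Cones are built from the end of the list, hence the reversal.  The last element is injective on the cohomology in
  degree zero, which is the quotient by the preceding ones, and there is none below.
\<close>

lemma koszul_exact_regular:
  assumes "set ys \<subseteq> carrier R" "weakly_regular ys" "n < 0"
  shows "exact_at (koszul_complex R (rev ys)) n"
  using assms
proof (induction ys arbitrary: n rule: rev_induct)
  case Nil
  then show ?case using koszul_exact_outside[of "[]" n] by simp
next
  case (snoc y ys)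
  have ys: "set ys \<subseteq> carrier R" "set (rev ys) \<subseteq> carrier R" and y: "y \<in> carrier R" using snoc.prems by auto
  have nth: "(ys @ [y]) ! i = ys ! i" "take i (ys @ [y]) = take i ys" if "i < length ys" for i
    using that by (simp_all add: nth_append)
  have reg: "weakly_regular ys"
    unfolding weakly_regular_def
  proof (intro allI impI)
    fix i assume i: "i < length ys"
    then show "\<forall>r\<in>carrier R. ys ! i \<otimes> r \<in> Idl (set (take i ys)) \<longrightarrow> r \<in> Idl (set (take i ys))"
      using snoc.prems(2)[unfolded weakly_regular_def, THEN spec[of _ i]] nth[OF i] by simp
  qed
  have last: "\<forall>r\<in>carrier R. y \<otimes> r \<in> Idl (set ys) \<longrightarrow> r \<in> Idl (set ys)"
    using snoc.prems(2)[unfolded weakly_regular_def, THEN spec[of _ "length ys"]] by simp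
  interpret K: tree_complex R "koszul_complex R (rev ys)" using koszul_complex ys(2) .
  have "cohomology_injective (koszul_complex R (rev ys)) y (n + 1)"
  proof (cases "n + 1 = 0")
    case True then show ?thesis using last koszul_injective_zero[OF ys(2) y] by simp
  next
    case False
    then have "n + 1 < 0" using snoc.prems(3) by simp
    then show ?thesis by (rule exact_imp_injective[OF snoc.IH[OF ys(1) reg]])
  qed
  then show ?case using K.cone_exact_at[OF y snoc.IH[OF ys(1) reg snoc.prems(3)]] by simp
qed

end

context noetherian_cring
begin

text \<open>
  A power of \<open>b \<in> P\<close> times some \<open>s \<notin> P\<close> lies in the ideal of the list, hence kills the cohomology; so each \<open>b\<close>
  carries a class that survives at \<open>P\<close> one degree down.
\<close>

lemma koszul_not_loc_exact:
  assumes P: "P \<in> minimal_primes R (set cs)" and bs: "set bs \<subseteq> P"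
    and ne: "\<not> loc_exact_at (koszul_complex R cs) (carrier R - P) t"
  shows "\<not> loc_exact_at (koszul_complex R (bs @ cs)) (carrier R - P) (t - int (length bs))"
  using bs
proof (induction bs)
  case Nil then show ?case using ne by simp
next
  case (Cons b bs)
  let ?K = "koszul_complex R (bs @ cs)"
  note pP = minimal_primesD(1,2)[OF P]
  have bsP: "set bs \<subseteq> P" "b \<in> P" using Cons.prems by auto
  have P': "P \<in> minimal_primes R (set (bs @ cs))"
    using pP bsP minimal_primesD(3)[OF P] by (intro minimal_primesI) auto
  have c: "set (bs @ cs) \<subseteq> carrier R" "b \<in> carrier R"
    using bsP pP(2) primeideal_subset[OF pP(1)] by auto
  interpret K: tree_complex R ?K using koszul_complex c(1) .
  obtain s N where sN: "s \<in> carrier R - P" "s \<otimes> b [^] (N::nat) \<in> Idl (set (bs @ cs))"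
    using minimal_prime_nilpotent[OF P' bsP(2)] by meson
  let ?t = "t - int (length (b # bs))"
  have tt: "?t + 1 = t - int (length bs)" by simp
  have "\<not> loc_exact_at (cone ?K b) (carrier R - P) ?t"
  proof (rule K.cone_not_loc_exact_at[OF c(2)])
    show "x \<otimes> y \<in> carrier R - P" if "x \<in> carrier R - P" "y \<in> carrier R - P" for x y
      using that prime_notin_mult[OF pP(1), of x y] by simp
    show "\<not> loc_exact_at ?K (carrier R - P) (?t + 1)" unfolding tt using Cons.IH[OF bsP(1)] .
    show "\<exists>s\<in>carrier R - P. \<exists>N. (s \<otimes> b [^] (N::nat)) \<odot>\<^bsub>?K\<^esub> z \<in> coboundaries ?K (?t + 1)"
      if "z \<in> cocycles ?K (?t + 1)" for z
      using K.null_homotopic_cocycle[OF koszul_null_homotopic[OF c(1) sN(2)] that] sN(1) by blast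
  qed simp
  then show ?case by simp
qed

end

lemma (in cochain_complex) exact_imp_loc_exact_at:
  assumes "exact_at M n" "\<one> \<in> S"
  shows "loc_exact_at M S n"
  unfolding loc_exact_at_def
proof (intro ballI bexI[OF _ assms(2)])
  fix z assume z: "z \<in> cocycles M n"
  then have "z \<in> carrier M" using comp_carrier by (auto simp: cocycles_def)
  then show "\<one> \<odot>\<^bsub>M\<^esub> z \<in> coboundaries M n" using assms(1) z unfolding exact_at_def by auto
qed

lemma (in cochain_complex) loc_exact_imp_exact_at:
  assumes "loc_exact_at M S n" "S \<subseteq> Units R"
  shows "exact_at M n"
  unfolding exact_at_def
proof
  fix z assume z: "z \<in> cocycles M n"
  then have zc: "z \<in> carrier M" using comp_carrier by (auto simp: cocycles_def)
  obtain s where s: "s \<in> S" "s \<odot>\<^bsub>M\<^esub> z \<in> coboundaries M n" using assms(1) z unfolding loc_exact_at_def by blast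
  then have u: "s \<in> Units R" using assms(2) by blast
  have "inv s \<odot>\<^bsub>M\<^esub> (s \<odot>\<^bsub>M\<^esub> z) \<in> coboundaries M n"
    using coboundaries_closed(2) s(2) R.Units_inv_closed[OF u] by blast
  moreover have "inv s \<odot>\<^bsub>M\<^esub> (s \<odot>\<^bsub>M\<^esub> z) = z"
    using u zc by (simp add: smult_assoc1[symmetric] R.Units_closed)
  ultimately show "z \<in> coboundaries M n" by simp
qed

context noetherian_local
begin

lemma notin_mm_units: "carrier R - \<mm> \<subseteq> Units R"
  using unit_of_notin_mm by blast

lemma one_notin_mm: "\<one> \<in> carrier R - \<mm>"
  using primeideal_one[OF primeideal_mm] by simp

text \<open>
  The Koszul complex on \<open>ys @ bs\<close> sees both that \<open>ys\<close> is regular (its cohomology starts no lower than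
  in degree \<open>- length bs\<close>) and that \<open>ys\<close> is nilpotent modulo \<open>bs\<close> (each element of \<open>ys\<close> lowers the bottom degree).
\<close>

lemma koszul_exact_of_regular_sequence:
  assumes ys: "set ys \<subseteq> \<mm>" "weakly_regular ys" and bs: "\<mm> \<in> minimal_primes R (set bs)"
    and n: "n < int (length ys) - int (length bs)"
  shows "exact_at (koszul_complex R bs) n"
proof (rule ccontr)
  assume ne: "\<not> exact_at (koszul_complex R bs) n"
  have c: "set ys \<subseteq> carrier R" "set bs \<subseteq> carrier R"
    using ys minimal_primesD(2)[OF bs] mm_subset by auto
  interpret B: tree_complex R "koszul_complex R bs" using koszul_complex c(2) .
  have "\<not> loc_exact_at (koszul_complex R bs) (carrier R - \<mm>) n"
    using ne B.loc_exact_imp_exact_at notin_mm_units by blast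
  then have 1: "\<not> loc_exact_at (koszul_complex R (ys @ bs)) (carrier R - \<mm>) (n - int (length ys))"
    by (rule koszul_not_loc_exact[OF bs ys(1)])
  have "exact_at (koszul_complex R (bs @ rev ys)) (n - int (length ys))"
    using koszul_exact_regular[OF c(1) ys(2)] n c by (intro koszul_exact_below[where t = 0]) auto
  moreover have "mset (bs @ rev ys) = mset (ys @ bs)" "set (bs @ rev ys) \<subseteq> carrier R" using c by auto
  then obtain f where "iso_of_complexes R (koszul_complex R (bs @ rev ys)) (koszul_complex R (ys @ bs)) f"
    by (rule koszul_permute_iso)
  then interpret iso_of_complexes R "koszul_complex R (bs @ rev ys)" "koszul_complex R (ys @ bs)" f .
  have "exact_at (koszul_complex R (ys @ bs)) (n - int (length ys))"
    using iso_exact_at calculation by simp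
  then show False using 1 Y.exact_imp_loc_exact_at one_notin_mm by blast
qed

text \<open>
  Compare with a list \<open>gs\<close> of generators of the maximal ideal: its Koszul complex is not exact in degree zero.
\<close>

lemma regular_sequence_bounded:
  "\<exists>k. \<forall>ys. set ys \<subseteq> \<mm> \<and> weakly_regular ys \<longrightarrow> length ys \<le> k"
proof -
  obtain A where A: "A \<subseteq> carrier R" "finite A" "\<mm> = Idl A" using finetely_gen[OF ideal_mm] by blast
  then obtain gs where gs: "set gs = A" using finite_list by blast
  have Q: "Q = \<mm>" if "primeideal Q R" "set gs \<subseteq> Q" for Q
    using genideal_minimal[OF primeideal.axioms(1)[OF that(1)] that(2)] prime_le_mm[OF that(1)] A(3) gs by simp
  have min: "\<mm> \<in> minimal_primes R (set gs)"
    using Q genideal_self[OF A(1)] A(3) gs by (intro minimal_primesI primeideal_mm) auto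
  have "length ys \<le> length gs" if ys: "set ys \<subseteq> \<mm>" "weakly_regular ys" for ys
  proof (rule ccontr)
    assume "\<not> length ys \<le> length gs"
    then have ex: "exact_at (koszul_complex R gs) 0"
      by (intro koszul_exact_of_regular_sequence[OF ys min]) simp
    have gsc: "set gs \<subseteq> carrier R" using A(1) gs by simp
    interpret K: tree_complex R "koszul_complex R gs" using koszul_complex gsc .
    have "\<not> loc_exact_at (koszul_complex R gs) (carrier R - \<mm>) 0"
      using gsc A(3) gs by (intro koszul_not_loc_exact_zero) auto
    then show False using K.exact_imp_loc_exact_at[OF ex one_notin_mm] by simp
  qed
  then show ?thesis by blast
qed

text \<open>
  An element outside all minimal primes over \<open>bs\<close>: chains of primes containing it can be extended below.
\<close>

lemma dimension_drop:
  assumes bs: "set bs \<subseteq> \<mm>" and C: "prime_chain R (set bs) (Suc r) C"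
  shows "\<exists>x\<in>\<mm>. \<forall>n C. prime_chain R (insert x (set bs)) n C \<longrightarrow> (\<exists>C'. prime_chain R (set bs) (Suc n) C')"
proof -
  have c: "set bs \<subseteq> carrier R" using bs mm_subset by blast
  have "\<mm> \<notin> minimal_primes R (set bs)"
  proof
    assume m: "\<mm> \<in> minimal_primes R (set bs)"
    have "primeideal (C 0) R" "set bs \<subseteq> C 0" "C 0 \<subset> C 1" "primeideal (C 1) R"
      using C unfolding prime_chain_def by auto
    then show False using minimal_primesD(3)[OF m, of "C 0"] prime_le_mm[of "C 0"] prime_le_mm[of "C 1"] by auto
  qed
  then have "\<forall>P\<in>minimal_primes R (set bs). primeideal P R \<and> \<not> \<mm> \<subseteq> P"
  proof (intro ballI conjI)
    fix P assume P: "P \<in> minimal_primes R (set bs)"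
    show "primeideal P R" using minimal_primesD(1)[OF P] .
    then show "\<not> \<mm> \<subseteq> P" using prime_le_mm[of P] P \<open>\<mm> \<notin> minimal_primes R (set bs)\<close> by auto
  qed
  then obtain x where x: "x \<in> \<mm>" "\<forall>P\<in>minimal_primes R (set bs). x \<notin> P"
    using prime_avoidance[OF finite_minimal_primes[OF c] _ ideal_mm] by meson
  have "\<exists>C'. prime_chain R (set bs) (Suc n) C'" if C: "prime_chain R (insert x (set bs)) n C" for n C
  proof -
    have C0: "primeideal (C 0) R" "set bs \<subseteq> C 0" "x \<in> C 0" using C unfolding prime_chain_def by auto
    obtain P where P: "P \<in> minimal_primes R (set bs)" "P \<subseteq> C 0"
      using minimal_prime_below[OF C0(1,2)] by (elim bexE) (rule that)
    then have "P \<subset> C 0" using x(2) C0(3) by auto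
    then show ?thesis
      using prime_chain_cons[OF C minimal_primesD(1,2)[OF P(1)]] by blast
  qed
  then show ?thesis using x(1) by blast
qed

text \<open>
  Induction on the bound \<open>r\<close> for the dimension.  If it is attained, an element that lowers the dimension is added to \<open>bs\<close>,
  and removed again by Nakayama's lemma.
\<close>

lemma koszul_exact_low:
  assumes ys: "set ys \<subseteq> \<mm>" "weakly_regular ys"
  shows "\<lbrakk>set bs \<subseteq> \<mm>; \<And>n C. prime_chain R (set bs) n C \<Longrightarrow> n \<le> r;
      n < int (length ys) - int (length bs) - int r\<rbrakk> \<Longrightarrow> exact_at (koszul_complex R bs) n"
proof (induction r arbitrary: bs)
  case 0
  have "Q = \<mm>" if Q: "primeideal Q R" "set bs \<subseteq> Q" for Q
  proof (rule ccontr)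
    assume "Q \<noteq> \<mm>"
    then have "prime_chain R (set bs) 1 (\<lambda>i. if i = 0 then Q else \<mm>)"
      using Q prime_le_mm[OF Q(1)] primeideal_mm 0(1) by (auto simp: prime_chain_def)
    then show False using 0(2)[of 1] by auto
  qed
  then have "\<mm> \<in> minimal_primes R (set bs)" using 0(1) by (intro minimal_primesI primeideal_mm) auto
  then show ?case using 0(3) by (intro koszul_exact_of_regular_sequence[OF ys]) simp_all
next
  case (Suc r)
  show ?case
  proof (cases "\<exists>C. prime_chain R (set bs) (Suc r) C")
    case False
    have "k \<le> r" if "prime_chain R (set bs) k C" for k C
    proof (rule ccontr)
      assume "\<not> k \<le> r"
      then have "k = Suc r" using Suc.prems(2)[OF that] by simp
      then show False using that False by blast
    qed
    then show ?thesis using Suc.IH[of bs] Suc.prems by simp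
  next
    case True
    then obtain x where x: "x \<in> \<mm>"
      "\<And>n C. prime_chain R (insert x (set bs)) n C \<Longrightarrow> \<exists>C'. prime_chain R (set bs) (Suc n) C'"
      using dimension_drop[OF Suc.prems(1)] by meson
    have "exact_at (koszul_complex R (x # bs)) n"
    proof (rule Suc.IH)
      show "set (x # bs) \<subseteq> \<mm>" using x(1) Suc.prems(1) by simp
      show "k \<le> r" if k: "prime_chain R (set (x # bs)) k C" for k C
      proof -
        obtain C' where "prime_chain R (set bs) (Suc k) C'" using x(2)[of k C] k by auto
        then show ?thesis using Suc.prems(2) by fastforce
      qed
      show "n < int (length ys) - int (length (x # bs)) - int r" using Suc.prems(3) by simp
    qed
    then show ?thesis using koszul_exact_drop[of "[x]" bs n] x(1) Suc.prems(1) mm_subset by auto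
  qed
qed

text \<open>
  Otherwise the complex on \<open>zs @ bs\<close>, for parameters \<open>zs\<close> at the first prime \<open>P\<close> of the chain, would be exact in degree
  \<open>- length bs\<close>; but at \<open>P\<close> it has a class there, since the elements of \<open>bs\<close> are nilpotent modulo \<open>zs\<close>.
\<close>

lemma koszul_not_exact:
  assumes bound: "\<And>n C. prime_chain R {} n C \<Longrightarrow> n \<le> d" and C: "prime_chain R (set bs) r C"
  shows "\<exists>n\<le>int d - int (length bs) - int r. \<not> exact_at (koszul_complex R bs) n"
proof (rule ccontr)
  assume "\<not> (\<exists>n\<le>int d - int (length bs) - int r. \<not> exact_at (koszul_complex R bs) n)"
  then have ex: "\<And>n. n < int d - int (length bs) - int r + 1 \<Longrightarrow> exact_at (koszul_complex R bs) n"
    by simp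
  define P where "P = C 0"
  have P: "primeideal P R" "set bs \<subseteq> P" using C unfolding prime_chain_def P_def by auto
  obtain zs C' where zs: "set zs \<subseteq> P" "P \<in> minimal_primes R (set zs)"
    "prime_chain R {} (length zs) C'" "C' (length zs) = P"
  proof -
    have "\<exists>zs C. set zs \<subseteq> P \<and> P \<in> minimal_primes R (set zs) \<and>
        prime_chain R {} (length zs) C \<and> C (length zs) = P"
      by (rule parameters_at_prime[OF P(1)]) (rule bound)
    then show thesis by (elim exE conjE) (rule that)
  qed
  have "prime_chain R {} (length zs + r) (\<lambda>i. if i \<le> length zs then C' i else C (i - length zs))"
    using prime_chain_append[OF zs(3) C] zs(4) P_def by simp
  then have hr: "length zs + r \<le> d" by (rule bound)
  have c: "set zs \<subseteq> carrier R" "set bs \<subseteq> carrier R" using zs(1) P(2) primeideal_subset[OF P(1)] by auto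
  have "Idl (set zs) \<subseteq> P" using genideal_minimal[OF primeideal.axioms(1)[OF P(1)] zs(1)] .
  then have "\<not> loc_exact_at (koszul_complex R zs) (carrier R - P) 0"
    using c by (intro koszul_not_loc_exact_zero) auto
  then have 1: "\<not> loc_exact_at (koszul_complex R (bs @ zs)) (carrier R - P) (0 - int (length bs))"
    by (rule koszul_not_loc_exact[OF zs(2) P(2)])
  have "exact_at (koszul_complex R (zs @ bs)) (0 - int (length bs))"
    using ex hr by (intro koszul_exact_below[where t = "int d - int (length bs) - int r + 1", OF c]) auto
  moreover have "mset (zs @ bs) = mset (bs @ zs)" "set (zs @ bs) \<subseteq> carrier R" using c by auto
  then obtain f where "iso_of_complexes R (koszul_complex R (zs @ bs)) (koszul_complex R (bs @ zs)) f"
    by (rule koszul_permute_iso)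
  then interpret iso_of_complexes R "koszul_complex R (zs @ bs)" "koszul_complex R (bs @ zs)" f .
  have "exact_at (koszul_complex R (bs @ zs)) (0 - int (length bs))"
    using iso_exact_at calculation by simp
  moreover have "\<one> \<in> carrier R - P" using primeideal_one[OF P(1)] by simp
  ultimately show False using 1 Y.exact_imp_loc_exact_at by blast
qed

end

text \<open>
  The Krull dimension of the quotient by \<open>X\<close>, provided that the chains of primes over \<open>X\<close> have bounded length and that there
  is one.
\<close>

definition prime_dim :: "('a, 'b) ring_scheme \<Rightarrow> 'a set \<Rightarrow> nat" where
  "prime_dim R X = Max {n. \<exists>C. prime_chain R X n C}"

text \<open>
  In the maximal ideal a weakly regular sequence is regular, so this says that the dimension is at most \<open>d\<close> and the depth at
  least \<open>d\<close>; both are \<open>d\<close>, as the depth never exceeds the dimension.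
\<close>

locale cohen_macaulay_local = noetherian_local R for R (structure) +
  fixes d :: nat
  assumes chain_bound: "prime_chain R {} n C \<Longrightarrow> n \<le> d"
    and regular: "\<exists>ys. set ys \<subseteq> \<mm> \<and> weakly_regular ys \<and> length ys = d"
begin

lemma prime_dim:
  assumes "X \<subseteq> \<mm>"
  shows "\<exists>C. prime_chain R X (prime_dim R X) C"
    and "\<And>n C. prime_chain R X n C \<Longrightarrow> n \<le> prime_dim R X"
proof -
  let ?A = "{n. \<exists>C. prime_chain R X n C}"
  have "?A \<subseteq> {..d}" using chain_bound prime_chain_mono[of R X _ _ "{}"] by blast
  then have fin: "finite ?A" using finite_subset by blast
  have "prime_chain R X 0 (\<lambda>_. \<mm>)" using assms primeideal_mm by (simp add: prime_chain_def)
  then have "0 \<in> ?A" by blast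
  then show "\<exists>C. prime_chain R X (prime_dim R X) C" using Max_in[OF fin] unfolding prime_dim_def by blast
  show "n \<le> prime_dim R X" if "prime_chain R X n C" for n C
    using Max_ge[OF fin] that unfolding prime_dim_def by blast
qed

text \<open>The lowest degree with non-vanishing cohomology of the Koszul complex on \<open>bs\<close>.\<close>

definition bottom :: "'a list \<Rightarrow> int" where
  "bottom bs = int d - int (length bs) - int (prime_dim R (set bs))"

theorem koszul_bottom:
  assumes bs: "set bs \<subseteq> \<mm>"
  shows "\<And>n. n < bottom bs \<Longrightarrow> exact_at (koszul_complex R bs) n"
    and "\<not> exact_at (koszul_complex R bs) (bottom bs)"
proof -
  obtain ys where ys: "set ys \<subseteq> \<mm>" "weakly_regular ys" "length ys = d" using regular by blast
  show low: "exact_at (koszul_complex R bs) n" if "n < bottom bs" for n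
    using that ys(3) by (intro koszul_exact_low[OF ys(1,2) bs prime_dim(2)[OF bs]])
      (auto simp: bottom_def)
  obtain C where "prime_chain R (set bs) (prime_dim R (set bs)) C" using prime_dim(1)[OF bs] by blast
  then have "\<exists>n\<le>bottom bs. \<not> exact_at (koszul_complex R bs) n"
    unfolding bottom_def by (rule koszul_not_exact[rotated]) (rule chain_bound)
  then obtain n where "n \<le> bottom bs" "\<not> exact_at (koszul_complex R bs) n" by blast
  then show "\<not> exact_at (koszul_complex R bs) (bottom bs)" using low[of n] by (cases "n = bottom bs") auto
qed

text \<open>
  By the long exact sequence, \<open>x\<close> is injective on the lowest cohomology exactly if the lowest degree for \<open>x # bs\<close> is not
  smaller than the one for \<open>bs\<close>.
\<close>

theorem koszul_regular_iff:
  assumes bs: "set bs \<subseteq> \<mm>" and x: "x \<in> \<mm>"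
  shows "cohomology_injective (koszul_complex R bs) x (bottom bs) \<longleftrightarrow>
    prime_dim R (insert x (set bs)) < prime_dim R (set bs)"
proof -
  have xbs: "set (x # bs) \<subseteq> \<mm>" using bs x by simp
  have c: "x \<in> carrier R" "set bs \<subseteq> carrier R" using bs x mm_subset by auto
  interpret K: tree_complex R "koszul_complex R bs" using koszul_complex c(2) .
  note low = koszul_bottom(1)[OF bs]
  have le: "bottom bs \<le> bottom (x # bs) \<longleftrightarrow> prime_dim R (insert x (set bs)) < prime_dim R (set bs)"
    by (auto simp: bottom_def)
  show ?thesis
  proof
    assume inj: "cohomology_injective (koszul_complex R bs) x (bottom bs)"
    have "exact_at (koszul_complex R (x # bs)) n" if "n < bottom bs" for n
    proof -
      have "cohomology_injective (koszul_complex R bs) x (n + 1)"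
        using inj low[of "n + 1"] that by (cases "n + 1 = bottom bs") (auto intro: exact_imp_injective)
      then show ?thesis using K.cone_exact_at[OF c(1) low[OF that]] by simp
    qed
    then have "bottom bs \<le> bottom (x # bs)" using koszul_bottom(2)[OF xbs] by (meson not_le)
    then show "prime_dim R (insert x (set bs)) < prime_dim R (set bs)" using le by simp
  next
    assume "prime_dim R (insert x (set bs)) < prime_dim R (set bs)"
    then have "bottom bs - 1 < bottom (x # bs)" using le by simp
    then have "exact_at (cone (koszul_complex R bs) x) (bottom bs - 1)"
      using koszul_bottom(1)[OF xbs] by simp
    then show "cohomology_injective (koszul_complex R bs) x (bottom bs)"
      using K.cone_exact_at_imp_injective[OF c(1), of "bottom bs - 1"] by simp
  qed
qed

lemma exists_regular_element:
  assumes "set bs \<subseteq> \<mm>" "prime_dim R (set bs) > 0"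
  shows "\<exists>x\<in>\<mm>. prime_dim R (insert x (set bs)) < prime_dim R (set bs)"
proof -
  obtain C where C: "prime_chain R (set bs) (prime_dim R (set bs)) C" using prime_dim(1)[OF assms(1)] by blast
  then have "prime_chain R (set bs) (Suc 0) C" using prime_chain_take[OF C, of "Suc 0"] assms(2) by simp
  then obtain x where x: "x \<in> \<mm>"
    "\<And>n C. prime_chain R (insert x (set bs)) n C \<Longrightarrow> \<exists>C'. prime_chain R (set bs) (Suc n) C'"
    using dimension_drop[OF assms(1)] by meson
  have "insert x (set bs) \<subseteq> \<mm>" using assms(1) x(1) by simp
  then obtain C' where "prime_chain R (set bs) (Suc (prime_dim R (insert x (set bs)))) C'"
    using prime_dim(1)[of "insert x (set bs)"] x(2) by meson
  then have "Suc (prime_dim R (insert x (set bs))) \<le> prime_dim R (set bs)"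
    by (rule prime_dim(2)[OF assms(1)])
  then show ?thesis using x(1) by (intro bexI[of _ x]) simp_all
qed

end


section \<open>Gradings\<close>

lemma (in abelian_group) finsum_superset:
  assumes "finite F" "{n. f n \<noteq> \<zero>} \<subseteq> F" "\<And>n. f n \<in> carrier G"
  shows "(\<Oplus>n\<in>{n. f n \<noteq> \<zero>}. f n) = (\<Oplus>n\<in>F. f n)"
  by (rule add.finprod_mono_neutral_cong_left) (use assms in auto)

context direct_sum_grading
begin

definition component :: "int \<Rightarrow> 'a \<Rightarrow> 'a" where
  "component n a = (THE f. decomposition G C a f) n"

lemma comp_mem_carrier: "a \<in> C n \<Longrightarrow> a \<in> carrier G"
  using additive_subgroup.a_subset[OF comp_subgroup[of n]] by blast

lemma comp_zero_mem: "\<zero> \<in> C n"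
  by (rule additive_subgroup.zero_closed[OF comp_subgroup])

lemma comp_add_mem: "\<lbrakk>a \<in> C n; b \<in> C n\<rbrakk> \<Longrightarrow> a \<oplus> b \<in> C n"
  by (rule additive_subgroup.a_closed[OF comp_subgroup])

lemma comp_minus_mem: "a \<in> C n \<Longrightarrow> \<ominus> a \<in> C n"
proof -
  assume a: "a \<in> C n"
  interpret S: additive_subgroup "C n" G by (rule comp_subgroup)
  show ?thesis using S.a_inv_closed[OF a] .
qed

lemma decompositionI:
  assumes "\<And>n. f n \<in> C n" "finite F" "{n. f n \<noteq> \<zero>} \<subseteq> F" "a = (\<Oplus>n\<in>F. f n)"
  shows "decomposition G C a f"
proof -
  have "f n \<in> carrier G" for n using comp_mem_carrier[OF assms(1)] .
  then show ?thesis
    unfolding decomposition_def assms(4)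
    using assms(1) finsum_superset[OF assms(2,3)] finite_subset[OF assms(3,2)] by simp
qed

lemma decomposition_superset:
  assumes "decomposition G C a f" "finite F" "{n. f n \<noteq> \<zero>} \<subseteq> F"
  shows "a = (\<Oplus>n\<in>F. f n)"
proof -
  have "f n \<in> C n" for n using assms(1) unfolding decomposition_def by simp
  then have "f n \<in> carrier G" for n by (rule comp_mem_carrier)
  then show ?thesis using finsum_superset[OF assms(2,3)] assms(1) unfolding decomposition_def by simp
qed

lemma component_decomposition:
  assumes "a \<in> carrier G"
  shows "decomposition G C a (\<lambda>n. component n a)"
  using theI'[OF decomposition_unique[OF assms]] by (simp add: component_def)

lemma component_eqI:
  assumes "a \<in> carrier G" "decomposition G C a f"
  shows "component n a = f n"
  using the1_equality[where P = "decomposition G C a", OF decomposition_unique[OF assms(1)] assms(2)] by (simp add: component_def)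

lemma component_mem: "a \<in> carrier G \<Longrightarrow> component n a \<in> C n"
  using component_decomposition unfolding decomposition_def by simp

lemma finite_components: "a \<in> carrier G \<Longrightarrow> finite {n. component n a \<noteq> \<zero>}"
  using component_decomposition unfolding decomposition_def by simp

lemma component_homogeneous:
  assumes "a \<in> C m"
  shows "component n a = (if n = m then a else \<zero>)"
proof -
  have "decomposition G C a (\<lambda>n. if n = m then a else \<zero>)"
  proof (rule decompositionI[of _ "{m}"])
    show "a = (\<Oplus>n\<in>{m}. if n = m then a else \<zero>)"
      using comp_mem_carrier[OF assms] by simp
  qed (use assms comp_zero_mem in auto)
  then show ?thesis using component_eqI comp_mem_carrier[OF assms] by blast
qed

lemma component_add:
  assumes a: "a \<in> carrier G" and b: "b \<in> carrier G"
  shows "component n (a \<oplus> b) = component n a \<oplus> component n b"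
proof -
  let ?F = "{n. component n a \<noteq> \<zero>} \<union> {n. component n b \<noteq> \<zero>}"
  have F: "finite ?F" using finite_components a b by simp
  have c: "component n a \<in> carrier G" "component n b \<in> carrier G" for n
    using component_mem comp_mem_carrier a b by blast+
  have "a \<oplus> b = (\<Oplus>n\<in>?F. component n a) \<oplus> (\<Oplus>n\<in>?F. component n b)"
    using decomposition_superset[OF component_decomposition[OF a] F]
      decomposition_superset[OF component_decomposition[OF b] F] by simp
  also have "\<dots> = (\<Oplus>n\<in>?F. component n a \<oplus> component n b)"
    using c by (intro finsum_addf[symmetric]) auto
  finally have "decomposition G C (a \<oplus> b) (\<lambda>n. component n a \<oplus> component n b)"
    using F component_mem a b comp_add_mem c by (intro decompositionI[of _ ?F]) auto
  then show ?thesis using component_eqI a b by simp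
qed

lemma homogeneous_induct [consumes 1, case_names homogeneous add]:
  assumes "a \<in> carrier G" and hom: "\<And>n x. x \<in> C n \<Longrightarrow> P x"
    and add: "\<And>x y. \<lbrakk>x \<in> carrier G; y \<in> carrier G; P x; P y\<rbrakk> \<Longrightarrow> P (x \<oplus> y)"
  shows "P a"
proof -
  have c: "component n a \<in> carrier G" for n using component_mem comp_mem_carrier assms(1) by blast
  have "P (\<Oplus>n\<in>F. component n a)" if "finite F" for F
    using that
  proof (induction F)
    case empty then show ?case using hom[OF comp_zero_mem] by simp
  next
    case (insert n F)
    then show ?case using c hom[OF component_mem[OF assms(1)]] by (simp add: finsum_insert add)
  qed
  from this[OF finite_components[OF assms(1)]] show ?thesis
    using component_decomposition[OF assms(1)] unfolding decomposition_def by metis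
qed

end

text \<open>The premise \<open>induct\<close> says that the homogeneous elements generate the group; \<open>p n\<close> is the projection to degree \<open>n\<close>.\<close>

lemma direct_sum_gradingI:
  fixes G (structure)
  assumes "abelian_group G" and sub: "\<And>n. additive_subgroup (C n) G"
    and p: "\<And>n a. a \<in> carrier G \<Longrightarrow> p n a \<in> C n"
    and add: "\<And>n a b. \<lbrakk>a \<in> carrier G; b \<in> carrier G\<rbrakk> \<Longrightarrow> p n (a \<oplus> b) = p n a \<oplus> p n b"
    and hom: "\<And>n m a. a \<in> C m \<Longrightarrow> p n a = (if n = m then a else \<zero>)"
    and induct: "\<And>P a. \<lbrakk>a \<in> carrier G; \<And>n x. x \<in> C n \<Longrightarrow> P x;
      \<And>x y. \<lbrakk>x \<in> carrier G; y \<in> carrier G; P x; P y\<rbrakk> \<Longrightarrow> P (x \<oplus> y)\<rbrakk> \<Longrightarrow> P a"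
  shows "direct_sum_grading G C"
proof -
  interpret abelian_group G by fact
  have C: "x \<in> carrier G" if "x \<in> C n" for x n
    using additive_subgroup.a_subset[OF sub[of n]] that by blast
  have pc: "p n a \<in> carrier G" if "a \<in> carrier G" for n a using C p that by blast
  have ex: "\<exists>F. finite F \<and> {n. p n a \<noteq> \<zero>} \<subseteq> F \<and> a = (\<Oplus>n\<in>F. p n a)" if "a \<in> carrier G" for a
    using that
  proof (rule induct)
    fix m x assume x: "x \<in> C m"
    then show "\<exists>F. finite F \<and> {n. p n x \<noteq> \<zero>} \<subseteq> F \<and> x = (\<Oplus>n\<in>F. p n x)"
      using C[OF x] hom[OF x] by (intro exI[of _ "{m}"]) auto
  next
    fix x y assume xy: "x \<in> carrier G" "y \<in> carrier G"
      and "\<exists>F. finite F \<and> {n. p n x \<noteq> \<zero>} \<subseteq> F \<and> x = (\<Oplus>n\<in>F. p n x)"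
      and "\<exists>F. finite F \<and> {n. p n y \<noteq> \<zero>} \<subseteq> F \<and> y = (\<Oplus>n\<in>F. p n y)"
    then obtain F F' where F: "finite F" "{n. p n x \<noteq> \<zero>} \<subseteq> F" "x = (\<Oplus>n\<in>F. p n x)"
      and F': "finite F'" "{n. p n y \<noteq> \<zero>} \<subseteq> F'" "y = (\<Oplus>n\<in>F'. p n y)" by blast
    have "(\<Oplus>n\<in>F. p n x) = (\<Oplus>n\<in>F \<union> F'. p n x)" "(\<Oplus>n\<in>F'. p n y) = (\<Oplus>n\<in>F \<union> F'. p n y)"
      by (rule add.finprod_mono_neutral_cong_left; use F(1,2) F'(1,2) pc xy in auto)+
    then have "x \<oplus> y = (\<Oplus>n\<in>F \<union> F'. p n x) \<oplus> (\<Oplus>n\<in>F \<union> F'. p n y)" using F(3) F'(3) by simp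
    also have "\<dots> = (\<Oplus>n\<in>F \<union> F'. p n (x \<oplus> y))"
      using pc xy by (simp add: add finsum_addf Pi_def)
    finally have "x \<oplus> y = (\<Oplus>n\<in>F \<union> F'. p n (x \<oplus> y))" .
    moreover have "{n. p n (x \<oplus> y) \<noteq> \<zero>} \<subseteq> F \<union> F'"
    proof (rule subsetI, rule ccontr)
      fix n assume n: "n \<in> {n. p n (x \<oplus> y) \<noteq> \<zero>}" "n \<notin> F \<union> F'"
      then have "p n x = \<zero>" "p n y = \<zero>" using F(2) F'(2) by auto
      then show False using n(1) by (simp add: add[OF xy])
    qed
    ultimately show "\<exists>F. finite F \<and> {n. p n (x \<oplus> y) \<noteq> \<zero>} \<subseteq> F \<and> x \<oplus> y = (\<Oplus>n\<in>F. p n (x \<oplus> y))"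
      using F(1) F'(1) by blast
  qed
  show ?thesis
  proof (intro direct_sum_grading.intro direct_sum_grading_axioms.intro sub)
    show "abelian_group G" by fact
    fix a assume a: "a \<in> carrier G"
    show "\<exists>!f. decomposition G C a f"
    proof (rule ex1I[of _ "\<lambda>n. p n a"])
      obtain F where F: "finite F" "{n. p n a \<noteq> \<zero>} \<subseteq> F" "a = (\<Oplus>n\<in>F. p n a)" using ex[OF a] by blast
      then show "decomposition G C a (\<lambda>n. p n a)"
        using finsum_superset[OF F(1,2)] pc[OF a] p[OF a] finite_subset[OF F(2,1)]
        by (auto simp: decomposition_def)
    next
      fix f assume f: "decomposition G C a f"
      then have fC: "\<And>n. f n \<in> C n" and fin: "finite {n. f n \<noteq> \<zero>}" and asum: "a = (\<Oplus>n\<in>{n. f n \<noteq> \<zero>}. f n)"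
        by (auto simp: decomposition_def)
      have "p n (\<Oplus>m\<in>F. f m) = (if n \<in> F then f n else \<zero>)" if "finite F" for F n
        using that
      proof (induction F)
        case empty
        have "p n \<zero> = \<zero>" using hom[OF additive_subgroup.zero_closed[OF sub[of n]], of n] by simp
        then show ?case by simp
      next
        case (insert m F)
        have "finsum G f F \<in> carrier G" using C[OF fC] by (intro finsum_closed) auto
        then show ?case using insert C[OF fC] hom[OF fC, of n m] by (auto simp: finsum_insert add Pi_def)
      qed
      from this[OF fin] have "p n a = (if f n \<noteq> \<zero> then f n else \<zero>)" for n unfolding asum by simp
      then show "f = (\<lambda>n. p n a)" by auto
    qed
  qed
qed


section \<open>DG-rings\<close>

definition degree_zero_ring :: "('a, 'b) dg_ring_scheme \<Rightarrow> ('a, 'b) dg_ring_scheme" where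
  "degree_zero_ring A = A\<lparr>carrier := dg_comp A 0\<rparr>"

lemma deg_sign_simps [simp]:
  "even n \<Longrightarrow> deg_sign A n a = a" "odd n \<Longrightarrow> deg_sign A n a = \<ominus>\<^bsub>A\<^esub> a"
  by (simp_all add: deg_sign_def)

context dg_ring
begin

lemma deg_sign_closed: "a \<in> carrier A \<Longrightarrow> deg_sign A n a \<in> carrier A"
  by (simp add: deg_sign_def)

lemma deg_sign_add: "\<lbrakk>a \<in> carrier A; b \<in> carrier A\<rbrakk> \<Longrightarrow>
    deg_sign A n (a \<oplus> b) = deg_sign A n a \<oplus> deg_sign A n b"
  by (simp add: deg_sign_def minus_add)

lemma diff_zero: "dg_diff A \<zero> = \<zero>"
  using diff_add[OF zero_closed zero_closed] diff_closed[OF zero_closed]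
  by (metis add.r_cancel_one' r_zero zero_closed)

lemma diff_minus:
  assumes "a \<in> carrier A"
  shows "dg_diff A (\<ominus> a) = \<ominus> dg_diff A a"
proof -
  have "dg_diff A (\<ominus> a) \<oplus> dg_diff A a = \<zero>"
    using diff_add[of "\<ominus> a" a] assms by (simp add: l_neg diff_zero)
  then show ?thesis using diff_closed assms by (simp add: minus_equality)
qed

lemma involution_eq_finsum:
  assumes a: "a \<in> carrier A" and F: "finite F" "{n. component n a \<noteq> \<zero>} \<subseteq> F"
  shows "grade_involution A a = (\<Oplus>n\<in>F. deg_sign A n (component n a))"
proof -
  have c: "component n a \<in> carrier A" for n using component_mem[OF a] comp_carrier by blast
  have "grade_involution A a = (\<Oplus>n\<in>{n. component n a \<noteq> \<zero>}. deg_sign A n (component n a))"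
    by (simp add: grade_involution_def Let_def component_def)
  also have "\<dots> = (\<Oplus>n\<in>F. deg_sign A n (component n a))"
    using F c by (intro add.finprod_mono_neutral_cong_left) (auto simp: deg_sign_def)
  finally show ?thesis .
qed

lemma involution_homogeneous:
  assumes "a \<in> dg_comp A m"
  shows "grade_involution A a = deg_sign A m a"
proof -
  have a: "a \<in> carrier A" using comp_carrier[OF assms] .
  have "grade_involution A a = (\<Oplus>n\<in>{m}. deg_sign A n (component n a))"
    using component_homogeneous[OF assms] by (intro involution_eq_finsum a) auto
  then show ?thesis using component_homogeneous[OF assms, of m] deg_sign_closed[OF a] by simp
qed

lemma involution_degree_zero: "a \<in> dg_comp A 0 \<Longrightarrow> grade_involution A a = a"
  using involution_homogeneous by simp

lemma involution_closed:
  assumes "a \<in> carrier A"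
  shows "grade_involution A a \<in> carrier A"
proof -
  have "deg_sign A n (component n a) \<in> carrier A" for n
    by (intro deg_sign_closed comp_carrier[OF component_mem[OF assms]])
  then show ?thesis
    unfolding involution_eq_finsum[OF assms finite_components[OF assms] subset_refl]
    by (intro finsum_closed) simp
qed

lemma involution_add:
  assumes a: "a \<in> carrier A" and b: "b \<in> carrier A"
  shows "grade_involution A (a \<oplus> b) = grade_involution A a \<oplus> grade_involution A b"
proof -
  let ?F = "{n. component n a \<noteq> \<zero>} \<union> {n. component n b \<noteq> \<zero>}"
  have F: "finite ?F" using finite_components a b by simp
  have c: "component n a \<in> carrier A" "component n b \<in> carrier A" for n
    using component_mem comp_carrier a b by blast+
  have "grade_involution A a \<oplus> grade_involution A b =
      (\<Oplus>n\<in>?F. deg_sign A n (component n a)) \<oplus> (\<Oplus>n\<in>?F. deg_sign A n (component n b))"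
    using involution_eq_finsum[OF a F] involution_eq_finsum[OF b F] by simp
  also have "\<dots> = (\<Oplus>n\<in>?F. deg_sign A n (component n a) \<oplus> deg_sign A n (component n b))"
    using c deg_sign_closed by (intro finsum_addf[symmetric]) auto
  also have "\<dots> = (\<Oplus>n\<in>?F. deg_sign A n (component n (a \<oplus> b)))"
    using component_add[OF a b] c by (simp add: deg_sign_add)
  also have "\<dots> = grade_involution A (a \<oplus> b)"
    using component_add[OF a b] c a b by (intro involution_eq_finsum[symmetric] F) auto
  finally show ?thesis by simp
qed


lemma involution_one: "grade_involution A \<one> = \<one>"
  using involution_degree_zero[OF one_comp] .

lemma involution_comp: "a \<in> dg_comp A n \<Longrightarrow> grade_involution A a \<in> dg_comp A n"
  using involution_homogeneous comp_minus_mem by (simp add: deg_sign_def)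

lemma involution_mult:
  assumes a: "a \<in> carrier A" and b: "b \<in> carrier A"
  shows "grade_involution A (a \<otimes> b) = grade_involution A a \<otimes> grade_involution A b"
  using a
proof (induction rule: homogeneous_induct)
  case (homogeneous m x)
  note x = comp_carrier[OF homogeneous]
  show ?case using b
  proof (induction rule: homogeneous_induct)
    case (homogeneous n y)
    note y = comp_carrier[OF homogeneous]
    show ?case
      using x y involution_homogeneous[OF homogeneous] involution_homogeneous[OF \<open>x \<in> dg_comp A m\<close>]
        involution_homogeneous[OF mult_comp[OF \<open>x \<in> dg_comp A m\<close> homogeneous]]
      by (cases "even m"; cases "even n") (simp_all add: l_minus r_minus)
  next
    case (add y z)
    then show ?case using x involution_closed by (simp add: r_distr involution_add)
  qed
next
  case (add x y)
  then show ?case using b involution_closed by (simp add: l_distr involution_add)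
qed


lemma cring_degree_zero: "cring (degree_zero_ring A)"
proof -
  have "ring (degree_zero_ring A)"
    unfolding degree_zero_ring_def by (rule subring_is_ring[OF degree_zero_subring])
  moreover have "comm_monoid (degree_zero_ring A)"
  proof (rule monoid.monoid_comm_monoidI)
    show "monoid (degree_zero_ring A)" using calculation ring.is_monoid by blast
  qed (use degree_zero_central comp_carrier in \<open>simp add: degree_zero_ring_def\<close>)
  ultimately show ?thesis by (rule cring.intro)
qed

end


subsection \<open>Adjoining a variable that kills a cocycle\<close>

text \<open>
  \<open>Pair y z\<close> stands for \<open>z + e y\<close>, where \<open>e\<close> has degree \<open>-1\<close>, square zero and \<open>d e = x\<close>.
  As a complex, this is the cone of \<open>x\<close> on \<open>A\<close>.
\<close>

definition tate_extension :: "('a pair_tree, 'b) dg_ring_scheme \<Rightarrow> 'a pair_tree \<Rightarrow> 'a pair_tree dg_ring" where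
  "tate_extension A x = \<lparr>
     carrier = {Pair y z | y z. y \<in> carrier A \<and> z \<in> carrier A},
     monoid.mult = (\<lambda>u v. Pair (left u \<otimes>\<^bsub>A\<^esub> right v \<oplus>\<^bsub>A\<^esub> grade_involution A (right u) \<otimes>\<^bsub>A\<^esub> left v)
                        (right u \<otimes>\<^bsub>A\<^esub> right v)),
     one = Pair \<zero>\<^bsub>A\<^esub> \<one>\<^bsub>A\<^esub>,
     zero = Pair \<zero>\<^bsub>A\<^esub> \<zero>\<^bsub>A\<^esub>,
     add = (\<lambda>u v. Pair (left u \<oplus>\<^bsub>A\<^esub> left v) (right u \<oplus>\<^bsub>A\<^esub> right v)),
     dg_comp = (\<lambda>n. {Pair y z | y z. y \<in> dg_comp A (n + 1) \<and> z \<in> dg_comp A n}),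
     dg_diff = (\<lambda>u. Pair (\<ominus>\<^bsub>A\<^esub> dg_diff A (left u)) (x \<otimes>\<^bsub>A\<^esub> left u \<oplus>\<^bsub>A\<^esub> dg_diff A (right u)))\<rparr>"

lemma tate_simps [simp]:
  "Pair y z \<in> carrier (tate_extension A x) \<longleftrightarrow> y \<in> carrier A \<and> z \<in> carrier A"
  "Pair y z \<otimes>\<^bsub>tate_extension A x\<^esub> Pair y' z' =
     Pair (y \<otimes>\<^bsub>A\<^esub> z' \<oplus>\<^bsub>A\<^esub> grade_involution A z \<otimes>\<^bsub>A\<^esub> y') (z \<otimes>\<^bsub>A\<^esub> z')"
  "\<one>\<^bsub>tate_extension A x\<^esub> = Pair \<zero>\<^bsub>A\<^esub> \<one>\<^bsub>A\<^esub>"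
  "\<zero>\<^bsub>tate_extension A x\<^esub> = Pair \<zero>\<^bsub>A\<^esub> \<zero>\<^bsub>A\<^esub>"
  "Pair y z \<oplus>\<^bsub>tate_extension A x\<^esub> Pair y' z' = Pair (y \<oplus>\<^bsub>A\<^esub> y') (z \<oplus>\<^bsub>A\<^esub> z')"
  "Pair y z \<in> dg_comp (tate_extension A x) n \<longleftrightarrow> y \<in> dg_comp A (n + 1) \<and> z \<in> dg_comp A n"
  "dg_diff (tate_extension A x) (Pair y z) =
    Pair (\<ominus>\<^bsub>A\<^esub> dg_diff A y) (x \<otimes>\<^bsub>A\<^esub> y \<oplus>\<^bsub>A\<^esub> dg_diff A z)"
  by (simp_all add: tate_extension_def)

lemma tate_carrierE:
  assumes "u \<in> carrier (tate_extension A x)"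
  obtains y z where "u = Pair y z" "y \<in> carrier A" "z \<in> carrier A"
  using assms by (auto simp: tate_extension_def)

lemma tate_compE:
  assumes "u \<in> dg_comp (tate_extension A x) n"
  obtains y z where "u = Pair y z" "y \<in> dg_comp A (n + 1)" "z \<in> dg_comp A n"
  using assms by (auto simp: tate_extension_def)

text \<open>
  In the Leibniz rule for \<open>z + e y\<close>, the two terms \<open>t\<close> come from the differential of \<open>e\<close> and cancel.
\<close>

lemma (in abelian_group) cancel_middle:
  assumes "a \<in> carrier G" "b \<in> carrier G" "c \<in> carrier G" "e \<in> carrier G" "t \<in> carrier G"
  shows "(a \<oplus> (t \<oplus> b)) \<oplus> ((\<ominus> t \<oplus> c) \<oplus> e) = a \<oplus> b \<oplus> (c \<oplus> e)"
    and "(a \<oplus> (\<ominus> t \<oplus> b)) \<oplus> ((t \<oplus> c) \<oplus> e) = a \<oplus> b \<oplus> (c \<oplus> e)"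
proof -
  have "(a \<oplus> (t \<oplus> b)) \<oplus> ((\<ominus> t \<oplus> c) \<oplus> e) = (t \<oplus> \<ominus> t) \<oplus> (a \<oplus> b \<oplus> (c \<oplus> e))"
    using assms by (simp add: a_ac)
  then show "(a \<oplus> (t \<oplus> b)) \<oplus> ((\<ominus> t \<oplus> c) \<oplus> e) = a \<oplus> b \<oplus> (c \<oplus> e)" using assms by (simp add: r_neg)
  have "(a \<oplus> (\<ominus> t \<oplus> b)) \<oplus> ((t \<oplus> c) \<oplus> e) = (t \<oplus> \<ominus> t) \<oplus> (a \<oplus> b \<oplus> (c \<oplus> e))"
    using assms by (simp add: a_ac)
  then show "(a \<oplus> (\<ominus> t \<oplus> b)) \<oplus> ((t \<oplus> c) \<oplus> e) = a \<oplus> b \<oplus> (c \<oplus> e)" using assms by (simp add: r_neg)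
qed

locale tree_dg_ring = dg_ring A for A :: "('a pair_tree, 'b) dg_ring_scheme" (structure)
begin

abbreviation involution :: "'a pair_tree \<Rightarrow> 'a pair_tree" where
  "involution \<equiv> grade_involution A"

lemma ring_tate: "ring (tate_extension A x)" (is "ring ?T")
proof (rule ringI)
  show "abelian_group ?T"
  proof (rule abelian_groupI)
    fix u assume "u \<in> carrier ?T"
    then obtain y z where "u = Pair y z" "y \<in> carrier A" "z \<in> carrier A" by (rule tate_carrierE)
    then show "\<exists>v\<in>carrier ?T. v \<oplus>\<^bsub>?T\<^esub> u = \<zero>\<^bsub>?T\<^esub>"
      by (intro bexI[of _ "Pair (\<ominus> y) (\<ominus> z)"]) (simp_all add: l_neg)
  qed (auto elim!: tate_carrierE simp: a_ac)
  show "monoid ?T"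
  proof (rule monoidI)
    fix u v w assume "u \<in> carrier ?T" "v \<in> carrier ?T" "w \<in> carrier ?T"
    then obtain y z y' z' y'' z'' where "u = Pair y z" "v = Pair y' z'" "w = Pair y'' z''"
      "y \<in> carrier A" "z \<in> carrier A" "y' \<in> carrier A" "z' \<in> carrier A" "y'' \<in> carrier A" "z'' \<in> carrier A"
      by (elim tate_carrierE)
    then show "u \<otimes>\<^bsub>?T\<^esub> v \<otimes>\<^bsub>?T\<^esub> w = u \<otimes>\<^bsub>?T\<^esub> (v \<otimes>\<^bsub>?T\<^esub> w)"
      by (simp add: l_distr r_distr m_assoc a_assoc involution_mult involution_closed)
  qed (auto elim!: tate_carrierE simp: involution_closed involution_one)
  fix u v w assume "u \<in> carrier ?T" "v \<in> carrier ?T" "w \<in> carrier ?T"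
  then obtain y z y' z' y'' z'' where "u = Pair y z" "v = Pair y' z'" "w = Pair y'' z''"
    "y \<in> carrier A" "z \<in> carrier A" "y' \<in> carrier A" "z' \<in> carrier A" "y'' \<in> carrier A" "z'' \<in> carrier A"
    by (elim tate_carrierE)
  then show "(u \<oplus>\<^bsub>?T\<^esub> v) \<otimes>\<^bsub>?T\<^esub> w = u \<otimes>\<^bsub>?T\<^esub> w \<oplus>\<^bsub>?T\<^esub> v \<otimes>\<^bsub>?T\<^esub> w"
    "w \<otimes>\<^bsub>?T\<^esub> (u \<oplus>\<^bsub>?T\<^esub> v) = w \<otimes>\<^bsub>?T\<^esub> u \<oplus>\<^bsub>?T\<^esub> w \<otimes>\<^bsub>?T\<^esub> v"
    by (simp_all add: l_distr r_distr involution_add involution_closed a_ac)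
qed

lemma tate_minus:
  assumes "y \<in> carrier A" "z \<in> carrier A"
  shows "\<ominus>\<^bsub>tate_extension A x\<^esub> Pair y z = Pair (\<ominus> y) (\<ominus> z)"
proof -
  interpret T: ring "tate_extension A x" by (rule ring_tate)
  show ?thesis using assms by (intro T.minus_equality) (simp_all add: l_neg)
qed

lemma grading_tate: "direct_sum_grading (tate_extension A x) (dg_comp (tate_extension A x))"
    (is "direct_sum_grading ?T _")
proof (rule direct_sum_gradingI[where p = "\<lambda>n u. Pair (component (n + 1) (left u)) (component n (right u))"])
  interpret T: ring ?T by (rule ring_tate)
  show "abelian_group ?T" by (rule T.is_abelian_group)
  show "additive_subgroup (dg_comp ?T n) ?T" for n
  proof (rule additive_subgroup.intro, rule group.subgroupI[OF T.a_group])
    have "Pair \<zero> \<zero> \<in> dg_comp ?T n" by (simp add: comp_zero_mem)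
    then show "dg_comp ?T n \<noteq> {}" by blast
    show "inv\<^bsub>add_monoid ?T\<^esub> u \<in> dg_comp ?T n" if "u \<in> dg_comp ?T n" for u
      using that unfolding a_inv_def[symmetric]
      by (elim tate_compE) (simp add: tate_minus comp_carrier comp_minus_mem)
  qed (auto elim!: tate_compE simp: comp_carrier comp_add_mem)
  show "Pair (component (n + 1) (left u)) (component n (right u)) \<in> dg_comp ?T n" if "u \<in> carrier ?T" for n u
    using that by (elim tate_carrierE) (simp add: component_mem)
  show "Pair (component (n + 1) (left (u \<oplus>\<^bsub>?T\<^esub> v))) (component n (right (u \<oplus>\<^bsub>?T\<^esub> v))) =
      Pair (component (n + 1) (left u)) (component n (right u)) \<oplus>\<^bsub>?T\<^esub>
      Pair (component (n + 1) (left v)) (component n (right v))"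
    if "u \<in> carrier ?T" "v \<in> carrier ?T" for n u v
    using that by (elim tate_carrierE) (simp add: component_add)
  show "Pair (component (n + 1) (left u)) (component n (right u)) = (if n = m then u else \<zero>\<^bsub>?T\<^esub>)"
    if "u \<in> dg_comp ?T m" for n m u
    using that by (elim tate_compE) (simp add: component_homogeneous)
  fix P u assume u: "u \<in> carrier ?T" and hom: "\<And>n x. x \<in> dg_comp ?T n \<Longrightarrow> P x"
    and plus: "\<And>x y. \<lbrakk>x \<in> carrier ?T; y \<in> carrier ?T; P x; P y\<rbrakk> \<Longrightarrow> P (x \<oplus>\<^bsub>?T\<^esub> y)"
  obtain y z where yz: "u = Pair y z" "y \<in> carrier A" "z \<in> carrier A" using u by (rule tate_carrierE)
  have "P (Pair y \<zero>)" using yz(2)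
  proof (induction rule: homogeneous_induct)
    case (homogeneous n y) then show ?case by (intro hom[of _ "n - 1"]) (simp add: comp_zero_mem)
  next
    case (add y y') then show ?case using plus[of "Pair y \<zero>" "Pair y' \<zero>"] by simp
  qed
  moreover have "P (Pair \<zero> z)" using yz(3)
  proof (induction rule: homogeneous_induct)
    case (homogeneous n y) then show ?case by (intro hom[of _ n]) (simp add: comp_zero_mem)
  next
    case (add y y') then show ?case using plus[of "Pair \<zero> y" "Pair \<zero> y'"] by simp
  qed
  ultimately show "P u" using plus[of "Pair y \<zero>" "Pair \<zero> z"] yz by simp
qed

lemma leibniz_tate:
  assumes x: "x \<in> dg_comp A 0" and y: "y \<in> dg_comp A (n + 1)" and z: "z \<in> dg_comp A n"
    and y': "y' \<in> carrier A" and z': "z' \<in> carrier A"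
  shows "dg_diff (tate_extension A x) (Pair y z \<otimes>\<^bsub>tate_extension A x\<^esub> Pair y' z') =
     dg_diff (tate_extension A x) (Pair y z) \<otimes>\<^bsub>tate_extension A x\<^esub> Pair y' z' \<oplus>\<^bsub>tate_extension A x\<^esub>
     deg_sign (tate_extension A x) n (Pair y z \<otimes>\<^bsub>tate_extension A x\<^esub> dg_diff (tate_extension A x) (Pair y' z'))"
proof -
  have xc: "x \<in> carrier A" and yc: "y \<in> carrier A" and zc: "z \<in> carrier A"
    using comp_carrier x y z by blast+
  note c = xc yc zc y' z' diff_closed[OF yc] diff_closed[OF zc] diff_closed[OF y'] diff_closed[OF z']
  have dinv: "grade_involution A (x \<otimes> y \<oplus> dg_diff A z) = deg_sign A (n + 1) (x \<otimes> y \<oplus> dg_diff A z)"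
    using mult_comp[OF x y] diff_comp[OF z] by (intro involution_homogeneous comp_add_mem) simp_all
  have l1: "dg_diff A (y \<otimes> z') = dg_diff A y \<otimes> z' \<oplus> deg_sign A (n + 1) (y \<otimes> dg_diff A z')"
    using leibniz[OF y z'] .
  have l2: "dg_diff A (z \<otimes> y') = dg_diff A z \<otimes> y' \<oplus> deg_sign A n (z \<otimes> dg_diff A y')"
    using leibniz[OF z y'] .
  have l3: "dg_diff A (z \<otimes> z') = dg_diff A z \<otimes> z' \<oplus> deg_sign A n (z \<otimes> dg_diff A z')"
    using leibniz[OF z z'] .
  have xy: "y \<otimes> (x \<otimes> y') = x \<otimes> (y \<otimes> y')" "z \<otimes> (x \<otimes> y') = x \<otimes> (z \<otimes> y')"
    using degree_zero_central[OF x yc] degree_zero_central[OF x zc] c by (metis m_assoc)+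
  let ?t = "x \<otimes> (y \<otimes> y')"
  show ?thesis
  proof (cases "even n")
    case True
    have zi: "grade_involution A z = z" using involution_homogeneous[OF z] True by simp
    have e1: "\<ominus> dg_diff A (y \<otimes> z' \<oplus> z \<otimes> y') =
        (\<ominus> (dg_diff A y \<otimes> z') \<oplus> \<ominus> (dg_diff A z \<otimes> y')) \<oplus> (y \<otimes> dg_diff A z' \<oplus> \<ominus> (z \<otimes> dg_diff A y'))"
      using True c by (simp add: diff_add l1 l2 minus_add a_ac)
    have e2: "\<ominus> dg_diff A y \<otimes> z' \<oplus> grade_involution A (x \<otimes> y \<oplus> dg_diff A z) \<otimes> y' \<oplus>
        (y \<otimes> (x \<otimes> y' \<oplus> dg_diff A z') \<oplus> z \<otimes> (\<ominus> dg_diff A y')) =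
        (\<ominus> (dg_diff A y \<otimes> z') \<oplus> (\<ominus> ?t \<oplus> \<ominus> (dg_diff A z \<otimes> y'))) \<oplus>
        ((?t \<oplus> y \<otimes> dg_diff A z') \<oplus> \<ominus> (z \<otimes> dg_diff A y'))"
      using True c xy by (simp add: dinv minus_add l_minus r_minus l_distr r_distr m_assoc)
    have e3: "x \<otimes> (y \<otimes> z' \<oplus> z \<otimes> y') \<oplus> dg_diff A (z \<otimes> z') =
        (x \<otimes> y \<oplus> dg_diff A z) \<otimes> z' \<oplus> z \<otimes> (x \<otimes> y' \<oplus> dg_diff A z')"
      using True c xy by (simp add: l3 l_distr r_distr m_assoc a_ac)
    show ?thesis
      using True c e3 unfolding tate_simps zi e1 e2 deg_sign_simps(1)[OF True]
      by (subst cancel_middle(2)) simp_all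
  next
    case False
    have zi: "grade_involution A z = \<ominus> z" using involution_homogeneous[OF z] False by simp
    have e1: "\<ominus> dg_diff A (y \<otimes> z' \<oplus> \<ominus> z \<otimes> y') =
        (\<ominus> (dg_diff A y \<otimes> z') \<oplus> dg_diff A z \<otimes> y') \<oplus> (\<ominus> (y \<otimes> dg_diff A z') \<oplus> \<ominus> (z \<otimes> dg_diff A y'))"
      using False c by (simp add: diff_add l1 l2 l_minus diff_minus minus_add a_ac)
    have e2: "\<ominus> dg_diff A y \<otimes> z' \<oplus> grade_involution A (x \<otimes> y \<oplus> dg_diff A z) \<otimes> y' \<oplus>
        \<ominus> (y \<otimes> (x \<otimes> y' \<oplus> dg_diff A z') \<oplus> \<ominus> z \<otimes> (\<ominus> dg_diff A y')) =
        (\<ominus> (dg_diff A y \<otimes> z') \<oplus> (?t \<oplus> dg_diff A z \<otimes> y')) \<oplus>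
        ((\<ominus> ?t \<oplus> \<ominus> (y \<otimes> dg_diff A z')) \<oplus> \<ominus> (z \<otimes> dg_diff A y'))"
      using False c xy by (simp add: dinv minus_add l_minus r_minus l_distr r_distr m_assoc)
    have e3: "x \<otimes> (y \<otimes> z' \<oplus> \<ominus> z \<otimes> y') \<oplus> dg_diff A (z \<otimes> z') =
        (x \<otimes> y \<oplus> dg_diff A z) \<otimes> z' \<oplus> \<ominus> (z \<otimes> (x \<otimes> y' \<oplus> dg_diff A z'))"
      using False c xy by (simp add: l3 l_distr r_distr m_assoc minus_add l_minus r_minus a_ac)
    show ?thesis
      using False c e3 unfolding tate_simps zi e1 deg_sign_simps(2)[OF False]
      by (subst tate_minus, simp, simp, unfold tate_simps e2, subst cancel_middle(1)) simp_all
  qed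
qed

theorem dg_ring_tate:
  assumes x: "x \<in> dg_comp A 0"
  shows "tree_dg_ring (tate_extension A x)" (is "tree_dg_ring ?T")
proof -
  have xc: "x \<in> carrier A" using comp_carrier[OF x] .
  show ?thesis
  proof (intro tree_dg_ring.intro dg_ring.intro dg_ring_axioms.intro ring_tate grading_tate)
    show "\<one>\<^bsub>?T\<^esub> \<in> dg_comp ?T 0" by (simp add: one_comp comp_zero_mem)
    show "dg_comp ?T n = {\<zero>\<^bsub>?T\<^esub>}" if "n > 0" for n
      using that comp_nonpositive[of n] comp_nonpositive[of "n + 1"] by (auto elim!: tate_compE)
  next
    fix u assume "u \<in> carrier ?T"
    then obtain y z where u: "u = Pair y z" "y \<in> carrier A" "z \<in> carrier A" by (rule tate_carrierE)
    note c = u(2,3) xc diff_closed[OF u(2)] diff_closed[OF u(3)]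
    show "dg_diff ?T u \<in> carrier ?T" using c by (simp add: u(1))
    show "dg_diff ?T (dg_diff ?T u) = \<zero>\<^bsub>?T\<^esub>"
      using c diff_diff[OF u(2)] diff_diff[OF u(3)]
      by (simp add: u(1) diff_minus diff_add diff_degree_zero_mult[OF x] r_minus l_neg diff_closed)
    fix v assume "v \<in> carrier ?T"
    then obtain y' z' where v: "v = Pair y' z'" "y' \<in> carrier A" "z' \<in> carrier A" by (rule tate_carrierE)
    show "dg_diff ?T (u \<oplus>\<^bsub>?T\<^esub> v) = dg_diff ?T u \<oplus>\<^bsub>?T\<^esub> dg_diff ?T v"
      using c v(2,3) diff_closed[OF v(2)] diff_closed[OF v(3)]
      by (simp add: u(1) v(1) diff_add minus_add r_distr a_ac)
  next
    fix u n assume "u \<in> dg_comp ?T n"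
    then obtain y z where u: "u = Pair y z" "y \<in> dg_comp A (n + 1)" "z \<in> dg_comp A n" by (rule tate_compE)
    show "dg_diff ?T u \<in> dg_comp ?T (n + 1)"
      using u diff_comp[OF u(2)] diff_comp[OF u(3)] mult_comp[OF x u(2)] by (simp add: comp_minus_mem comp_add_mem)
    show "dg_diff ?T (u \<otimes>\<^bsub>?T\<^esub> v) = dg_diff ?T u \<otimes>\<^bsub>?T\<^esub> v \<oplus>\<^bsub>?T\<^esub> deg_sign ?T n (u \<otimes>\<^bsub>?T\<^esub> dg_diff ?T v)"
      if v: "v \<in> carrier ?T" for v
    proof -
      obtain y' z' where "v = Pair y' z'" "y' \<in> carrier A" "z' \<in> carrier A" using v by (rule tate_carrierE)
      then show ?thesis using leibniz_tate[OF x u(2,3)] u(1) by simp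
    qed
    show "u \<otimes>\<^bsub>?T\<^esub> u = \<zero>\<^bsub>?T\<^esub>" if "odd n"
    proof -
      have "even ((n + 1) * n)" by simp
      then have "z \<otimes> y = y \<otimes> z" using graded_commute[OF u(2,3)] by simp
      then show ?thesis
        using u comp_carrier[OF u(2)] comp_carrier[OF u(3)] that odd_square[OF u(3)] involution_homogeneous[OF u(3)]
        by (simp add: l_minus r_neg)
    qed
    fix v m assume "v \<in> dg_comp ?T m"
    then obtain y' z' where v: "v = Pair y' z'" "y' \<in> dg_comp A (m + 1)" "z' \<in> dg_comp A m" by (rule tate_compE)
    note c = comp_carrier[OF u(2)] comp_carrier[OF u(3)] comp_carrier[OF v(2)] comp_carrier[OF v(3)]
    have "y \<otimes> z' \<in> dg_comp A (n + m + 1)" "grade_involution A z \<otimes> y' \<in> dg_comp A (n + m + 1)"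
      using mult_comp[OF u(2) v(3)] mult_comp[OF involution_comp[OF u(3)] v(2)] by (simp_all add: algebra_simps)
    then show "u \<otimes>\<^bsub>?T\<^esub> v \<in> dg_comp ?T (n + m)"
      using mult_comp[OF u(3) v(3)] by (simp add: u(1) v(1) comp_add_mem)
    have "z' \<otimes> z = deg_sign A (n * m) (z \<otimes> z')" "y' \<otimes> z = deg_sign A (n * (m + 1)) (z \<otimes> y')"
      "z' \<otimes> y = deg_sign A ((n + 1) * m) (y \<otimes> z')"
      using graded_commute[OF u(3) v(3)] graded_commute[OF u(3) v(2)] graded_commute[OF u(2) v(3)] by simp_all
    then show "v \<otimes>\<^bsub>?T\<^esub> u = deg_sign ?T (n * m) (u \<otimes>\<^bsub>?T\<^esub> v)"
      using c involution_homogeneous[OF u(3)] involution_homogeneous[OF v(3)]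
      by (cases "even n"; cases "even m") (simp_all add: u(1) v(1) tate_minus minus_add l_minus a_comm)
  qed
qed

end


subsection \<open>The Koszul DG-ring\<close>

definition discrete_dg_ring :: "('a, 'b) ring_scheme \<Rightarrow> 'a pair_tree dg_ring" where
  "discrete_dg_ring R = \<lparr>carrier = Leaf ` carrier R,
     monoid.mult = (\<lambda>x y. Leaf (leaf x \<otimes>\<^bsub>R\<^esub> leaf y)), one = Leaf \<one>\<^bsub>R\<^esub>,
     zero = Leaf \<zero>\<^bsub>R\<^esub>,
     add = (\<lambda>x y. Leaf (leaf x \<oplus>\<^bsub>R\<^esub> leaf y)),
     dg_comp = (\<lambda>n. if n = 0 then Leaf ` carrier R else {Leaf \<zero>\<^bsub>R\<^esub>}),
     dg_diff = (\<lambda>_. Leaf \<zero>\<^bsub>R\<^esub>)\<rparr>"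

lemma discrete_dg_ring_simps [simp]:
  "carrier (discrete_dg_ring R) = Leaf ` carrier R"
  "Leaf a \<otimes>\<^bsub>discrete_dg_ring R\<^esub> Leaf b = Leaf (a \<otimes>\<^bsub>R\<^esub> b)"
  "\<one>\<^bsub>discrete_dg_ring R\<^esub> = Leaf \<one>\<^bsub>R\<^esub>"
  "\<zero>\<^bsub>discrete_dg_ring R\<^esub> = Leaf \<zero>\<^bsub>R\<^esub>"
  "Leaf a \<oplus>\<^bsub>discrete_dg_ring R\<^esub> Leaf b = Leaf (a \<oplus>\<^bsub>R\<^esub> b)"
  "dg_comp (discrete_dg_ring R) n = (if n = 0 then Leaf ` carrier R else {Leaf \<zero>\<^bsub>R\<^esub>})"
  "dg_diff (discrete_dg_ring R) u = Leaf \<zero>\<^bsub>R\<^esub>"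
  by (simp_all add: discrete_dg_ring_def)

lemma (in cring) discrete_dg_ring: "tree_dg_ring (discrete_dg_ring R)" (is "tree_dg_ring ?D")
proof -
  have g: "abelian_group ?D"
    by (rule abelian_groupI) (auto simp: a_ac intro: bexI[of _ "\<ominus> a" for a] l_neg)
  have r: "ring ?D"
    by (rule ringI[OF g], rule monoidI) (auto simp: m_assoc l_distr r_distr)
  interpret D: ring ?D by (rule r)
  have neg: "\<ominus>\<^bsub>?D\<^esub> Leaf a = Leaf (\<ominus> a)" if "a \<in> carrier R" for a
    using that by (intro D.minus_equality) (auto simp: l_neg)
  have gr: "direct_sum_grading ?D (dg_comp ?D)"
  proof (rule direct_sum_gradingI[where p = "\<lambda>n u. if n = 0 then u else Leaf \<zero>", OF g])
    show "additive_subgroup (dg_comp ?D n) ?D" for n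
    proof (rule additive_subgroup.intro, rule group.subgroupI[OF D.a_group])
      show "inv\<^bsub>add_monoid ?D\<^esub> u \<in> dg_comp ?D n" if "u \<in> dg_comp ?D n" for u
        using that neg unfolding a_inv_def[symmetric] by (auto split: if_splits)
    qed auto
    fix P u assume u: "u \<in> carrier ?D" and "\<And>n x. x \<in> dg_comp ?D n \<Longrightarrow> P x"
    from this(2)[of u 0] u show "P u" by simp
  qed (auto split: if_splits)
  show ?thesis
  proof (intro tree_dg_ring.intro dg_ring.intro dg_ring_axioms.intro r gr)
    fix a b n assume "a \<in> dg_comp ?D n" "b \<in> carrier ?D"
    then show "dg_diff ?D (a \<otimes>\<^bsub>?D\<^esub> b) = dg_diff ?D a \<otimes>\<^bsub>?D\<^esub> b \<oplus>\<^bsub>?D\<^esub> deg_sign ?D n (a \<otimes>\<^bsub>?D\<^esub> dg_diff ?D b)"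
      by (auto simp: deg_sign_def neg split: if_splits)
  next
    fix a b m n assume "a \<in> dg_comp ?D m" "b \<in> dg_comp ?D n"
    then show "b \<otimes>\<^bsub>?D\<^esub> a = deg_sign ?D (m * n) (a \<otimes>\<^bsub>?D\<^esub> b)"
      by (auto simp: deg_sign_def neg m_comm split: if_splits)
  qed (auto split: if_splits)
qed

text \<open>The element \<open>c\<close> of \<open>R\<close>, as an element of degree zero of the Koszul DG-ring on \<open>xs\<close>.\<close>

primrec koszul_scalar :: "('a, 'b) ring_scheme \<Rightarrow> 'a list \<Rightarrow> 'a \<Rightarrow> 'a pair_tree" where
  "koszul_scalar R [] c = Leaf c"
| "koszul_scalar R (x # xs) c = Pair \<zero>\<^bsub>koszul_complex R xs\<^esub> (koszul_scalar R xs c)"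

primrec koszul_dg_ring :: "('a, 'b) ring_scheme \<Rightarrow> 'a list \<Rightarrow> 'a pair_tree dg_ring" where
  "koszul_dg_ring R [] = discrete_dg_ring R"
| "koszul_dg_ring R (x # xs) = tate_extension (koszul_dg_ring R xs) (koszul_scalar R xs x)"

lemma koszul_dg_ring_eq_complex:
  "carrier (koszul_dg_ring R xs) = carrier (koszul_complex R xs)"
  "zero (koszul_dg_ring R xs) = zero (koszul_complex R xs)"
  "add (koszul_dg_ring R xs) = add (koszul_complex R xs)"
  "dg_comp (koszul_dg_ring R xs) = dgm_comp (koszul_complex R xs)"
  by (induction xs)
    (simp_all add: discrete_dg_ring_def unit_complex_def tate_extension_def cone_def)

lemma a_inv_koszul: "a_inv (koszul_dg_ring R xs) = a_inv (koszul_complex R xs)"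
  by (simp add: fun_eq_iff a_inv_def m_inv_def koszul_dg_ring_eq_complex)

context cring
begin

lemma koszul_scalar_comp:
  "\<lbrakk>set xs \<subseteq> carrier R; c \<in> carrier R\<rbrakk> \<Longrightarrow> koszul_scalar R xs c \<in> dgm_comp (koszul_complex R xs) 0"
proof (induction xs)
  case (Cons x xs)
  then interpret K: tree_complex R "koszul_complex R xs" using koszul_complex by simp
  show ?case using Cons by (simp add: K.comp_zero)
qed simp

lemma koszul_dg_ring: "set xs \<subseteq> carrier R \<Longrightarrow> tree_dg_ring (koszul_dg_ring R xs)"
proof (induction xs)
  case Nil show ?case using discrete_dg_ring by simp
next
  case (Cons x xs)
  then interpret K: tree_dg_ring "koszul_dg_ring R xs" by simp
  show ?case
    using K.dg_ring_tate[of "koszul_scalar R xs x"] koszul_scalar_comp[of xs x] Cons.prems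
    by (simp add: koszul_dg_ring_eq_complex)
qed

lemma koszul_smult_eq:
  "\<lbrakk>set xs \<subseteq> carrier R; c \<in> carrier R; t \<in> carrier (koszul_complex R xs)\<rbrakk> \<Longrightarrow>
    c \<odot>\<^bsub>koszul_complex R xs\<^esub> t = koszul_scalar R xs c \<otimes>\<^bsub>koszul_dg_ring R xs\<^esub> t"
proof (induction xs arbitrary: t)
  case Nil then show ?case by auto
next
  case (Cons x xs)
  then interpret D: tree_dg_ring "koszul_dg_ring R xs" using koszul_dg_ring by simp
  interpret K: tree_complex R "koszul_complex R xs" using koszul_complex Cons.prems by simp
  obtain y z where t: "t = Pair y z" "y \<in> carrier (koszul_complex R xs)" "z \<in> carrier (koszul_complex R xs)"
    using Cons.prems(3) by (auto elim: cone_carrierE)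
  have s: "koszul_scalar R xs c \<in> dg_comp (koszul_dg_ring R xs) 0"
    using koszul_scalar_comp Cons.prems by (simp add: koszul_dg_ring_eq_complex)
  have z: "\<zero>\<^bsub>koszul_complex R xs\<^esub> \<otimes>\<^bsub>koszul_dg_ring R xs\<^esub> z = \<zero>\<^bsub>koszul_dg_ring R xs\<^esub>"
    using D.l_null[of z] t(3) by (simp add: koszul_dg_ring_eq_complex)
  have "koszul_scalar R xs c \<otimes>\<^bsub>koszul_dg_ring R xs\<^esub> y \<in> carrier (koszul_dg_ring R xs)"
    using D.m_closed[OF D.comp_carrier[OF s]] t(2) by (simp add: koszul_dg_ring_eq_complex)
  then show ?case
    using Cons t D.involution_degree_zero[OF s] z by simp
qed

lemma koszul_diff_eq:
  "\<lbrakk>set xs \<subseteq> carrier R; t \<in> carrier (koszul_complex R xs)\<rbrakk> \<Longrightarrow>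
    dgm_diff (koszul_complex R xs) t = dg_diff (koszul_dg_ring R xs) t"
proof (induction xs arbitrary: t)
  case Nil then show ?case by simp
next
  case (Cons x xs)
  then obtain y z where t: "t = Pair y z" "y \<in> carrier (koszul_complex R xs)" "z \<in> carrier (koszul_complex R xs)"
    by (auto elim: cone_carrierE)
  then show ?case using Cons koszul_smult_eq[of xs x y] by (simp add: koszul_dg_ring_eq_complex(3) a_inv_koszul)
qed

lemma koszul_scalar_hom:
  assumes "set xs \<subseteq> carrier R"
  shows "koszul_scalar R xs \<in> ring_hom R (degree_zero_ring (koszul_dg_ring R xs))"
proof (rule ring_hom_memI)
  show "koszul_scalar R xs c \<in> carrier (degree_zero_ring (koszul_dg_ring R xs))" if "c \<in> carrier R" for c
    using koszul_scalar_comp[OF assms that] by (simp add: degree_zero_ring_def koszul_dg_ring_eq_complex)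
  have one: "koszul_scalar R xs \<one> = \<one>\<^bsub>koszul_dg_ring R xs\<^esub>"
    by (induction xs) (simp_all add: koszul_dg_ring_eq_complex)
  then show "koszul_scalar R xs \<one> = \<one>\<^bsub>degree_zero_ring (koszul_dg_ring R xs)\<^esub>"
    by (simp add: degree_zero_ring_def)
  have add: "koszul_scalar R xs (c \<oplus> c') = koszul_scalar R xs c \<oplus>\<^bsub>koszul_complex R xs\<^esub> koszul_scalar R xs c'"
    if "c \<in> carrier R" "c' \<in> carrier R" for c c'
    using assms
  proof (induction xs)
    case (Cons x xs)
    then interpret K: tree_complex R "koszul_complex R xs" using koszul_complex by simp
    show ?case using Cons that by simp
  qed simp
  have smult: "koszul_scalar R xs (c \<otimes> c') = c \<odot>\<^bsub>koszul_complex R xs\<^esub> koszul_scalar R xs c'"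
    if "c \<in> carrier R" "c' \<in> carrier R" for c c'
    using assms
  proof (induction xs)
    case (Cons x xs)
    then interpret K: tree_complex R "koszul_complex R xs" using koszul_complex by simp
    show ?case using Cons that by simp
  qed simp
  interpret K: tree_complex R "koszul_complex R xs" using koszul_complex assms .
  fix c c' assume c: "c \<in> carrier R" "c' \<in> carrier R"
  show "koszul_scalar R xs (c \<otimes> c') =
      koszul_scalar R xs c \<otimes>\<^bsub>degree_zero_ring (koszul_dg_ring R xs)\<^esub> koszul_scalar R xs c'"
    using smult[OF c] koszul_smult_eq[OF assms c(1) K.comp_carrier[OF koszul_scalar_comp[OF assms c(2)]]]
    by (simp add: degree_zero_ring_def)
  show "koszul_scalar R xs (c \<oplus> c') =
      koszul_scalar R xs c \<oplus>\<^bsub>degree_zero_ring (koszul_dg_ring R xs)\<^esub> koszul_scalar R xs c'"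
    using add[OF c] by (simp add: degree_zero_ring_def koszul_dg_ring_eq_complex)
qed

lemma last_leaf_scalar: "last_leaf (koszul_scalar R xs c) = c"
  by (induction xs) auto

lemma koszul_scalar_image:
  "koszul_scalar R xs ` carrier R = dgm_comp (koszul_complex R xs) 0" if "set xs \<subseteq> carrier R"
  using that
proof (induction xs)
  case (Cons x xs)
  have comp: "dgm_comp (koszul_complex R (x # xs)) 0 =
      Pair \<zero>\<^bsub>koszul_complex R xs\<^esub> ` dgm_comp (koszul_complex R xs) 0"
    using koszul_comp_trivial[of 1 xs] by (auto simp: cone_def)
  have IH: "koszul_scalar R xs ` carrier R = dgm_comp (koszul_complex R xs) 0" using Cons by simp
  show ?case unfolding comp IH[symmetric] by (auto simp: image_def)
qed simp


end


subsection \<open>DG-rings of fractions\<close>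

lemma ring_cong:
  assumes "carrier S = carrier R" "monoid.mult S = monoid.mult R" "one S = one R" "zero S = zero R" "add S = add R"
    "ring R"
  shows "ring S"
proof -
  interpret R: ring R by fact
  have neg: "\<exists>y\<in>carrier R. y \<oplus>\<^bsub>R\<^esub> x = \<zero>\<^bsub>R\<^esub>" if "x \<in> carrier R" for x
    using R.l_neg[OF that] R.a_inv_closed[OF that] by blast
  show ?thesis
  proof (rule ringI)
    show "abelian_group S" by (rule abelian_groupI) (simp_all add: assms(1-5) R.a_ac neg)
    show "monoid S" by (rule monoidI) (simp_all add: assms(1-5) R.m_assoc)
  qed (simp_all add: assms(1-5) R.l_distr R.r_distr)
qed

lemma dg_fraction_ring_simps [simp]:
  "carrier (dg_fraction_ring A S) = carrier (fraction_ring A S)"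
  "monoid.mult (dg_fraction_ring A S) = monoid.mult (fraction_ring A S)"
  "one (dg_fraction_ring A S) = one (fraction_ring A S)"
  "zero (dg_fraction_ring A S) = zero (fraction_ring A S)"
  "add (dg_fraction_ring A S) = add (fraction_ring A S)"
  by (simp_all add: dg_fraction_ring_def Let_def)

locale dg_denominators = dg_ring A for A :: "('a, 'b) dg_ring_scheme" (structure) +
  fixes S :: "'a set"
  assumes S_degree_zero: "S \<subseteq> dg_comp A 0" and S_one: "\<one> \<in> S"
    and S_mult: "\<lbrakk>s \<in> S; t \<in> S\<rbrakk> \<Longrightarrow> s \<otimes> t \<in> S"

sublocale dg_denominators \<subseteq> Z: central_denominators A S
  by (rule central_denominators[OF S_degree_zero S_one S_mult])

context dg_denominators
begin

abbreviation F :: "('a \<times> 'a) set dg_ring" where "F \<equiv> dg_fraction_ring A S"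
abbreviation frac :: "'a \<Rightarrow> 'a \<Rightarrow> ('a \<times> 'a) set" where "frac \<equiv> fraction A S"

lemma S_deg: "s \<in> S \<Longrightarrow> s \<in> dg_comp A 0"
  using S_degree_zero by blast

lemma ring_F: "ring F"
  by (rule ring_cong[OF _ _ _ _ _ Z.ring_fraction_ring]) simp_all

lemma F_compE:
  assumes "U \<in> dg_comp F n"
  obtains a s where "U = frac a s" "a \<in> dg_comp A n" "s \<in> S"
  using assms unfolding dg_fraction_ring_def Let_def by auto

lemma F_compI: "\<lbrakk>a \<in> dg_comp A n; s \<in> S\<rbrakk> \<Longrightarrow> frac a s \<in> dg_comp F n"
  unfolding dg_fraction_ring_def Let_def by auto

lemma F_diff: "\<lbrakk>a \<in> carrier A; s \<in> S\<rbrakk> \<Longrightarrow> dg_diff F (frac a s) = frac (dg_diff A a) s"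
  by (rule fraction_diff[OF S_degree_zero S_one S_mult])

lemma frac_add_same:
  assumes "a \<in> carrier A" "b \<in> carrier A" "s \<in> S"
  shows "frac a s \<oplus>\<^bsub>F\<^esub> frac b s = frac (a \<oplus> b) s"
proof -
  have "frac a s \<oplus>\<^bsub>F\<^esub> frac b s = frac (s \<otimes> (a \<oplus> b)) (s \<otimes> s)"
    using assms by (simp add: Z.fraction_add r_distr)
  also have "\<dots> = frac (a \<oplus> b) s"
    using assms S_mult by (intro Z.fraction_eqI) (auto simp: m_assoc)
  finally show ?thesis .
qed

lemma frac_zero: "s \<in> S \<Longrightarrow> frac \<zero> s = \<zero>\<^bsub>F\<^esub>"
  using S_one by (simp add: Z.fraction_zero, intro Z.fraction_eqI) auto

lemma frac_minus:
  assumes "a \<in> carrier A" "s \<in> S"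
  shows "\<ominus>\<^bsub>F\<^esub> frac a s = frac (\<ominus> a) s"
proof -
  interpret F: ring F by (rule ring_F)
  show ?thesis
    using assms frac_add_same[of "\<ominus> a" a s] frac_zero
    by (intro F.minus_equality) (simp_all add: l_neg Z.fraction_closed)
qed

lemma frac_deg_sign: "\<lbrakk>a \<in> carrier A; s \<in> S\<rbrakk> \<Longrightarrow> deg_sign F n (frac a s) = frac (deg_sign A n a) s"
  by (simp add: deg_sign_def frac_minus)

lemma component_scale:
  assumes s: "s \<in> dg_comp A 0" and a: "a \<in> carrier A"
  shows "component n (s \<otimes> a) = s \<otimes> component n a"
  using a
proof (induction rule: homogeneous_induct)
  case (homogeneous m x)
  have "s \<otimes> x \<in> dg_comp A m" using mult_comp[OF s homogeneous] by simp
  then show ?case using homogeneous comp_carrier[OF s] by (simp add: component_homogeneous)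
next
  case (add x y)
  then show ?case
    using comp_carrier[OF s] comp_carrier[OF component_mem[of x n]] comp_carrier[OF component_mem[of y n]]
    by (simp add: r_distr component_add)
qed

text \<open>All fractions in the class \<open>U\<close> give the same element, so the union is of a single class.\<close>

definition frac_component :: "int \<Rightarrow> ('a \<times> 'a) set \<Rightarrow> ('a \<times> 'a) set" where
  "frac_component n U = (\<Union>(a, s)\<in>U. frac (component n a) s)"

lemma frac_component:
  assumes "a \<in> carrier A" "s \<in> S"
  shows "frac_component n (frac a s) = frac (component n a) s"
  unfolding frac_component_def
proof (rule Z.fraction_union[OF assms])
  fix b t assume "(b, t) \<in> frac a s"
  then obtain u where b: "b \<in> carrier A" "t \<in> S" and u: "u \<in> S" "u \<otimes> (t \<otimes> a) = u \<otimes> (s \<otimes> b)"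
    unfolding Z.fraction_mem_iff by blast
  have "component n (u \<otimes> (t \<otimes> a)) = component n (u \<otimes> (s \<otimes> b))" using u by simp
  then have "u \<otimes> (t \<otimes> component n a) = u \<otimes> (s \<otimes> component n b)"
    using assms b u(1) by (simp add: component_scale S_deg)
  then show "frac (component n b) t = frac (component n a) s"
    using assms b u(1) comp_carrier[OF component_mem]
    by (subst Z.fraction_eq_iff) (auto intro!: bexI[of _ u])
qed

lemma frac_eq_zero_iff:
  assumes "a \<in> carrier A" "s \<in> S"
  shows "frac a s = \<zero>\<^bsub>F\<^esub> \<longleftrightarrow> (\<exists>u\<in>S. u \<otimes> a = \<zero>)"
  using assms S_one by (simp add: Z.fraction_zero Z.fraction_eq_iff)

lemma grading_F: "direct_sum_grading F (dg_comp F)"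
proof (rule direct_sum_gradingI[where p = frac_component])
  interpret F: ring F by (rule ring_F)
  show "abelian_group F" by (rule F.is_abelian_group)
  show "additive_subgroup (dg_comp F n) F" for n
  proof (rule additive_subgroup.intro, rule group.subgroupI[OF F.a_group])
    show "dg_comp F n \<subseteq> carrier (add_monoid F)"
      by (auto elim!: F_compE simp: Z.fraction_closed comp_carrier)
    show "dg_comp F n \<noteq> {}" using F_compI[OF comp_zero_mem S_one] by blast
    show "inv\<^bsub>add_monoid F\<^esub> U \<in> dg_comp F n" if "U \<in> dg_comp F n" for U
      using that unfolding a_inv_def[symmetric]
      by (elim F_compE) (simp add: frac_minus comp_carrier F_compI comp_minus_mem)
    fix U V assume "U \<in> dg_comp F n" "V \<in> dg_comp F n"
    then obtain a s b t where U: "U = frac a s" "a \<in> dg_comp A n" "s \<in> S"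
      and V: "V = frac b t" "b \<in> dg_comp A n" "t \<in> S" by (elim F_compE)
    have "t \<otimes> a \<oplus> s \<otimes> b \<in> dg_comp A n"
      using mult_comp[OF S_deg[OF V(3)] U(2)] mult_comp[OF S_deg[OF U(3)] V(2)] by (simp add: comp_add_mem)
    then show "U \<otimes>\<^bsub>add_monoid F\<^esub> V \<in> dg_comp F n"
      using U V by (simp add: Z.fraction_add comp_carrier F_compI S_mult)
  qed
  fix n U assume "U \<in> carrier F"
  then obtain a s where U: "U = frac a s" "a \<in> carrier A" "s \<in> S" by (auto elim: Z.fractionE)
  show "frac_component n U \<in> dg_comp F n" using U by (simp add: frac_component F_compI component_mem)
  fix V assume "V \<in> carrier F"
  then obtain b t where V: "V = frac b t" "b \<in> carrier A" "t \<in> S" by (auto elim: Z.fractionE)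
  show "frac_component n (U \<oplus>\<^bsub>F\<^esub> V) = frac_component n U \<oplus>\<^bsub>F\<^esub> frac_component n V"
    using U V by (simp add: Z.fraction_add frac_component S_mult component_add component_scale S_deg
        comp_carrier[OF component_mem])
next
  fix n m U assume "U \<in> dg_comp F m"
  then obtain a s where "U = frac a s" "a \<in> dg_comp A m" "s \<in> S" by (rule F_compE)
  then show "frac_component n U = (if n = m then U else \<zero>\<^bsub>F\<^esub>)"
    using frac_zero by (simp add: frac_component comp_carrier component_homogeneous)
next
  fix P U assume U: "U \<in> carrier F" and hom: "\<And>n x. x \<in> dg_comp F n \<Longrightarrow> P x"
    and plus: "\<And>x y. \<lbrakk>x \<in> carrier F; y \<in> carrier F; P x; P y\<rbrakk> \<Longrightarrow> P (x \<oplus>\<^bsub>F\<^esub> y)"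
  obtain a s where as: "U = frac a s" "a \<in> carrier A" "s \<in> S" using U by (auto elim: Z.fractionE)
  from as(2) have "P (frac a s)"
  proof (induction rule: homogeneous_induct)
    case (homogeneous n x)
    then show ?case by (rule hom[OF F_compI[OF _ as(3)]])
  next
    case (add x y)
    then show ?case using plus[of "frac x s" "frac y s"] as(3) by (simp add: Z.fraction_closed frac_add_same del: dg_fraction_ring_simps(5))
  qed
  then show "P U" using as(1) by simp
qed

theorem dg_ring_F: "dg_ring F"
proof (intro dg_ring.intro dg_ring_axioms.intro ring_F grading_F)
  show "\<one>\<^bsub>F\<^esub> \<in> dg_comp F 0" using F_compI[OF one_comp S_one] by (simp add: Z.fraction_one)
  show "dg_comp F n = {\<zero>\<^bsub>F\<^esub>}" if "n > 0" for n
  proof -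
    have "\<zero>\<^bsub>F\<^esub> \<in> dg_comp F n" using F_compI[OF comp_zero_mem S_one] frac_zero[OF S_one] by simp
    moreover have "U = \<zero>\<^bsub>F\<^esub>" if U: "U \<in> dg_comp F n" for U
    proof -
      obtain a s where "U = frac a s" "a \<in> dg_comp A n" "s \<in> S" using U by (rule F_compE)
      then show ?thesis using comp_nonpositive[OF \<open>n > 0\<close>] frac_zero[of s] by simp
    qed
    ultimately show ?thesis by blast
  qed
next
  fix U assume "U \<in> carrier F"
  then obtain a s where U: "U = frac a s" "a \<in> carrier A" "s \<in> S" by (auto elim: Z.fractionE)
  show "dg_diff F U \<in> carrier F" using U by (simp add: F_diff Z.fraction_closed diff_closed)
  show "dg_diff F (dg_diff F U) = \<zero>\<^bsub>F\<^esub>"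
    using U frac_zero[OF U(3)] by (simp add: F_diff diff_closed diff_diff)
  fix V assume "V \<in> carrier F"
  then obtain b t where V: "V = frac b t" "b \<in> carrier A" "t \<in> S" by (auto elim: Z.fractionE)
  show "dg_diff F (U \<oplus>\<^bsub>F\<^esub> V) = dg_diff F U \<oplus>\<^bsub>F\<^esub> dg_diff F V"
    using U V by (simp add: Z.fraction_add F_diff S_mult diff_closed diff_add diff_degree_zero_mult S_deg)
next
  fix U n assume "U \<in> dg_comp F n"
  then obtain a s where U: "U = frac a s" "a \<in> dg_comp A n" "s \<in> S" by (rule F_compE)
  note a = comp_carrier[OF U(2)]
  show "dg_diff F U \<in> dg_comp F (n + 1)" using U a by (simp add: F_diff F_compI diff_comp)
  show "U \<otimes>\<^bsub>F\<^esub> U = \<zero>\<^bsub>F\<^esub>" if "odd n"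
    using U a odd_square[OF U(2) that] frac_zero[OF S_mult[OF U(3,3)]] by (simp add: Z.fraction_mult)
  show "dg_diff F (U \<otimes>\<^bsub>F\<^esub> V) = dg_diff F U \<otimes>\<^bsub>F\<^esub> V \<oplus>\<^bsub>F\<^esub> deg_sign F n (U \<otimes>\<^bsub>F\<^esub> dg_diff F V)"
    if V0: "V \<in> carrier F" for V
  proof -
    obtain b t where V: "V = frac b t" "b \<in> carrier A" "t \<in> S" using V0 by (auto elim: Z.fractionE)
    have st: "s \<otimes> t \<in> S" using U(3) V(3) by (rule S_mult)
    have 1: "dg_diff F (U \<otimes>\<^bsub>F\<^esub> V) = frac (dg_diff A a \<otimes> b \<oplus> deg_sign A n (a \<otimes> dg_diff A b)) (s \<otimes> t)"
      using U V a st by (simp add: Z.fraction_mult F_diff leibniz[OF U(2) V(2)])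
    have 2: "dg_diff F U \<otimes>\<^bsub>F\<^esub> V = frac (dg_diff A a \<otimes> b) (s \<otimes> t)"
      using U V a by (simp add: Z.fraction_mult F_diff diff_closed)
    have "U \<otimes>\<^bsub>F\<^esub> dg_diff F V = frac (a \<otimes> dg_diff A b) (s \<otimes> t)"
      using U V a by (simp add: Z.fraction_mult F_diff diff_closed)
    then have 3: "deg_sign F n (U \<otimes>\<^bsub>F\<^esub> dg_diff F V) = frac (deg_sign A n (a \<otimes> dg_diff A b)) (s \<otimes> t)"
      using a V st by (simp add: frac_deg_sign diff_closed)
    show ?thesis unfolding 1 2 3
      using a V st by (intro frac_add_same[symmetric]) (simp_all add: diff_closed deg_sign_closed)
  qed
  fix V m assume "V \<in> dg_comp F m"
  then obtain b t where V: "V = frac b t" "b \<in> dg_comp A m" "t \<in> S" by (rule F_compE)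
  note b = comp_carrier[OF V(2)]
  show "U \<otimes>\<^bsub>F\<^esub> V \<in> dg_comp F (n + m)"
    using U V a b by (simp add: Z.fraction_mult F_compI S_mult mult_comp)
  show "V \<otimes>\<^bsub>F\<^esub> U = deg_sign F (n * m) (U \<otimes>\<^bsub>F\<^esub> V)"
    using U V a b graded_commute[OF U(2) V(2)] degree_zero_central[OF S_deg[OF U(3)], of t]
    by (simp add: Z.fraction_mult frac_deg_sign S_mult)
qed

end


section \<open>Localization of complexes\<close>

text \<open>
  \<open>R'\<close> is the localization of \<open>R\<close> at \<open>S\<close> up to isomorphism.  The part of degree zero of a localized Koszul DG-ring
  is one, and so is that of the Koszul DG-ring itself, for \<open>S = {\<one>}\<close>.
\<close>

locale localization_hom = R: cring R + R': cring R'
  for R :: "('a, 'b) ring_scheme" and R' :: "('c, 'd) ring_scheme" +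
  fixes S :: "'a set" and \<iota> :: "'a \<Rightarrow> 'c"
  assumes hom: "\<iota> \<in> ring_hom R R'"
    and denominators: "S \<subseteq> carrier R" "\<one>\<^bsub>R\<^esub> \<in> S" "\<And>s t. \<lbrakk>s \<in> S; t \<in> S\<rbrakk> \<Longrightarrow> s \<otimes>\<^bsub>R\<^esub> t \<in> S"
    and units: "s \<in> S \<Longrightarrow> \<iota> s \<in> Units R'"
    and kernel: "r \<in> carrier R \<Longrightarrow> \<iota> r = \<zero>\<^bsub>R'\<^esub> \<longleftrightarrow> (\<exists>s\<in>S. s \<otimes>\<^bsub>R\<^esub> r = \<zero>\<^bsub>R\<^esub>)"
    and fractions: "r' \<in> carrier R' \<Longrightarrow> \<exists>s\<in>S. \<exists>r\<in>carrier R. \<iota> s \<otimes>\<^bsub>R'\<^esub> r' = \<iota> r"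

text \<open>
  The map \<open>f\<close> makes \<open>Y\<close> a localization of \<open>X\<close>: its kernel is \<open>S\<close>-torsion, and every element of \<open>Y\<close> is a fraction of an
  element of its image.
\<close>

definition localization_map ::
    "('a, 'b) ring_scheme \<Rightarrow> 'a set \<Rightarrow> ('a \<Rightarrow> 'r) \<Rightarrow> ('a, 'm, 'c) dg_module_scheme \<Rightarrow>
     ('r, 'n, 'd) dg_module_scheme \<Rightarrow> ('m \<Rightarrow> 'n) \<Rightarrow> bool" where
  "localization_map R S \<iota> X Y f \<longleftrightarrow> (\<forall>n.
     (\<forall>u\<in>dgm_comp X n. f u \<in> dgm_comp Y n \<and> f (dgm_diff X u) = dgm_diff Y (f u) \<and>
        (\<forall>a\<in>carrier R. f (a \<odot>\<^bsub>X\<^esub> u) = \<iota> a \<odot>\<^bsub>Y\<^esub> f u) \<and>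
        (\<forall>v\<in>dgm_comp X n. f (u \<oplus>\<^bsub>X\<^esub> v) = f u \<oplus>\<^bsub>Y\<^esub> f v) \<and>
        (f u = \<zero>\<^bsub>Y\<^esub> \<longleftrightarrow> (\<exists>s\<in>S. s \<odot>\<^bsub>X\<^esub> u = \<zero>\<^bsub>X\<^esub>))) \<and>
     (\<forall>w\<in>dgm_comp Y n. \<exists>s\<in>S. \<exists>u\<in>dgm_comp X n. \<iota> s \<odot>\<^bsub>Y\<^esub> w = f u))"

lemma localization_mapD:
  assumes "localization_map R S \<iota> X Y f"
  shows "u \<in> dgm_comp X n \<Longrightarrow> f u \<in> dgm_comp Y n"
    "u \<in> dgm_comp X n \<Longrightarrow> f (dgm_diff X u) = dgm_diff Y (f u)"
    "\<lbrakk>u \<in> dgm_comp X n; a \<in> carrier R\<rbrakk> \<Longrightarrow> f (a \<odot>\<^bsub>X\<^esub> u) = \<iota> a \<odot>\<^bsub>Y\<^esub> f u"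
    "\<lbrakk>u \<in> dgm_comp X n; v \<in> dgm_comp X n\<rbrakk> \<Longrightarrow> f (u \<oplus>\<^bsub>X\<^esub> v) = f u \<oplus>\<^bsub>Y\<^esub> f v"
    "u \<in> dgm_comp X n \<Longrightarrow> f u = \<zero>\<^bsub>Y\<^esub> \<longleftrightarrow> (\<exists>s\<in>S. s \<odot>\<^bsub>X\<^esub> u = \<zero>\<^bsub>X\<^esub>)"
    "w \<in> dgm_comp Y n \<Longrightarrow> \<exists>s\<in>S. \<exists>u\<in>dgm_comp X n. \<iota> s \<odot>\<^bsub>Y\<^esub> w = f u"
  using assms unfolding localization_map_def by blast+

lemma (in module) unit_smult_cancel:
  assumes "u \<in> Units R" "x \<in> carrier M" "y \<in> carrier M" "u \<odot>\<^bsub>M\<^esub> x = u \<odot>\<^bsub>M\<^esub> y"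
  shows "x = y"
proof -
  have "(inv u \<otimes> u) \<odot>\<^bsub>M\<^esub> x = (inv u \<otimes> u) \<odot>\<^bsub>M\<^esub> y"
    using assms by (simp add: smult_assoc1 R.Units_closed del: R.Units_l_inv)
  then show ?thesis using assms by simp
qed

context localization_hom
begin

lemmas hom_closed = ring_hom_closed[OF hom]

lemma S_carrier: "s \<in> S \<Longrightarrow> s \<in> carrier R"
  using denominators(1) by blast

lemma unit_closed: "s \<in> S \<Longrightarrow> \<iota> s \<in> carrier R'"
  using units R'.Units_closed by blast

lemma hom_zero: "\<iota> \<zero>\<^bsub>R\<^esub> = \<zero>\<^bsub>R'\<^esub>"
  using kernel[OF R.zero_closed] denominators(2) R.l_one[OF R.zero_closed] by blast

lemma unit_complex_localization:
  "localization_map R S \<iota> (unit_complex R) (unit_complex R') (map_pair_tree \<iota>)"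
  unfolding localization_map_def
proof (intro allI conjI ballI)
  fix n u assume u: "u \<in> dgm_comp (unit_complex R) n"
  then obtain r where r: "u = Leaf r" "r \<in> carrier R" "n \<noteq> 0 \<Longrightarrow> r = \<zero>\<^bsub>R\<^esub>" by (auto split: if_splits)
  show "map_pair_tree \<iota> u \<in> dgm_comp (unit_complex R') n"
    using r hom_closed hom_zero by (auto split: if_splits)
  show "map_pair_tree \<iota> (dgm_diff (unit_complex R) u) = dgm_diff (unit_complex R') (map_pair_tree \<iota> u)"
    using hom_zero by simp
  show "map_pair_tree \<iota> (a \<odot>\<^bsub>unit_complex R\<^esub> u) = \<iota> a \<odot>\<^bsub>unit_complex R'\<^esub> map_pair_tree \<iota> u"
    if "a \<in> carrier R" for a using r that ring_hom_mult[OF hom] by simp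
  show "map_pair_tree \<iota> (u \<oplus>\<^bsub>unit_complex R\<^esub> v) =
      map_pair_tree \<iota> u \<oplus>\<^bsub>unit_complex R'\<^esub> map_pair_tree \<iota> v" if "v \<in> dgm_comp (unit_complex R) n" for v
    using r that ring_hom_add[OF hom] by (auto simp: hom_zero split: if_splits)
  show "map_pair_tree \<iota> u = \<zero>\<^bsub>unit_complex R'\<^esub> \<longleftrightarrow> (\<exists>s\<in>S. s \<odot>\<^bsub>unit_complex R\<^esub> u = \<zero>\<^bsub>unit_complex R\<^esub>)"
    using r kernel by simp
next
  fix n w assume w: "w \<in> dgm_comp (unit_complex R') n"
  show "\<exists>s\<in>S. \<exists>u\<in>dgm_comp (unit_complex R) n. \<iota> s \<odot>\<^bsub>unit_complex R'\<^esub> w = map_pair_tree \<iota> u"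
  proof (cases "n = 0")
    case True
    then obtain r' where "w = Leaf r'" "r' \<in> carrier R'" using w by auto
    then show ?thesis using True fractions[of r'] by force
  next
    case False
    then show ?thesis using w denominators(2) hom_zero unit_closed by (intro bexI[of _ "\<one>\<^bsub>R\<^esub>"]) auto
  qed
qed

text \<open>
  Torsion in the two components is killed by a common element of \<open>S\<close>, and fractions have a common denominator.
\<close>

lemma cone_localization:
  assumes X: "tree_complex R X" and Y: "tree_complex R' Y" and x: "x \<in> carrier R"
    and f: "localization_map R S \<iota> X Y (map_pair_tree \<iota>)"
  shows "localization_map R S \<iota> (cone X x) (cone Y (\<iota> x)) (map_pair_tree \<iota>)"
  unfolding localization_map_def
proof (intro allI conjI ballI)
  interpret X: tree_complex R X by fact
  interpret Y: tree_complex R' Y by fact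
  note D = localization_mapD[OF f]
  have f0: "map_pair_tree \<iota> \<zero>\<^bsub>X\<^esub> = \<zero>\<^bsub>Y\<^esub>"
    using D(5)[OF X.comp_zero[of 0]] denominators by (auto simp: S_carrier)
  have fminus: "map_pair_tree \<iota> (\<ominus>\<^bsub>X\<^esub> u) = \<ominus>\<^bsub>Y\<^esub> map_pair_tree \<iota> u" if u: "u \<in> dgm_comp X n" for u n
  proof -
    have "map_pair_tree \<iota> (\<ominus>\<^bsub>X\<^esub> u) \<oplus>\<^bsub>Y\<^esub> map_pair_tree \<iota> u = \<zero>\<^bsub>Y\<^esub>"
      using D(4)[OF X.comp_minus[OF u] u] X.comp_carrier[OF u] f0 by (simp add: X.M.l_neg)
    then show ?thesis
      using Y.comp_carrier[OF D(1)[OF u]] Y.comp_carrier[OF D(1)[OF X.comp_minus[OF u]]]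
      by (simp add: Y.M.minus_equality)
  qed
  {
    fix n u assume "u \<in> dgm_comp (cone X x) n"
    then obtain y z where u: "u = Pair y z" "y \<in> dgm_comp X (n + 1)" "z \<in> dgm_comp X n" by (rule cone_compE)
    show "map_pair_tree \<iota> u \<in> dgm_comp (cone Y (\<iota> x)) n" using u D(1) by simp
    show "map_pair_tree \<iota> (dgm_diff (cone X x) u) = dgm_diff (cone Y (\<iota> x)) (map_pair_tree \<iota> u)"
      using u D(2)[OF u(2)] D(2)[OF u(3)] D(3)[OF u(2) x] fminus[OF X.diff_comp[OF u(2)]]
        D(4)[OF X.comp_smult[OF x u(2)] X.diff_comp[OF u(3)]] by simp
    show "map_pair_tree \<iota> (a \<odot>\<^bsub>cone X x\<^esub> u) = \<iota> a \<odot>\<^bsub>cone Y (\<iota> x)\<^esub> map_pair_tree \<iota> u"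
      if "a \<in> carrier R" for a using u D(3)[OF u(2) that] D(3)[OF u(3) that] by simp
    show "map_pair_tree \<iota> u = \<zero>\<^bsub>cone Y (\<iota> x)\<^esub> \<longleftrightarrow> (\<exists>s\<in>S. s \<odot>\<^bsub>cone X x\<^esub> u = \<zero>\<^bsub>cone X x\<^esub>)"
    proof
      assume "map_pair_tree \<iota> u = \<zero>\<^bsub>cone Y (\<iota> x)\<^esub>"
      then obtain s t where st: "s \<in> S" "s \<odot>\<^bsub>X\<^esub> y = \<zero>\<^bsub>X\<^esub>" "t \<in> S" "t \<odot>\<^bsub>X\<^esub> z = \<zero>\<^bsub>X\<^esub>"
        using D(5)[OF u(2)] D(5)[OF u(3)] u(1) by auto
      note sc = S_carrier[OF st(1)] S_carrier[OF st(3)]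
      have "(s \<otimes>\<^bsub>R\<^esub> t) \<odot>\<^bsub>X\<^esub> y = \<zero>\<^bsub>X\<^esub>"
        using sc st X.comp_carrier[OF u(2)] X.smult_assoc1[of t s y] R.m_comm[of s t] by simp
      moreover have "(s \<otimes>\<^bsub>R\<^esub> t) \<odot>\<^bsub>X\<^esub> z = \<zero>\<^bsub>X\<^esub>"
        using sc st X.comp_carrier[OF u(3)] X.smult_assoc1[of s t z] by simp
      ultimately show "\<exists>s\<in>S. s \<odot>\<^bsub>cone X x\<^esub> u = \<zero>\<^bsub>cone X x\<^esub>"
        using denominators(3)[OF st(1,3)] u(1) by (intro bexI[of _ "s \<otimes>\<^bsub>R\<^esub> t"]) simp_all
    qed (use D(5)[OF u(2)] D(5)[OF u(3)] u(1) in auto)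
    fix v assume "v \<in> dgm_comp (cone X x) n"
    then obtain y' z' where v: "v = Pair y' z'" "y' \<in> dgm_comp X (n + 1)" "z' \<in> dgm_comp X n" by (rule cone_compE)
    show "map_pair_tree \<iota> (u \<oplus>\<^bsub>cone X x\<^esub> v) = map_pair_tree \<iota> u \<oplus>\<^bsub>cone Y (\<iota> x)\<^esub> map_pair_tree \<iota> v"
      using D(4)[OF u(2) v(2)] D(4)[OF u(3) v(3)] by (simp add: u(1) v(1))
  }
  fix n w assume "w \<in> dgm_comp (cone Y (\<iota> x)) n"
  then obtain y z where w: "w = Pair y z" "y \<in> dgm_comp Y (n + 1)" "z \<in> dgm_comp Y n" by (rule cone_compE)
  obtain s y' where s: "s \<in> S" "y' \<in> dgm_comp X (n + 1)" "\<iota> s \<odot>\<^bsub>Y\<^esub> y = map_pair_tree \<iota> y'" using D(6)[OF w(2)] by blast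
  obtain t z' where t: "t \<in> S" "z' \<in> dgm_comp X n" "\<iota> t \<odot>\<^bsub>Y\<^esub> z = map_pair_tree \<iota> z'" using D(6)[OF w(3)] by blast
  note sc = S_carrier[OF s(1)] S_carrier[OF t(1)] and uc = unit_closed[OF s(1)] unit_closed[OF t(1)]
  have hs: "\<iota> (s \<otimes>\<^bsub>R\<^esub> t) = \<iota> s \<otimes>\<^bsub>R'\<^esub> \<iota> t" using ring_hom_mult[OF hom] sc by simp
  have "\<iota> (s \<otimes>\<^bsub>R\<^esub> t) \<odot>\<^bsub>Y\<^esub> y = map_pair_tree \<iota> (t \<odot>\<^bsub>X\<^esub> y')"
    using hs uc Y.comp_carrier[OF w(2)] Y.smult_assoc1[of "\<iota> t" "\<iota> s" y] D(3)[OF s(2) sc(2)] s(3)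
    by (simp add: R'.m_comm)
  moreover have "\<iota> (s \<otimes>\<^bsub>R\<^esub> t) \<odot>\<^bsub>Y\<^esub> z = map_pair_tree \<iota> (s \<odot>\<^bsub>X\<^esub> z')"
    using hs uc Y.comp_carrier[OF w(3)] Y.smult_assoc1[of "\<iota> s" "\<iota> t" z] D(3)[OF t(2) sc(1)] t(3) by simp
  ultimately show "\<exists>s\<in>S. \<exists>u\<in>dgm_comp (cone X x) n. \<iota> s \<odot>\<^bsub>cone Y (\<iota> x)\<^esub> w = map_pair_tree \<iota> u"
    using denominators(3)[OF s(1) t(1)] X.comp_smult[OF sc(2) s(2)] X.comp_smult[OF sc(1) t(2)] w(1)
    by (intro bexI[of _ "s \<otimes>\<^bsub>R\<^esub> t"] bexI[of _ "Pair (t \<odot>\<^bsub>X\<^esub> y') (s \<odot>\<^bsub>X\<^esub> z')"]) simp_all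
qed

lemma koszul_localization:
  "set xs \<subseteq> carrier R \<Longrightarrow>
    localization_map R S \<iota> (koszul_complex R xs) (koszul_complex R' (map \<iota> xs)) (map_pair_tree \<iota>)"
proof (induction xs)
  case Nil show ?case using unit_complex_localization by simp
next
  case (Cons x xs)
  have "set (map \<iota> xs) \<subseteq> carrier R'" using Cons.prems hom_closed by auto
  then show ?case
    using Cons cone_localization[OF R.koszul_complex[of xs] R'.koszul_complex[of "map \<iota> xs"], of x] by simp
qed

text \<open>
  An element \<open>w\<close> of \<open>Y\<close> corresponds to \<open>z\<close> in \<open>Z\<close> if both are the fraction \<open>u / s\<close> for some \<open>u\<close> in \<open>X\<close>.  The
  premise \<open>disjoint\<close> lets one function serve all degrees, as only zero occurs in several of them.
\<close>

theorem localization_unique: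
  assumes X: "cochain_complex R X" and Y: "cochain_complex R' Y" and Z: "cochain_complex R' Z"
    and f: "localization_map R S \<iota> X Y f" and g: "localization_map R S \<iota> X Z g"
    and disjoint: "\<And>m n w. \<lbrakk>w \<in> dgm_comp Y m; w \<in> dgm_comp Y n; m \<noteq> n\<rbrakk> \<Longrightarrow> w = \<zero>\<^bsub>Y\<^esub>"
  shows "\<exists>h. complex_iso R' Y Z h"
proof -
  interpret X: cochain_complex R X by fact
  interpret Y: cochain_complex R' Y by fact
  interpret Z: cochain_complex R' Z by fact
  note F = localization_mapD[OF f] and G = localization_mapD[OF g]
  note hom_m = ring_hom_mult[OF hom]
  define rel where "rel = (\<lambda>n w z. w \<in> dgm_comp Y n \<and> z \<in> dgm_comp Z n \<and>
    (\<exists>s\<in>S. \<exists>u\<in>dgm_comp X n. \<iota> s \<odot>\<^bsub>Y\<^esub> w = f u \<and> \<iota> s \<odot>\<^bsub>Z\<^esub> z = g u))"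
  have relI: "rel n w z" if "w \<in> dgm_comp Y n" "z \<in> dgm_comp Z n" "s \<in> S" "u \<in> dgm_comp X n"
    "\<iota> s \<odot>\<^bsub>Y\<^esub> w = f u" "\<iota> s \<odot>\<^bsub>Z\<^esub> z = g u" for n w z s u
    using that unfolding rel_def by blast
  have relE: "\<exists>s u. s \<in> S \<and> u \<in> dgm_comp X n \<and> \<iota> s \<odot>\<^bsub>Y\<^esub> w = f u \<and> \<iota> s \<odot>\<^bsub>Z\<^esub> z = g u \<and>
      w \<in> dgm_comp Y n \<and> z \<in> dgm_comp Z n" if "rel n w z" for n w z
    using that unfolding rel_def by blast
  \<comment> \<open>An element of \<open>X\<close> vanishes in \<open>Y\<close> if and only if it vanishes in \<open>Z\<close>, so \<open>rel\<close> respects zero in both directions.\<close>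
  have zero_iff: "w = \<zero>\<^bsub>Y\<^esub> \<longleftrightarrow> z = \<zero>\<^bsub>Z\<^esub>" if r: "rel n w z" for n w z
  proof -
    obtain s u where su: "s \<in> S" "u \<in> dgm_comp X n" "\<iota> s \<odot>\<^bsub>Y\<^esub> w = f u" "\<iota> s \<odot>\<^bsub>Z\<^esub> z = g u"
      "w \<in> dgm_comp Y n" "z \<in> dgm_comp Z n" using relE[OF r] by blast
    have "w = \<zero>\<^bsub>Y\<^esub> \<longleftrightarrow> f u = \<zero>\<^bsub>Y\<^esub>"
      using su(3) Y.unit_smult_cancel[OF units[OF su(1)] Y.comp_carrier[OF su(5)], of "\<zero>\<^bsub>Y\<^esub>"] unit_closed[OF su(1)]
      by auto
    also have "\<dots> \<longleftrightarrow> g u = \<zero>\<^bsub>Z\<^esub>" using F(5)[OF su(2)] G(5)[OF su(2)] by simp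
    also have "\<dots> \<longleftrightarrow> z = \<zero>\<^bsub>Z\<^esub>"
      using su(4) Z.unit_smult_cancel[OF units[OF su(1)] Z.comp_carrier[OF su(6)], of "\<zero>\<^bsub>Z\<^esub>"] unit_closed[OF su(1)]
      by auto
    finally show ?thesis .
  qed
  have scale: "\<iota> (t \<otimes>\<^bsub>R\<^esub> s) \<odot>\<^bsub>Y\<^esub> w = f (t \<odot>\<^bsub>X\<^esub> u) \<and> \<iota> (t \<otimes>\<^bsub>R\<^esub> s) \<odot>\<^bsub>Z\<^esub> z = g (t \<odot>\<^bsub>X\<^esub> u)"
    if "t \<in> S" "s \<in> S" "u \<in> dgm_comp X n" "w \<in> dgm_comp Y n" "z \<in> dgm_comp Z n"
      "\<iota> s \<odot>\<^bsub>Y\<^esub> w = f u" "\<iota> s \<odot>\<^bsub>Z\<^esub> z = g u" for s t u w z n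
    using that S_carrier unit_closed hom_m[of t s] F(3)[OF that(3), of t] G(3)[OF that(3), of t]
      Y.comp_carrier[OF that(4)] Z.comp_carrier[OF that(5)]
    by (simp add: Y.smult_assoc1 Z.smult_assoc1)
  have rel_add: "rel n (w \<oplus>\<^bsub>Y\<^esub> w') (z \<oplus>\<^bsub>Z\<^esub> z')" if r: "rel n w z" "rel n w' z'" for n w z w' z'
  proof -
    obtain s u where su: "s \<in> S" "u \<in> dgm_comp X n" "\<iota> s \<odot>\<^bsub>Y\<^esub> w = f u" "\<iota> s \<odot>\<^bsub>Z\<^esub> z = g u"
      "w \<in> dgm_comp Y n" "z \<in> dgm_comp Z n" using relE[OF r(1)] by blast
    obtain t v where tv: "t \<in> S" "v \<in> dgm_comp X n" "\<iota> t \<odot>\<^bsub>Y\<^esub> w' = f v" "\<iota> t \<odot>\<^bsub>Z\<^esub> z' = g v"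
      "w' \<in> dgm_comp Y n" "z' \<in> dgm_comp Z n" using relE[OF r(2)] by blast
    note 1 = scale[OF tv(1) su(1,2,5,6,3,4)]
    note 2 = scale[OF su(1) tv(1,2,5,6,3,4)]
    have ts: "t \<otimes>\<^bsub>R\<^esub> s \<in> S" "s \<otimes>\<^bsub>R\<^esub> t = t \<otimes>\<^bsub>R\<^esub> s"
      using denominators(3)[OF tv(1) su(1)] S_carrier[OF tv(1)] S_carrier[OF su(1)] by (simp_all add: R.m_comm)
    note uc = X.comp_smult[OF S_carrier[OF tv(1)] su(2)] X.comp_smult[OF S_carrier[OF su(1)] tv(2)]
    show ?thesis
    proof (rule relI[OF _ _ ts(1) X.comp_add[OF uc]])
      show "\<iota> (t \<otimes>\<^bsub>R\<^esub> s) \<odot>\<^bsub>Y\<^esub> (w \<oplus>\<^bsub>Y\<^esub> w') = f (t \<odot>\<^bsub>X\<^esub> u \<oplus>\<^bsub>X\<^esub> s \<odot>\<^bsub>X\<^esub> v)"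
        using 1 2 ts unit_closed[OF ts(1)] Y.comp_carrier[OF su(5)] Y.comp_carrier[OF tv(5)] F(4)[OF uc]
        by (simp add: Y.smult_r_distr)
      show "\<iota> (t \<otimes>\<^bsub>R\<^esub> s) \<odot>\<^bsub>Z\<^esub> (z \<oplus>\<^bsub>Z\<^esub> z') = g (t \<odot>\<^bsub>X\<^esub> u \<oplus>\<^bsub>X\<^esub> s \<odot>\<^bsub>X\<^esub> v)"
        using 1 2 ts unit_closed[OF ts(1)] Z.comp_carrier[OF su(6)] Z.comp_carrier[OF tv(6)] G(4)[OF uc]
        by (simp add: Z.smult_r_distr)
    qed (use su tv Y.comp_add Z.comp_add in auto)
  qed
  have rel_smult: "rel n (a \<odot>\<^bsub>Y\<^esub> w) (a \<odot>\<^bsub>Z\<^esub> z)" if r: "rel n w z" and a: "a \<in> carrier R'" for n w z a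
  proof -
    obtain s u where su: "s \<in> S" "u \<in> dgm_comp X n" "\<iota> s \<odot>\<^bsub>Y\<^esub> w = f u" "\<iota> s \<odot>\<^bsub>Z\<^esub> z = g u"
      "w \<in> dgm_comp Y n" "z \<in> dgm_comp Z n" using relE[OF r] by blast
    obtain t b where tb: "t \<in> S" "b \<in> carrier R" "\<iota> t \<otimes>\<^bsub>R'\<^esub> a = \<iota> b" using fractions[OF a] by blast
    note c = unit_closed[OF su(1)] unit_closed[OF tb(1)] S_carrier[OF su(1)] S_carrier[OF tb(1)] a
      Y.comp_carrier[OF su(5)] Z.comp_carrier[OF su(6)] hom_closed[OF tb(2)]
    have eq: "\<iota> (t \<otimes>\<^bsub>R\<^esub> s) \<otimes>\<^bsub>R'\<^esub> a = \<iota> b \<otimes>\<^bsub>R'\<^esub> \<iota> s"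
      using c hom_m[of t s] tb(3) by (metis R'.m_assoc R'.m_comm R'.m_closed)
    show ?thesis
    proof (rule relI[OF _ _ denominators(3)[OF tb(1) su(1)] X.comp_smult[OF tb(2) su(2)]])
      show "\<iota> (t \<otimes>\<^bsub>R\<^esub> s) \<odot>\<^bsub>Y\<^esub> (a \<odot>\<^bsub>Y\<^esub> w) = f (b \<odot>\<^bsub>X\<^esub> u)"
        using eq c unit_closed[OF denominators(3)[OF tb(1) su(1)]] F(3)[OF su(2) tb(2)] su(3)
        by (simp add: Y.smult_assoc1[symmetric]) (simp add: Y.smult_assoc1)
      show "\<iota> (t \<otimes>\<^bsub>R\<^esub> s) \<odot>\<^bsub>Z\<^esub> (a \<odot>\<^bsub>Z\<^esub> z) = g (b \<odot>\<^bsub>X\<^esub> u)"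
        using eq c unit_closed[OF denominators(3)[OF tb(1) su(1)]] G(3)[OF su(2) tb(2)] su(4)
        by (simp add: Z.smult_assoc1[symmetric]) (simp add: Z.smult_assoc1)
    qed (use su a Y.comp_smult Z.comp_smult in auto)
  qed
  have rel_diff: "rel (n + 1) (dgm_diff Y w) (dgm_diff Z z)" if r: "rel n w z" for n w z
  proof -
    obtain s u where su: "s \<in> S" "u \<in> dgm_comp X n" "\<iota> s \<odot>\<^bsub>Y\<^esub> w = f u" "\<iota> s \<odot>\<^bsub>Z\<^esub> z = g u"
      "w \<in> dgm_comp Y n" "z \<in> dgm_comp Z n" using relE[OF r] by blast
    show ?thesis
      using relI[OF Y.diff_comp[OF su(5)] Z.diff_comp[OF su(6)] su(1) X.diff_comp[OF su(2)]]
        F(2)[OF su(2)] G(2)[OF su(2)] su(3,4) Y.diff_smult[OF unit_closed[OF su(1)] su(5)]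
        Z.diff_smult[OF unit_closed[OF su(1)] su(6)] by simp
  qed
  have uminus: "\<ominus>\<^bsub>R'\<^esub> \<one>\<^bsub>R'\<^esub> \<in> carrier R'" by simp
  have rel_eq_iff: "w = w' \<longleftrightarrow> z = z'" if r: "rel n w z" "rel n w' z'" for n w z w' z'
  proof -
    have c: "w \<in> carrier Y" "w' \<in> carrier Y" "z \<in> carrier Z" "z' \<in> carrier Z"
      using r Y.comp_carrier Z.comp_carrier unfolding rel_def by blast+
    have "rel n (w \<oplus>\<^bsub>Y\<^esub> \<ominus>\<^bsub>Y\<^esub> w') (z \<oplus>\<^bsub>Z\<^esub> \<ominus>\<^bsub>Z\<^esub> z')"
      using rel_add[OF r(1) rel_smult[OF r(2) uminus]] c by (simp add: Y.smult_l_minus Z.smult_l_minus)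
    from zero_iff[OF this] show ?thesis
      using c by (metis Y.M.minus_equality Y.M.minus_minus Y.M.r_neg Y.M.a_inv_closed
          Z.M.minus_equality Z.M.minus_minus Z.M.r_neg Z.M.a_inv_closed)
  qed
  have total: "\<exists>z. rel n w z" if w: "w \<in> dgm_comp Y n" for n w
  proof -
    obtain s u where su: "s \<in> S" "u \<in> dgm_comp X n" "\<iota> s \<odot>\<^bsub>Y\<^esub> w = f u" using F(6)[OF w] by blast
    have u: "\<iota> s \<in> Units R'" using units su(1) .
    have gu: "g u \<in> dgm_comp Z n" using G(1)[OF su(2)] .
    have "\<iota> s \<odot>\<^bsub>Z\<^esub> (inv\<^bsub>R'\<^esub> \<iota> s \<odot>\<^bsub>Z\<^esub> g u) = g u"
      using u Z.comp_carrier[OF gu] by (simp add: Z.smult_assoc1[symmetric] R'.Units_closed)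
    then show ?thesis
      using relI[OF w Z.comp_smult[OF R'.Units_inv_closed[OF u] gu] su] by blast
  qed
  have onto: "\<exists>w. rel n w z" if z: "z \<in> dgm_comp Z n" for n z
  proof -
    obtain s u where su: "s \<in> S" "u \<in> dgm_comp X n" "\<iota> s \<odot>\<^bsub>Z\<^esub> z = g u" using G(6)[OF z] by blast
    have u: "\<iota> s \<in> Units R'" using units su(1) .
    have fu: "f u \<in> dgm_comp Y n" using F(1)[OF su(2)] .
    have "\<iota> s \<odot>\<^bsub>Y\<^esub> (inv\<^bsub>R'\<^esub> \<iota> s \<odot>\<^bsub>Y\<^esub> f u) = f u"
      using u Y.comp_carrier[OF fu] by (simp add: Y.smult_assoc1[symmetric] R'.Units_closed)
    then show ?thesis
      using relI[OF Y.comp_smult[OF R'.Units_inv_closed[OF u] fu] z su(1,2) _ su(3)] by blast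
  qed
  define h where "h = (\<lambda>w. SOME z. \<exists>n. rel n w z)"
  have h: "h w = z" if r: "rel n w z" for n w z
  proof -
    have "\<exists>m. rel m w (h w)" unfolding h_def by (rule someI[of _ z]) (use r in blast)
    then obtain m where m: "rel m w (h w)" by blast
    show ?thesis
    proof (cases "m = n")
      case True then show ?thesis using rel_eq_iff[OF m] r by blast
    next
      case False
      have "w = \<zero>\<^bsub>Y\<^esub>" using disjoint[OF _ _ False] m r unfolding rel_def by blast
      then show ?thesis using zero_iff[OF m] zero_iff[OF r] by simp
    qed
  qed
  have hrel: "rel n w (h w)" if w: "w \<in> dgm_comp Y n" for n w
    using total[OF w] h by blast
  have "complex_iso R' Y Z h"
  proof (rule complex_isoI)
    show "h u \<in> dgm_comp Z n" if "u \<in> dgm_comp Y n" for n u using hrel[OF that] unfolding rel_def by blast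
    show "u = v" if "u \<in> dgm_comp Y n" "v \<in> dgm_comp Y n" "h u = h v" for n u v
      using rel_eq_iff[OF hrel[OF that(1)] hrel[OF that(2)]] that(3) by simp
    show "\<exists>u\<in>dgm_comp Y n. w = h u" if w: "w \<in> dgm_comp Z n" for n w
    proof -
      obtain u where u: "rel n u w" using onto[OF w] by blast
      then show ?thesis using h[OF u] unfolding rel_def by blast
    qed
    show "h (dgm_diff Y u) = dgm_diff Z (h u)" if "u \<in> dgm_comp Y n" for n u
      by (rule h[OF rel_diff[OF hrel[OF that]]])
    show "h (a \<odot>\<^bsub>Y\<^esub> u) = a \<odot>\<^bsub>Z\<^esub> h u" if "a \<in> carrier R'" "u \<in> dgm_comp Y n" for n a u
      by (rule h[OF rel_smult[OF hrel[OF that(2)] that(1)]])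
    show "h (u \<oplus>\<^bsub>Y\<^esub> v) = h u \<oplus>\<^bsub>Z\<^esub> h v" if "u \<in> dgm_comp Y n" "v \<in> dgm_comp Y n" for n u v
      by (rule h[OF rel_add[OF hrel[OF that(1)] hrel[OF that(2)]]])
  qed
  then show ?thesis by blast
qed

end


section \<open>Surjective ring homomorphisms\<close>

locale surjective_hom = ring_hom_cring R S h for R (structure) and S (structure) and h +
  assumes surj: "h ` carrier R = carrier S"
begin

abbreviation ker :: "'a set" where "ker \<equiv> a_kernel R S h"

lemma ker_iff: "r \<in> ker \<longleftrightarrow> r \<in> carrier R \<and> h r = \<zero>\<^bsub>S\<^esub>"
  unfolding a_kernel_def' by (rule mem_Collect_eq)

definition preimage :: "'c set \<Rightarrow> 'a set" where
  "preimage K = {r \<in> carrier R. h r \<in> K}"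

lemma image_mem_iff:
  assumes "ideal I R" "ker \<subseteq> I" "r \<in> carrier R"
  shows "h r \<in> h ` I \<longleftrightarrow> r \<in> I"
proof
  interpret I: ideal I R by fact
  assume "h r \<in> h ` I"
  then obtain i where i: "i \<in> I" "h r = h i" by blast
  have ic: "i \<in> carrier R" using I.Icarr[OF i(1)] .
  have "h (r \<ominus> i) = \<zero>\<^bsub>S\<^esub>" using i(2) ic assms(3) by (simp add: R.minus_eq S.r_neg)
  then have "r \<ominus> i \<in> I" using ker_iff ic assms(2,3) by auto
  then have "(r \<ominus> i) \<oplus> i \<in> I" using i(1) by (rule I.a_closed)
  then show "r \<in> I" using ic assms(3) by (simp add: R.minus_eq R.a_assoc R.l_neg)
qed blast

lemma preimage_ideal: "ideal K S \<Longrightarrow> ideal (preimage K) R"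
  unfolding preimage_def by (rule ring.ideal_vimage)

lemma preimage_prime: "primeideal P S \<Longrightarrow> primeideal (preimage P) R"
  unfolding preimage_def by (rule ring.primeideal_vimage[OF R.is_cring])

lemma ker_le_preimage: "ideal K S \<Longrightarrow> ker \<subseteq> preimage K"
  using additive_subgroup.zero_closed[OF ideal.axioms(1), of K S] by (auto simp: ker_iff preimage_def)

lemma image_preimage:
  assumes "ideal K S"
  shows "h ` preimage K = K"
proof -
  have "K \<subseteq> carrier S" using additive_subgroup.a_subset[OF ideal.axioms(1)[OF assms]] .
  then show ?thesis unfolding preimage_def surj[symmetric] by auto
qed

lemma image_ideal:
  assumes "ideal I R"
  shows "ideal (h ` I) S"
proof (rule idealI[OF S.ring_axioms])
  interpret I: ideal I R by fact
  show "subgroup (h ` I) (add_monoid S)"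
  proof (rule group.subgroupI[OF S.a_group])
    show "h ` I \<noteq> {}" using I.zero_closed by blast
    show "inv\<^bsub>add_monoid S\<^esub> a \<in> h ` I" if a: "a \<in> h ` I" for a
    proof -
      obtain i where i: "i \<in> I" "a = h i" using a by blast
      then have "\<ominus>\<^bsub>S\<^esub> a = h (\<ominus> i)" using I.Icarr by simp
      moreover have "\<ominus> i \<in> I" using i(1) by (rule I.a_inv_closed)
      ultimately show ?thesis unfolding a_inv_def[symmetric] by (rule image_eqI)
    qed
    show "a \<otimes>\<^bsub>add_monoid S\<^esub> b \<in> h ` I" if "a \<in> h ` I" "b \<in> h ` I" for a b
    proof -
      obtain i j where "i \<in> I" "a = h i" "j \<in> I" "b = h j" using \<open>a \<in> h ` I\<close> \<open>b \<in> h ` I\<close> by blast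
      then show ?thesis using I.a_closed I.Icarr by (intro image_eqI[of _ _ "i \<oplus> j"]) simp_all
    qed
  qed (use I.Icarr in auto)
  fix a x assume "a \<in> h ` I" "x \<in> carrier S"
  then obtain i r where "i \<in> I" "a = h i" "r \<in> carrier R" "x = h r" unfolding surj[symmetric] by blast
  then show "x \<otimes>\<^bsub>S\<^esub> a \<in> h ` I" "a \<otimes>\<^bsub>S\<^esub> x \<in> h ` I"
    using I.I_l_closed I.I_r_closed I.Icarr
    by (auto intro: image_eqI[of _ _ "r \<otimes> i"] image_eqI[of _ _ "i \<otimes> r"])
qed

lemma image_proper:
  assumes "ideal I R" "ker \<subseteq> I" "I \<noteq> carrier R"
  shows "h ` I \<noteq> carrier S"
proof
  assume "h ` I = carrier S"
  then have "h r \<in> h ` I" if "r \<in> carrier R" for r using that surj by blast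
  then have "carrier R \<subseteq> I" using image_mem_iff[OF assms(1,2)] by blast
  moreover have "I \<subseteq> carrier R" using additive_subgroup.a_subset[OF ideal.axioms(1)[OF assms(1)]] .
  ultimately show False using assms(3) by simp
qed

lemma image_prime:
  assumes P: "primeideal P R" "ker \<subseteq> P"
  shows "primeideal (h ` P) S"
proof (rule primeidealI)
  note I = primeideal.axioms(1)[OF P(1)]
  note mem = image_mem_iff[OF I P(2)]
  show "ideal (h ` P) S" by (rule image_ideal[OF I])
  show "cring S" by (rule S.is_cring)
  show "carrier S \<noteq> h ` P" using image_proper[OF I P(2)] primeideal.I_notcarr[OF P(1)] by metis
  fix a b assume ab: "a \<in> carrier S" "b \<in> carrier S" "a \<otimes>\<^bsub>S\<^esub> b \<in> h ` P"
  then obtain x y where xy: "a = h x" "b = h y" "x \<in> carrier R" "y \<in> carrier R"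
    unfolding surj[symmetric] by blast
  then have "h (x \<otimes> y) \<in> h ` P" using ab(3) by simp
  then have "x \<otimes> y \<in> P" by (rule iffD1[OF mem[OF R.m_closed[OF xy(3,4)]]])
  then have "x \<in> P \<or> y \<in> P" using primeideal.I_prime[OF P(1) xy(3,4)] by simp
  then show "a \<in> h ` P \<or> b \<in> h ` P" using xy by blast
qed

lemma preimage_chain:
  assumes P: "\<And>i. i \<le> n \<Longrightarrow> primeideal (P i) S" "\<And>i. i < n \<Longrightarrow> P i \<subset> P (Suc i)"
  shows "prime_chain R ker n (\<lambda>i. preimage (P i))"
  unfolding prime_chain_def
proof (intro conjI allI impI)
  fix i assume "i \<le> n"
  then have "primeideal (P i) S" using P by simp
  then show "primeideal (preimage (P i)) R" "ker \<subseteq> preimage (P i)"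
    by (auto intro!: preimage_prime ker_le_preimage dest: primeideal.axioms(1))
next
  fix i assume i: "i < n"
  then have "primeideal (P i) S" "primeideal (P (Suc i)) S" and s: "P i \<subset> P (Suc i)"
    using P by simp_all
  note p = this(1,2)[THEN primeideal.axioms(1)]
  have "preimage (P i) \<subseteq> preimage (P (Suc i))"
    unfolding preimage_def by (rule Collect_mono) (use subsetD[OF psubset_imp_subset[OF s]] in simp)
  moreover have "preimage (P i) \<noteq> preimage (P (Suc i))"
  proof
    assume "preimage (P i) = preimage (P (Suc i))"
    from arg_cong[OF this, of "\<lambda>X. h ` X"] have "P i = P (Suc i)"
      unfolding image_preimage[OF p(1)] image_preimage[OF p(2)] .
    then show False using s by simp
  qed
  ultimately show "preimage (P i) \<subset> preimage (P (Suc i))" by (rule psubsetI)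
qed

text \<open>Primes of \<open>S\<close> correspond to the primes of \<open>R\<close> above the kernel.\<close>

lemma prime_chains_eq:
  "{n. \<exists>P. (\<forall>i\<le>n. primeideal (P i) S) \<and> (\<forall>i<n. P i \<subset> P (Suc i))} = {n. \<exists>C. prime_chain R ker n C}"
proof (intro subset_antisym subsetI; elim CollectE exE)
  fix n P assume "(\<forall>i\<le>n. primeideal (P i) S) \<and> (\<forall>i<n. P i \<subset> P (Suc i))"
  then have "prime_chain R ker n (\<lambda>i. preimage (P i))" by (intro preimage_chain) simp_all
  then show "n \<in> {n. \<exists>C. prime_chain R ker n C}" by blast
next
  fix n C assume C: "prime_chain R ker n C"
  have p: "primeideal (C i) R" "ker \<subseteq> C i" if "i \<le> n" for i using C that by (auto simp: prime_chain_def)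
  have "h ` C i \<subset> h ` C (Suc i)" if i: "i < n" for i
  proof -
    have s: "C i \<subset> C (Suc i)" using C i by (simp add: prime_chain_def)
    then obtain x where x: "x \<in> C (Suc i)" "x \<notin> C i" by blast
    have pi: "primeideal (C (Suc i)) R" "primeideal (C i) R" using p[of i] p[of "Suc i"] i by simp_all
    have "x \<in> carrier R" using x(1) R.primeideal_subset[OF pi(1)] by blast
    then have "h x \<notin> h ` C i"
      using image_mem_iff[OF primeideal.axioms(1)[OF pi(2)]] p[of i] i x(2) by simp
    then show ?thesis using x(1) s by blast
  qed
  then have "(\<forall>i\<le>n. primeideal (h ` C i) S) \<and> (\<forall>i<n. h ` C i \<subset> h ` C (Suc i))"
    using image_prime p by simp
  then show "n \<in> {n. \<exists>P. (\<forall>i\<le>n. primeideal (P i) S) \<and> (\<forall>i<n. P i \<subset> P (Suc i))}"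
    by (intro CollectI exI[of _ "\<lambda>i. h ` C i"])
qed

lemma image_Idl:
  assumes A: "A \<subseteq> carrier R"
  shows "Idl\<^bsub>S\<^esub> (h ` A) = h ` (Idl A)"
proof (rule subset_antisym)
  have hA: "h ` A \<subseteq> carrier S" using A by auto
  have "A \<subseteq> Idl A" by (rule R.genideal_self[OF A])
  then show "Idl\<^bsub>S\<^esub> (h ` A) \<subseteq> h ` (Idl A)"
    by (intro S.genideal_minimal image_ideal R.genideal_ideal A image_mono)
  have "A \<subseteq> preimage (Idl\<^bsub>S\<^esub> (h ` A))"
    using A S.genideal_self[OF hA] unfolding preimage_def by blast
  then have "Idl A \<subseteq> preimage (Idl\<^bsub>S\<^esub> (h ` A))"
    by (intro R.genideal_minimal preimage_ideal S.genideal_ideal hA)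
  then show "h ` (Idl A) \<subseteq> Idl\<^bsub>S\<^esub> (h ` A)" unfolding preimage_def by blast
qed

lemma image_noetherian:
  assumes "noetherian_ring R"
  shows "noetherian_ring S"
proof (rule ring.noetherian_ringI)
  show "ring S" by (rule S.ring_axioms)
  fix K assume K: "ideal K S"
  obtain A where A: "A \<subseteq> carrier R" "finite A" "preimage K = Idl A"
    using noetherian_ring.finetely_gen[OF assms preimage_ideal[OF K]] by blast
  have "K = Idl\<^bsub>S\<^esub> (h ` A)" using image_Idl[OF A(1)] image_preimage[OF K] A(3) by simp
  moreover have "h ` A \<subseteq> carrier S" "finite (h ` A)" using A by auto
  ultimately show "\<exists>A\<subseteq>carrier S. finite A \<and> K = Idl\<^bsub>S\<^esub> A" by (intro exI[of _ "h ` A"]) simp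
qed

lemma image_local:
  assumes "noetherian_local R" and le: "ker \<subseteq> max_ideal R"
  shows "local_ring S" "max_ideal S = h ` max_ideal R"
proof -
  interpret L: noetherian_local R by fact
  let ?M = "h ` max_ideal R"
  have M: "maximalideal ?M S"
  proof (rule maximalidealI)
    show "ideal ?M S" by (rule image_ideal[OF L.ideal_mm])
    show "carrier S \<noteq> ?M"
      using image_proper[OF L.ideal_mm le] primeideal.I_notcarr[OF L.primeideal_mm] by metis
    fix K assume K: "ideal K S" "?M \<subseteq> K" "K \<subseteq> carrier S"
    show "K = ?M \<or> K = carrier S"
    proof (cases "preimage K = carrier R")
      case True then show ?thesis using image_preimage[OF K(1)] surj by simp
    next
      case False
      then have "preimage K \<subseteq> max_ideal R" by (rule L.proper_ideal_le_mm[OF preimage_ideal[OF K(1)]])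
      from image_mono[OF this, of h] show ?thesis unfolding image_preimage[OF K(1)] using K(2) by simp
    qed
  qed
  have uniq: "M' = ?M" if M': "maximalideal M' S" for M'
  proof -
    have I: "ideal M' S" using maximalideal.axioms(1)[OF M'] .
    have "preimage M' \<noteq> carrier R"
      using image_preimage[OF I] surj maximalideal.I_notcarr[OF M'] by metis
    then have "preimage M' \<subseteq> max_ideal R" by (rule L.proper_ideal_le_mm[OF preimage_ideal[OF I]])
    from image_mono[OF this, of h] have "M' \<subseteq> ?M" unfolding image_preimage[OF I] .
    moreover have "?M \<subseteq> carrier S" "?M \<noteq> carrier S" "ideal ?M S"
      using additive_subgroup.a_subset[OF ideal.axioms(1)[OF maximalideal.axioms(1)[OF M]]]
        maximalideal.I_notcarr[OF M] maximalideal.axioms(1)[OF M] by auto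
    ultimately show ?thesis using maximalideal.I_maximal[OF M', of ?M] by blast
  qed
  show "local_ring S" unfolding local_ring_def using S.is_cring M uniq by (intro conjI ex1I)
  show "max_ideal S = ?M"
    by (subst max_ideal_def, rule the_equality[where P = "\<lambda>M. maximalideal M S", OF M uniq])
qed

end

locale quotient_by_ideal = ideal J R + cring R for J and R (structure)
begin

lemma quotient_carrier: "carrier (R Quot J) = (\<lambda>r. J +> r) ` carrier R"
  by (auto simp: FactRing_def A_RCOSETS_def')

lemma coset_eq_iff:
  assumes "a \<in> carrier R" "b \<in> carrier R"
  shows "J +> a = J +> b \<longleftrightarrow> a \<ominus> b \<in> J"
proof -
  have "J +> a = J +> b \<longleftrightarrow> a \<in> J +> b"
    using a_rcos_self[OF assms(1)] a_repr_independence'[OF _ assms(2), of a] by blast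
  then show ?thesis using a_rcos_module_minus[OF ring_axioms assms(2,1)] by simp
qed

lemma coset_eq_J_iff: "a \<in> carrier R \<Longrightarrow> J +> a = J \<longleftrightarrow> a \<in> J"
  using a_rcos_const[of a] a_rcos_self[of a] by blast

lemma quotient_zero: "\<zero>\<^bsub>R Quot J\<^esub> = J"
  by (simp add: FactRing_def)

sublocale proj: surjective_hom R "R Quot J" "(+>) J"
  by (rule surjective_hom.intro[OF rcos_ring_hom_cring[OF is_cring]], rule surjective_hom_axioms.intro)
    (rule quotient_carrier[symmetric])

lemma proj_kernel: "a_kernel R (R Quot J) ((+>) J) = J"
proof (rule Set.set_eqI)
  fix r
  have "r \<in> a_kernel R (R Quot J) ((+>) J) \<longleftrightarrow> r \<in> carrier R \<and> J +> r = J"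
    unfolding a_kernel_def' quotient_zero by (rule mem_Collect_eq)
  then show "r \<in> a_kernel R (R Quot J) ((+>) J) \<longleftrightarrow> r \<in> J"
    using coset_eq_J_iff[of r] Icarr[of r] by argo
qed

end


section \<open>Cohomology modules\<close>

context cochain_complex
begin

abbreviation coset :: "int \<Rightarrow> 'm \<Rightarrow> 'm set" where
  "coset n z \<equiv> coboundaries M n +>\<^bsub>M\<^esub> z"

lemma coboundaries_abelian_subgroup: "abelian_subgroup (coboundaries M n) M"
  by (rule abelian_subgroupI3[OF additive_subgroup.intro M.abelian_group_axioms])
    (rule submodule.axioms(1)[OF coboundaries_submodule])

lemma coset_eq_iff:
  assumes "z \<in> carrier M" "w \<in> carrier M"
  shows "coset n z = coset n w \<longleftrightarrow> z \<oplus>\<^bsub>M\<^esub> \<ominus>\<^bsub>M\<^esub> w \<in> coboundaries M n"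
proof -
  interpret B: abelian_subgroup "coboundaries M n" M by (rule coboundaries_abelian_subgroup)
  have "coset n z = coset n w \<longleftrightarrow> z \<in> coset n w"
    using B.a_rcos_self[OF assms(1)] B.a_repr_independence'[OF _ assms(2), of z] by blast
  then show ?thesis using B.a_rcos_module[OF assms(2,1)] by simp
qed

lemma coset_self: "z \<in> carrier M \<Longrightarrow> z \<in> coset n z"
  using abelian_subgroup.a_rcos_self[OF coboundaries_abelian_subgroup] .

lemma coset_add:
  "\<lbrakk>z \<in> carrier M; w \<in> carrier M\<rbrakk> \<Longrightarrow> coset n z <+>\<^bsub>M\<^esub> coset n w = coset n (z \<oplus>\<^bsub>M\<^esub> w)"
  using abelian_subgroup.a_rcos_sum[OF coboundaries_abelian_subgroup] .

lemma coset_eq_coboundaries_iff: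
  assumes "z \<in> carrier M"
  shows "coset n z = coboundaries M n \<longleftrightarrow> z \<in> coboundaries M n"
  using abelian_subgroup.a_rcos_const[OF coboundaries_abelian_subgroup, of z n] coset_self[OF assms, of n] by blast

lemma cocycle_carrier: "z \<in> cocycles M n \<Longrightarrow> z \<in> carrier M"
  using comp_carrier by (auto simp: cocycles_def)

lemma cohomology_nonzero_iff: "cohomology_nonzero M n \<longleftrightarrow> \<not> exact_at M n"
proof -
  have "\<zero>\<^bsub>M\<^esub> \<in> cocycles M n" by (simp add: cocycles_iff comp_zero diff_zero)
  then have "carrier (cohomology M n) = {\<zero>\<^bsub>cohomology M n\<^esub>} \<longleftrightarrow> (\<forall>z\<in>cocycles M n. coset n z = coboundaries M n)"
    unfolding cohomology_def by auto
  also have "\<dots> \<longleftrightarrow> exact_at M n"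
    using coset_eq_coboundaries_iff[OF cocycle_carrier] unfolding exact_at_def by blast
  finally show ?thesis unfolding cohomology_nonzero_def by simp
qed

lemma cohomological_inf_eq:
  assumes "\<And>n. n < s \<Longrightarrow> exact_at M n" "\<not> exact_at M s"
  shows "cohomological_inf M = s"
  unfolding cohomological_inf_def
  by (rule cInf_eq_minimum) (use assms in \<open>auto simp: cohomology_nonzero_iff not_less[symmetric]\<close>)

text \<open>All elements of \<open>U\<close> act on the cohomology in the same way as \<open>x\<close>.\<close>

lemma cohomology_smult:
  assumes x: "x \<in> U" and U: "U \<subseteq> carrier R"
    and null: "\<And>a z. \<lbrakk>a \<in> U; z \<in> cocycles M n\<rbrakk> \<Longrightarrow> (a \<ominus> x) \<odot>\<^bsub>M\<^esub> z \<in> coboundaries M n"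
    and z: "z \<in> cocycles M n"
  shows "U \<odot>\<^bsub>cohomology M n\<^esub> coset n z = coset n (x \<odot>\<^bsub>M\<^esub> z)"
proof -
  have zc: "z \<in> carrier M" using cocycle_carrier[OF z] .
  have xc: "x \<in> carrier R" using x U by blast
  have eq: "coset n (a \<odot>\<^bsub>M\<^esub> w) = coset n (x \<odot>\<^bsub>M\<^esub> z)" if a: "a \<in> U" and w: "w \<in> coset n z" for a w
  proof -
    have ac: "a \<in> carrier R" using a U by blast
    interpret B: abelian_subgroup "coboundaries M n" M by (rule coboundaries_abelian_subgroup)
    have wc: "w \<in> carrier M" using B.a_elemrcos_carrier[OF zc w] .
    have wz: "w \<oplus>\<^bsub>M\<^esub> \<ominus>\<^bsub>M\<^esub> z \<in> coboundaries M n" using B.a_rcos_module[OF zc wc] w by simp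
    have "a \<odot>\<^bsub>M\<^esub> (w \<oplus>\<^bsub>M\<^esub> \<ominus>\<^bsub>M\<^esub> z) \<oplus>\<^bsub>M\<^esub> (a \<ominus> x) \<odot>\<^bsub>M\<^esub> z \<in> coboundaries M n"
      using coboundaries_closed(2)[OF ac wz] null[OF a z] by (rule coboundaries_closed(3))
    moreover have "a \<odot>\<^bsub>M\<^esub> (w \<oplus>\<^bsub>M\<^esub> \<ominus>\<^bsub>M\<^esub> z) \<oplus>\<^bsub>M\<^esub> (a \<ominus> x) \<odot>\<^bsub>M\<^esub> z
        = a \<odot>\<^bsub>M\<^esub> w \<oplus>\<^bsub>M\<^esub> (\<ominus>\<^bsub>M\<^esub> (a \<odot>\<^bsub>M\<^esub> z) \<oplus>\<^bsub>M\<^esub> a \<odot>\<^bsub>M\<^esub> z) \<oplus>\<^bsub>M\<^esub> \<ominus>\<^bsub>M\<^esub> (x \<odot>\<^bsub>M\<^esub> z)"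
      using ac xc wc zc by (simp add: smult_r_distr smult_r_minus smult_l_distr smult_l_minus R.minus_eq M.a_assoc)
    moreover have "\<dots> = a \<odot>\<^bsub>M\<^esub> w \<oplus>\<^bsub>M\<^esub> \<ominus>\<^bsub>M\<^esub> (x \<odot>\<^bsub>M\<^esub> z)"
      using ac xc wc zc by (simp add: M.l_neg)
    ultimately show ?thesis using coset_eq_iff[of "a \<odot>\<^bsub>M\<^esub> w" "x \<odot>\<^bsub>M\<^esub> z" n] ac xc wc zc by simp
  qed
  have "(\<Union>a\<in>U. \<Union>w\<in>coset n z. coset n (a \<odot>\<^bsub>M\<^esub> w)) = coset n (x \<odot>\<^bsub>M\<^esub> z)"
    using eq x coset_self[OF zc, of n] by blast
  then show ?thesis by (simp add: cohomology_def)
qed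

lemma regular_element_iff:
  assumes x: "x \<in> U" and U: "U \<subseteq> carrier R"
    and null: "\<And>a z n. \<lbrakk>a \<in> U; z \<in> cocycles M n\<rbrakk> \<Longrightarrow> (a \<ominus> x) \<odot>\<^bsub>M\<^esub> z \<in> coboundaries M n"
  shows "regular_element M U \<longleftrightarrow> cohomology_injective M x (cohomological_inf M)"
proof -
  let ?n = "cohomological_inf M"
  have xc: "x \<in> carrier R" using x U by blast
  have carrier: "carrier (cohomology M ?n) = coset ?n ` cocycles M ?n" by (simp add: cohomology_def)
  note sm = cohomology_smult[OF x U null, where n = ?n]
  have "regular_element M U \<longleftrightarrow> (\<forall>z\<in>cocycles M ?n. \<forall>w\<in>cocycles M ?n.
      coset ?n (x \<odot>\<^bsub>M\<^esub> z) = coset ?n (x \<odot>\<^bsub>M\<^esub> w) \<longrightarrow> coset ?n z = coset ?n w)"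
    unfolding regular_element_def Let_def inj_on_def carrier using sm by auto
  also have "\<dots> \<longleftrightarrow> cohomology_injective M x ?n"
  proof
    assume *: "\<forall>z\<in>cocycles M ?n. \<forall>w\<in>cocycles M ?n.
      coset ?n (x \<odot>\<^bsub>M\<^esub> z) = coset ?n (x \<odot>\<^bsub>M\<^esub> w) \<longrightarrow> coset ?n z = coset ?n w"
    show "cohomology_injective M x ?n" unfolding cohomology_injective_def
    proof (intro ballI impI)
      fix z assume z: "z \<in> cocycles M ?n" "x \<odot>\<^bsub>M\<^esub> z \<in> coboundaries M ?n"
      have 0: "\<zero>\<^bsub>M\<^esub> \<in> cocycles M ?n" by (simp add: cocycles_iff comp_zero diff_zero)
      have "coset ?n (x \<odot>\<^bsub>M\<^esub> z) = coset ?n (x \<odot>\<^bsub>M\<^esub> \<zero>\<^bsub>M\<^esub>)"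
        using z xc cocycle_carrier[OF z(1)] by (simp add: coset_eq_iff minus_zero)
      then have "coset ?n z = coset ?n \<zero>\<^bsub>M\<^esub>" using * z(1) 0 by blast
      then show "z \<in> coboundaries M ?n" using cocycle_carrier[OF z(1)] by (simp add: coset_eq_iff minus_zero)
    qed
  next
    assume inj: "cohomology_injective M x ?n"
    show "\<forall>z\<in>cocycles M ?n. \<forall>w\<in>cocycles M ?n.
      coset ?n (x \<odot>\<^bsub>M\<^esub> z) = coset ?n (x \<odot>\<^bsub>M\<^esub> w) \<longrightarrow> coset ?n z = coset ?n w"
    proof (intro ballI impI)
      fix z w assume zw: "z \<in> cocycles M ?n" "w \<in> cocycles M ?n"
        "coset ?n (x \<odot>\<^bsub>M\<^esub> z) = coset ?n (x \<odot>\<^bsub>M\<^esub> w)"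
      note c = cocycle_carrier[OF zw(1)] cocycle_carrier[OF zw(2)] xc
      have "x \<odot>\<^bsub>M\<^esub> (z \<oplus>\<^bsub>M\<^esub> \<ominus>\<^bsub>M\<^esub> w) \<in> coboundaries M ?n"
        using zw(3) c by (simp add: coset_eq_iff smult_r_distr smult_r_minus)
      moreover have "z \<oplus>\<^bsub>M\<^esub> \<ominus>\<^bsub>M\<^esub> w \<in> cocycles M ?n"
        using cocycles_closed(3)[OF zw(1) cocycles_closed(1)[OF zw(2)]] .
      ultimately show "coset ?n z = coset ?n w"
        using inj c unfolding cohomology_injective_def by (simp add: coset_eq_iff)
    qed
  qed
  finally show ?thesis .
qed

text \<open>
  Every element of \<open>R\<close> acts on the cohomology through an element of \<open>T\<close>, so generators over \<open>R\<close> are also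
  generators over \<open>T\<close>.
\<close>

lemma cohomology_finitely_generated:
  assumes fg: "finitely_generated_submodule R M (cocycles M n)"
    and act: "\<And>a. a \<in> carrier R \<Longrightarrow> \<exists>U\<in>carrier T. \<forall>z\<in>cocycles M n.
      U \<odot>\<^bsub>cohomology M n\<^esub> coset n z = coset n (a \<odot>\<^bsub>M\<^esub> z)"
  shows "finitely_generated_module T (cohomology M n)"
proof -
  obtain V where V: "finite V" "V \<subseteq> cocycles M n" "\<And>N'. \<lbrakk>submodule N' R M; V \<subseteq> N'\<rbrakk> \<Longrightarrow> cocycles M n \<subseteq> N'"
    using fg unfolding finitely_generated_submodule_def by meson
  have carrier: "carrier (cohomology M n) = coset n ` cocycles M n" by (simp add: cohomology_def)
  have "N = carrier (cohomology M n)" if N: "submodule N T (cohomology M n)" "coset n ` V \<subseteq> N" for N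
  proof -
    have Nsub: "subgroup N (add_monoid (cohomology M n))" using N(1) by (rule submodule.axioms(1))
    have Nc: "N \<subseteq> carrier (cohomology M n)" using subgroup.subset[OF Nsub] by simp
    let ?N = "{z \<in> cocycles M n. coset n z \<in> N}"
    have smult: "a \<odot>\<^bsub>M\<^esub> z \<in> ?N" if "a \<in> carrier R" "z \<in> ?N" for a z
    proof -
      obtain U where U: "U \<in> carrier T" "U \<odot>\<^bsub>cohomology M n\<^esub> coset n z = coset n (a \<odot>\<^bsub>M\<^esub> z)"
        using act[OF \<open>a \<in> carrier R\<close>] \<open>z \<in> ?N\<close> by blast
      have "U \<odot>\<^bsub>cohomology M n\<^esub> coset n z \<in> N" using submodule.smult_closed[OF N(1) U(1)] that(2) by simp
      then show ?thesis using U(2) cocycles_closed(2)[of a z n] that by simp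
    qed
    have "submodule ?N R M"
    proof (rule submoduleI)
      show "?N \<subseteq> carrier M" using cocycle_carrier by blast
      have "\<zero>\<^bsub>cohomology M n\<^esub> \<in> N" using subgroup.one_closed[OF Nsub] by simp
      then have "coset n \<zero>\<^bsub>M\<^esub> \<in> N" using coset_eq_coboundaries_iff[of "\<zero>\<^bsub>M\<^esub>" n] coboundaries_zero
        by (simp add: cohomology_def)
      then show "\<zero>\<^bsub>M\<^esub> \<in> ?N" by (simp add: cocycles_iff comp_zero diff_zero)
      fix z assume z: "z \<in> ?N"
      show "\<ominus>\<^bsub>M\<^esub> z \<in> ?N" using smult[of "\<ominus> \<one>" z] z cocycle_carrier[of z n] by (simp add: smult_l_minus)
      show "a \<odot>\<^bsub>M\<^esub> z \<in> ?N" if "a \<in> carrier R" for a using smult[OF that z] .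
      fix w assume w: "w \<in> ?N"
      have "coset n z \<oplus>\<^bsub>cohomology M n\<^esub> coset n w \<in> N" using subgroup.m_closed[OF Nsub] z w by simp
      then show "z \<oplus>\<^bsub>M\<^esub> w \<in> ?N"
        using z w coset_add[OF cocycle_carrier cocycle_carrier, of z n w n n] cocycles_closed(3)[of z n w]
        by (simp add: cohomology_def)
    qed
    then have "cocycles M n \<subseteq> ?N" using V(2) N(2) by (intro V(3)) auto
    then show ?thesis using Nc unfolding carrier by blast
  qed
  moreover have "finite (coset n ` V)" "coset n ` V \<subseteq> carrier (cohomology M n)"
    using V(1,2) unfolding carrier by auto
  ultimately show ?thesis unfolding finitely_generated_module_def by (intro exI[of _ "coset n ` V"]) simp
qed

end

lemma (in iso_of_complexes) iso_cocycles_finitely_generated: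
  assumes "noetherian_at R X n"
  shows "finitely_generated_submodule R Y (cocycles Y n)"
proof -
  have "finitely_generated_submodule R X (cocycles X n)"
    using assms X.cocycles_submodule[of n] unfolding noetherian_at_def by (auto simp: cocycles_def)
  then obtain U where U: "finite U" "U \<subseteq> cocycles X n" "\<And>N'. \<lbrakk>submodule N' R X; U \<subseteq> N'\<rbrakk> \<Longrightarrow> cocycles X n \<subseteq> N'"
    unfolding finitely_generated_submodule_def by meson
  have comp: "u \<in> dgm_comp X n" if "u \<in> cocycles X n" for u using that by (simp add: cocycles_def)
  have "cocycles Y n \<subseteq> N'" if N': "submodule N' R Y" "f ` U \<subseteq> N'" for N'
  proof
    fix w assume "w \<in> cocycles Y n"
    then obtain u where u: "u \<in> cocycles X n" "w = f u" by (rule iso_cocycle_ex)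
    note E = Y.submoduleE[OF N'(1)]
    have "submodule {u \<in> dgm_comp X n. f u \<in> N'} R X"
    proof (rule X.submoduleI)
      show "{u \<in> dgm_comp X n. f u \<in> N'} \<subseteq> carrier X" using X.comp_carrier by blast
      show "\<zero>\<^bsub>X\<^esub> \<in> {u \<in> dgm_comp X n. f u \<in> N'}"
        using X.comp_zero iso_zero Y.submodule_zero[OF N'(1)] by simp
    qed (use X.comp_closed iso_minus isoD(4,5) E in auto)
    then have "cocycles X n \<subseteq> {u \<in> dgm_comp X n. f u \<in> N'}" using U(2) N'(2) comp by (intro U(3)) auto
    then show "w \<in> N'" using u by blast
  qed
  moreover have "f ` U \<subseteq> cocycles Y n" using U(2) comp iso_cocycles_iff by blast
  ultimately show ?thesis using U(1) unfolding finitely_generated_submodule_def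
    by (intro exI[of _ "f ` U"]) simp
qed


section \<open>DG-rings presented by a Koszul complex\<close>

lemma regular_dg_module_simps [simp]:
  "carrier (regular_dg_module A) = carrier A" "zero (regular_dg_module A) = zero A"
  "add (regular_dg_module A) = add A" "smult (regular_dg_module A) = monoid.mult A"
  "dgm_comp (regular_dg_module A) = dg_comp A" "dgm_diff (regular_dg_module A) = dg_diff A"
  by (simp_all add: regular_dg_module_def)

lemma degree_zero_ring_simps [simp]:
  "carrier (degree_zero_ring A) = dg_comp A 0" "monoid.mult (degree_zero_ring A) = monoid.mult A"
  "one (degree_zero_ring A) = one A" "zero (degree_zero_ring A) = zero A" "add (degree_zero_ring A) = add A"
  by (simp_all add: degree_zero_ring_def)

lemma tree_dg_module_simps [simp]:
  "carrier (tree_dg_module M) = Leaf ` carrier M" "zero (tree_dg_module M) = Leaf (zero M)"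
  "Leaf x \<oplus>\<^bsub>tree_dg_module M\<^esub> Leaf y = Leaf (x \<oplus>\<^bsub>M\<^esub> y)"
  "a \<odot>\<^bsub>tree_dg_module M\<^esub> Leaf x = Leaf (a \<odot>\<^bsub>M\<^esub> x)"
  "dgm_comp (tree_dg_module M) n = Leaf ` dgm_comp M n"
  "dgm_diff (tree_dg_module M) (Leaf x) = Leaf (dgm_diff M x)"
  by (simp_all add: tree_dg_module_def)

lemma (in cochain_complex) tree_dg_module: "tree_complex R (tree_dg_module M)"
proof -
  have g: "abelian_group (tree_dg_module M)"
    by (rule abelian_groupI) (auto simp: M.a_ac intro: bexI[of _ "\<ominus>\<^bsub>M\<^esub> a" for a] M.l_neg)
  have m: "module R (tree_dg_module M)"
    by (rule moduleI[OF R.is_cring g]) (auto simp: smult_l_distr smult_r_distr smult_assoc1)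
  interpret U: module R "tree_dg_module M" by (rule m)
  have neg: "\<ominus>\<^bsub>tree_dg_module M\<^esub> Leaf a = Leaf (\<ominus>\<^bsub>M\<^esub> a)" if "a \<in> carrier M" for a
    using that by (intro U.M.minus_equality) (auto simp: M.l_neg)
  show ?thesis
  proof (intro tree_complex.intro cochain_complex.intro cochain_complex_axioms.intro m)
    show "submodule (dgm_comp (tree_dg_module M) n) R (tree_dg_module M)" for n
      by (rule U.submoduleI) (auto simp: neg comp_carrier comp_closed)
  qed (auto simp: comp_closed diff_add diff_smult diff_diff)
qed

lemma (in cochain_complex) tree_dg_module_iso: "complex_iso R M (tree_dg_module M) Leaf"
  by (rule complex_isoI) auto

text \<open>Scalars of degree zero are not affected by the sign, so over the part of degree zero this is the cone.\<close>

lemma mult_cone_eq: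
  "mult_cone A M x = (cone M x)\<lparr>smult :=
     \<lambda>a u. Pair (grade_involution A a \<odot>\<^bsub>M\<^esub> left u) (a \<odot>\<^bsub>M\<^esub> right u)\<rparr>"
  by (simp add: mult_cone_def cone_def)

lemma (in cochain_complex) complex_change_smult:
  assumes "\<And>a x. \<lbrakk>a \<in> carrier R; x \<in> carrier M\<rbrakk> \<Longrightarrow> g a x = a \<odot>\<^bsub>M\<^esub> x"
  shows "cochain_complex R (M\<lparr>smult := g\<rparr>)" (is "cochain_complex R ?N")
proof -
  have ag: "abelian_group ?N"
  proof (rule abelian_groupI)
    show "\<exists>y\<in>carrier ?N. y \<oplus>\<^bsub>?N\<^esub> x = \<zero>\<^bsub>?N\<^esub>" if "x \<in> carrier ?N" for x
      using that by (intro bexI[of _ "\<ominus>\<^bsub>M\<^esub> x"]) (simp_all add: M.l_neg)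
  qed (simp_all add: M.a_ac)
  have m: "module R ?N"
    by (rule moduleI[OF R.is_cring ag])
      (simp_all add: assms smult_l_distr smult_r_distr smult_assoc1)
  interpret N: module R ?N by (rule m)
  have neg: "\<ominus>\<^bsub>?N\<^esub> x = \<ominus>\<^bsub>M\<^esub> x" for x by (simp add: a_inv_def m_inv_def)
  show ?thesis
  proof (intro cochain_complex.intro cochain_complex_axioms.intro m)
    show "submodule (dgm_comp ?N n) R ?N" for n
      by (rule N.submoduleI) (use comp_carrier comp_closed assms in \<open>auto simp: neg\<close>)
  qed (use diff_comp diff_add diff_smult diff_diff assms comp_carrier diff_carrier in auto)
qed

context dg_ring
begin

abbreviation R\<^sub>0 :: "('a, 'b) dg_ring_scheme" where "R\<^sub>0 \<equiv> degree_zero_ring A"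

lemma regular_complex: "cochain_complex R\<^sub>0 (regular_dg_module A)"
proof -
  interpret R0: cring R\<^sub>0 by (rule cring_degree_zero)
  have ag: "abelian_group (regular_dg_module A)"
  proof (rule abelian_groupI)
    show "\<exists>y\<in>carrier (regular_dg_module A). y \<oplus>\<^bsub>regular_dg_module A\<^esub> x = \<zero>\<^bsub>regular_dg_module A\<^esub>"
      if "x \<in> carrier (regular_dg_module A)" for x
      using that by (intro bexI[of _ "\<ominus> x"]) (simp_all add: l_neg)
  qed (simp_all add: a_ac)
  have m: "module R\<^sub>0 (regular_dg_module A)"
    by (rule moduleI[OF R0.is_cring ag]) (simp_all add: comp_carrier l_distr r_distr m_assoc)
  interpret N: module R\<^sub>0 "regular_dg_module A" by (rule m)
  have neg: "\<ominus>\<^bsub>regular_dg_module A\<^esub> x = \<ominus> x" for x by (simp add: a_inv_def m_inv_def)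
  show ?thesis
  proof (intro cochain_complex.intro cochain_complex_axioms.intro m)
    show "submodule (dgm_comp (regular_dg_module A) n) R\<^sub>0 (regular_dg_module A)" for n
      by (rule N.submoduleI) (use comp_carrier comp_zero_mem comp_add_mem comp_minus_mem mult_comp[of _ 0 _ n] in \<open>auto simp: neg\<close>)
  qed (auto simp: diff_comp diff_add diff_diff comp_carrier diff_degree_zero_mult)
qed

lemma cocycles_zero: "cocycles (regular_dg_module A) 0 = dg_comp A 0"
  using diff_degree_zero by (auto simp: cocycles_def)

lemma H0_eq: "H0 A = R\<^sub>0 Quot coboundaries (regular_dg_module A) 0"
  unfolding H0_def cocycles_zero degree_zero_ring_def ..

lemma mult_cone_complex:
  assumes "tree_complex R\<^sub>0 M" "x \<in> dg_comp A 0"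
  shows "tree_complex R\<^sub>0 (mult_cone A M x)" "complex_iso R\<^sub>0 (cone M x) (mult_cone A M x) (\<lambda>u. u)"
proof -
  interpret M: tree_complex R\<^sub>0 M by fact
  interpret C: tree_complex R\<^sub>0 "cone M x" using assms by (intro M.cone_complex) simp
  have eq: "Pair (grade_involution A a \<odot>\<^bsub>M\<^esub> left u) (a \<odot>\<^bsub>M\<^esub> right u) = a \<odot>\<^bsub>cone M x\<^esub> u"
    if "a \<in> carrier R\<^sub>0" "u \<in> carrier (cone M x)" for a u
    using that by (auto elim!: cone_carrierE simp: involution_degree_zero)
  show "tree_complex R\<^sub>0 (mult_cone A M x)"
    unfolding mult_cone_eq by (rule tree_complex.intro, rule C.complex_change_smult[OF eq])
  show "complex_iso R\<^sub>0 (cone M x) (mult_cone A M x) (\<lambda>u. u)"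
    unfolding mult_cone_eq by (rule complex_isoI) (use eq C.comp_carrier in auto)
qed

end

text \<open>What Koszul DG-rings and their localizations have in common.\<close>

locale koszul_presented = dg_ring A + R0: noetherian_cring "degree_zero_ring A"
  for A :: "('a, 'b) dg_ring_scheme" (structure) +
  fixes bs :: "'a list"
  assumes bs_degree_zero: "set bs \<subseteq> dg_comp A 0"
    and presentation: "\<exists>f. complex_iso (degree_zero_ring A) (koszul_complex (degree_zero_ring A) bs) (regular_dg_module A) f"
begin

abbreviation J :: "'a set" where "J \<equiv> coboundaries (regular_dg_module A) 0"

definition presents :: "('a, 'a pair_tree) dg_module \<Rightarrow> 'a list \<Rightarrow> bool" where
  "presents M cs \<longleftrightarrow> tree_complex R\<^sub>0 M \<and> set cs \<subseteq> dg_comp A 0 \<and> (\<exists>f. complex_iso R\<^sub>0 (koszul_complex R\<^sub>0 cs) M f)"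

lemma koszul_R0: "set cs \<subseteq> dg_comp A 0 \<Longrightarrow> tree_complex R\<^sub>0 (koszul_complex R\<^sub>0 cs)"
  using R0.koszul_complex by simp

lemma presentsE:
  assumes "presents M cs"
  obtains f where "iso_of_complexes R\<^sub>0 (koszul_complex R\<^sub>0 cs) M f"
proof -
  obtain f where f: "complex_iso R\<^sub>0 (koszul_complex R\<^sub>0 cs) M f" "tree_complex R\<^sub>0 M" "set cs \<subseteq> dg_comp A 0"
    using assms unfolding presents_def by blast
  have "iso_of_complexes R\<^sub>0 (koszul_complex R\<^sub>0 cs) M f"
    by (intro iso_of_complexes.intro iso_of_complexes_axioms.intro f(1) tree_complex.axioms f(2) koszul_R0 f(3))
  then show thesis by (rule that)
qed

lemma presents_tree: "presents (tree_dg_module (regular_dg_module A)) bs"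
proof -
  interpret M: cochain_complex R\<^sub>0 "regular_dg_module A" by (rule regular_complex)
  obtain f where "complex_iso R\<^sub>0 (koszul_complex R\<^sub>0 bs) (regular_dg_module A) f" using presentation by blast
  from complex_iso_trans[OF this M.tree_dg_module_iso] show ?thesis
    unfolding presents_def using M.tree_dg_module bs_degree_zero by blast
qed

lemma presents_cone:
  assumes M: "presents M cs" and x: "x \<in> dg_comp A 0"
  shows "presents (mult_cone A M x) (x # cs)"
proof -
  obtain f where f: "complex_iso R\<^sub>0 (koszul_complex R\<^sub>0 cs) M f" and tM: "tree_complex R\<^sub>0 M"
    and cs: "set cs \<subseteq> dg_comp A 0"
    using M unfolding presents_def by blast
  have "complex_iso R\<^sub>0 (cone (koszul_complex R\<^sub>0 cs) x) (cone M x) (\<lambda>u. Pair (f (left u)) (f (right u)))"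
    using x by (intro cone_iso koszul_R0 cs tM f) simp
  from complex_iso_trans[OF this mult_cone_complex(2)[OF tM x]] mult_cone_complex(1)[OF tM x]
  show ?thesis unfolding presents_def using x cs by auto
qed

lemma iso_regular:
  obtains f where "iso_of_complexes R\<^sub>0 (koszul_complex R\<^sub>0 bs) (regular_dg_module A) f"
proof -
  obtain f where "complex_iso R\<^sub>0 (koszul_complex R\<^sub>0 bs) (regular_dg_module A) f" using presentation by blast
  then have "iso_of_complexes R\<^sub>0 (koszul_complex R\<^sub>0 bs) (regular_dg_module A) f"
    by (intro iso_of_complexes.intro iso_of_complexes_axioms.intro tree_complex.axioms koszul_R0 bs_degree_zero regular_complex)
  then show thesis by (rule that)
qed

text \<open>The cohomology is therefore a module over the quotient by the ideal of the list.\<close>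

lemma Idl_null:
  assumes "iso_of_complexes R\<^sub>0 (koszul_complex R\<^sub>0 cs) M f" "set cs \<subseteq> dg_comp A 0"
    "r \<in> Idl\<^bsub>R\<^sub>0\<^esub> (set cs)" "z \<in> cocycles M n"
  shows "r \<odot>\<^bsub>M\<^esub> z \<in> coboundaries M n"
proof -
  interpret iso_of_complexes R\<^sub>0 "koszul_complex R\<^sub>0 cs" M f by fact
  obtain u where u: "u \<in> cocycles (koszul_complex R\<^sub>0 cs) n" "z = f u" using assms(4) by (rule iso_cocycle_ex)
  have "r \<odot>\<^bsub>koszul_complex R\<^sub>0 cs\<^esub> u \<in> coboundaries (koszul_complex R\<^sub>0 cs) n"
    using X.null_homotopic_cocycle[OF R0.koszul_null_homotopic[OF _ assms(3)] u(1)] assms(2) by simp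
  moreover have "r \<in> carrier R\<^sub>0"
    using ideal.Icarr[OF R0.genideal_ideal assms(3)] assms(2) by simp
  ultimately show ?thesis using iso_multiple_coboundary_iff[of u n r] u by (simp add: cocycles_def)
qed

lemma J_eq: "J = Idl\<^bsub>R\<^sub>0\<^esub> (set bs)"
proof -
  let ?K = "koszul_complex R\<^sub>0 bs"
  obtain f where f: "iso_of_complexes R\<^sub>0 ?K (regular_dg_module A) f" by (rule iso_regular)
  interpret iso_of_complexes R\<^sub>0 ?K "regular_dg_module A" f by (rule f)
  have bs: "set bs \<subseteq> carrier R\<^sub>0" using bs_degree_zero by simp
  note deg0 = R0.koszul_degree_zero[OF bs]
  show ?thesis
  proof (intro subset_antisym subsetI)
    fix r assume r: "r \<in> Idl\<^bsub>R\<^sub>0\<^esub> (set bs)"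
    then have rc: "r \<in> dg_comp A 0" using ideal.Icarr[OF R0.genideal_ideal[OF bs]] by simp
    have "\<one> \<in> cocycles (regular_dg_module A) 0" using cocycles_zero one_comp by simp
    from Idl_null[OF f bs_degree_zero r this] show "r \<in> J" using comp_carrier[OF rc] by simp
  next
    fix r assume r: "r \<in> J"
    have rc: "r \<in> dg_comp A 0" using Y.coboundaries_comp[OF r] by simp
    have "\<one>\<^bsub>R\<^sub>0\<^esub> \<in> last_leaf ` dgm_comp ?K 0" using deg0(1) R0.one_closed by simp
    then obtain u where u: "u \<in> dgm_comp ?K 0" "last_leaf u = \<one>\<^bsub>R\<^sub>0\<^esub>" by force
    have v: "f u \<in> dg_comp A 0" using isoD(2)[OF u(1)] by simp
    have "f u \<otimes> r \<in> J" using Y.coboundaries_closed(2)[of "f u" r 0] v r by simp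
    then have "r \<odot>\<^bsub>regular_dg_module A\<^esub> f u \<in> J"
      using degree_zero_central[OF rc comp_carrier[OF v]] by simp
    then have "r \<odot>\<^bsub>?K\<^esub> u \<in> coboundaries ?K 0" using iso_multiple_coboundary_iff[OF u(1)] rc by simp
    then have "last_leaf (r \<odot>\<^bsub>?K\<^esub> u) \<in> Idl\<^bsub>R\<^sub>0\<^esub> (set bs)"
      using R0.koszul_coboundaries_zero[OF bs X.comp_smult[OF _ u(1)]] rc by simp
    then show "r \<in> Idl\<^bsub>R\<^sub>0\<^esub> (set bs)" using deg0(3)[OF u(1)] u(2) rc comp_carrier[OF rc] by simp
  qed
qed

lemma J_ideal: "ideal J R\<^sub>0"
  unfolding J_eq using bs_degree_zero by (intro R0.genideal_ideal) simp

sublocale Q: quotient_by_ideal J "degree_zero_ring A"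
  by (intro quotient_by_ideal.intro J_ideal R0.is_cring)

lemma H0_eq_Q: "H0 A = R\<^sub>0 Quot J"
  by (rule H0_eq)

lemma coset_R0: "J +>\<^bsub>R\<^sub>0\<^esub> r = J +>\<^bsub>A\<^esub> r"
  by (simp add: a_r_coset_def r_coset_def)

lemma coset_difference:
  assumes "a \<in> J +>\<^bsub>R\<^sub>0\<^esub> x" "b \<in> J +>\<^bsub>R\<^sub>0\<^esub> x" "x \<in> dg_comp A 0"
  shows "a \<in> dg_comp A 0" "a \<ominus>\<^bsub>R\<^sub>0\<^esub> b \<in> J"
proof -
  have x: "x \<in> carrier R\<^sub>0" using assms(3) by simp
  have a: "a \<in> carrier R\<^sub>0" "b \<in> carrier R\<^sub>0" using Q.a_elemrcos_carrier[OF x] assms(1,2) by auto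
  then show "a \<in> dg_comp A 0" by simp
  have "J +>\<^bsub>R\<^sub>0\<^esub> a = J +>\<^bsub>R\<^sub>0\<^esub> x" "J +>\<^bsub>R\<^sub>0\<^esub> b = J +>\<^bsub>R\<^sub>0\<^esub> x"
    using Q.a_repr_independence'[OF assms(1) x] Q.a_repr_independence'[OF assms(2) x] by simp_all
  then show "a \<ominus>\<^bsub>R\<^sub>0\<^esub> b \<in> J" using Q.coset_eq_iff[OF a] by simp
qed

theorem noetherian: "noetherian_dg_ring A"
proof -
  obtain f where f: "iso_of_complexes R\<^sub>0 (koszul_complex R\<^sub>0 bs) (regular_dg_module A) f" by (rule iso_regular)
  interpret iso_of_complexes R\<^sub>0 "koszul_complex R\<^sub>0 bs" "regular_dg_module A" f by (rule f)
  have "finitely_generated_module (H0 A) (cohomology (regular_dg_module A) n)" for n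
  proof (rule Y.cohomology_finitely_generated)
    show "finitely_generated_submodule R\<^sub>0 (regular_dg_module A) (cocycles (regular_dg_module A) n)"
      using bs_degree_zero by (intro iso_cocycles_finitely_generated R0.koszul_noetherian_at) simp
    fix a assume a: "a \<in> carrier R\<^sub>0"
    have self: "a \<in> J +>\<^bsub>R\<^sub>0\<^esub> a" using Q.a_rcos_self[OF a] .
    have diff: "b \<in> carrier R\<^sub>0 \<and> b \<ominus>\<^bsub>R\<^sub>0\<^esub> a \<in> J" if "b \<in> J +>\<^bsub>R\<^sub>0\<^esub> a" for b
      using coset_difference[OF that self] a by simp
    have "(J +>\<^bsub>R\<^sub>0\<^esub> a) \<odot>\<^bsub>cohomology (regular_dg_module A) n\<^esub> Y.coset n z = Y.coset n (a \<odot>\<^bsub>regular_dg_module A\<^esub> z)"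
      if z: "z \<in> cocycles (regular_dg_module A) n" for z
    proof (rule Y.cohomology_smult[OF self _ _ z])
      show "J +>\<^bsub>R\<^sub>0\<^esub> a \<subseteq> carrier R\<^sub>0" using diff by blast
      show "(b \<ominus>\<^bsub>R\<^sub>0\<^esub> a) \<odot>\<^bsub>regular_dg_module A\<^esub> z \<in> coboundaries (regular_dg_module A) n"
        if "b \<in> J +>\<^bsub>R\<^sub>0\<^esub> a" "z \<in> cocycles (regular_dg_module A) n" for b z
        using Idl_null[OF f bs_degree_zero _ that(2)] diff[OF that(1)] J_eq by simp
    qed
    moreover have "J +>\<^bsub>R\<^sub>0\<^esub> a \<in> carrier (H0 A)" using a unfolding H0_eq_Q Q.quotient_carrier by blast
    ultimately show "\<exists>U\<in>carrier (H0 A). \<forall>z\<in>cocycles (regular_dg_module A) n.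
        U \<odot>\<^bsub>cohomology (regular_dg_module A) n\<^esub> Y.coset n z = Y.coset n (a \<odot>\<^bsub>regular_dg_module A\<^esub> z)" by blast
  qed
  moreover have "noetherian_ring (H0 A)"
    unfolding H0_eq_Q by (rule Q.proj.image_noetherian[OF R0.noetherian_ring_axioms])
  ultimately show ?thesis unfolding noetherian_dg_ring_def using dg_ring_axioms by blast
qed

theorem bounded: "bounded_cohomology A"
proof -
  obtain f where f: "iso_of_complexes R\<^sub>0 (koszul_complex R\<^sub>0 bs) (regular_dg_module A) f" by (rule iso_regular)
  interpret iso_of_complexes R\<^sub>0 "koszul_complex R\<^sub>0 bs" "regular_dg_module A" f by (rule f)
  have "\<not> cohomology_nonzero (regular_dg_module A) n" if "n < - int (length bs)" for n
    using Y.cohomology_nonzero_iff iso_exact_at R0.koszul_exact_outside[of bs n] bs_degree_zero that by simp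
  then show ?thesis unfolding bounded_cohomology_def by blast
qed

end


subsection \<open>The Cohen-Macaulay case\<close>

text \<open>
  Adding an element to \<open>bs\<close> does not raise the lowest degree of cohomology of the Koszul complex, by Nakayama's lemma;
  the formula for that degree turns this into a bound on the dimension.
\<close>

lemma (in cohen_macaulay_local) prime_dim_insert_ge:
  assumes bs: "set bs \<subseteq> \<mm>" and x: "x \<in> \<mm>"
  shows "prime_dim R (set bs) \<le> Suc (prime_dim R (insert x (set bs)))"
proof (rule ccontr)
  assume "\<not> ?thesis"
  then have "bottom bs < bottom (x # bs)" by (simp add: bottom_def)
  moreover have "set (x # bs) \<subseteq> \<mm>" using bs x by simp
  ultimately have "exact_at (koszul_complex R ([x] @ bs)) (bottom bs)"
    using koszul_bottom(1)[of "x # bs" "bottom bs"] by simp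
  moreover have "set [x] \<subseteq> \<mm>" "set bs \<subseteq> carrier R" using x bs mm_subset by auto
  ultimately have "exact_at (koszul_complex R bs) (bottom bs)" using koszul_exact_drop by blast
  then show False using koszul_bottom(2)[OF bs] by simp
qed

lemma (in cring) prime_chain_Idl:
  assumes "X \<subseteq> carrier R"
  shows "prime_chain R (Idl X) n C \<longleftrightarrow> prime_chain R X n C"
proof -
  have "primeideal P R \<and> Idl X \<subseteq> P \<longleftrightarrow> primeideal P R \<and> X \<subseteq> P" for P
    using Idl_subset_ideal[OF primeideal.axioms(1) assms, of P] by meson
  then show ?thesis unfolding prime_chain_def by simp
qed

locale koszul_presented_cm = koszul_presented A bs + R0: cohen_macaulay_local "degree_zero_ring A" d
  for A :: "('a, 'b) dg_ring_scheme" (structure) and bs d +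
  assumes bs_local: "set bs \<subseteq> max_ideal (degree_zero_ring A)"
begin

abbreviation \<mm>\<^sub>0 :: "'a set" where "\<mm>\<^sub>0 \<equiv> max_ideal R\<^sub>0"

lemma J_le_mm: "J \<subseteq> \<mm>\<^sub>0"
  unfolding J_eq using bs_local by (intro R0.genideal_minimal R0.ideal_mm)

lemma mm_deg: "x \<in> \<mm>\<^sub>0 \<Longrightarrow> x \<in> dg_comp A 0"
  using R0.mm_subset by auto

lemma H0_local: "local_ring (H0 A)" "max_ideal (H0 A) = (+>\<^bsub>R\<^sub>0\<^esub>) J ` \<mm>\<^sub>0"
  unfolding H0_eq_Q using Q.proj.image_local[OF R0.noetherian_local_axioms] J_le_mm Q.proj_kernel by simp_all

lemma krull_dim_H0: "krull_dim (H0 A) = enat (prime_dim R\<^sub>0 (set bs))"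
proof -
  have bs: "set bs \<subseteq> carrier R\<^sub>0" using bs_degree_zero by simp
  have "krull_dim (H0 A) = (SUP n \<in> {n. \<exists>C. prime_chain R\<^sub>0 (set bs) n C}. enat n)"
    unfolding krull_dim_def H0_eq_Q Q.proj.prime_chains_eq Q.proj_kernel unfolding J_eq R0.prime_chain_Idl[OF bs] ..
  also have "\<dots> = enat (prime_dim R\<^sub>0 (set bs))"
    using R0.prime_dim[OF bs_local] by (intro antisym SUP_least SUP_upper) auto
  finally show ?thesis .
qed

lemma coset_of_mm:
  assumes "x \<in> \<mm>\<^sub>0" "a \<in> J +>\<^bsub>R\<^sub>0\<^esub> x"
  shows "a \<in> \<mm>\<^sub>0"
proof -
  interpret m: ideal \<mm>\<^sub>0 R\<^sub>0 by (rule R0.ideal_mm)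
  obtain j where "j \<in> J" "a = j \<oplus>\<^bsub>R\<^sub>0\<^esub> x" using assms(2) unfolding a_r_coset_def' by blast
  then show ?thesis using m.a_closed J_le_mm assms(1) by blast
qed

text \<open>
  All representatives \<open>y\<close> of a class in \<open>H\<^sup>0(A)\<close> have the same action on the cohomology, so any one of them
  decides regularity.  This matters because the Koszul cone is formed with an unspecified representative.
\<close>

lemma regular_element_presented:
  assumes M: "presents M cs" and cs: "set cs \<subseteq> \<mm>\<^sub>0" and J: "J \<subseteq> Idl\<^bsub>R\<^sub>0\<^esub> (set cs)"
    and x: "x \<in> \<mm>\<^sub>0" and y: "y \<in> J +>\<^bsub>R\<^sub>0\<^esub> x"
  shows "regular_element M (J +>\<^bsub>R\<^sub>0\<^esub> x) \<longleftrightarrow> prime_dim R\<^sub>0 (insert y (set cs)) < prime_dim R\<^sub>0 (set cs)"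
proof -
  have csd: "set cs \<subseteq> dg_comp A 0" using cs mm_deg by blast
  obtain f where f: "iso_of_complexes R\<^sub>0 (koszul_complex R\<^sub>0 cs) M f" using M by (rule presentsE)
  interpret iso_of_complexes R\<^sub>0 "koszul_complex R\<^sub>0 cs" M f by (rule f)
  have ym: "y \<in> \<mm>\<^sub>0" using coset_of_mm[OF x y] .
  have inf: "cohomological_inf M = R0.bottom cs"
    using iso_exact_at R0.koszul_bottom[OF cs] by (intro Y.cohomological_inf_eq) auto
  note diff = coset_difference[OF _ y mm_deg[OF x]]
  have "regular_element M (J +>\<^bsub>R\<^sub>0\<^esub> x) \<longleftrightarrow> cohomology_injective M y (cohomological_inf M)"
  proof (rule Y.regular_element_iff[OF y])
    show "J +>\<^bsub>R\<^sub>0\<^esub> x \<subseteq> carrier R\<^sub>0" using diff(1) by auto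
    show "(a \<ominus>\<^bsub>R\<^sub>0\<^esub> y) \<odot>\<^bsub>M\<^esub> z \<in> coboundaries M n" if "a \<in> J +>\<^bsub>R\<^sub>0\<^esub> x" "z \<in> cocycles M n" for a z n
      using Idl_null[OF f csd _ that(2)] diff(2)[OF that(1)] J by blast
  qed
  also have "\<dots> \<longleftrightarrow> cohomology_injective (koszul_complex R\<^sub>0 cs) y (R0.bottom cs)"
    unfolding inf using iso_cohomology_injective mm_deg[OF ym] by simp
  also have "\<dots> \<longleftrightarrow> prime_dim R\<^sub>0 (insert y (set cs)) < prime_dim R\<^sub>0 (set cs)"
    by (rule R0.koszul_regular_iff[OF cs ym])
  finally show ?thesis .
qed

lemma Idl_Cons:
  assumes "set cs \<subseteq> \<mm>\<^sub>0" "y \<in> \<mm>\<^sub>0" "J \<subseteq> Idl\<^bsub>R\<^sub>0\<^esub> (set cs)"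
  shows "J \<subseteq> Idl\<^bsub>R\<^sub>0\<^esub> (set (y # cs))"
proof -
  have "Idl\<^bsub>R\<^sub>0\<^esub> (set cs) \<subseteq> Idl\<^bsub>R\<^sub>0\<^esub> (set (y # cs))"
    using assms(1,2) R0.mm_subset by (intro R0.subset_Idl_subset) auto
  then show ?thesis using assms(3) by blast
qed

lemma koszul_cone_presented:
  assumes M: "presents M cs" and x: "x \<in> \<mm>\<^sub>0"
  obtains y where "y \<in> J +>\<^bsub>R\<^sub>0\<^esub> x" "y \<in> \<mm>\<^sub>0" "presents (koszul_cone A M (J +>\<^bsub>R\<^sub>0\<^esub> x)) (y # cs)"
proof -
  have "x \<in> J +>\<^bsub>R\<^sub>0\<^esub> x" using Q.a_rcos_self mm_deg[OF x] by simp
  then have y: "(SOME y. y \<in> J +>\<^bsub>R\<^sub>0\<^esub> x) \<in> J +>\<^bsub>R\<^sub>0\<^esub> x" by (rule someI)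
  note ym = coset_of_mm[OF x y]
  show thesis using that[OF y ym] presents_cone[OF M mm_deg[OF ym]] unfolding koszul_cone_def by blast
qed

text \<open>Each regular element lowers the dimension by at least one.\<close>

lemma regular_sequence_le_dim:
  assumes "presents M cs" "set cs \<subseteq> \<mm>\<^sub>0" "J \<subseteq> Idl\<^bsub>R\<^sub>0\<^esub> (set cs)"
    "set Us \<subseteq> max_ideal (H0 A)" "dg_regular_sequence A M Us"
  shows "length Us \<le> prime_dim R\<^sub>0 (set cs)"
  using assms
proof (induction Us arbitrary: M cs)
  case (Cons U Us)
  obtain x where x: "x \<in> \<mm>\<^sub>0" "U = J +>\<^bsub>R\<^sub>0\<^esub> x" using Cons.prems(4) H0_local(2) by auto
  obtain y where y: "y \<in> J +>\<^bsub>R\<^sub>0\<^esub> x" "y \<in> \<mm>\<^sub>0" "presents (koszul_cone A M U) (y # cs)"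
    using koszul_cone_presented[OF Cons.prems(1) x(1)] x(2) by blast
  have "prime_dim R\<^sub>0 (insert y (set cs)) < prime_dim R\<^sub>0 (set cs)"
    using regular_element_presented[OF Cons.prems(1-3) x(1) y(1)] Cons.prems(5) x(2) by simp
  moreover have "length Us \<le> prime_dim R\<^sub>0 (set (y # cs))"
    using Cons.prems y(2) by (intro Cons.IH[OF y(3)] Idl_Cons) auto
  ultimately show ?case by simp
qed simp

text \<open>Each regular element can be chosen to lower the dimension, and it does so by one only.\<close>

lemma exists_regular_sequence:
  assumes "presents M cs" "set cs \<subseteq> \<mm>\<^sub>0" "J \<subseteq> Idl\<^bsub>R\<^sub>0\<^esub> (set cs)"
  shows "\<exists>Us. set Us \<subseteq> max_ideal (H0 A) \<and> dg_regular_sequence A M Us \<and> length Us = prime_dim R\<^sub>0 (set cs)"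
  using assms
proof (induction "prime_dim R\<^sub>0 (set cs)" arbitrary: M cs)
  case 0
  then show ?case by (intro exI[of _ "[]"]) simp
next
  case (Suc k)
  obtain x where x: "x \<in> \<mm>\<^sub>0" "prime_dim R\<^sub>0 (insert x (set cs)) < prime_dim R\<^sub>0 (set cs)"
    using R0.exists_regular_element[OF Suc.prems(2)] Suc.hyps(2) by auto
  let ?U = "J +>\<^bsub>R\<^sub>0\<^esub> x"
  obtain y where y: "y \<in> ?U" "y \<in> \<mm>\<^sub>0" "presents (koszul_cone A M ?U) (y # cs)"
    using koszul_cone_presented[OF Suc.prems(1) x(1)] by blast
  have "x \<in> ?U" using Q.a_rcos_self mm_deg[OF x(1)] by simp
  then have reg: "regular_element M ?U" using regular_element_presented[OF Suc.prems x(1)] x(2) by blast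
  then have "prime_dim R\<^sub>0 (insert y (set cs)) < prime_dim R\<^sub>0 (set cs)"
    using regular_element_presented[OF Suc.prems x(1) y(1)] by blast
  then have k: "k = prime_dim R\<^sub>0 (set (y # cs))"
    using R0.prime_dim_insert_ge[OF Suc.prems(2) y(2)] Suc.hyps(2) by simp
  have "set (y # cs) \<subseteq> \<mm>\<^sub>0" using Suc.prems(2) y(2) by simp
  from Suc.hyps(1)[OF k y(3) this Idl_Cons[OF Suc.prems(2) y(2) Suc.prems(3)]]
  obtain Us where Us: "set Us \<subseteq> max_ideal (H0 A)" "dg_regular_sequence A (koszul_cone A M ?U) Us"
    "length Us = prime_dim R\<^sub>0 (set (y # cs))" by blast
  then show ?case
    using reg x(1) k Suc.hyps(2) H0_local(2) by (intro exI[of _ "?U # Us"]) auto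
qed

theorem local_cohen_macaulay: "local_cohen_macaulay_dg_ring A"
proof -
  have J: "J \<subseteq> Idl\<^bsub>R\<^sub>0\<^esub> (set bs)" using J_eq by simp
  obtain Us where Us: "set Us \<subseteq> max_ideal (H0 A)" "dg_regular_sequence A (tree_dg_module (regular_dg_module A)) Us"
    "length Us = prime_dim R\<^sub>0 (set bs)" using exists_regular_sequence[OF presents_tree bs_local J] by blast
  have "seq_depth A (regular_dg_module A) = enat (prime_dim R\<^sub>0 (set bs))"
    unfolding seq_depth_def
  proof (intro antisym SUP_least)
    show "enat (length Us) \<le> enat (prime_dim R\<^sub>0 (set bs))"
      if "Us \<in> {Us. set Us \<subseteq> max_ideal (H0 A) \<and> dg_regular_sequence A (tree_dg_module (regular_dg_module A)) Us}" for Us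
      using regular_sequence_le_dim[OF presents_tree bs_local J] that by simp
    show "enat (prime_dim R\<^sub>0 (set bs)) \<le> (SUP Us\<in>{Us. set Us \<subseteq> max_ideal (H0 A) \<and>
        dg_regular_sequence A (tree_dg_module (regular_dg_module A)) Us}. enat (length Us))"
      unfolding Us(3)[symmetric] by (rule SUP_upper) (use Us in simp)
  qed
  then show ?thesis
    unfolding local_cohen_macaulay_dg_ring_def noetherian_local_dg_ring_def
    using noetherian bounded H0_local(1) krull_dim_H0 by simp
qed

end


section \<open>Cohen-Macaulay local rings\<close>

lemma (in noetherian_local) regular_sequence_weakly_regular:
  assumes "regular_sequence R ys"
  shows "weakly_regular ys"
  unfolding weakly_regular_def
proof (intro allI impI ballI)
  have ys: "set ys \<subseteq> carrier R" using assms unfolding regular_sequence_def by blast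
  fix i r assume i: "i < length ys" and r: "r \<in> carrier R" and yr: "ys ! i \<otimes> r \<in> Idl (set (take i ys))"
  let ?I = "Idl (set (take i ys))"
  have y: "ys ! i \<in> carrier R" using ys i by auto
  have "set (take i ys) \<subseteq> carrier R" using ys set_take_subset by fastforce
  then interpret Q: quotient_by_ideal ?I R
    by (intro quotient_by_ideal.intro genideal_ideal is_cring)
  have nzd: "nonzerodivisor (R Quot ?I) (?I +> ys ! i)"
    using assms i unfolding regular_sequence_def Let_def by blast
  note zero = Q.quotient_zero
  have "(?I +> ys ! i) \<otimes>\<^bsub>R Quot ?I\<^esub> (?I +> r) = ?I +> (ys ! i \<otimes> r)"
    using Q.proj.hom_mult[OF y r] by simp
  also have "\<dots> = \<zero>\<^bsub>R Quot ?I\<^esub>" using Q.coset_eq_J_iff[OF m_closed[OF y r]] yr zero by simp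
  finally have "?I +> r = \<zero>\<^bsub>R Quot ?I\<^esub>"
    using nzd Q.quotient_carrier r unfolding nonzerodivisor_def by blast
  then show "r \<in> ?I" using Q.coset_eq_J_iff[OF r] zero by simp
qed

text \<open>
  In particular the Krull dimension is finite, since regular sequences are not longer than a list of
  generators of the maximal ideal.
\<close>

lemma cohen_macaulay_local_ring_imp_local:
  assumes "cohen_macaulay_local_ring R"
  shows "\<exists>d. cohen_macaulay_local R d"
proof -
  have ax: "noetherian_ring R" "local_ring R" "local_depth R = krull_dim R"
    using assms unfolding cohen_macaulay_local_ring_def by simp_all
  have "cring R" using ax(2) unfolding local_ring_def by simp
  then interpret noetherian_local R
    by (intro noetherian_local.intro noetherian_cring.intro noetherian_local_axioms.intro ax)
  let ?A = "{ys. set ys \<subseteq> max_ideal R \<and> regular_sequence R ys}"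
  obtain k where k: "\<And>ys. set ys \<subseteq> max_ideal R \<and> weakly_regular ys \<Longrightarrow> length ys \<le> k"
    using regular_sequence_bounded by blast
  have "length ` ?A \<subseteq> {..k}" using k regular_sequence_weakly_regular by auto
  then have fin: "finite (length ` ?A)" using finite_subset by blast
  have "\<exists>ys. set ys \<subseteq> max_ideal R \<and> weakly_regular ys \<and> local_depth R = enat (length ys)"
  proof (cases "?A = {}")
    case True
    then have "local_depth R = enat (length ([] :: 'a list))" 
      unfolding local_depth_def True by (simp add: bot_enat_def zero_enat_def)
    then show ?thesis by (intro exI[of _ "[]"]) (simp add: weakly_regular_def)
  next
    case False
    then have "Max (length ` ?A) \<in> length ` ?A" using fin by (intro Max_in) auto
    then obtain ys where ys: "ys \<in> ?A" "Max (length ` ?A) = length ys" by blast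
    have "local_depth R = enat (length ys)"
      unfolding local_depth_def
    proof (intro antisym SUP_least)
      show "enat (length zs) \<le> enat (length ys)" if "zs \<in> ?A" for zs
        using that Max_ge[OF fin, of "length zs"] ys(2) by auto
      show "enat (length ys) \<le> (SUP xs\<in>?A. enat (length xs))" using ys(1) by (rule SUP_upper)
    qed
    then show ?thesis using ys(1) regular_sequence_weakly_regular by blast
  qed
  then obtain ys where ys: "set ys \<subseteq> max_ideal R" "weakly_regular ys" "local_depth R = enat (length ys)" by blast
  have "n \<le> length ys" if C: "prime_chain R {} n C" for n C
  proof -
    have "enat n \<le> krull_dim R"
      unfolding krull_dim_def by (rule SUP_upper) (use C in \<open>auto simp: prime_chain_def\<close>)
    then show ?thesis unfolding ax(3)[symmetric] ys(3) by simp
  qed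
  then have "cohen_macaulay_local R (length ys)"
    by (intro cohen_macaulay_local.intro noetherian_local_axioms cohen_macaulay_local_axioms.intro)
      (use ys in auto)
  then show ?thesis by blast
qed

lemma cohen_macaulay_local_iso:
  assumes R: "cohen_macaulay_local R d" and S: "cring S" and h: "h \<in> ring_iso R S"
  shows "cohen_macaulay_local S d"
proof -
  interpret R: cohen_macaulay_local R d by fact
  interpret S: cring S by fact
  have hom: "h \<in> ring_hom R S" and surj: "h ` carrier R = carrier S" and inj: "inj_on h (carrier R)"
    using h unfolding ring_iso_def bij_betw_def by auto
  interpret surjective_hom R S h
    by (intro surjective_hom.intro ring_hom_cring.intro ring_hom_cring_axioms.intro surjective_hom_axioms.intro
        R.is_cring S.is_cring hom surj)
  have ker: "a_kernel R S h = {\<zero>\<^bsub>R\<^esub>}"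
  proof (rule subset_antisym; rule subsetI)
    fix r assume "r \<in> a_kernel R S h"
    then have "r \<in> carrier R" "h r = h \<zero>\<^bsub>R\<^esub>" using ker_iff by simp_all
    then show "r \<in> {\<zero>\<^bsub>R\<^esub>}" using inj_onD[OF inj] by simp
  qed (simp add: ker_iff)
  have "ideal (max_ideal R) R" by (rule R.ideal_mm)
  then have le: "a_kernel R S h \<subseteq> max_ideal R"
    using ker additive_subgroup.zero_closed[OF ideal.axioms(1)] by auto
  note loc = image_local[OF R.noetherian_local_axioms le]
  have nl: "noetherian_local S"
    by (intro noetherian_local.intro noetherian_cring.intro noetherian_local_axioms.intro S.is_cring
        image_noetherian R.noetherian_ring_axioms loc(1))
  interpret S: noetherian_local S by (rule nl)
  obtain ys where ys: "set ys \<subseteq> max_ideal R" "R.weakly_regular ys" "length ys = d" using R.regular by blast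
  have ysc: "set ys \<subseteq> carrier R" using ys(1) R.mm_subset by blast
  have "S.weakly_regular (map h ys)"
    unfolding S.weakly_regular_def
  proof (intro allI impI ballI)
    fix i s assume i: "i < length (map h ys)" and s: "s \<in> carrier S"
      and ys_s: "map h ys ! i \<otimes>\<^bsub>S\<^esub> s \<in> Idl\<^bsub>S\<^esub> (set (take i (map h ys)))"
    have sub: "set (take i ys) \<subseteq> carrier R" using ysc set_take_subset by fastforce
    have eq: "Idl\<^bsub>S\<^esub> (set (take i (map h ys))) = h ` (Idl\<^bsub>R\<^esub> (set (take i ys)))"
      using image_Idl[OF sub] by (simp add: take_map)
    have I: "ideal (Idl\<^bsub>R\<^esub> (set (take i ys))) R" using R.genideal_ideal[OF sub] .
    have kI: "a_kernel R S h \<subseteq> Idl\<^bsub>R\<^esub> (set (take i ys))"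
      using ker additive_subgroup.zero_closed[OF ideal.axioms(1)[OF I]] by simp
    obtain r where r: "r \<in> carrier R" "s = h r" using s surj by blast
    have y: "ys ! i \<in> carrier R" using ysc i by auto
    have "h (ys ! i \<otimes>\<^bsub>R\<^esub> r) \<in> h ` (Idl\<^bsub>R\<^esub> (set (take i ys)))" using ys_s i r y eq by simp
    then have "ys ! i \<otimes>\<^bsub>R\<^esub> r \<in> Idl\<^bsub>R\<^esub> (set (take i ys))"
      by (rule iffD1[OF image_mem_iff[OF I kI R.m_closed[OF y r(1)]]])
    then have "r \<in> Idl\<^bsub>R\<^esub> (set (take i ys))"
      using ys(2) i r(1) unfolding R.weakly_regular_def by simp
    then show "s \<in> Idl\<^bsub>S\<^esub> (set (take i (map h ys)))" unfolding eq r(2) by (rule imageI)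
  qed
  moreover have "set (map h ys) \<subseteq> max_ideal S" using ys(1) loc(2) by auto
  moreover have "n \<le> d" if C: "prime_chain S {} n C" for n C
  proof -
    have "prime_chain R (a_kernel R S h) n (\<lambda>i. preimage (C i))"
      using C by (intro preimage_chain) (auto simp: prime_chain_def)
    then have "prime_chain R {} n (\<lambda>i. preimage (C i))" by (rule prime_chain_mono) simp
    then show ?thesis by (rule R.chain_bound)
  qed
  ultimately show ?thesis
    using ys(3) nl by (intro cohen_macaulay_local.intro cohen_macaulay_local_axioms.intro exI[of _ "map h ys"]) auto
qed


section \<open>The Koszul DG-ring and its localizations\<close>

lemma (in cring) koszul_comp_disjoint:
  "\<lbrakk>set xs \<subseteq> carrier R; w \<in> dgm_comp (koszul_complex R xs) m; w \<in> dgm_comp (koszul_complex R xs) n; m \<noteq> n\<rbrakk>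
    \<Longrightarrow> w = \<zero>\<^bsub>koszul_complex R xs\<^esub>"
  by (induction xs arbitrary: w m n) (auto elim!: cone_compE split: if_splits)

text \<open>
  The Koszul complex of the localized list is one localization of the Koszul complex, so it is isomorphic to any other.
\<close>

lemma (in localization_hom) koszul_presentation:
  assumes X: "cochain_complex R (koszul_complex R xs)" and Z: "cochain_complex R' Z"
    and xs: "set xs \<subseteq> carrier R" and g: "localization_map R S \<iota> (koszul_complex R xs) Z g"
  shows "\<exists>f. complex_iso R' (koszul_complex R' (map \<iota> xs)) Z f"
proof -
  have xs': "set (map \<iota> xs) \<subseteq> carrier R'" using xs hom_closed by auto
  show ?thesis
    by (rule localization_unique[OF X tree_complex.axioms[OF R'.koszul_complex[OF xs']] Z koszul_localization[OF xs] g])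
      (rule R'.koszul_comp_disjoint[OF xs'])
qed

locale koszul_data = noetherian_cring R for R (structure) +
  fixes as :: "'a list"
  assumes as_carrier: "set as \<subseteq> carrier R"
begin

abbreviation A :: "'a pair_tree dg_ring" where "A \<equiv> koszul_dg_ring R as"
abbreviation \<sigma> :: "'a \<Rightarrow> 'a pair_tree" where "\<sigma> \<equiv> koszul_scalar R as"

sublocale A: tree_dg_ring A
  by (rule koszul_dg_ring[OF as_carrier])

lemma complex: "tree_complex R (koszul_complex R as)"
  by (rule koszul_complex[OF as_carrier])

lemma \<sigma>_hom: "\<sigma> \<in> ring_hom R (degree_zero_ring A)"
  by (rule koszul_scalar_hom[OF as_carrier])

lemma \<sigma>_image: "\<sigma> ` carrier R = dg_comp A 0"
  using koszul_scalar_image[OF as_carrier] by (simp add: koszul_dg_ring_eq_complex)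

lemma \<sigma>_inj: "\<lbrakk>\<sigma> c = \<sigma> c'\<rbrakk> \<Longrightarrow> c = c'"
  using last_leaf_scalar by metis

lemma \<sigma>_props:
  "c \<in> carrier R \<Longrightarrow> \<sigma> c \<in> dg_comp A 0" "c \<in> carrier R \<Longrightarrow> \<sigma> c \<in> carrier A"
  "\<lbrakk>c \<in> carrier R; c' \<in> carrier R\<rbrakk> \<Longrightarrow> \<sigma> (c \<otimes> c') = \<sigma> c \<otimes>\<^bsub>A\<^esub> \<sigma> c'"
  "\<lbrakk>c \<in> carrier R; c' \<in> carrier R\<rbrakk> \<Longrightarrow> \<sigma> (c \<oplus> c') = \<sigma> c \<oplus>\<^bsub>A\<^esub> \<sigma> c'"
  "\<sigma> \<one> = \<one>\<^bsub>A\<^esub>" "\<sigma> \<zero> = \<zero>\<^bsub>A\<^esub>"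
proof -
  show 1: "c \<in> carrier R \<Longrightarrow> \<sigma> c \<in> dg_comp A 0" using ring_hom_closed[OF \<sigma>_hom, of c] by simp
  show "c \<in> carrier R \<Longrightarrow> \<sigma> c \<in> carrier A" using A.comp_carrier[OF 1] .
  show "\<lbrakk>c \<in> carrier R; c' \<in> carrier R\<rbrakk> \<Longrightarrow> \<sigma> (c \<otimes> c') = \<sigma> c \<otimes>\<^bsub>A\<^esub> \<sigma> c'"
    using ring_hom_mult[OF \<sigma>_hom] by simp
  show "\<lbrakk>c \<in> carrier R; c' \<in> carrier R\<rbrakk> \<Longrightarrow> \<sigma> (c \<oplus> c') = \<sigma> c \<oplus>\<^bsub>A\<^esub> \<sigma> c'"
    using ring_hom_add[OF \<sigma>_hom] by simp
  show "\<sigma> \<one> = \<one>\<^bsub>A\<^esub>" using ring_hom_one[OF \<sigma>_hom] by simp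
  show "\<sigma> \<zero> = \<zero>\<^bsub>A\<^esub>"
    using ring_hom_zero[OF \<sigma>_hom ring_axioms cring.axioms(1)[OF A.cring_degree_zero]] by simp
qed

lemma \<sigma>E:
  assumes "a \<in> dg_comp A 0"
  obtains c where "c \<in> carrier R" "a = \<sigma> c"
  using assms \<sigma>_image by blast

sublocale \<sigma>: surjective_hom R "degree_zero_ring A" \<sigma>
  by (intro surjective_hom.intro ring_hom_cring.intro ring_hom_cring_axioms.intro surjective_hom_axioms.intro
      is_cring A.cring_degree_zero \<sigma>_hom) (simp add: \<sigma>_image)

lemma smult_eq: "\<lbrakk>c \<in> carrier R; t \<in> dgm_comp (koszul_complex R as) n\<rbrakk> \<Longrightarrow>
    c \<odot>\<^bsub>koszul_complex R as\<^esub> t = \<sigma> c \<otimes>\<^bsub>A\<^esub> t"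
  using koszul_smult_eq[OF as_carrier] cochain_complex.comp_carrier[OF tree_complex.axioms[OF complex]] by blast

lemma diff_eq: "t \<in> dgm_comp (koszul_complex R as) n \<Longrightarrow> dgm_diff (koszul_complex R as) t = dg_diff A t"
  using koszul_diff_eq[OF as_carrier] cochain_complex.comp_carrier[OF tree_complex.axioms[OF complex]] by blast

lemma comp_eq: "dgm_comp (koszul_complex R as) n = dg_comp A n"
  by (simp add: koszul_dg_ring_eq_complex)

lemma coboundaries_eq: "coboundaries (regular_dg_module A) n = coboundaries (koszul_complex R as) n"
  unfolding coboundaries_def using diff_eq[of _ "n - 1"] by (simp add: comp_eq)

lemma scalar_in_boundaries_iff:
  "c \<in> carrier R \<Longrightarrow> \<sigma> c \<in> coboundaries (regular_dg_module A) 0 \<longleftrightarrow> c \<in> Idl (set as)"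
  using koszul_coboundaries_zero[OF as_carrier koszul_scalar_comp[OF as_carrier]]
  by (simp add: coboundaries_eq last_leaf_scalar)

lemma noetherian_degree_zero: "noetherian_cring (degree_zero_ring A)"
  by (intro noetherian_cring.intro A.cring_degree_zero \<sigma>.image_noetherian noetherian_ring_axioms)

text \<open>The case of the trivial localization.\<close>

theorem presented: "koszul_presented A (map \<sigma> as)"
proof -
  interpret L: localization_hom R "degree_zero_ring A" "{\<one>}" \<sigma>
  proof (intro localization_hom.intro localization_hom_axioms.intro is_cring A.cring_degree_zero \<sigma>_hom)
    show "\<sigma> s \<in> Units (degree_zero_ring A)" if "s \<in> {\<one>}" for s
    proof -
      have "\<one>\<^bsub>degree_zero_ring A\<^esub> \<in> Units (degree_zero_ring A)"
        using \<sigma>.S.Units_one_closed .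
      then show ?thesis using that \<sigma>_props(5) by simp
    qed
    show "\<sigma> r = \<zero>\<^bsub>degree_zero_ring A\<^esub> \<longleftrightarrow> (\<exists>s\<in>{\<one>}. s \<otimes> r = \<zero>)" if "r \<in> carrier R" for r
      using that \<sigma>_props(6) \<sigma>_inj[of r \<zero>] by auto
    show "\<exists>s\<in>{\<one>}. \<exists>r\<in>carrier R. \<sigma> s \<otimes>\<^bsub>degree_zero_ring A\<^esub> r' = \<sigma> r"
      if "r' \<in> carrier (degree_zero_ring A)" for r'
    proof -
      have r': "r' \<in> dg_comp A 0" using that by simp
      then obtain c where "c \<in> carrier R" "r' = \<sigma> c" by (rule \<sigma>E)
      then show ?thesis using \<sigma>_props(2)[of c] by (auto simp: \<sigma>_props(5))
    qed
  qed auto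
  interpret K: tree_complex R "koszul_complex R as" by (rule complex)
  have "localization_map R {\<one>} \<sigma> (koszul_complex R as) (regular_dg_module A) (\<lambda>t. t)"
    unfolding localization_map_def
  proof (intro allI conjI ballI)
    fix n t assume t: "t \<in> dgm_comp (koszul_complex R as) n"
    show "t \<in> dgm_comp (regular_dg_module A) n" using t comp_eq by simp
    show "dgm_diff (koszul_complex R as) t = dgm_diff (regular_dg_module A) t" using diff_eq[OF t] by simp
    show "c \<odot>\<^bsub>koszul_complex R as\<^esub> t = \<sigma> c \<odot>\<^bsub>regular_dg_module A\<^esub> t" if "c \<in> carrier R" for c
      using smult_eq[OF that t] by simp
    show "t \<oplus>\<^bsub>koszul_complex R as\<^esub> u = t \<oplus>\<^bsub>regular_dg_module A\<^esub> u" for u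
      by (simp add: koszul_dg_ring_eq_complex)
    show "t = \<zero>\<^bsub>regular_dg_module A\<^esub> \<longleftrightarrow> (\<exists>s\<in>{\<one>}. s \<odot>\<^bsub>koszul_complex R as\<^esub> t = \<zero>\<^bsub>koszul_complex R as\<^esub>)"
      using K.comp_carrier[OF t] by (simp add: koszul_dg_ring_eq_complex)
  next
    fix n w assume w: "w \<in> dgm_comp (regular_dg_module A) n"
    then have "w \<in> carrier A" using A.comp_carrier by simp
    then show "\<exists>s\<in>{\<one>}. \<exists>u\<in>dgm_comp (koszul_complex R as) n. \<sigma> s \<odot>\<^bsub>regular_dg_module A\<^esub> w = u"
      using w comp_eq \<sigma>_props(5) by simp
  qed
  from L.koszul_presentation[OF tree_complex.axioms[OF complex] A.regular_complex as_carrier this]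
  show ?thesis
    using \<sigma>_props(1) as_carrier
    by (intro koszul_presented.intro A.dg_ring_axioms noetherian_degree_zero koszul_presented_axioms.intro) auto
qed

end

locale localized_koszul_data = koszul_data R as + den: dg_denominators "koszul_dg_ring R as" S
  for R (structure) and as S
begin

abbreviation T :: "'a set" where "T \<equiv> {c \<in> carrier R. \<sigma> c \<in> S}"
abbreviation F :: "('a pair_tree \<times> 'a pair_tree) set dg_ring" where "F \<equiv> dg_fraction_ring A S"
abbreviation frac where "frac \<equiv> fraction A S"
abbreviation \<iota> where "\<iota> c \<equiv> frac (\<sigma> c) \<one>\<^bsub>A\<^esub>"

lemma S_scalar:
  assumes "s \<in> S"
  obtains t where "t \<in> T" "s = \<sigma> t"
proof -
  obtain c where "c \<in> carrier R" "s = \<sigma> c" using den.S_deg[OF assms] by (rule \<sigma>E)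
  then show thesis using that assms by simp
qed

lemma T_mult: "\<lbrakk>s \<in> T; t \<in> T\<rbrakk> \<Longrightarrow> s \<otimes> t \<in> T"
  using den.S_mult \<sigma>_props(3) by simp

lemma T_one: "\<one> \<in> T"
  using den.S_one \<sigma>_props(5) by simp

sublocale frF: dg_ring F
  by (rule den.dg_ring_F)

lemma F0_carrier: "U \<in> dg_comp F 0 \<Longrightarrow> \<exists>c t. c \<in> carrier R \<and> t \<in> T \<and> U = frac (\<sigma> c) (\<sigma> t)"
proof -
  assume "U \<in> dg_comp F 0"
  then obtain a s where U: "U = frac a s" "a \<in> dg_comp A 0" "s \<in> S" by (rule den.F_compE)
  obtain c where "c \<in> carrier R" "a = \<sigma> c" using U(2) by (rule \<sigma>E)
  moreover obtain t where "t \<in> T" "s = \<sigma> t" using U(3) by (rule S_scalar)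
  ultimately show ?thesis using U(1) by blast
qed

lemma scalar_fraction_eq_iff:
  assumes "c \<in> carrier R" "s \<in> T" "c' \<in> carrier R" "s' \<in> T"
  shows "frac (\<sigma> c) (\<sigma> s) = frac (\<sigma> c') (\<sigma> s') \<longleftrightarrow> (\<exists>u\<in>T. u \<otimes> (s' \<otimes> c) = u \<otimes> (s \<otimes> c'))"
proof -
  have "frac (\<sigma> c) (\<sigma> s) = frac (\<sigma> c') (\<sigma> s') \<longleftrightarrow>
      (\<exists>u\<in>S. u \<otimes>\<^bsub>A\<^esub> (\<sigma> s' \<otimes>\<^bsub>A\<^esub> \<sigma> c) = u \<otimes>\<^bsub>A\<^esub> (\<sigma> s \<otimes>\<^bsub>A\<^esub> \<sigma> c'))"
    using assms \<sigma>_props(2) by (intro den.Z.fraction_eq_iff) auto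
  also have "\<dots> \<longleftrightarrow> (\<exists>u\<in>T. \<sigma> u \<otimes>\<^bsub>A\<^esub> (\<sigma> s' \<otimes>\<^bsub>A\<^esub> \<sigma> c) = \<sigma> u \<otimes>\<^bsub>A\<^esub> (\<sigma> s \<otimes>\<^bsub>A\<^esub> \<sigma> c'))"
  proof
    assume "\<exists>u\<in>S. u \<otimes>\<^bsub>A\<^esub> (\<sigma> s' \<otimes>\<^bsub>A\<^esub> \<sigma> c) = u \<otimes>\<^bsub>A\<^esub> (\<sigma> s \<otimes>\<^bsub>A\<^esub> \<sigma> c')"
    then obtain u where u: "u \<in> S" "u \<otimes>\<^bsub>A\<^esub> (\<sigma> s' \<otimes>\<^bsub>A\<^esub> \<sigma> c) = u \<otimes>\<^bsub>A\<^esub> (\<sigma> s \<otimes>\<^bsub>A\<^esub> \<sigma> c')" by blast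
    obtain v where "v \<in> T" "u = \<sigma> v" using u(1) by (rule S_scalar)
    then show "\<exists>u\<in>T. \<sigma> u \<otimes>\<^bsub>A\<^esub> (\<sigma> s' \<otimes>\<^bsub>A\<^esub> \<sigma> c) = \<sigma> u \<otimes>\<^bsub>A\<^esub> (\<sigma> s \<otimes>\<^bsub>A\<^esub> \<sigma> c')" using u(2) by blast
  qed blast
  also have "\<dots> \<longleftrightarrow> (\<exists>u\<in>T. \<sigma> (u \<otimes> (s' \<otimes> c)) = \<sigma> (u \<otimes> (s \<otimes> c')))"
    using assms by (intro bex_cong) (simp_all add: \<sigma>_props(3))
  also have "\<dots> \<longleftrightarrow> (\<exists>u\<in>T. u \<otimes> (s' \<otimes> c) = u \<otimes> (s \<otimes> c'))"
    using \<sigma>_inj by (intro bex_cong) auto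
  finally show ?thesis .
qed

sublocale Tden: central_denominators R T
  by unfold_locales (use T_mult T_one m_comm in auto)

declare Tden.S_mem [simp del]

text \<open>All denominators are scalars, so the fractions of degree zero are fractions of elements of \<open>R\<close>.\<close>

lemma fraction_ring_iso: "\<exists>h. h \<in> ring_iso (fraction_ring R T) (degree_zero_ring F)"
proof -
  define h where "h = (\<lambda>U. \<Union>(c, s)\<in>U. frac (\<sigma> c) (\<sigma> s))"
  have h: "h (fraction R T c s) = frac (\<sigma> c) (\<sigma> s)" if cs: "c \<in> carrier R" "s \<in> T" for c s
    unfolding h_def
  proof (rule Tden.fraction_union[OF cs])
    fix b t assume "(b, t) \<in> fraction R T c s"
    then have bt: "b \<in> carrier R \<and> t \<in> T \<and> (\<exists>u\<in>T. u \<otimes> (t \<otimes> c) = u \<otimes> (s \<otimes> b))"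
      unfolding Tden.fraction_mem_iff .
    then have "frac (\<sigma> c) (\<sigma> s) = frac (\<sigma> b) (\<sigma> t)"
      by (intro iffD2[OF scalar_fraction_eq_iff[OF cs, of b t]]) (elim conjE, assumption)+
    then show "frac (\<sigma> b) (\<sigma> t) = frac (\<sigma> c) (\<sigma> s)" by simp
  qed
  note [simp] = \<sigma>_props
  have TR: "t \<in> carrier R" "\<sigma> t \<in> S" if "t \<in> T" for t using that by simp_all
  have "h \<in> ring_iso (fraction_ring R T) (degree_zero_ring F)"
  proof (rule ring_iso_memI)
    fix U assume "U \<in> carrier (fraction_ring R T)"
    then obtain c s where U: "U = fraction R T c s" "c \<in> carrier R" "s \<in> T" by (rule Tden.fractionE)
    show "h U \<in> carrier (degree_zero_ring F)" using U h[OF U(2,3)] den.F_compI[of "\<sigma> c" 0 "\<sigma> s"] by simp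
    fix V assume "V \<in> carrier (fraction_ring R T)"
    then obtain b t where V: "V = fraction R T b t" "b \<in> carrier R" "t \<in> T" by (rule Tden.fractionE)
    note hU = h[OF U(2,3)] and hV = h[OF V(2,3)]
    have st: "s \<otimes> t \<in> T" using T_mult[OF U(3) V(3)] .
    show "h (U \<otimes>\<^bsub>fraction_ring R T\<^esub> V) = h U \<otimes>\<^bsub>degree_zero_ring F\<^esub> h V"
      using U V TR[OF U(3)] TR[OF V(3)] h[OF m_closed[OF U(2) V(2)] st] hU hV
      by (simp add: Tden.fraction_mult den.Z.fraction_mult)
    have sum: "t \<otimes> c \<oplus> s \<otimes> b \<in> carrier R"
      using U(2) V(2) TR(1)[OF U(3)] TR(1)[OF V(3)] by simp
    show "h (U \<oplus>\<^bsub>fraction_ring R T\<^esub> V) = h U \<oplus>\<^bsub>degree_zero_ring F\<^esub> h V"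
      using U V TR[OF U(3)] TR[OF V(3)] h[OF sum st] hU hV
      by (simp add: Tden.fraction_add den.Z.fraction_add)
  next
    show "h \<one>\<^bsub>fraction_ring R T\<^esub> = \<one>\<^bsub>degree_zero_ring F\<^esub>"
      using h[OF one_closed T_one] by (simp add: Tden.fraction_one den.Z.fraction_one)
    show "bij_betw h (carrier (fraction_ring R T)) (carrier (degree_zero_ring F))"
      unfolding bij_betw_def
    proof
      show "inj_on h (carrier (fraction_ring R T))"
      proof (rule inj_onI)
        fix U V assume "U \<in> carrier (fraction_ring R T)" "V \<in> carrier (fraction_ring R T)" and eq: "h U = h V"
        then obtain c s b t where U: "U = fraction R T c s" "c \<in> carrier R" "s \<in> T"
          and V: "V = fraction R T b t" "b \<in> carrier R" "t \<in> T" by (elim Tden.fractionE)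
        then show "U = V"
          using eq h scalar_fraction_eq_iff[OF U(2,3) V(2,3)] Tden.fraction_eq_iff[OF U(2,3) V(2,3)] by simp
      qed
      show "h ` carrier (fraction_ring R T) = carrier (degree_zero_ring F)"
      proof (rule subset_antisym; rule subsetI)
        fix V assume "V \<in> h ` carrier (fraction_ring R T)"
        then obtain U where "V = h U" "U \<in> carrier (fraction_ring R T)" by blast
        moreover obtain c s where "U = fraction R T c s" "c \<in> carrier R" "s \<in> T"
          using calculation(2) by (rule Tden.fractionE)
        ultimately show "V \<in> carrier (degree_zero_ring F)"
          using h[of c s] den.F_compI[of "\<sigma> c" 0 "\<sigma> s"] by simp
      next
        fix V assume "V \<in> carrier (degree_zero_ring F)"
        then have "V \<in> dg_comp F 0" by simp
        then obtain c t where "c \<in> carrier R" "t \<in> T" "V = frac (\<sigma> c) (\<sigma> t)" using F0_carrier by blast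
        then show "V \<in> h ` carrier (fraction_ring R T)"
          using h[of c t] Tden.fraction_closed[of c t] by (intro image_eqI[of _ _ "fraction R T c t"]) simp_all
      qed
    qed
  qed
  then show ?thesis by blast
qed

lemma localization: "localization_hom R (degree_zero_ring F) T \<iota>"
proof (intro localization_hom.intro localization_hom_axioms.intro is_cring frF.cring_degree_zero)
  note [simp] = \<sigma>_props
  have one: "\<one>\<^bsub>A\<^esub> \<in> S" using den.S_one .
  show "\<iota> \<in> ring_hom R (degree_zero_ring F)"
  proof (rule ring_hom_memI)
    show "\<iota> c \<in> carrier (degree_zero_ring F)" if "c \<in> carrier R" for c
      using den.F_compI[of "\<sigma> c" 0] that one by simp
    show "\<iota> (c \<otimes> c') = \<iota> c \<otimes>\<^bsub>degree_zero_ring F\<^esub> \<iota> c'" if "c \<in> carrier R" "c' \<in> carrier R" for c c'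
      using that one by (simp add: den.Z.fraction_mult)
    show "\<iota> (c \<oplus> c') = \<iota> c \<oplus>\<^bsub>degree_zero_ring F\<^esub> \<iota> c'" if "c \<in> carrier R" "c' \<in> carrier R" for c c'
      using that den.frac_add_same[of "\<sigma> c" "\<sigma> c'" "\<one>\<^bsub>A\<^esub>"] one by simp
    show "\<iota> \<one> = \<one>\<^bsub>degree_zero_ring F\<^esub>" by (simp add: den.Z.fraction_one)
  qed
  show "\<iota> s \<in> Units (degree_zero_ring F)" if s: "s \<in> T" for s
  proof -
    interpret F0: cring "degree_zero_ring F" by (rule frF.cring_degree_zero)
    have sS: "\<sigma> s \<in> S" "\<sigma> s \<in> carrier A" using s by simp_all
    have c: "\<iota> s \<in> dg_comp F 0" "frac \<one>\<^bsub>A\<^esub> (\<sigma> s) \<in> dg_comp F 0"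
      using den.F_compI[of "\<sigma> s" 0] den.F_compI[OF A.one_comp] s one by simp_all
    have "\<iota> s \<otimes>\<^bsub>F\<^esub> frac \<one>\<^bsub>A\<^esub> (\<sigma> s) = frac (\<sigma> s) (\<sigma> s)"
      using sS one by (simp add: den.Z.fraction_mult)
    also have "\<dots> = \<one>\<^bsub>F\<^esub>"
      using sS one by (simp add: den.Z.fraction_one, intro den.Z.fraction_eqI) simp_all
    finally have 1: "\<iota> s \<otimes>\<^bsub>F\<^esub> frac \<one>\<^bsub>A\<^esub> (\<sigma> s) = \<one>\<^bsub>F\<^esub>" .
    then have "frac \<one>\<^bsub>A\<^esub> (\<sigma> s) \<otimes>\<^bsub>F\<^esub> \<iota> s = \<one>\<^bsub>F\<^esub>" using F0.m_comm[of "\<iota> s" "frac \<one>\<^bsub>A\<^esub> (\<sigma> s)"] c by simp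
    then show ?thesis using 1 c unfolding Units_def by auto
  qed
  show "\<iota> r = \<zero>\<^bsub>degree_zero_ring F\<^esub> \<longleftrightarrow> (\<exists>s\<in>T. s \<otimes> r = \<zero>)" if r: "r \<in> carrier R" for r
  proof -
    have "\<iota> r = \<zero>\<^bsub>degree_zero_ring F\<^esub> \<longleftrightarrow> frac (\<sigma> r) (\<sigma> \<one>) = frac (\<sigma> \<zero>) (\<sigma> \<one>)"
      by (simp add: den.Z.fraction_zero)
    also have "\<dots> \<longleftrightarrow> (\<exists>u\<in>T. u \<otimes> (\<one> \<otimes> r) = u \<otimes> (\<one> \<otimes> \<zero>))"
      using r T_one by (intro scalar_fraction_eq_iff) simp_all
    also have "\<dots> \<longleftrightarrow> (\<exists>s\<in>T. s \<otimes> r = \<zero>)" using r by (intro bex_cong) simp_all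
    finally show ?thesis .
  qed
  show "\<exists>s\<in>T. \<exists>r\<in>carrier R. \<iota> s \<otimes>\<^bsub>degree_zero_ring F\<^esub> r' = \<iota> r" if "r' \<in> carrier (degree_zero_ring F)" for r'
  proof -
    have "r' \<in> dg_comp F 0" using that by simp
    then obtain c t where ct: "c \<in> carrier R" "t \<in> T" "r' = frac (\<sigma> c) (\<sigma> t)" using F0_carrier by blast
    have "\<iota> t \<otimes>\<^bsub>F\<^esub> r' = frac (\<sigma> t \<otimes>\<^bsub>A\<^esub> \<sigma> c) (\<sigma> t)" using ct one by (simp add: den.Z.fraction_mult)
    also have "\<dots> = \<iota> c" using ct one by (intro den.Z.fraction_eqI) simp_all
    finally show ?thesis using ct by (intro bexI[of _ t] bexI[of _ c]) simp_all
  qed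
qed (use T_mult T_one in auto)

text \<open>
  Fractions of elements of the Koszul complex have scalar denominators, so \<open>F\<close> is a localization of it as a complex.
\<close>

lemma localized_koszul_presentation:
  "\<exists>f. complex_iso (degree_zero_ring F) (koszul_complex (degree_zero_ring F) (map \<iota> as)) (regular_dg_module F) f"
proof -
  interpret L: localization_hom R "degree_zero_ring F" T \<iota> by (rule localization)
  have one: "\<one>\<^bsub>A\<^esub> \<in> S" using den.S_one .
  have "localization_map R T \<iota> (koszul_complex R as) (regular_dg_module F) (\<lambda>t. frac t \<one>\<^bsub>A\<^esub>)"
    unfolding localization_map_def
  proof (intro allI conjI ballI)
    fix n t assume t: "t \<in> dgm_comp (koszul_complex R as) n"
    have tA: "t \<in> dg_comp A n" using t comp_eq by simp
    note tc = A.comp_carrier[OF tA]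
    show "frac t \<one>\<^bsub>A\<^esub> \<in> dgm_comp (regular_dg_module F) n" using den.F_compI[OF tA one] by simp
    show "frac (dgm_diff (koszul_complex R as) t) \<one>\<^bsub>A\<^esub> = dgm_diff (regular_dg_module F) (frac t \<one>\<^bsub>A\<^esub>)"
      using diff_eq[OF t] den.F_diff[OF tc one] by simp
    show "frac (c \<odot>\<^bsub>koszul_complex R as\<^esub> t) \<one>\<^bsub>A\<^esub> = \<iota> c \<odot>\<^bsub>regular_dg_module F\<^esub> frac t \<one>\<^bsub>A\<^esub>"
      if "c \<in> carrier R" for c
      using smult_eq[OF that t] \<sigma>_props(2)[OF that] tc one by (simp add: den.Z.fraction_mult)
    show "frac (t \<oplus>\<^bsub>koszul_complex R as\<^esub> u) \<one>\<^bsub>A\<^esub> = frac t \<one>\<^bsub>A\<^esub> \<oplus>\<^bsub>regular_dg_module F\<^esub> frac u \<one>\<^bsub>A\<^esub>"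
      if "u \<in> dgm_comp (koszul_complex R as) n" for u
    proof -
      have "u \<in> carrier A" using that comp_eq A.comp_carrier by simp
      then show ?thesis using den.frac_add_same[OF tc _ one] by (simp add: koszul_dg_ring_eq_complex)
    qed
    have "frac t \<one>\<^bsub>A\<^esub> = \<zero>\<^bsub>F\<^esub> \<longleftrightarrow> (\<exists>u\<in>S. u \<otimes>\<^bsub>A\<^esub> t = \<zero>\<^bsub>A\<^esub>)" by (rule den.frac_eq_zero_iff[OF tc one])
    also have "\<dots> \<longleftrightarrow> (\<exists>s\<in>T. \<sigma> s \<otimes>\<^bsub>A\<^esub> t = \<zero>\<^bsub>A\<^esub>)"
    proof
      assume "\<exists>u\<in>S. u \<otimes>\<^bsub>A\<^esub> t = \<zero>\<^bsub>A\<^esub>"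
      then obtain u where u: "u \<in> S" "u \<otimes>\<^bsub>A\<^esub> t = \<zero>\<^bsub>A\<^esub>" by blast
      obtain v where "v \<in> T" "u = \<sigma> v" using u(1) by (rule S_scalar)
      then show "\<exists>s\<in>T. \<sigma> s \<otimes>\<^bsub>A\<^esub> t = \<zero>\<^bsub>A\<^esub>" using u(2) by blast
    qed blast
    also have "\<dots> \<longleftrightarrow> (\<exists>s\<in>T. s \<odot>\<^bsub>koszul_complex R as\<^esub> t = \<zero>\<^bsub>koszul_complex R as\<^esub>)"
      using smult_eq[OF _ t] by (intro bex_cong) (simp_all add: koszul_dg_ring_eq_complex)
    finally show "frac t \<one>\<^bsub>A\<^esub> = \<zero>\<^bsub>regular_dg_module F\<^esub> \<longleftrightarrow>
        (\<exists>s\<in>T. s \<odot>\<^bsub>koszul_complex R as\<^esub> t = \<zero>\<^bsub>koszul_complex R as\<^esub>)" by simp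
  next
    fix n w assume "w \<in> dgm_comp (regular_dg_module F) n"
    then have "w \<in> dg_comp F n" by simp
    then obtain a s where w: "w = frac a s" "a \<in> dg_comp A n" "s \<in> S" by (rule den.F_compE)
    obtain t where t: "t \<in> T" "s = \<sigma> t" using w(3) by (rule S_scalar)
    have "\<iota> t \<otimes>\<^bsub>F\<^esub> w = frac (s \<otimes>\<^bsub>A\<^esub> a) s"
      using w t one A.comp_carrier[OF w(2)] by (simp add: den.Z.fraction_mult)
    also have "\<dots> = frac a \<one>\<^bsub>A\<^esub>"
      using w one A.comp_carrier[OF w(2)] by (intro den.Z.fraction_eqI) simp_all
    finally show "\<exists>s\<in>T. \<exists>u\<in>dgm_comp (koszul_complex R as) n. \<iota> s \<odot>\<^bsub>regular_dg_module F\<^esub> w = frac u \<one>\<^bsub>A\<^esub>"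
      using t(1) w(2) comp_eq by (intro bexI[of _ t] bexI[of _ a]) simp_all
  qed
  from L.koszul_presentation[OF tree_complex.axioms[OF complex] frF.regular_complex as_carrier this]
  show ?thesis .
qed

end

context koszul_data
begin

sublocale AP: koszul_presented A "map \<sigma> as"
  by (rule presented)

text \<open>
  The prime \<open>P\<close> of \<open>H\<^sup>0(A)\<close> corresponds to a prime of \<open>R\<close> that contains the list, so the list maps into the maximal
  ideal of the localization.
\<close>

lemma localization_cohen_macaulay:
  assumes CM: "\<And>P. primeideal P R \<Longrightarrow> cohen_macaulay_local_ring (localization R P)"
    and P: "primeideal P (H0 A)"
  shows "local_cohen_macaulay_dg_ring (dg_localization A P)"
proof -
  define \<pp> where "\<pp> = AP.Q.proj.preimage P"
  have P': "primeideal P (degree_zero_ring A Quot AP.J)" using P unfolding AP.H0_eq_Q .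
  have \<pp>: "primeideal \<pp> (degree_zero_ring A)" unfolding \<pp>_def by (rule AP.Q.proj.preimage_prime[OF P'])
  have J\<pp>: "AP.J \<subseteq> \<pp>"
    using AP.Q.proj.ker_le_preimage[OF primeideal.axioms(1)[OF P']] unfolding AP.Q.proj_kernel \<pp>_def .
  have pi: "pi_preimage A P = \<pp>"
    unfolding pi_preimage_def \<pp>_def AP.Q.proj.preimage_def by (simp add: AP.coset_R0)
  define S where "S = dg_comp A 0 - \<pp>"
  note one_notin = cring.primeideal_one[OF A.cring_degree_zero \<pp>]
    and mult_notin = cring.prime_notin_mult[OF A.cring_degree_zero \<pp>]
  interpret localized_koszul_data R as S
  proof (intro localized_koszul_data.intro koszul_data_axioms dg_denominators.intro A.dg_ring_axioms dg_denominators_axioms.intro)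
    show "S \<subseteq> dg_comp A 0" by (simp add: S_def)
    show "\<one>\<^bsub>A\<^esub> \<in> S" using one_notin A.one_comp by (simp add: S_def)
    show "s \<otimes>\<^bsub>A\<^esub> t \<in> S" if "s \<in> S" "t \<in> S" for s t
      using mult_notin[of s t] A.mult_comp[of s 0 t 0] that by (simp add: S_def)
  qed
  have loc: "dg_localization A P = F" unfolding dg_localization_def pi S_def ..
  have T: "T = carrier R - \<sigma>.preimage \<pp>"
    using \<sigma>_props(1) by (auto simp: S_def \<sigma>.preimage_def)
  have "cohen_macaulay_local_ring (fraction_ring R T)"
    using CM[OF \<sigma>.preimage_prime[OF \<pp>]] unfolding localization_def T .
  then obtain d where d: "cohen_macaulay_local (fraction_ring R T) d"
    using cohen_macaulay_local_ring_imp_local by blast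
  obtain h where "h \<in> ring_iso (fraction_ring R T) (degree_zero_ring F)" using fraction_ring_iso by blast
  then have cm: "cohen_macaulay_local (degree_zero_ring F) d"
    by (rule cohen_macaulay_local_iso[OF d frF.cring_degree_zero])
  interpret F0: cohen_macaulay_local "degree_zero_ring F" d by (rule cm)
  have \<iota>0: "\<iota> a \<in> dg_comp F 0" if "a \<in> set as" for a
    using den.F_compI[OF \<sigma>_props(1) den.S_one] that as_carrier by blast
  have "\<iota> a \<in> max_ideal (degree_zero_ring F)" if a: "a \<in> set as" for a
  proof (rule ccontr)
    assume "\<iota> a \<notin> max_ideal (degree_zero_ring F)"
    then have "\<iota> a \<in> Units (degree_zero_ring F)" using F0.unit_of_notin_mm \<iota>0[OF a] by simp
    then obtain V where V: "V \<in> dg_comp F 0" "\<iota> a \<otimes>\<^bsub>F\<^esub> V = \<one>\<^bsub>F\<^esub>" unfolding Units_def by auto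
    obtain b t where bt: "V = frac b t" "b \<in> dg_comp A 0" "t \<in> S" using V(1) by (rule den.F_compE)
    have ac: "a \<in> carrier R" using a as_carrier by blast
    note c = \<sigma>_props(2)[OF ac] A.comp_carrier[OF bt(2)] den.Z.S_mem[OF bt(3)]
    have "frac (\<sigma> a \<otimes>\<^bsub>A\<^esub> b) t = frac \<one>\<^bsub>A\<^esub> \<one>\<^bsub>A\<^esub>"
      using V(2) bt(1,3) c den.S_one by (simp add: den.Z.fraction_mult den.Z.fraction_one)
    then have "\<exists>u\<in>S. u \<otimes>\<^bsub>A\<^esub> (\<one>\<^bsub>A\<^esub> \<otimes>\<^bsub>A\<^esub> (\<sigma> a \<otimes>\<^bsub>A\<^esub> b)) = u \<otimes>\<^bsub>A\<^esub> (t \<otimes>\<^bsub>A\<^esub> \<one>\<^bsub>A\<^esub>)"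
      using c bt(3) den.S_one den.Z.fraction_eq_iff[of "\<sigma> a \<otimes>\<^bsub>A\<^esub> b" t "\<one>\<^bsub>A\<^esub>" "\<one>\<^bsub>A\<^esub>"] by simp
    then obtain u where u: "u \<in> S" "u \<otimes>\<^bsub>A\<^esub> (\<sigma> a \<otimes>\<^bsub>A\<^esub> b) = u \<otimes>\<^bsub>A\<^esub> t" using c by auto
    have "a \<in> Idl (set as)" using a genideal_self[OF as_carrier] by blast
    then have "\<sigma> a \<in> \<pp>" using scalar_in_boundaries_iff[OF ac] J\<pp> by blast
    moreover interpret \<pp>: primeideal \<pp> "degree_zero_ring A" by (rule \<pp>)
    have "\<sigma> a \<otimes>\<^bsub>A\<^esub> b \<in> \<pp>" using \<pp>.I_r_closed[OF calculation, of b] bt(2) by simp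
    then have "u \<otimes>\<^bsub>A\<^esub> (\<sigma> a \<otimes>\<^bsub>A\<^esub> b) \<in> \<pp>" using \<pp>.I_l_closed[of "\<sigma> a \<otimes>\<^bsub>A\<^esub> b" u] den.S_deg[OF u(1)] by simp
    moreover have "u \<otimes>\<^bsub>A\<^esub> t \<in> S" using den.S_mult[OF u(1) bt(3)] .
    ultimately show False using u(2) by (simp add: S_def)
  qed
  then have "koszul_presented_cm F (map \<iota> as) d"
    using \<iota>0 localized_koszul_presentation
    by (intro koszul_presented_cm.intro koszul_presented_cm_axioms.intro koszul_presented.intro frF.dg_ring_axioms
        F0.noetherian_cring_axioms koszul_presented_axioms.intro cm) auto
  then show ?thesis unfolding loc by (rule koszul_presented_cm.local_cohen_macaulay)
qed

lemma H0_iso: "R Quot (Idl (set as)) \<simeq> H0 A"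
proof -
  have g: "(\<lambda>c. AP.J +>\<^bsub>degree_zero_ring A\<^esub> \<sigma> c) \<in> ring_hom R (degree_zero_ring A Quot AP.J)"
    using ring_hom_trans[OF \<sigma>_hom AP.Q.proj.homh] by (simp add: comp_def)
  interpret comp: ring_hom_ring R "degree_zero_ring A Quot AP.J" "\<lambda>c. AP.J +>\<^bsub>degree_zero_ring A\<^esub> \<sigma> c"
    by (rule ring_hom_ringI2[OF ring_axioms AP.Q.quotient_is_ring g])
  have "a_kernel R (degree_zero_ring A Quot AP.J) (\<lambda>c. AP.J +>\<^bsub>degree_zero_ring A\<^esub> \<sigma> c) = Idl (set as)"
  proof (rule Set.set_eqI)
    fix c
    have "c \<in> Idl (set as) \<Longrightarrow> c \<in> carrier R" using ideal.Icarr[OF genideal_ideal[OF as_carrier]] .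
    moreover have "AP.J +>\<^bsub>degree_zero_ring A\<^esub> \<sigma> c = AP.J \<longleftrightarrow> c \<in> Idl (set as)" if "c \<in> carrier R"
      using AP.Q.coset_eq_J_iff[of "\<sigma> c"] \<sigma>_props(1)[OF that] scalar_in_boundaries_iff[OF that] by simp
    ultimately show "c \<in> a_kernel R (degree_zero_ring A Quot AP.J) (\<lambda>c. AP.J +>\<^bsub>degree_zero_ring A\<^esub> \<sigma> c)
        \<longleftrightarrow> c \<in> Idl (set as)"
      unfolding a_kernel_def' AP.Q.quotient_zero mem_Collect_eq by blast
  qed
  moreover have "(\<lambda>c. AP.J +>\<^bsub>degree_zero_ring A\<^esub> \<sigma> c) ` carrier R = carrier (degree_zero_ring A Quot AP.J)"
    unfolding AP.Q.quotient_carrier degree_zero_ring_simps(1) \<sigma>_image[symmetric] image_image ..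
  ultimately show ?thesis using comp.FactRing_iso unfolding AP.H0_eq_Q by simp
qed

end

theorem corollary4p10:
  fixes B :: "('b, 'm) ring_scheme" and C :: "('c, 'n) ring_scheme"
  assumes "cring B" and "noetherian_ring B"
    and "cohen_macaulay_ring C" and "ideal I C" and "B \<simeq> C Quot I"
  shows "\<exists>A :: 'c pair_tree dg_ring. cohen_macaulay_dg_ring A \<and> H0 A \<simeq> B"
proof -
  have C: "cring C" "noetherian_ring C" "\<And>P. primeideal P C \<Longrightarrow> cohen_macaulay_local_ring (localization C P)"
    using assms(3) unfolding cohen_macaulay_ring_def by simp_all
  obtain X where X: "X \<subseteq> carrier C" "finite X" "I = Idl\<^bsub>C\<^esub> X"
    using noetherian_ring.finetely_gen[OF C(2) assms(4)] by blast
  obtain as where as: "set as = X" using finite_list[OF X(2)] by blast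
  interpret koszul_data C as
    by (intro koszul_data.intro noetherian_cring.intro C koszul_data_axioms.intro) (use X as in simp)
  have "cohen_macaulay_dg_ring A"
    unfolding cohen_macaulay_dg_ring_def
    using AP.noetherian AP.bounded localization_cohen_macaulay[OF C(3)] by blast
  moreover have "B \<simeq> H0 A" using ring_iso_trans[OF assms(5)] H0_iso X(3) as by simp
  then have "H0 A \<simeq> B" using ring_iso_sym cring.axioms(1)[OF assms(1)] by blast
  ultimately show ?thesis by blast
qed

end
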